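(* Let $n\ge1$, $0<\sigma_0<\sigma_1<1$, and let $$\mathcal{C}:=\{(t,x)\in\mathbb{R}\times\mathbb{R}^n \mid -1<t<0,\ |x|<\sigma_1|t|\}.$$ Let $1<p<1+\frac{4}{n-1}$, and let $V\in C^1(\overline{\mathcal{C}})$ satisfy $V\ge\epsilon$ on $\overline{\mathcal C}$ for some constant $\epsilon>0$. Let $\phi$ be a (real-valued) $C^2$-solution on $\mathcal{C}$ of $$\Box\phi+V|\phi|^{p-1}\phi=0,$$ and assume that $(0,0)$ belongs to the singular set of $\phi$. Suppose that $$\limsup_{t\to0^-}|t|^{2-n+\frac{4}{p-1}}\int_{|x|<\sigma_0|t|}\left[|\nabla\phi(t,x)|^2+|t|^{-2}\phi(t,x)^2\right]dx>0.$$ Then $$\limsup_{t\to0^-}\left[|t|^{2-n+\frac{4}{p-1}}\int_{\mathcal{A}^{\sigma_0,\sigma_1}(t)}|\nabla\phi|^2+|t|^{-n+\frac{4}{p-1}}\int_{\mathcal{A}^{\sigma_0,\sigma_1}(t)}|\phi|^2\right]>0.$$ (As $\sigma_1\in(\sigma_0,1)$ is arbitrary, this holds for every $\sigma_0<\sigma_1<1$ for which $\phi$ is a solution on the corresponding cone $\mathcal{C}$.)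
   Context: $\Box:=-\partial_t^2+\Delta_x$ is the wave operator on $\mathbb{R}^{n+1}=\mathbb{R}_t\times\mathbb{R}^n_x$. For a $C^1$ function $\phi$, $|\nabla\phi|^2:=(\partial_t\phi)^2+\sum_{i=1}^n(\partial_{x^i}\phi)^2$. For $n=1$, $\frac{4}{n-1}$ is read as $+\infty$. For $0<\sigma_0<\sigma_1<1$ and $t\in\mathbb{R}$, $\mathcal{A}^{\sigma_0,\sigma_1}(t):=\{(t,x)\mid \sigma_0|t|<|x|<\sigma_1|t|\}$; integrals over it are with respect to $n$-dimensional Lebesgue measure in $x$. "$(0,0)$ belongs to the singular set of $\phi$" means that $(0,0)$ is a blow-up point of $\phi$, i.e. $\phi$ cannot be continued as a regular (locally $H^1$) solution to a neighbourhood of $(0,0)$. The limsups are allowed to equal $+\infty$. *)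

theory Defs
  imports "HOL-Analysis.Analysis"
begin

definition pd :: "'a::euclidean_space \<Rightarrow> ('a \<Rightarrow> real) \<Rightarrow> 'a \<Rightarrow> real" where
  "pd b f z = frechet_derivative f (at z) b"

text \<open>The set \<open>S\<close> is meant to be open, since the derivatives are two-sided.\<close>

primrec Ck_on :: "nat \<Rightarrow> 'a::euclidean_space set \<Rightarrow> ('a \<Rightarrow> real) \<Rightarrow> bool" where
  "Ck_on 0 S f \<longleftrightarrow> continuous_on S f"
| "Ck_on (Suc k) S f \<longleftrightarrow>
     (\<forall>z\<in>S. f differentiable (at z)) \<and> (\<forall>b\<in>Basis. Ck_on k S (pd b f))"

text \<open>The class \<open>C\<^sup>1\<close> on the closure of an open set \<open>S\<close>: the function is \<open>C\<^sup>1\<close> on \<open>S\<close>, it is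
  continuous on the closure, and its first derivatives extend continuously to the closure.\<close>

definition C1_on_closure :: "'a::euclidean_space set \<Rightarrow> ('a \<Rightarrow> real) \<Rightarrow> bool" where
  "C1_on_closure S f \<longleftrightarrow> Ck_on 1 S f \<and> continuous_on (closure S) f \<and>
     (\<forall>b\<in>Basis. \<exists>g. continuous_on (closure S) g \<and> (\<forall>z\<in>S. g z = pd b f z))"

definition dt :: "(real \<times> (real^'n) \<Rightarrow> real) \<Rightarrow> real \<times> (real^'n) \<Rightarrow> real" where
  "dt = pd (1, 0)"

definition dx :: "'n::finite \<Rightarrow> (real \<times> (real^'n) \<Rightarrow> real) \<Rightarrow> real \<times> (real^'n) \<Rightarrow> real" where
  "dx i = pd (0, axis i 1)"

definition wave_op :: "(real \<times> (real^'n::finite) \<Rightarrow> real) \<Rightarrow> real \<times> (real^'n) \<Rightarrow> real" where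
  "wave_op f z = - dt (dt f) z + (\<Sum>i\<in>UNIV. dx i (dx i f) z)"

definition grad_sq :: "(real \<times> (real^'n::finite) \<Rightarrow> real) \<Rightarrow> real \<times> (real^'n) \<Rightarrow> real" where
  "grad_sq f z = (dt f z)\<^sup>2 + (\<Sum>i\<in>UNIV. (dx i f z)\<^sup>2)"

definition nonlin :: "real \<Rightarrow> real \<Rightarrow> real" where
  "nonlin p u = \<bar>u\<bar> powr (p - 1) * u"

definition tip_cone :: "real \<Rightarrow> (real \<times> (real^'n::finite)) set" where
  "tip_cone \<sigma> = {(t, x). -1 < t \<and> t < 0 \<and> norm x < \<sigma> * \<bar>t\<bar>}"

text \<open>The time slice of the annular region, as a subset of \<open>\<real>\<^sup>n\<close>.\<close>

definition annulus :: "real \<Rightarrow> real \<Rightarrow> real \<Rightarrow> (real^'n::finite) set" where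
  "annulus \<sigma>0 \<sigma>1 t = {x. \<sigma>0 * \<bar>t\<bar> < norm x \<and> norm x < \<sigma>1 * \<bar>t\<bar>}"

definition C2_solution ::
  "real \<Rightarrow> (real \<times> (real^'n::finite) \<Rightarrow> real) \<Rightarrow> (real \<times> (real^'n)) set
     \<Rightarrow> (real \<times> (real^'n) \<Rightarrow> real) \<Rightarrow> bool" where
  "C2_solution p V S \<phi> \<longleftrightarrow>
     Ck_on 2 S \<phi> \<and> (\<forall>z\<in>S. wave_op \<phi> z + V z * nonlin p (\<phi> z) = 0)"

definition test_fun :: "'a::euclidean_space set \<Rightarrow> ('a \<Rightarrow> real) \<Rightarrow> bool" where
  "test_fun U \<eta> \<longleftrightarrow> (\<forall>k. Ck_on k UNIV \<eta>) \<and>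
     compact (closure {z. \<eta> z \<noteq> 0}) \<and> closure {z. \<eta> z \<noteq> 0} \<subseteq> U"

definition L1_loc :: "'a::euclidean_space set \<Rightarrow> ('a \<Rightarrow> real) \<Rightarrow> bool" where
  "L1_loc U f \<longleftrightarrow> (\<forall>K. compact K \<and> K \<subseteq> U \<longrightarrow> set_integrable lborel K f)"

definition L2_loc :: "'a::euclidean_space set \<Rightarrow> ('a \<Rightarrow> real) \<Rightarrow> bool" where
  "L2_loc U f \<longleftrightarrow> set_borel_measurable lborel U f \<and> L1_loc U (\<lambda>z. (f z)\<^sup>2)"

definition weak_pd ::
  "'a::euclidean_space set \<Rightarrow> 'a \<Rightarrow> ('a \<Rightarrow> real) \<Rightarrow> ('a \<Rightarrow> real) \<Rightarrow> bool" where
  "weak_pd U b f g \<longleftrightarrow> (\<forall>\<eta>. test_fun U \<eta> \<longrightarrow>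
     (LINT z:U|lborel. f z * pd b \<eta> z) = - (LINT z:U|lborel. g z * \<eta> z))"

definition H1_loc :: "'a::euclidean_space set \<Rightarrow> ('a \<Rightarrow> real) \<Rightarrow> bool" where
  "H1_loc U f \<longleftrightarrow> L2_loc U f \<and> (\<forall>b\<in>Basis. \<exists>g. L2_loc U g \<and> weak_pd U b f g)"

text \<open>A locally \<open>H\<^sup>1\<close> function solving the wave equation on \<open>U\<close> in the sense of distributions.\<close>

definition H1_solution ::
  "real \<Rightarrow> (real \<times> (real^'n::finite) \<Rightarrow> real) \<Rightarrow> (real \<times> (real^'n)) set
     \<Rightarrow> (real \<times> (real^'n) \<Rightarrow> real) \<Rightarrow> bool" where
  "H1_solution p W U \<psi> \<longleftrightarrow> H1_loc U \<psi> \<and> L1_loc U (\<lambda>z. W z * nonlin p (\<psi> z)) \<and>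
     (\<forall>\<eta>. test_fun U \<eta> \<longrightarrow>
        (LINT z:U|lborel. \<psi> z * wave_op \<eta> z + W z * nonlin p (\<psi> z) * \<eta> z) = 0)"

text \<open>A point \<open>z\<close> is singular for a solution \<open>\<phi>\<close> on \<open>S\<close> if \<open>\<phi>\<close> has no continuation to a
  neighbourhood of \<open>z\<close> as a locally \<open>H\<^sup>1\<close> solution. The potential \<open>V\<close> is given only on the
  closure of \<open>S\<close>, so the continued equation involves some \<open>C\<^sup>1\<close> extension \<open>W\<close> of \<open>V\<close>.\<close>

definition singular_point ::
  "real \<Rightarrow> (real \<times> (real^'n::finite) \<Rightarrow> real) \<Rightarrow> (real \<times> (real^'n)) set
     \<Rightarrow> (real \<times> (real^'n) \<Rightarrow> real) \<Rightarrow> real \<times> (real^'n) \<Rightarrow> bool" where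
  "singular_point p V S \<phi> z \<longleftrightarrow> \<not> (\<exists>U W \<psi>. open U \<and> z \<in> U \<and>
     Ck_on 1 U W \<and> (\<forall>y\<in>U \<inter> closure S. W y = V y) \<and>
     H1_solution p W U \<psi> \<and> (\<forall>y\<in>U \<inter> S. \<psi> y = \<phi> y))"

end

(*
  By contraposition, suppose the annulus functional tends to 0. The equation is invariant under
  phi -> l^(2/(p-1)) phi(l t, l x), which carries the slice t = -l to t = -1, so it suffices to bound the solid
  cone at t = -1 by the annulus on a fixed time interval, uniformly for small derivatives of V.
  Testing the equation with phi times a cutoff bounds the potential energy on the annulus. A Carleman estimate
  with the weight f^a, where f is the squared Lorentzian distance to a point q off the solid cone, has positive
  bulk terms because p is subconformal; its boundary terms at f = 0 vanish in the limit since a > 0, and those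
  from the spatial cutoff live on the annulus. It controls (S_q phi + gamma phi)^2 + |phi|^(p+1) on a thin time
  slab, S_q being the scaling derivative about q, and moving q recovers all first derivatives. Energy flux and
  L^r bounds pass from the slab to the slice t = -1, where Gagliardo--Nirenberg absorbs the potential term of
  the energy.
*)

theory Submission
  imports Defs
begin

section \<open>Directional derivatives and integration by parts\<close>

text \<open>Uniformity shapes the proof: the estimates are applied to a whole family of rescaled
  solutions, so every constant is fixed before \<open>u\<close> and \<open>V\<close> are quantified.
  Rescaling by \<open>l\<close> multiplies the derivatives of \<open>V\<close> by \<open>l\<close>,
  which is why a smallness threshold \<open>\<nu>\<close> for them is harmless. The one bound that
  depends on the solution, for the flux through the level sets of \<open>f\<close> near 0, is
  multiplied by a power of the cutoff width and removed by a limit taken for each solution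
  separately. With \<open>\<gamma> = (n - 1) / 2 + a\<close> the bulk coefficient
  \<open>2 - (p - 1) * \<gamma>\<close> is positive exactly when
  \<open>a < 2 / (p - 1) - (n - 1) / 2\<close>, so an admissible \<open>a > 0\<close> exists exactly
  in the subconformal range. The same range returns at the end: \<open>r = (p + 3) / 2\<close> is
  the largest power of |u| whose time derivative is controlled by the squared gradient plus the
  power p + 1 of |u|, and passing from \<open>r\<close> to \<open>p + 1\<close> by
  Gagliardo--Nirenberg needs \<open>(p - 1) * (n - 1) < 4\<close>. The absorption closes only for
  small data; contraposition supplies the smallness.\<close>

abbreviation has_ddv :: "('a::euclidean_space \<Rightarrow> real) \<Rightarrow> 'a \<Rightarrow> 'a \<Rightarrow> real \<Rightarrow> bool" where
  "has_ddv f b z D \<equiv> ((\<lambda>h. f (z + h *\<^sub>R b)) has_real_derivative D) (at 0)"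

lemma has_ddv_line:
  assumes "has_ddv f b (z + s *\<^sub>R b) D"
  shows "((\<lambda>h. f (z + h *\<^sub>R b)) has_real_derivative D) (at s)"
proof -
  have "((\<lambda>h. f (z + (h + s) *\<^sub>R b)) has_real_derivative D) (at 0)"
    using assms by (simp add: algebra_simps)
  then show ?thesis
    using DERIV_shift[of "\<lambda>h. f (z + h *\<^sub>R b)" D 0 s] by simp
qed

lemma differentiable_has_ddv:
  assumes "f differentiable (at z)"
  shows "has_ddv f b z (pd b f z)"
proof -
  let ?D = "frechet_derivative f (at z)"
  have D: "(f has_derivative ?D) (at z)"
    using assms frechet_derivative_works by blast
  have 1: "((\<lambda>h. z + h *\<^sub>R b) has_derivative (\<lambda>h. h *\<^sub>R b)) (at 0)"
    by (auto intro!: derivative_eq_intros)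
  have "((\<lambda>h. f (z + h *\<^sub>R b)) has_derivative (\<lambda>h. ?D (h *\<^sub>R b))) (at 0)"
    by (rule has_derivative_compose[OF 1, of f, simplified, OF D])
  moreover have "?D (h *\<^sub>R b) = h * ?D b" for h
    using has_derivative_linear[OF D] by (simp add: linear_scale)
  ultimately show ?thesis
    by (simp add: has_field_derivative_def pd_def mult_commute_abs)
qed

lemma ddv_mvt_bound:
  assumes "\<And>z. has_ddv G b z (G' z)" "\<And>z. \<bar>G' z\<bar> \<le> M"
  shows "\<bar>G (z + h *\<^sub>R b) - G z\<bar> \<le> M * \<bar>h\<bar>"
proof -
  have d: "((\<lambda>s. G (z + s *\<^sub>R b)) has_field_derivative G' (z + s *\<^sub>R b)) (at s within UNIV)" for s
    using has_ddv_line[OF assms(1)] by simp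
  have "norm (G (z + h *\<^sub>R b) - G (z + 0 *\<^sub>R b)) \<le> M * norm (h - 0)"
    by (rule field_differentiable_bound[OF _ d]) (use assms(2) in auto)
  then show ?thesis by simp
qed

text \<open>The mixed second difference of \<open>f\<close> does not depend on the order of the two
  steps. Evaluated by the mean value theorem in either order it is \<open>(h k)\<^sup>2\<close>
  times a mixed derivative at a point near \<open>z\<close>, and continuity lets both points tend to
  \<open>z\<close>.\<close>

lemma second_ddv_symmetric:
  fixes f :: "'a::euclidean_space \<Rightarrow> real"
  assumes "open S" "z \<in> S"
    and b: "\<And>w. w \<in> S \<Longrightarrow> has_ddv f b w (fb w)"
    and c: "\<And>w. w \<in> S \<Longrightarrow> has_ddv f c w (fc w)"
    and cb: "\<And>w. w \<in> S \<Longrightarrow> has_ddv fb c w (fbc w)"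
    and bc: "\<And>w. w \<in> S \<Longrightarrow> has_ddv fc b w (fcb w)"
    and cont: "continuous_on S fbc" "continuous_on S fcb"
  shows "fbc z = fcb z"
proof -
  obtain r where r: "r > 0" "ball z r \<subseteq> S"
    using assms(1,2) openE by blast
  \<comment> \<open>\<open>h k * N < r\<close> keeps the parallelogram at \<open>z\<close> with
    sides \<open>h k *\<^sub>R b\<close> and \<open>h k *\<^sub>R c\<close> inside the ball. The 1
    in \<open>N\<close> covers \<open>b = c = 0\<close>, and \<open>k + 2\<close> makes the
    inequality strict already at \<open>k = 0\<close>.\<close>
  define N where "N = norm b + norm c + 1"
  have N: "N > 0" unfolding N_def by (simp add: add_nonneg_pos)
  define h where "h k = r / N / real (k + 2)" for k :: nat
  have h0: "h k > 0" for k unfolding h_def using r N by simp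
  have hN: "h k * N < r" for k
  proof -
    have "h k * N = r / real (k + 2)" unfolding h_def using N by simp
    also have "\<dots> < r / 1" using r by (intro divide_strict_left_mono) auto
    finally show ?thesis by simp
  qed
  have inS: "z + s *\<^sub>R b + t *\<^sub>R c \<in> S" if "0 \<le> s" "s \<le> h k" "0 \<le> t" "t \<le> h k" for s t k
  proof -
    have "norm (s *\<^sub>R b + t *\<^sub>R c) \<le> s * norm b + t * norm c"
      using norm_triangle_ineq[of "s *\<^sub>R b" "t *\<^sub>R c"] that by simp
    also have "\<dots> \<le> h k * norm b + h k * norm c"
      using that by (intro add_mono mult_right_mono) auto
    also have "\<dots> \<le> h k * N" unfolding N_def using h0[of k] by (simp add: algebra_simps)
    also have "\<dots> < r" by (rule hN)
    finally show ?thesis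
      using r(2) by (auto simp: dist_norm add.assoc norm_minus_commute subset_iff)
  qed
  define D where "D k = f (z + h k *\<^sub>R b + h k *\<^sub>R c) - f (z + h k *\<^sub>R b) - f (z + h k *\<^sub>R c) + f z" for k
  \<comment> \<open>Stated for abstract directions because it is applied twice, with the roles of
    \<open>b\<close> and \<open>c\<close> exchanged.\<close>
  have key: "\<exists>s t. 0 \<le> s \<and> s \<le> h k \<and> 0 \<le> t \<and> t \<le> h k \<and>
      D k = (h k)\<^sup>2 * gbc (z + s *\<^sub>R b' + t *\<^sub>R c')"
    if bb: "\<And>w. w \<in> S \<Longrightarrow> has_ddv f b' w (gb w)"
      and cc: "\<And>w. w \<in> S \<Longrightarrow> has_ddv gb c' w (gbc w)"
      and i: "\<And>s t. 0 \<le> s \<Longrightarrow> s \<le> h k \<Longrightarrow> 0 \<le> t \<Longrightarrow> t \<le> h k \<Longrightarrow> z + s *\<^sub>R b' + t *\<^sub>R c' \<in> S"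
      and De: "D k = f (z + h k *\<^sub>R b' + h k *\<^sub>R c') - f (z + h k *\<^sub>R b') - f (z + h k *\<^sub>R c') + f z"
    for k gb gbc b' c'
  proof -
    have "\<exists>s. 0 < s \<and> s < h k \<and>
        (f (z + h k *\<^sub>R c' + h k *\<^sub>R b') - f (z + h k *\<^sub>R b')) - (f (z + h k *\<^sub>R c' + 0 *\<^sub>R b') - f (z + 0 *\<^sub>R b'))
        = (h k - 0) * (gb (z + h k *\<^sub>R c' + s *\<^sub>R b') - gb (z + s *\<^sub>R b'))"
    proof (rule MVT2[where f = "\<lambda>s. f (z + h k *\<^sub>R c' + s *\<^sub>R b') - f (z + s *\<^sub>R b')", OF h0])
      fix s assume s: "0 \<le> s" "s \<le> h k"
      have "z + s *\<^sub>R b' \<in> S" "z + h k *\<^sub>R c' + s *\<^sub>R b' \<in> S"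
        using i[of s 0] i[of s "h k"] s h0[of k] by (auto simp: algebra_simps)
      then show "((\<lambda>s. f (z + h k *\<^sub>R c' + s *\<^sub>R b') - f (z + s *\<^sub>R b')) has_real_derivative
          gb (z + h k *\<^sub>R c' + s *\<^sub>R b') - gb (z + s *\<^sub>R b')) (at s)"
        using has_ddv_line[OF bb, of "z + h k *\<^sub>R c'" s] has_ddv_line[OF bb, of z s] by (intro DERIV_diff)
    qed
    then obtain s where s: "0 < s" "s < h k" and
      es: "D k = h k * (gb (z + s *\<^sub>R b' + h k *\<^sub>R c') - gb (z + s *\<^sub>R b'))"
      unfolding De by (auto simp: algebra_simps)
    have "\<exists>t. 0 < t \<and> t < h k \<and>
        gb (z + s *\<^sub>R b' + h k *\<^sub>R c') - gb (z + s *\<^sub>R b' + 0 *\<^sub>R c') = (h k - 0) * gbc (z + s *\<^sub>R b' + t *\<^sub>R c')"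
    proof (rule MVT2[OF h0])
      fix t assume "0 \<le> t" "t \<le> h k"
      then show "((\<lambda>t. gb (z + s *\<^sub>R b' + t *\<^sub>R c')) has_real_derivative gbc (z + s *\<^sub>R b' + t *\<^sub>R c')) (at t)"
        using s has_ddv_line[OF cc, of "z + s *\<^sub>R b'" t] i[of s t] by auto
    qed
    then obtain t where "0 < t" "t < h k"
      "gb (z + s *\<^sub>R b' + h k *\<^sub>R c') - gb (z + s *\<^sub>R b') = h k * gbc (z + s *\<^sub>R b' + t *\<^sub>R c')"
      by auto
    with s es show ?thesis
      by (intro exI[of _ s] exI[of _ t]) (auto simp: power2_eq_square)
  qed
  have "\<exists>s t. 0 \<le> s \<and> s \<le> h k \<and> 0 \<le> t \<and> t \<le> h k \<and> D k = (h k)\<^sup>2 * fbc (z + s *\<^sub>R b + t *\<^sub>R c)" for k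
    by (rule key[OF b cb inS]) (auto simp: D_def)
  then obtain s1 t1 where 1: "\<And>k. 0 \<le> s1 k \<and> s1 k \<le> h k \<and> 0 \<le> t1 k \<and> t1 k \<le> h k \<and>
      D k = (h k)\<^sup>2 * fbc (z + s1 k *\<^sub>R b + t1 k *\<^sub>R c)" by metis
  have "\<exists>s t. 0 \<le> s \<and> s \<le> h k \<and> 0 \<le> t \<and> t \<le> h k \<and> D k = (h k)\<^sup>2 * fcb (z + s *\<^sub>R c + t *\<^sub>R b)" for k
    proof (rule key[OF c bc])
    show "z + s *\<^sub>R c + t *\<^sub>R b \<in> S" if "0 \<le> s" "s \<le> h k" "0 \<le> t" "t \<le> h k" for s t
      using inS[of t k s] that by (simp add: algebra_simps)
    show "D k = f (z + h k *\<^sub>R c + h k *\<^sub>R b) - f (z + h k *\<^sub>R c) - f (z + h k *\<^sub>R b) + f z"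
      by (simp add: D_def algebra_simps)
  qed
  then obtain s2 t2 where 2: "\<And>k. 0 \<le> s2 k \<and> s2 k \<le> h k \<and> 0 \<le> t2 k \<and> t2 k \<le> h k \<and>
      D k = (h k)\<^sup>2 * fcb (z + s2 k *\<^sub>R c + t2 k *\<^sub>R b)" by metis
  have h_lim: "h \<longlonglongrightarrow> 0"
    using tendsto_mult_right_zero[OF LIMSEQ_ignore_initial_segment[OF LIMSEQ_inverse_real_of_nat, of 1], of "r / N"]
    by (simp add: h_def[abs_def] divide_inverse algebra_simps)
  have sq: "x \<longlonglongrightarrow> 0" if "\<And>k. 0 \<le> x k \<and> x k \<le> h k" for x
    by (rule tendsto_sandwich[OF _ _ tendsto_const h_lim]) (use that in auto)
  have lim: "(\<lambda>k. g (z + s k *\<^sub>R b' + t k *\<^sub>R c')) \<longlonglongrightarrow> g z"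
    if "continuous_on S g" "s \<longlonglongrightarrow> 0" "t \<longlonglongrightarrow> 0" for g s t b' c'
  proof -
    have "isCont g z" using that(1) assms(1,2) continuous_on_eq_continuous_at by blast
    moreover have "(\<lambda>k. z + s k *\<^sub>R b' + t k *\<^sub>R c') \<longlonglongrightarrow> z + 0 *\<^sub>R b' + 0 *\<^sub>R c'"
      by (intro tendsto_intros that)
    ultimately show ?thesis using isCont_tendsto_compose[of z g] by simp
  qed
  have "fbc (z + s1 k *\<^sub>R b + t1 k *\<^sub>R c) = fcb (z + s2 k *\<^sub>R c + t2 k *\<^sub>R b)" for k
    using 1[of k] 2[of k] h0[of k] by auto
  moreover have "(\<lambda>k. fbc (z + s1 k *\<^sub>R b + t1 k *\<^sub>R c)) \<longlonglongrightarrow> fbc z"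
    by (intro lim cont sq) (use 1 in auto)
  moreover have "(\<lambda>k. fcb (z + s2 k *\<^sub>R c + t2 k *\<^sub>R b)) \<longlonglongrightarrow> fcb z"
    by (intro lim cont sq) (use 2 in auto)
  ultimately show ?thesis using LIMSEQ_unique by simp
qed

text \<open>The point is that \<open>g'\<close> vanishes on \<open>S - K\<close> too, since this set
  is open and \<open>g\<close> is 0 on it. Hence \<open>G\<close> and \<open>G'\<close> agree with
  \<open>g\<close> and \<open>g'\<close> on \<open>S\<close> and with 0 on \<open>- K\<close>, two
  open sets that cover the space.\<close>

lemma extend_by_zero:
  fixes g g' :: "'a::euclidean_space \<Rightarrow> real"
  assumes S: "open S" "compact K" "K \<subseteq> S"
    and g: "continuous_on S g" "\<And>z. z \<in> S - K \<Longrightarrow> g z = 0"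
    and d: "\<And>z. z \<in> S \<Longrightarrow> has_ddv g b z (g' z)" "continuous_on S g'"
  defines "G \<equiv> \<lambda>z. if z \<in> K then g z else 0" and "G' \<equiv> \<lambda>z. if z \<in> K then g' z else 0"
  shows "continuous_on UNIV G" "has_ddv G b z (G' z)" "continuous_on UNIV G'"
proof -
  have oK: "open (- K)" using S by (simp add: compact_imp_closed open_Compl)
  have U: "UNIV = S \<union> - K" using S by auto
  have line: "\<forall>\<^sub>F h in at 0. z + h *\<^sub>R b \<in> T" if "open T" "z \<in> T" for T and z :: 'a
  proof -
    have "((\<lambda>h. z + h *\<^sub>R b) \<longlongrightarrow> z + 0 *\<^sub>R b) (at 0)" by (intro tendsto_intros)
    then show ?thesis using topological_tendstoD that by fastforce
  qed
  have g'0: "g' z = 0" if z: "z \<in> S - K" for z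
  proof -
    have "\<forall>\<^sub>F h in at 0. z + h *\<^sub>R b \<in> S \<inter> - K"
      using S oK z by (intro line) auto
    then have "\<forall>\<^sub>F h in at 0. g (z + h *\<^sub>R b) = 0"
      by eventually_elim (use g in auto)
    moreover have "g (z + 0 *\<^sub>R b) = 0" using g(2) z by simp
    ultimately have "((\<lambda>h. 0) has_real_derivative g' z) (at 0)"
      using DERIV_cong_ev[OF refl _ refl, of "\<lambda>h. g (z + h *\<^sub>R b)" "\<lambda>h. 0" 0 "g' z"] d(1)[of z] z
      by (auto simp: eventually_nhds_conv_at)
    then show ?thesis using DERIV_unique DERIV_const by blast
  qed
  have GS: "G z = g z" "G' z = g' z" if "z \<in> S" for z
    using that g g'0 by (auto simp: G_def G'_def)
  have GK: "G z = 0" "G' z = 0" if "z \<in> - K" for z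
    using that by (auto simp: G_def G'_def)
  have cs: "continuous_on S G" "continuous_on S G'"
    using g(1) d(2) GS by (auto cong: continuous_on_cong)
  have ck: "continuous_on (- K) G" "continuous_on (- K) G'"
    by (subst continuous_on_cong[OF refl GK(1)] continuous_on_cong[OF refl GK(2)]; simp)+
  show "continuous_on UNIV G" "continuous_on UNIV G'"
    unfolding U using S oK cs ck by (auto intro: continuous_on_open_Un)
  show "has_ddv G b z (G' z)"
  proof (cases "z \<in> S")
    case True
    have "\<forall>\<^sub>F h in at 0. G (z + h *\<^sub>R b) = g (z + h *\<^sub>R b)"
      using line[OF S(1) True] by eventually_elim (auto simp: GS)
    then show ?thesis
      using DERIV_cong_ev[OF refl _ refl, of "\<lambda>h. G (z + h *\<^sub>R b)" "\<lambda>h. g (z + h *\<^sub>R b)" 0 "g' z"] d(1) True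
      by (auto simp: eventually_nhds_conv_at GS)
  next
    case False
    then have z: "z \<in> - K" using S by auto
    have "\<forall>\<^sub>F h in at 0. G (z + h *\<^sub>R b) = 0"
      using line[OF oK z] by eventually_elim (auto simp: GK)
    then show ?thesis
      using DERIV_cong_ev[OF refl _ refl, of "\<lambda>h. G (z + h *\<^sub>R b)" "\<lambda>h. 0" 0 0] z
      by (auto simp: eventually_nhds_conv_at GK)
  qed
qed

section \<open>Translation invariance and integration by parts\<close>

lemma integral_lborel_shift:
  fixes f :: "'a::euclidean_space \<Rightarrow> real"
  assumes "f \<in> borel_measurable borel"
  shows "(LINT z|lborel. f (z + c)) = (LINT z|lborel. f z)"
proof -
  have "(LINT z|lborel. f z) = (LINT z|distr lborel borel ((+) c). f z)"
    by (simp add: lborel_distr_plus)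
  also have "\<dots> = (LINT z|lborel. f (c + z))"
    using assms by (intro integral_distr) auto
  finally show ?thesis by (simp add: add.commute)
qed

lemma compact_support_integrable:
  fixes G :: "'a::euclidean_space \<Rightarrow> real"
  assumes "compact K" "continuous_on UNIV G" "\<And>z. z \<notin> K \<Longrightarrow> G z = 0"
  shows "integrable lborel G"
proof -
  have "integrable lborel (\<lambda>z. indicator K z *\<^sub>R G z)"
    by (rule borel_integrable_compact[OF assms(1)]) (use assms(2) continuous_on_subset in blast)
  moreover have "(\<lambda>z. indicator K z *\<^sub>R G z) = G"
    using assms(3) by (force simp: indicator_def fun_eq_iff)
  ultimately show ?thesis by simp
qed

text \<open>Integrals of difference quotients vanish by translation invariance, and dominated
  convergence passes to the derivative. The weight \<open>w\<close> may be discontinuous as long as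
  it is constant along \<open>b\<close>: with the indicator of a half space in time this permits
  spatial integration by parts up to a fixed time.\<close>

lemma integral_ddv_zero:
  fixes G G' w :: "'a::euclidean_space \<Rightarrow> real"
  assumes K: "compact K" and G: "continuous_on UNIV G" "\<And>z. z \<notin> K \<Longrightarrow> G z = 0"
    and G': "continuous_on UNIV G'" "\<And>z. z \<notin> K \<Longrightarrow> G' z = 0"
    and d: "\<And>z. has_ddv G b z (G' z)"
    and w: "w \<in> borel_measurable borel" "\<And>z. \<bar>w z\<bar> \<le> 1" "\<And>z h. w (z + h *\<^sub>R b) = w z"
  shows "(LINT z|lborel. w z * G' z) = 0"
proof -
  have Gm[measurable]: "G \<in> borel_measurable borel" "G' \<in> borel_measurable borel"
    using G G' borel_measurable_continuous_onI by auto
  note w(1)[measurable]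
  have "bounded (G' ` K)"
    using K G'(1) by (meson compact_continuous_image compact_imp_bounded continuous_on_subset subset_UNIV)
  then obtain M where M: "\<And>z. z \<in> K \<Longrightarrow> \<bar>G' z\<bar> \<le> M" "M \<ge> 0"
    unfolding bounded_pos by force
  have M': "\<bar>G' z\<bar> \<le> M" for z using M G'(2)[of z] by (cases "z \<in> K") auto
  obtain R where R: "\<And>z. z \<in> K \<Longrightarrow> norm z \<le> R"
    using compact_imp_bounded[OF K] by (auto simp: bounded_iff)
  \<comment> \<open>Contains the supports of all difference quotients, because
    \<open>h k \<le> 1\<close>; it carries the integrable majorant.\<close>
  define C where "C = cball (0::'a) (R + norm b)"
  define h where "h k = inverse (real (Suc k))" for k
  have h: "0 < h k" "h k \<le> 1" for k by (auto simp: h_def field_simps)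
  define s where "s k z = w z * ((G (z + h k *\<^sub>R b) - G z) / h k)" for k z
  have sbound: "norm (s k z) \<le> M * indicator C z" for k z
  proof (cases "z \<in> C")
    case True
    have "\<bar>(G (z + h k *\<^sub>R b) - G z) / h k\<bar> \<le> M"
      using ddv_mvt_bound[of G b G' M z "h k", OF d M'] h[of k] by (simp add: field_simps)
    then have "\<bar>w z\<bar> * \<bar>(G (z + h k *\<^sub>R b) - G z) / h k\<bar> \<le> 1 * M"
      using w(2) by (intro mult_mono) auto
    then show ?thesis using True by (simp add: s_def abs_mult)
  next
    case False
    then have n: "norm z > R + norm b" by (auto simp: C_def)
    have "norm (z + h k *\<^sub>R b) \<ge> norm z - h k * norm b"
      using norm_diff_ineq[of z "h k *\<^sub>R b"] h[of k] by simp
    moreover have "h k * norm b \<le> norm b" using h[of k] by (simp add: mult_left_le_one_le)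
    ultimately have "z \<notin> K" "z + h k *\<^sub>R b \<notin> K" using R n norm_ge_zero[of b] by (smt (verit))+
    then show ?thesis using False G by (simp add: s_def)
  qed
  have lim: "(\<lambda>k. s k z) \<longlonglongrightarrow> w z * G' z" for z
  proof -
    have "((\<lambda>h. (G (z + h *\<^sub>R b) - G z) / h) \<longlongrightarrow> G' z) (at 0)"
      using d[of z] by (simp add: DERIV_def)
    moreover have "filterlim h (at 0) sequentially"
      unfolding filterlim_at using h LIMSEQ_inverse_real_of_nat by (auto simp: h_def[abs_def] less_imp_neq[symmetric])
    ultimately have "(\<lambda>k. (G (z + h k *\<^sub>R b) - G z) / h k) \<longlonglongrightarrow> G' z"
      by (rule filterlim_compose)
    then show ?thesis unfolding s_def by (intro tendsto_intros)
  qed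
  have iC: "integrable lborel (\<lambda>z. M * indicator C z :: real)"
    using emeasure_bounded_finite[of C]
    by (intro integrable_mult_right integrable_real_indicator) (auto simp: C_def)
  have "(\<lambda>k. LINT z|lborel. s k z) \<longlonglongrightarrow> (LINT z|lborel. w z * G' z)"
    by (rule integral_dominated_convergence[OF _ _ iC]) (use lim sbound in \<open>auto simp: s_def\<close>)
  moreover have "(LINT z|lborel. s k z) = 0" for k
  proof -
    have i: "integrable lborel (\<lambda>z. w z * G z)"
      using compact_support_integrable[OF K G]
      by (rule Bochner_Integration.integrable_bound) (use w(2) in \<open>auto simp: abs_mult mult_left_le_one_le\<close>)
    have "(LINT z|lborel. w (z + h k *\<^sub>R b) * G (z + h k *\<^sub>R b)) = (LINT z|lborel. w z * G z)"
      by (rule integral_lborel_shift) auto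
    moreover have "integrable lborel (\<lambda>z. w (z + h k *\<^sub>R b) * G (z + h k *\<^sub>R b))"
    proof -
      have "integrable (distr lborel borel ((+) (h k *\<^sub>R b))) (\<lambda>z. w z * G z)"
        using i by (simp add: lborel_distr_plus)
      then show ?thesis by (subst (asm) integrable_distr_eq) (auto simp: add.commute)
    qed
    ultimately have "(LINT z|lborel. w z * G (z + h k *\<^sub>R b) - w z * G z) = 0"
      using i by (subst Bochner_Integration.integral_diff) (auto simp: w(3))
    moreover have "s k = (\<lambda>z. (w z * G (z + h k *\<^sub>R b) - w z * G z) / h k)"
      by (auto simp: s_def field_simps)
    ultimately show ?thesis by simp
  qed
  ultimately show ?thesis using LIMSEQ_unique by (simp add: LIMSEQ_const_iff)
qed

text \<open>Fubini and the fundamental theorem in time. This is how values on a single time slice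
  are recovered from space-time integrals.\<close>

lemma integral_halfspace_ddv:
  fixes G G' :: "real \<times> 'b::euclidean_space \<Rightarrow> real"
  assumes K: "compact K" and G: "continuous_on UNIV G" "\<And>z. z \<notin> K \<Longrightarrow> G z = 0"
    and G': "continuous_on UNIV G'" "\<And>z. z \<notin> K \<Longrightarrow> G' z = 0"
    and d: "\<And>z. has_ddv G (1, 0) z (G' z)"
  shows "(LINT z|lborel. indicator {z. fst z \<le> T} z * G' z) = (LINT x|lborel. G (T, x))"
proof -
  have Gm[measurable]: "G \<in> borel_measurable borel" "G' \<in> borel_measurable borel"
    using G G' borel_measurable_continuous_onI by auto
  have [measurable]: "{z::real \<times> 'b. fst z \<le> T} \<in> sets borel"
    by (intro borel_closed closed_Collect_le continuous_intros)
  obtain R where R: "\<And>z. z \<in> K \<Longrightarrow> norm z \<le> R"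
    using compact_imp_bounded[OF K] by (auto simp: bounded_iff)
  \<comment> \<open>A time below the support of \<open>G\<close> and below \<open>T\<close>, so that
    the lower boundary term vanishes and the half line may be replaced by
    \<open>{a..T}\<close>.\<close>
  define a where "a = min (- \<bar>R\<bar> - 1) (T - 1)"
  have aK: "(t, x) \<notin> K" if "t \<le> a" for t x
  proof
    assume "(t, x) \<in> K"
    then have "norm (t, x) \<le> R" using R by auto
    moreover have "\<bar>t\<bar> \<le> norm (t, x)" using norm_fst_le[of t x] by simp
    ultimately show False using that by (auto simp: a_def)
  qed
  have "(\<lambda>z. indicator {z. fst z \<le> T} z * G' z) \<in> borel_measurable borel"
    by measurable
  then have i: "integrable lborel (\<lambda>z. indicator {z. fst z \<le> T} z * G' z)"
    by (intro Bochner_Integration.integrable_bound[OF compact_support_integrable[OF K G']])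
      (auto simp: indicator_def)
  have inner: "(LINT t|lborel. indicator {z. fst z \<le> T} (t, x) * G' (t, x)) = G (T, x)" for x
  proof -
    have eq: "(\<lambda>t. indicator {z. fst z \<le> T} (t, x) * G' (t, x)) = (\<lambda>t. indicator {a..T} t *\<^sub>R G' (t, x))"
    proof
      fix t show "indicator {z. fst z \<le> T} (t, x) * G' (t, x) = indicator {a..T} t *\<^sub>R G' (t, x)"
        using aK[of t x] G'(2)[of "(t, x)"] by (cases "t \<le> a") (auto simp: indicator_def)
    qed
    have "((\<lambda>t. G (t, x)) has_vector_derivative G' (t, x)) (at t within {a..T})" for t
      using has_ddv_line[where f = G and b = "(1, 0)" and z = "(0, x)" and s = t, OF d]
      by (simp add: has_real_derivative_iff_has_vector_derivative has_vector_derivative_at_within)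
    moreover have "continuous_on {a..T} (\<lambda>t. G' (t, x))"
      by (intro continuous_on_compose2[OF G'(1)] continuous_intros) auto
    ultimately have "(LINT t|lborel. indicator {a..T} t *\<^sub>R G' (t, x)) = G (T, x) - G (a, x)"
      by (intro integral_FTC_atLeastAtMost) (auto simp: a_def)
    then show ?thesis using G(2)[OF aK[of a x]] by (simp add: eq)
  qed
  have "(LINT z|lborel. indicator {z. fst z \<le> T} z * G' z) =
      (LINT x|lborel. LINT t|lborel. indicator {z. fst z \<le> T} (t, x) * G' (t, x))"
    using lborel_pair.integral_snd[of "\<lambda>t x. indicator {z. fst z \<le> T} (t, x) * G' (t, x)"] i
    by (simp add: lborel_prod case_prod_unfold)
  then show ?thesis by (simp only: inner)
qed

lemma integral_compact_ddv_zero: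
  fixes g g' w :: "'a::euclidean_space \<Rightarrow> real"
  assumes S: "open S" "compact K" "K \<subseteq> S"
    and g: "continuous_on S g" "\<And>z. z \<in> S - K \<Longrightarrow> g z = 0"
    and d: "\<And>z. z \<in> S \<Longrightarrow> has_ddv g b z (g' z)" "continuous_on S g'"
    and w: "w \<in> borel_measurable borel" "\<And>z. \<bar>w z\<bar> \<le> 1" "\<And>z h. w (z + h *\<^sub>R b) = w z"
  shows "(LINT z:K|lborel. w z * g' z) = 0"
proof -
  note E = extend_by_zero[OF S g d]
  have "(LINT z|lborel. w z * (if z \<in> K then g' z else 0)) = 0"
    by (rule integral_ddv_zero[OF S(2) E(1) _ E(3) _ E(2) w]) auto
  moreover have "(\<lambda>z. w z * (if z \<in> K then g' z else 0)) = (\<lambda>z. indicator K z *\<^sub>R (w z * g' z))"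
    by (auto simp: indicator_def)
  ultimately show ?thesis by (simp add: set_lebesgue_integral_def)
qed

lemma integral_compact_halfspace_ddv:
  fixes g g' :: "real \<times> 'b::euclidean_space \<Rightarrow> real"
  assumes S: "open S" "compact K" "K \<subseteq> S"
    and g: "continuous_on S g" "\<And>z. z \<in> S - K \<Longrightarrow> g z = 0"
    and d: "\<And>z. z \<in> S \<Longrightarrow> has_ddv g (1, 0) z (g' z)" "continuous_on S g'"
  shows "(LINT z:K|lborel. indicator {z. fst z \<le> T} z * g' z) = (LINT x:(Pair T -` K)|lborel. g (T, x))"
proof -
  note E = extend_by_zero[OF S g d]
  have "(LINT z|lborel. indicator {z. fst z \<le> T} z * (if z \<in> K then g' z else 0)) =
      (LINT x|lborel. (if (T, x) \<in> K then g (T, x) else 0))"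
    by (rule integral_halfspace_ddv[OF S(2) E(1) _ E(3) _ E(2)]) auto
  moreover have "(\<lambda>z. indicator {z. fst z \<le> T} z * (if z \<in> K then g' z else 0)) =
      (\<lambda>z. indicator K z *\<^sub>R (indicator {z. fst z \<le> T} z * g' z))"
    by (auto simp: indicator_def)
  moreover have "(\<lambda>x. if (T, x) \<in> K then g (T, x) else 0) = (\<lambda>x. indicator (Pair T -` K) x *\<^sub>R g (T, x))"
    by (auto simp: indicator_def)
  ultimately show ?thesis by (simp add: set_lebesgue_integral_def)
qed

section \<open>A Gagliardo--Nirenberg inequality\<close>

text \<open>The integral of \<open>(d s - ?m)\<^sup>2\<close> is nonnegative; this is
  Cauchy--Schwarz on an interval of length 1.\<close>

lemma integral_sq_le:
  fixes d :: "real \<Rightarrow> real"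
  assumes "continuous_on {0..1} d"
  shows "(integral {0..1} d)\<^sup>2 \<le> integral {0..1} (\<lambda>s. (d s)\<^sup>2)"
proof -
  let ?m = "integral {0..1} d"
  have i: "d integrable_on {0..1}" "(\<lambda>s. (d s)\<^sup>2) integrable_on {0..1}"
    using assms by (auto intro!: integrable_continuous_interval continuous_intros)
  have "((\<lambda>s. (d s)\<^sup>2 - 2 * ?m * d s + ?m\<^sup>2) has_integral
      (integral {0..1} (\<lambda>s. (d s)\<^sup>2) - 2 * ?m * ?m + ?m\<^sup>2)) {0..1}"
    using has_integral_const_real[of "?m\<^sup>2" 0 1]
    by (intro has_integral_add has_integral_diff has_integral_mult_right integrable_integral i) auto
  then have "0 \<le> integral {0..1} (\<lambda>s. (d s)\<^sup>2) - 2 * ?m * ?m + ?m\<^sup>2"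
  proof (rule has_integral_nonneg)
    fix s
    have "(d s)\<^sup>2 - 2 * ?m * d s + ?m\<^sup>2 = (d s - ?m)\<^sup>2"
      by (simp add: power2_eq_square algebra_simps)
    then show "0 \<le> (d s)\<^sup>2 - 2 * ?m * d s + ?m\<^sup>2" by simp
  qed
  then show ?thesis by (simp add: power2_eq_square)
qed

lemma pd_sum_Basis:
  fixes u :: "'a::euclidean_space \<Rightarrow> real"
  assumes "u differentiable (at x)"
  shows "pd v u x = (\<Sum>b\<in>Basis. (v \<bullet> b) * pd b u x)"
proof -
  have l: "linear (frechet_derivative u (at x))"
    using assms frechet_derivative_works has_derivative_linear by blast
  have "pd v u x = frechet_derivative u (at x) (\<Sum>b\<in>Basis. (v \<bullet> b) *\<^sub>R b)"
    by (simp add: pd_def euclidean_representation)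
  also have "\<dots> = (\<Sum>b\<in>Basis. (v \<bullet> b) * pd b u x)"
    by (simp add: linear_sum[OF l] linear_scale[OF l] pd_def)
  finally show ?thesis .
qed

lemma norm_sq_Basis: "(norm v)\<^sup>2 = (\<Sum>b\<in>Basis. (v \<bullet> b)\<^sup>2)"
  unfolding power2_norm_eq_inner euclidean_inner[of v v] by (simp add: power2_eq_square)

lemma pd_sq_le:
  fixes u :: "'a::euclidean_space \<Rightarrow> real"
  assumes "u differentiable (at x)"
  shows "(pd v u x)\<^sup>2 \<le> (norm v)\<^sup>2 * (\<Sum>b\<in>Basis. (pd b u x)\<^sup>2)"
proof -
  have "(pd v u x)\<^sup>2 \<le> (\<Sum>b\<in>Basis. (v \<bullet> b)\<^sup>2) * (\<Sum>b\<in>Basis. (pd b u x)\<^sup>2)"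
    using Cauchy_Schwarz_ineq_sum[of "\<lambda>b. v \<bullet> b" "\<lambda>b. pd b u x" Basis]
    by (simp only: pd_sum_Basis[OF assms, of v, symmetric])
  then show ?thesis by (simp add: norm_sq_Basis)
qed

lemma nn_integral_lborel_shift:
  fixes f :: "'a::euclidean_space \<Rightarrow> ennreal"
  assumes [measurable]: "f \<in> borel_measurable borel"
  shows "(\<integral>\<^sup>+z. f (z + c) \<partial>lborel) = (\<integral>\<^sup>+z. f z \<partial>lborel)"
proof -
  have "(\<integral>\<^sup>+z. f z \<partial>lborel) = (\<integral>\<^sup>+z. f z \<partial>distr lborel borel ((+) c))"
    by (simp add: lborel_distr_plus)
  also have "\<dots> = (\<integral>\<^sup>+z. f (c + z) \<partial>lborel)"
    by (intro nn_integral_distr) auto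
  finally show ?thesis by (simp add: add.commute)
qed

locale smooth_fun =
  fixes u :: "'a::euclidean_space \<Rightarrow> real"
  assumes diff: "\<And>x. u differentiable (at x)"
    and cont_pd: "\<And>b. b \<in> Basis \<Longrightarrow> continuous_on UNIV (pd b u)"
begin

definition gr :: "'a \<Rightarrow> real" where "gr x = (\<Sum>b\<in>Basis. (pd b u x)\<^sup>2)"

lemma cont_u: "continuous_on UNIV u"
  using diff by (simp add: differentiable_imp_continuous_within continuous_on_eq_continuous_within)

lemma cont_gr: "continuous_on UNIV gr"
  unfolding gr_def by (intro continuous_intros cont_pd)

lemma measurable_u_gr [measurable]: "u \<in> borel_measurable borel" "gr \<in> borel_measurable borel"
  using cont_u cont_gr borel_measurable_continuous_onI by auto

lemma gr_nonneg: "0 \<le> gr x" unfolding gr_def by (intro sum_nonneg) auto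

text \<open>The fundamental theorem along the segment from \<open>x\<close> to \<open>x + v\<close>,
  then \<open>integral_sq_le\<close>. The right side is a nonnegative integral so that the order of
  integration can later be exchanged without integrability of \<open>gr\<close>.\<close>

lemma shift_pointwise:
  "ennreal ((u (x + v) - u x)\<^sup>2) \<le> (\<integral>\<^sup>+s\<in>{0..1}. ennreal ((norm v)\<^sup>2 * gr (x + s *\<^sub>R v)) \<partial>lborel)"
proof -
  let ?d = "\<lambda>s. pd v u (x + s *\<^sub>R v)"
  have eq: "pd v u = (\<lambda>x. \<Sum>b\<in>Basis. (v \<bullet> b) * pd b u x)"
    using pd_sum_Basis[OF diff] by blast
  have "continuous_on UNIV (\<lambda>x. \<Sum>b\<in>Basis. (v \<bullet> b) * pd b u x)"
    by (intro continuous_intros cont_pd)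
  then have "continuous_on UNIV (pd v u)" by (simp only: eq[symmetric])
  then have cd: "continuous_on {0..1} ?d"
    by (rule continuous_on_compose2) (auto intro!: continuous_intros)
  have cg: "continuous_on {0..1} (\<lambda>s. (norm v)\<^sup>2 * gr (x + s *\<^sub>R v))"
    by (intro continuous_intros continuous_on_compose2[OF cont_gr]) auto
  have "(?d has_integral (u (x + 1 *\<^sub>R v) - u (x + 0 *\<^sub>R v))) {0..1}"
  proof (rule fundamental_theorem_of_calculus)
    fix s :: real
    show "((\<lambda>s. u (x + s *\<^sub>R v)) has_vector_derivative ?d s) (at s within {0..1})"
      using has_ddv_line[where f = u and z = x and s = s and b = v, OF differentiable_has_ddv[OF diff]]
      by (simp add: has_real_derivative_iff_has_vector_derivative has_vector_derivative_at_within)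
  qed simp
  then have "u (x + v) - u x = integral {0..1} ?d" by (simp add: integral_unique)
  then have "(u (x + v) - u x)\<^sup>2 \<le> integral {0..1} (\<lambda>s. (?d s)\<^sup>2)"
    using integral_sq_le[OF cd] by simp
  also have "\<dots> \<le> integral {0..1} (\<lambda>s. (norm v)\<^sup>2 * gr (x + s *\<^sub>R v))"
  proof (rule integral_le)
    show "(pd v u (x + s *\<^sub>R v))\<^sup>2 \<le> (norm v)\<^sup>2 * gr (x + s *\<^sub>R v)" for s
      unfolding gr_def by (rule pd_sq_le[OF diff])
  qed (intro integrable_continuous_interval continuous_on_power cd cg)+
  also have "ennreal \<dots> = (\<integral>\<^sup>+s\<in>{0..1}. ennreal ((norm v)\<^sup>2 * gr (x + s *\<^sub>R v)) \<partial>lborel)"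
  proof -
    have i: "set_integrable lborel {0..1} (\<lambda>s. (norm v)\<^sup>2 * gr (x + s *\<^sub>R v))"
      unfolding set_integrable_def by (rule borel_integrable_compact[OF _ cg]) auto
    have "integral {0..1} (\<lambda>s. (norm v)\<^sup>2 * gr (x + s *\<^sub>R v)) =
        (LINT s:{0..1}|lborel. (norm v)\<^sup>2 * gr (x + s *\<^sub>R v))"
      by (rule set_borel_integral_eq_integral(2)[OF i, symmetric])
    also have "ennreal \<dots> = (\<integral>\<^sup>+s. ennreal (indicator {0..1} s * ((norm v)\<^sup>2 * gr (x + s *\<^sub>R v))) \<partial>lborel)"
      using i gr_nonneg unfolding set_lebesgue_integral_def set_integrable_def
      by (subst nn_integral_eq_integral) auto
    also have "\<dots> = (\<integral>\<^sup>+s\<in>{0..1}. ennreal ((norm v)\<^sup>2 * gr (x + s *\<^sub>R v)) \<partial>lborel)"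
      by (intro nn_integral_cong) (auto simp: indicator_def)
    finally show ?thesis .
  qed
  finally show ?thesis by (simp add: ennreal_leI)
qed

text \<open>After the order of integration is exchanged, each \<open>s\<close> in the unit interval
  contributes the same integral of \<open>gr\<close>, by translation invariance.\<close>

lemma shift_L2:
  "(\<integral>\<^sup>+x. ennreal ((u (x + v) - u x)\<^sup>2) \<partial>lborel) \<le> ennreal ((norm v)\<^sup>2) * (\<integral>\<^sup>+x. ennreal (gr x) \<partial>lborel)"
proof -
  have [measurable]: "(\<lambda>p. gr (fst p + snd p *\<^sub>R v)) \<in> borel_measurable (borel \<Otimes>\<^sub>M borel)"
    unfolding borel_prod
    by (intro borel_measurable_continuous_onI continuous_on_compose2[OF cont_gr] continuous_intros) auto
  have "(\<integral>\<^sup>+x. ennreal ((u (x + v) - u x)\<^sup>2) \<partial>lborel) \<le>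
      (\<integral>\<^sup>+x. \<integral>\<^sup>+s. ennreal ((norm v)\<^sup>2 * gr (x + s *\<^sub>R v)) * indicator {0..1} s \<partial>lborel \<partial>lborel)"
    by (intro nn_integral_mono shift_pointwise)
  also have "\<dots> = (\<integral>\<^sup>+s. \<integral>\<^sup>+x. ennreal ((norm v)\<^sup>2 * gr (x + s *\<^sub>R v)) * indicator {0..1} s \<partial>lborel \<partial>lborel)"
    by (rule lborel_pair.Fubini') (simp add: case_prod_unfold)
  also have "\<dots> = (\<integral>\<^sup>+s. (ennreal ((norm v)\<^sup>2) * (\<integral>\<^sup>+x. ennreal (gr x) \<partial>lborel)) * indicator {0..1::real} s \<partial>lborel)"
  proof (rule nn_integral_cong)
    fix s :: real
    have "(\<integral>\<^sup>+x. ennreal ((norm v)\<^sup>2 * gr (x + s *\<^sub>R v)) * indicator {0..1} s \<partial>lborel) =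
      ennreal ((norm v)\<^sup>2) * (\<integral>\<^sup>+x. ennreal (gr (x + s *\<^sub>R v)) \<partial>lborel) * indicator {0..1} s"
      by (simp add: nn_integral_multc nn_integral_cmult ennreal_mult' gr_nonneg)
    then show "(\<integral>\<^sup>+x. ennreal ((norm v)\<^sup>2 * gr (x + s *\<^sub>R v)) * indicator {0..1} s \<partial>lborel) =
      ennreal ((norm v)\<^sup>2) * (\<integral>\<^sup>+x. ennreal (gr x) \<partial>lborel) * indicator {0..1} s"
      using nn_integral_lborel_shift[of "\<lambda>x. ennreal (gr x)" "s *\<^sub>R v"] by simp
  qed
  also have "\<dots> = ennreal ((norm v)\<^sup>2) * (\<integral>\<^sup>+x. ennreal (gr x) \<partial>lborel)"
    by (simp add: nn_integral_cmult_indicator)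
  finally show ?thesis .
qed

text \<open>If \<open>\<bar>u x\<bar> > l\<close> then for at least half of the vectors \<open>v\<close> in a cube of side \<open>h\<close> the value \<open>u (x + v)\<close>
  differs from \<open>u x\<close> by more than \<open>l / 2\<close>.\<close>

lemma level_set_measure:
  fixes r l A G h :: real
  assumes "0 < r" "0 < l" "0 \<le> A" "0 \<le> G" "0 < h"
    and A: "(\<integral>\<^sup>+x. ennreal (\<bar>u x\<bar> powr r) \<partial>lborel) \<le> ennreal A"
    and G: "(\<integral>\<^sup>+x. ennreal (gr x) \<partial>lborel) \<le> ennreal G"
    and h: "2 * ((2 / l) powr r * A) \<le> h ^ DIM('a)"
  shows "emeasure lborel {x. l < \<bar>u x\<bar>} \<le> ennreal (8 * real DIM('a) * h\<^sup>2 * G / l\<^sup>2)"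
proof -
  let ?n = "DIM('a)"
  define V where "V = cbox (0::'a) (h *\<^sub>R One)"
  have V[measurable]: "V \<in> sets borel" by (simp add: V_def)
  have eV: "emeasure lborel V = ennreal (h ^ ?n)"
    using \<open>0 < h\<close> by (simp add: V_def emeasure_lborel_cbox_eq inner_Basis prod_constant)
  have nV: "(norm v)\<^sup>2 \<le> ?n * h\<^sup>2" if "v \<in> V" for v
  proof -
    have "(v \<bullet> b)\<^sup>2 \<le> h\<^sup>2" if "b \<in> Basis" for b
      using \<open>v \<in> V\<close> that by (intro power_mono) (auto simp: V_def mem_box)
    then have "(\<Sum>b\<in>Basis. (v \<bullet> b)\<^sup>2) \<le> ?n * h\<^sup>2" by (intro sum_bounded_above) auto
    then show ?thesis by (simp add: norm_sq_Basis)
  qed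
  define I where "I x = (\<integral>\<^sup>+v\<in>V. ennreal ((u (x + v) - u x)\<^sup>2) \<partial>lborel)" for x
  have [measurable]: "(\<lambda>p. u (fst p + snd p)) \<in> borel_measurable (borel \<Otimes>\<^sub>M borel)"
    by measurable
  \<comment> \<open>By Chebyshev the \<open>v\<close> with
    \<open>\<bar>u (x + v)\<bar> \<ge> l / 2\<close> fill at most half of the cube; that is
    hypothesis \<open>h\<close>. For the other \<open>v\<close> the difference is at least
    \<open>l / 2\<close> in absolute value, so its square integral pays for the remaining
    \<open>h ^ ?n / 2\<close>.\<close>
  have pw: "ennreal (h ^ ?n / 2) \<le> ennreal (4 / l\<^sup>2) * I x" if x: "l < \<bar>u x\<bar>" for x
  proof -
    have "ennreal (h ^ ?n) = (\<integral>\<^sup>+v. indicator V v \<partial>lborel)" by (simp add: eV)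
    also have "\<dots> \<le> (\<integral>\<^sup>+v. ennreal ((2 / l) powr r) * ennreal (\<bar>u (x + v)\<bar> powr r) +
        ennreal (4 / l\<^sup>2) * (ennreal ((u (x + v) - u x)\<^sup>2) * indicator V v) \<partial>lborel)"
    proof (rule nn_integral_mono)
      fix v
      show "indicator V v \<le> ennreal ((2 / l) powr r) * ennreal (\<bar>u (x + v)\<bar> powr r) +
        ennreal (4 / l\<^sup>2) * (ennreal ((u (x + v) - u x)\<^sup>2) * indicator V v)"
      proof (cases "v \<in> V")
        case True
        have "1 \<le> (2 / l) powr r * \<bar>u (x + v)\<bar> powr r + 4 / l\<^sup>2 * (u (x + v) - u x)\<^sup>2"
        proof (cases "l / 2 \<le> \<bar>u (x + v)\<bar>")
          case True
          have "1 = (2 / l * (l / 2)) powr r" using \<open>0 < l\<close> by simp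
          also have "\<dots> \<le> (2 / l * \<bar>u (x + v)\<bar>) powr r"
            using True \<open>0 < l\<close> \<open>0 < r\<close> by (intro powr_mono2 mult_left_mono) auto
          also have "\<dots> = (2 / l) powr r * \<bar>u (x + v)\<bar> powr r"
            using \<open>0 < l\<close> by (intro powr_mult)
          finally show ?thesis by (smt (verit) divide_nonneg_nonneg zero_le_power2 mult_nonneg_nonneg)
        next
          case False
          then have "l / 2 \<le> \<bar>u (x + v) - u x\<bar>" using x by (simp add: abs_if split: if_splits)
          then have "(l / 2)\<^sup>2 \<le> (u (x + v) - u x)\<^sup>2"
            using \<open>0 < l\<close> by (subst abs_le_square_iff[symmetric]) auto
          then have "4 / l\<^sup>2 * (l / 2)\<^sup>2 \<le> 4 / l\<^sup>2 * (u (x + v) - u x)\<^sup>2"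
            by (intro mult_left_mono) auto
          moreover have "4 / l\<^sup>2 * (l / 2)\<^sup>2 = 1" using \<open>0 < l\<close> by (simp add: power2_eq_square)
          ultimately show ?thesis by (smt (verit) powr_ge_zero mult_nonneg_nonneg)
        qed
        then have "ennreal 1 \<le> ennreal ((2 / l) powr r * \<bar>u (x + v)\<bar> powr r + 4 / l\<^sup>2 * (u (x + v) - u x)\<^sup>2)"
          by (rule ennreal_leI)
        also have "\<dots> = ennreal ((2 / l) powr r) * ennreal (\<bar>u (x + v)\<bar> powr r) +
            ennreal (4 / l\<^sup>2) * ennreal ((u (x + v) - u x)\<^sup>2)"
          by (subst ennreal_plus) (auto simp: ennreal_mult simp del: times_divide_eq_left)
        finally show ?thesis using True by simp
      qed simp
    qed
    also have "\<dots> = ennreal ((2 / l) powr r) * (\<integral>\<^sup>+v. ennreal (\<bar>u (v + x)\<bar> powr r) \<partial>lborel) + ennreal (4 / l\<^sup>2) * I x"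
      unfolding I_def by (subst nn_integral_add) (auto simp: nn_integral_cmult add.commute)
    also have "\<dots> \<le> ennreal ((2 / l) powr r) * ennreal A + ennreal (4 / l\<^sup>2) * I x"
      using A nn_integral_lborel_shift[of "\<lambda>x. ennreal (\<bar>u x\<bar> powr r)" x]
      by (intro add_right_mono mult_left_mono) auto
    also have "\<dots> \<le> ennreal (h ^ ?n / 2) + ennreal (4 / l\<^sup>2) * I x"
      using h by (intro add_right_mono) (auto simp: ennreal_mult[symmetric] \<open>0 \<le> A\<close> intro!: ennreal_leI)
    finally have "ennreal (h ^ ?n / 2) + ennreal (h ^ ?n / 2) \<le> ennreal (h ^ ?n / 2) + ennreal (4 / l\<^sup>2) * I x"
      using \<open>0 < h\<close> by (simp add: ennreal_plus[symmetric] del: ennreal_plus)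
    then show ?thesis by (simp add: ennreal_add_left_cancel_le)
  qed
  have [measurable]: "{x. l < \<bar>u x\<bar>} \<in> sets borel" by measurable
  have "ennreal (h ^ ?n / 2) * emeasure lborel {x. l < \<bar>u x\<bar>} =
      (\<integral>\<^sup>+x. ennreal (h ^ ?n / 2) * indicator {x. l < \<bar>u x\<bar>} x \<partial>lborel)"
    by (simp add: nn_integral_cmult)
  also have "\<dots> \<le> (\<integral>\<^sup>+x. ennreal (4 / l\<^sup>2) * I x \<partial>lborel)"
    by (intro nn_integral_mono) (use pw in \<open>auto simp: indicator_def\<close>)
  also have "\<dots> = ennreal (4 / l\<^sup>2) * (\<integral>\<^sup>+x. I x \<partial>lborel)"
    unfolding I_def by (intro nn_integral_cmult) measurable
  also have "(\<integral>\<^sup>+x. I x \<partial>lborel) = (\<integral>\<^sup>+v. \<integral>\<^sup>+x. ennreal ((u (x + v) - u x)\<^sup>2) * indicator V v \<partial>lborel \<partial>lborel)"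
    unfolding I_def by (rule lborel_pair.Fubini') (simp add: case_prod_unfold)
  also have "\<dots> \<le> (\<integral>\<^sup>+v. ennreal (real ?n * h\<^sup>2 * G) * indicator V v \<partial>lborel)"
  proof (rule nn_integral_mono)
    fix v
    show "(\<integral>\<^sup>+x. ennreal ((u (x + v) - u x)\<^sup>2) * indicator V v \<partial>lborel) \<le> ennreal (real ?n * h\<^sup>2 * G) * indicator V v"
    proof (cases "v \<in> V")
      case True
      have "(\<integral>\<^sup>+x. ennreal ((u (x + v) - u x)\<^sup>2) \<partial>lborel) \<le> ennreal ((norm v)\<^sup>2) * (\<integral>\<^sup>+x. ennreal (gr x) \<partial>lborel)"
        by (rule shift_L2)
      also have "\<dots> \<le> ennreal (real ?n * h\<^sup>2) * ennreal G"
        by (intro mult_mono ennreal_leI nV True G) auto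
      finally show ?thesis using True \<open>0 \<le> G\<close> by (simp add: ennreal_mult)
    qed simp
  qed
  also have "\<dots> = ennreal (real ?n * h\<^sup>2 * G) * ennreal (h ^ ?n)"
    by (simp add: nn_integral_cmult eV)
  finally have "ennreal (h ^ ?n / 2) * emeasure lborel {x. l < \<bar>u x\<bar>} \<le>
      ennreal (4 / l\<^sup>2) * (ennreal (real ?n * h\<^sup>2 * G) * ennreal (h ^ ?n))"
    by (simp add: mult_left_mono)
  also have "\<dots> = ennreal (h ^ ?n / 2) * ennreal (8 * real ?n * h\<^sup>2 * G / l\<^sup>2)"
    using \<open>0 < h\<close> \<open>0 \<le> G\<close> by (simp add: ennreal_mult[symmetric] field_simps)
  finally show ?thesis
    using \<open>0 < h\<close> by (subst (asm) ennreal_mult_le_mult_iff) auto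
qed

text \<open>Dyadic layer-cake decomposition: where \<open>\<bar>u x\<bar> \<le> 1\<close> the power
  \<open>r\<close> dominates, and the level sets \<open>2 ^ k < \<bar>u x\<bar>\<close> are measured
  by \<open>level_set_measure\<close>. The resulting series is geometric with ratio
  \<open>\<theta>\<close>, and the upper bound on \<open>q\<close> says precisely that
  \<open>\<theta> < 1\<close>. The gradient enters linearly, multiplied by a positive power of
  \<open>A\<close>; this is what makes the later absorption possible.\<close>

lemma gagliardo_nirenberg:
  fixes r q A G :: real
  assumes "0 < r" "r \<le> q" "q < 2 + 2 * r / DIM('a)" "0 < A" "0 \<le> G"
    and A: "(\<integral>\<^sup>+x. ennreal (\<bar>u x\<bar> powr r) \<partial>lborel) \<le> ennreal A"
    and G: "(\<integral>\<^sup>+x. ennreal (gr x) \<partial>lborel) \<le> ennreal G"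
  shows "(\<integral>\<^sup>+x. ennreal (\<bar>u x\<bar> powr q) \<partial>lborel) \<le>
    ennreal (A + 8 * real DIM('a) * 2 powr q * (2 powr (r + 1)) powr (2 / DIM('a)) /
      (1 - 2 powr (q - 2 - 2 * r / DIM('a))) * A powr (2 / DIM('a)) * G)"
proof -
  let ?n = "real DIM('a)"
  have n: "?n > 0" by simp
  define \<theta> where "\<theta> = (2::real) powr (q - 2 - 2 * r / ?n)"
  have \<theta>: "0 < \<theta>" "\<theta> < 1"
  proof -
    show "0 < \<theta>" by (simp add: \<theta>_def)
    have "\<theta> < 2 powr 0" unfolding \<theta>_def using assms(3) by (intro powr_less_mono) auto
    then show "\<theta> < 1" by simp
  qed
  define c where "c = 8 * ?n * 2 powr q * (2 powr (r + 1)) powr (2 / ?n) * A powr (2 / ?n) * G"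
  have c0: "0 \<le> c" unfolding c_def using \<open>0 \<le> G\<close> by simp
  have lev: "emeasure lborel {x. 2 ^ k < \<bar>u x\<bar>} * ennreal (2 powr ((real k + 1) * q)) \<le> ennreal (c * \<theta> ^ k)" for k
  proof -
    \<comment> \<open>The smallest cube that \<open>level_set_measure\<close> allows at level
      \<open>2 ^ k\<close>: its last hypothesis holds with equality. Since \<open>h\<close> shrinks
      as \<open>k\<close> grows, the factor \<open>h\<^sup>2\<close> produces the decay
      \<open>2 powr (- 2 * r / ?n * k)\<close>.\<close>
    define h where "h = (2 * ((2 / 2 ^ k) powr r * A)) powr (1 / ?n)"
    have h: "h > 0" unfolding h_def using \<open>0 < A\<close> by simp
    have "h ^ DIM('a) = 2 * ((2 / 2 ^ k) powr r * A)"
      unfolding h_def using \<open>0 < A\<close> n by (simp add: powr_powr powr_realpow[symmetric])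
    then have "emeasure lborel {x. 2 ^ k < \<bar>u x\<bar>} \<le> ennreal (8 * ?n * h\<^sup>2 * G / (2 ^ k)\<^sup>2)"
      using \<open>0 < A\<close> \<open>0 \<le> G\<close> \<open>0 < r\<close> h by (intro level_set_measure[OF _ _ _ _ _ A G]) auto
    then have "emeasure lborel {x. 2 ^ k < \<bar>u x\<bar>} * ennreal (2 powr ((real k + 1) * q)) \<le>
        ennreal (8 * ?n * h\<^sup>2 * G / (2 ^ k)\<^sup>2) * ennreal (2 powr ((real k + 1) * q))"
      by (intro mult_right_mono) auto
    also have "\<dots> = ennreal (c * \<theta> ^ k)"
    proof -
      have k2: "(2::real) ^ k = 2 powr real k" by (simp add: powr_realpow)
      have e0: "2 / 2 ^ k = 2 powr (1 - real k)" by (simp add: k2 powr_diff)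
      have "2 * (2 / 2 ^ k) powr r = 2 powr (1 + (1 - real k) * r)"
        unfolding e0 powr_powr powr_add by simp
      also have "1 + (1 - real k) * r = r + 1 + - r * real k" by algebra
      finally have e1: "2 * ((2 / 2 ^ k) powr r * A) = (2 powr (r + 1) * 2 powr (- r * real k)) * A"
        by (simp only: powr_add mult.assoc[symmetric])
      have e2: "(2 powr (- r * real k)) powr (2 / ?n) = 2 powr (- 2 * r / ?n * real k)"
        unfolding powr_powr by (rule arg_cong[of _ _ "(powr) 2"]) simp
      have "h\<^sup>2 = (2 * ((2 / 2 ^ k) powr r * A)) powr (1 / ?n + 1 / ?n)"
        unfolding h_def powr_add by (simp add: power2_eq_square)
      also have "1 / ?n + 1 / ?n = 2 / ?n" by simp
      finally have h2: "h\<^sup>2 = (2 powr (r + 1)) powr (2 / ?n) * 2 powr (- 2 * r / ?n * k) * A powr (2 / ?n)"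
        unfolding e1 powr_mult e2 .
      have "\<theta> ^ k = \<theta> powr real k" using \<theta>(1) by (simp add: powr_realpow)
      also have "\<dots> = 2 powr ((q * k + (- 2 * r / ?n * k)) - (real k + real k))"
        unfolding \<theta>_def powr_powr
        by (rule arg_cong[of _ _ "(powr) 2"]) (simp add: left_diff_distrib)
      finally have t: "\<theta> ^ k = 2 powr (q * k) * 2 powr (- 2 * r / ?n * k) / (2 ^ k)\<^sup>2"
        unfolding powr_diff powr_add k2 power2_eq_square .
      have "8 * ?n * h\<^sup>2 * G / (2 ^ k)\<^sup>2 * 2 powr ((real k + 1) * q) = c * \<theta> ^ k"
        unfolding h2 t c_def by (simp only: distrib_right powr_add mult_1) (simp add: mult.commute[of q])
      then show ?thesis using \<open>0 \<le> G\<close> by (simp add: ennreal_mult[symmetric])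
    qed
    finally show ?thesis .
  qed
  have pw: "ennreal (\<bar>u x\<bar> powr q) \<le> ennreal (\<bar>u x\<bar> powr r) +
     (\<Sum>k. indicator {x. 2 ^ k < \<bar>u x\<bar>} x * ennreal (2 powr ((real k + 1) * q)))" for x
  proof (cases "\<bar>u x\<bar> \<le> 1")
    case True
    then have "\<bar>u x\<bar> powr q \<le> \<bar>u x\<bar> powr r"
      using \<open>r \<le> q\<close> \<open>0 < r\<close> by (intro powr_mono') auto
    then show ?thesis by (intro add_increasing2 ennreal_leI) auto
  next
    case False
    obtain m where m: "\<bar>u x\<bar> < 2 ^ m" using real_arch_pow[of 2] by auto
    \<comment> \<open>The dyadic index of \<open>x\<close>: it is positive because
      \<open>\<bar>u x\<bar> > 1\<close>, and minimality of \<open>j = Suc k\<close> puts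
      \<open>\<bar>u x\<bar>\<close> above \<open>2 ^ k\<close>.\<close>
    define j where "j = (LEAST m. \<bar>u x\<bar> \<le> 2 ^ m)"
    have j: "\<bar>u x\<bar> \<le> 2 ^ j" unfolding j_def by (rule LeastI[of _ m]) (use m in auto)
    have "j \<noteq> 0" using j False by (cases j) auto
    then obtain k where k: "j = Suc k" by (cases j) auto
    have k2: "2 ^ k < \<bar>u x\<bar>" using not_less_Least[of k "\<lambda>m. \<bar>u x\<bar> \<le> 2 ^ m"] k unfolding j_def by auto
    have "\<bar>u x\<bar> powr q \<le> (2 ^ j) powr q" using j assms by (intro powr_mono2) auto
    also have "\<dots> = 2 powr ((real k + 1) * q)"
      by (simp only: k powr_realpow[symmetric, of 2] zero_less_numeral powr_powr) (simp add: add.commute)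
    finally have uq: "ennreal (\<bar>u x\<bar> powr q) \<le> indicator {x. 2 ^ k < \<bar>u x\<bar>} x * ennreal (2 powr ((real k + 1) * q))"
      using k2 by (simp add: ennreal_leI)
    define F :: "nat \<Rightarrow> ennreal"
      where "F i = indicator {x. 2 ^ i < \<bar>u x\<bar>} x * ennreal (2 powr ((real i + 1) * q))" for i
    have "F k \<le> (\<Sum>i. F i)"
      using sum_le_suminf[of F "{k}"] by simp
    then have "indicator {x. 2 ^ k < \<bar>u x\<bar>} x * ennreal (2 powr ((real k + 1) * q)) \<le>
        (\<Sum>k. indicator {x. 2 ^ k < \<bar>u x\<bar>} x * ennreal (2 powr ((real k + 1) * q)))"
      unfolding F_def .
    with uq show ?thesis by (intro add_increasing) auto
  qed
  have "(\<integral>\<^sup>+x. ennreal (\<bar>u x\<bar> powr q) \<partial>lborel) \<le> (\<integral>\<^sup>+x. ennreal (\<bar>u x\<bar> powr r) +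
     (\<Sum>k. indicator {x. 2 ^ k < \<bar>u x\<bar>} x * ennreal (2 powr ((real k + 1) * q))) \<partial>lborel)"
    by (intro nn_integral_mono pw)
  also have "\<dots> = (\<integral>\<^sup>+x. ennreal (\<bar>u x\<bar> powr r) \<partial>lborel) +
     (\<Sum>k. emeasure lborel {x. 2 ^ k < \<bar>u x\<bar>} * ennreal (2 powr ((real k + 1) * q)))"
    by (subst nn_integral_add) (auto simp: nn_integral_suminf nn_integral_multc)
  also have "\<dots> \<le> ennreal A + (\<Sum>k. ennreal (c * \<theta> ^ k))"
    by (intro add_mono A suminf_le lev) auto
  also have "(\<Sum>k. ennreal (c * \<theta> ^ k)) = ennreal (c / (1 - \<theta>))"
    using \<theta> c0 sums_mult[OF geometric_sums[of \<theta>], of c]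
    by (intro suminf_ennreal_eq) auto
  also have "ennreal A + ennreal (c / (1 - \<theta>)) = ennreal (A + c / (1 - \<theta>))"
    using \<theta> c0 \<open>0 < A\<close> by simp
  finally show ?thesis unfolding c_def \<theta>_def by (simp add: mult_ac)
qed

end

section \<open>The Carleman identity\<close>

text \<open>At 0 the difference quotient is bounded by \<open>\<bar>h\<bar> powr (r - 1)\<close>,
  which tends to 0. The form of the derivative covers this point even for \<open>r < 2\<close>, as
  \<open>0 powr s = 0\<close> for every \<open>s\<close>.\<close>

lemma DERIV_abs_powr:
  assumes "r > 1"
  shows "((\<lambda>s. \<bar>s\<bar> powr r) has_real_derivative r * (\<bar>x\<bar> powr (r - 2) * x)) (at x)"
proof -
  consider "x > 0" | "x < 0" | "x = 0" by linarith
  then show ?thesis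
  proof cases
    case 1
    have "\<forall>\<^sub>F s in nhds x. s powr r = \<bar>s\<bar> powr r"
      by (rule eventually_mono[OF eventually_nhds_in_open[of "{0<..}" x]]) (use 1 in auto)
    moreover have "((\<lambda>s. s powr r) has_real_derivative r * x powr (r - 1)) (at x)"
      using 1 by (rule has_real_derivative_powr)
    moreover have "x powr (r - 1) = x powr (r - 2) * x"
      using 1 powr_add[of x "r - 2" 1] by simp
    ultimately show ?thesis
      using DERIV_cong_ev[OF refl, of "\<lambda>s. s powr r" "\<lambda>s. \<bar>s\<bar> powr r" x] 1 by auto
  next
    case 2
    have "\<forall>\<^sub>F s in nhds x. (- s) powr r = \<bar>s\<bar> powr r"
      by (rule eventually_mono[OF eventually_nhds_in_open[of "{..<0}" x]]) (use 2 in auto)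
    moreover have "((\<lambda>s. (- s) powr r) has_real_derivative - (r * (- x) powr (r - 1))) (at x)"
      using 2 by (auto intro!: derivative_eq_intros has_real_derivative_powr[THEN DERIV_chain2])
    moreover have "(- x) powr (r - 1) = (- x) powr (r - 2) * (- x)"
      using 2 powr_add[of "- x" "r - 2" 1] by simp
    ultimately show ?thesis
      using DERIV_cong_ev[OF refl, of "\<lambda>s. (- s) powr r" "\<lambda>s. \<bar>s\<bar> powr r" x] 2 by auto
  next
    case 3
    have lim: "((\<lambda>h. \<bar>h\<bar> powr (r - 1)) \<longlongrightarrow> 0) (at (0::real))"
    proof -
      have "((\<lambda>h::real. \<bar>h\<bar> powr (r - 1)) \<longlongrightarrow> \<bar>0\<bar> powr (r - 1)) (at 0)"
        by (rule tendsto_powr') (use assms in \<open>auto intro!: tendsto_rabs_zero\<close>)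
      then show ?thesis by simp
    qed
    have b: "norm ((\<bar>0 + h\<bar> powr r - \<bar>0\<bar> powr r) / h) \<le> \<bar>h\<bar> powr (r - 1)" for h :: real
      using powr_diff[of "\<bar>h\<bar>" r 1] by (cases "h = 0") auto
    have ev: "\<forall>\<^sub>F h in at 0. norm ((\<bar>0 + h\<bar> powr r - \<bar>0\<bar> powr r) / h) \<le> \<bar>h\<bar> powr (r - 1)"
      by (intro always_eventually allI b)
    have "((\<lambda>h. (\<bar>0 + h\<bar> powr r - \<bar>0\<bar> powr r) / h) \<longlongrightarrow> 0) (at (0::real))"
      by (rule Lim_null_comparison[OF ev lim])
    then show ?thesis using 3 by (simp add: DERIV_def)
  qed
qed

lemma continuous_on_abs_powr:
  fixes g :: "'a::topological_space \<Rightarrow> real"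
  assumes "continuous_on S g" "r > 0"
  shows "continuous_on S (\<lambda>z. \<bar>g z\<bar> powr r)"
  by (rule continuous_on_powr'[OF continuous_on_rabs[OF assms(1)] continuous_on_const]) (use assms(2) in auto)

lemma Ck_on_Suc_continuous:
  assumes "Ck_on (Suc k) S f"
  shows "continuous_on S f"
  unfolding continuous_on_eq_continuous_within
proof
  fix z assume "z \<in> S"
  then have "f differentiable (at z)" using assms by simp
  then show "continuous (at z within S) f"
    by (rule differentiable_imp_continuous_within[OF differentiable_at_withinI])
qed

text \<open>The Carleman identity at one point, freed from calculus: \<open>s\<close> is the
  signature, \<open>y\<close> stands for the coordinates of \<open>z - q\<close>, \<open>d\<close>
  and \<open>H\<close> for the first and second derivatives of \<open>u\<close>, \<open>vb\<close>
  for the first derivatives of \<open>V\<close>, and \<open>A\<close>, \<open>A1\<close>,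
  \<open>A2\<close> for the weight and its derivatives in \<open>f\<close>. The value of
  \<open>\<gamma>\<close> cancels \<open>A * L\<close> and at the same time turns the coefficient of
  \<open>u\<^sup>2\<close> into \<open>2 * A1 * \<gamma>\<^sup>2\<close>, which completes the
  square.\<close>

lemma carleman_algebra:
  fixes s y d vb :: "'b \<Rightarrow> real" and H :: "'b \<Rightarrow> 'b \<Rightarrow> real"
  assumes "finite B" and s: "\<And>b. b \<in> B \<Longrightarrow> s b * s b = 1"
    and H: "\<And>b c. b \<in> B \<Longrightarrow> c \<in> B \<Longrightarrow> H b c = H c b"
    and f: "f = (\<Sum>b\<in>B. s b * (y b)\<^sup>2)" and S: "S = (\<Sum>b\<in>B. y b * d b)" and L: "L = (\<Sum>b\<in>B. s b * (d b)\<^sup>2)"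
    and W: "(\<Sum>b\<in>B. s b * H b b) = - v * nl" and SV: "SV = (\<Sum>b\<in>B. y b * vb b)"
    and w: "nl * u = w" and U: "U = v * w / (p + 1)" and p: "p + 1 \<noteq> 0"
    and A: "f * A1 = a * A" "f * A2 = (a - 1) * A1"
    and g: "\<gamma> = (real (card B) - 2) / 2 + a"
  shows "(\<Sum>b\<in>B. A1 * (2 * s b * y b) * (s b * d b * S - y b / 2 * L + y b * U + \<gamma> * u * s b * d b)
     + A * (s b * H b b * S + s b * d b * (d b + (\<Sum>c\<in>B. y c * H c b)) - L / 2 - y b / 2 * (\<Sum>c\<in>B. s c * (2 * d c * H c b))
         + U + y b * (vb b * w / (p + 1) + v * nl * d b) + \<gamma> * d b * s b * d b + \<gamma> * u * s b * H b b)
     + \<gamma> * (A2 * (2 * s b * y b) * u\<^sup>2 * y b + A1 * (2 * u * d b) * y b + A1 * u\<^sup>2))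
   = 2 * A1 * (S + \<gamma> * u)\<^sup>2 + (2 - (p - 1) * \<gamma>) * A * U + A * SV * w / (p + 1)"
proof -
  \<comment> \<open>Apart from the trace, which the equation replaces, the Hessian enters through
    the derivative of \<open>S\<close> and through the derivative of \<open>L\<close>. By symmetry
    of \<open>H\<close> both contributions equal \<open>M\<close>, with opposite signs.\<close>
  define M where "M = (\<Sum>b\<in>B. \<Sum>c\<in>B. s b * d b * (y c * H c b))"
  have M2: "(\<Sum>b\<in>B. \<Sum>c\<in>B. y b * (s c * (d c * H c b))) = M"
    unfolding M_def by (subst sum.swap) (auto intro!: sum.cong simp: H mult_ac)
  have M3: "(\<Sum>b\<in>B. s b * d b * (\<Sum>c\<in>B. y c * H c b)) = M"
    by (simp add: M_def sum_distrib_left)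
  have M4: "(\<Sum>b\<in>B. y b * (\<Sum>c\<in>B. s c * (d c * H c b))) = M"
    by (simp add: M2[symmetric] sum_distrib_left)
  have ss: "s b * (s b * x) = x" if "b \<in> B" for b x
    using s[OF that] by (simp add: mult.assoc[symmetric])
  have "(\<Sum>b\<in>B. A1 * (2 * s b * y b) * (s b * d b * S - y b / 2 * L + y b * U + \<gamma> * u * s b * d b)) =
      (\<Sum>b\<in>B. 2 * A1 * S * (y b * d b) - A1 * L * (s b * (y b)\<^sup>2) + 2 * A1 * U * (s b * (y b)\<^sup>2) + 2 * A1 * \<gamma> * u * (y b * d b))"
  proof (rule sum.cong[OF refl])
    fix b assume b: "b \<in> B"
    have "A1 * (2 * s b * y b) * (s b * d b * S - y b / 2 * L + y b * U + \<gamma> * u * s b * d b) =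
      2 * A1 * S * (s b * (s b * (y b * d b))) - A1 * L * (s b * (y b)\<^sup>2) + 2 * A1 * U * (s b * (y b)\<^sup>2) + 2 * A1 * \<gamma> * u * (s b * (s b * (y b * d b)))"
      by (simp add: algebra_simps power2_eq_square)
    then show "A1 * (2 * s b * y b) * (s b * d b * S - y b / 2 * L + y b * U + \<gamma> * u * s b * d b) =
      2 * A1 * S * (y b * d b) - A1 * L * (s b * (y b)\<^sup>2) + 2 * A1 * U * (s b * (y b)\<^sup>2) + 2 * A1 * \<gamma> * u * (y b * d b)"
      by (simp only: ss[OF b])
  qed
  then have 1: "(\<Sum>b\<in>B. A1 * (2 * s b * y b) * (s b * d b * S - y b / 2 * L + y b * U + \<gamma> * u * s b * d b)) =
      2 * A1 * S * S - A1 * L * f + 2 * A1 * U * f + 2 * A1 * \<gamma> * u * S"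
    by (simp only: sum.distrib sum_subtractf sum_distrib_left[symmetric] f S)
  have "(\<Sum>b\<in>B. A * (s b * H b b * S + s b * d b * (d b + (\<Sum>c\<in>B. y c * H c b)) - L / 2 - y b / 2 * (\<Sum>c\<in>B. s c * (2 * d c * H c b))
         + U + y b * (vb b * w / (p + 1) + v * nl * d b) + \<gamma> * d b * s b * d b + \<gamma> * u * s b * H b b)) =
     A * (\<Sum>b\<in>B. S * (s b * H b b) + s b * (d b)\<^sup>2 + (\<Sum>c\<in>B. s b * d b * (y c * H c b)) - L / 2 - (\<Sum>c\<in>B. y b * (s c * (d c * H c b)))
         + U + w / (p + 1) * (y b * vb b) + v * nl * (y b * d b) + \<gamma> * (s b * (d b)\<^sup>2) + \<gamma> * u * (s b * H b b))"
    unfolding sum_distrib_left[symmetric]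
    by (intro arg_cong2[of _ _ _ _ "(*)"] refl sum.cong)
       (simp add: algebra_simps power2_eq_square sum_distrib_left)
  also have "\<dots> = A * (S * (- v * nl) + L + M - real (card B) * (L / 2) - M + real (card B) * U
      + w / (p + 1) * SV + v * nl * S + \<gamma> * L + \<gamma> * u * (- v * nl))"
    by (simp only: sum.distrib sum_subtractf sum_distrib_left[symmetric] sum_constant W L[symmetric] S[symmetric] SV[symmetric] M3 M4)
  also have "\<dots> = A * (L * (1 - real (card B) / 2 + \<gamma>) + real (card B) * U + w / (p + 1) * SV - \<gamma> * v * w)"
    unfolding w[symmetric] by (simp add: algebra_simps)
  finally have 2: "(\<Sum>b\<in>B. A * (s b * H b b * S + s b * d b * (d b + (\<Sum>c\<in>B. y c * H c b)) - L / 2 - y b / 2 * (\<Sum>c\<in>B. s c * (2 * d c * H c b))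
         + U + y b * (vb b * w / (p + 1) + v * nl * d b) + \<gamma> * d b * s b * d b + \<gamma> * u * s b * H b b)) =
     A * (L * (1 - real (card B) / 2 + \<gamma>) + real (card B) * U + w / (p + 1) * SV - \<gamma> * v * w)"
    .
  have "(\<Sum>b\<in>B. \<gamma> * (A2 * (2 * s b * y b) * u\<^sup>2 * y b + A1 * (2 * u * d b) * y b + A1 * u\<^sup>2)) =
     (\<Sum>b\<in>B. 2 * \<gamma> * A2 * u\<^sup>2 * (s b * (y b)\<^sup>2) + 2 * \<gamma> * A1 * u * (y b * d b) + \<gamma> * A1 * u\<^sup>2)"
    by (intro sum.cong refl) (simp add: algebra_simps power2_eq_square)
  then have 3: "(\<Sum>b\<in>B. \<gamma> * (A2 * (2 * s b * y b) * u\<^sup>2 * y b + A1 * (2 * u * d b) * y b + A1 * u\<^sup>2)) =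
     2 * \<gamma> * A2 * u\<^sup>2 * f + 2 * \<gamma> * A1 * u * S + real (card B) * (\<gamma> * A1 * u\<^sup>2)"
    by (simp only: sum.distrib sum_distrib_left[symmetric] f S sum_constant) (simp only: ac_simps)
  have "2 * A1 * S * S - A1 * L * f + 2 * A1 * U * f + 2 * A1 * \<gamma> * u * S
    + A * (L * (1 - real (card B) / 2 + \<gamma>) + real (card B) * U + w / (p + 1) * SV - \<gamma> * v * w)
    + (2 * \<gamma> * A2 * u\<^sup>2 * f + 2 * \<gamma> * A1 * u * S + real (card B) * (\<gamma> * A1 * u\<^sup>2))
    = 2 * A1 * (S + \<gamma> * u)\<^sup>2 + (2 - (p - 1) * \<gamma>) * A * U + A * SV * w / (p + 1)"
  proof -
    have vw: "v * w = (p + 1) * U" using U p by simp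
    have n: "real (card B) = 2 * \<gamma> - 2 * a + 2" using g by (simp add: field_simps)
    have "A1 * L * f = (f * A1) * L" by (simp only: ac_simps)
    then have e1: "A1 * L * f = a * A * L" by (simp only: A)
    have "2 * A1 * U * f = 2 * (f * A1) * U" by (simp only: ac_simps)
    then have e2: "2 * A1 * U * f = 2 * (a * A) * U" by (simp only: A)
    have "2 * \<gamma> * A2 * u\<^sup>2 * f = 2 * \<gamma> * (f * A2) * u\<^sup>2" by (simp only: ac_simps)
    then have e3: "2 * \<gamma> * A2 * u\<^sup>2 * f = 2 * \<gamma> * ((a - 1) * A1) * u\<^sup>2" by (simp only: A)
    have e4: "\<gamma> * v * w = \<gamma> * ((p + 1) * U)" using vw by simp
    have "w / (p + 1) * SV = SV * w / (p + 1)" by simp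
    then show ?thesis unfolding e1 e2 e3 e4 n
      by (simp add: algebra_simps power2_eq_square add_divide_distrib diff_divide_distrib)
  qed
  then show ?thesis by (simp only: sum.distrib 1 2 3)
qed

text \<open>The function \<open>sg\<close> is the signature: with \<open>sg (1, 0) = -1\<close> and \<open>sg = 1\<close> on the spatial basis vectors
  the sum in \<open>eq\<close> is the d'Alembertian.\<close>

locale wave_fun =
  fixes S :: "'a::euclidean_space set" and sg :: "'a \<Rightarrow> real" and p :: real and u V :: "'a \<Rightarrow> real"
  assumes open_S: "open S" and sg: "\<And>b. b \<in> Basis \<Longrightarrow> sg b * sg b = 1" and p1: "1 < p"
    and u2: "Ck_on 2 S u" and V1: "Ck_on 1 S V"
    and eq: "\<And>z. z \<in> S \<Longrightarrow> (\<Sum>b\<in>Basis. sg b * pd b (pd b u) z) = - V z * nonlin p (u z)"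
begin

lemma cont:
  "continuous_on S u" "b \<in> Basis \<Longrightarrow> continuous_on S (pd b u)"
  "b \<in> Basis \<Longrightarrow> c \<in> Basis \<Longrightarrow> continuous_on S (pd b (pd c u))"
  "continuous_on S V" "b \<in> Basis \<Longrightarrow> continuous_on S (pd b V)"
proof -
  have u: "Ck_on (Suc (Suc 0)) S u" and V: "Ck_on (Suc 0) S V"
    using u2 V1 by (simp_all add: numeral_2_eq_2)
  show "continuous_on S u" "continuous_on S V"
    by (rule Ck_on_Suc_continuous[OF u], rule Ck_on_Suc_continuous[OF V])
  show "b \<in> Basis \<Longrightarrow> continuous_on S (pd b u)"
    using u by (intro Ck_on_Suc_continuous[of 0]) simp
  show "b \<in> Basis \<Longrightarrow> c \<in> Basis \<Longrightarrow> continuous_on S (pd b (pd c u))"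
    using u by simp
  show "b \<in> Basis \<Longrightarrow> continuous_on S (pd b V)"
    using V by simp
qed

lemma ddv:
  "z \<in> S \<Longrightarrow> has_ddv u b z (pd b u z)"
  "z \<in> S \<Longrightarrow> c \<in> Basis \<Longrightarrow> has_ddv (pd c u) b z (pd b (pd c u) z)"
  "z \<in> S \<Longrightarrow> has_ddv V b z (pd b V z)"
  using u2 V1 by (simp_all add: numeral_2_eq_2 differentiable_has_ddv)

lemma pd_symmetric:
  assumes "z \<in> S" "b \<in> Basis" "c \<in> Basis"
  shows "pd c (pd b u) z = pd b (pd c u) z"
  by (rule second_ddv_symmetric[OF open_S assms(1), of u b "pd b u" c "pd c u"])
     (use assms in \<open>auto intro!: ddv cont\<close>)

definition w :: "'a \<Rightarrow> real" where "w z = \<bar>u z\<bar> powr (p + 1)"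
definition U :: "'a \<Rightarrow> real" where "U z = V z * w z / (p + 1)"
text \<open>The Lorentzian square of the gradient, which has no sign; \<open>Q\<close> is the
  positive quantity in which all errors are measured.\<close>

definition L :: "'a \<Rightarrow> real" where "L z = (\<Sum>b\<in>Basis. sg b * (pd b u z)\<^sup>2)"
definition Q :: "'a \<Rightarrow> real" where "Q z = (\<Sum>b\<in>Basis. (pd b u z)\<^sup>2) + (u z)\<^sup>2"

lemma w_nonneg: "0 \<le> w z" by (simp add: w_def)

lemma w_eq: "nonlin p (u z) * u z = w z"
proof -
  have "w z = \<bar>u z\<bar> powr (p - 1) * \<bar>u z\<bar> powr 2"
    unfolding w_def powr_add[symmetric] by (simp add: algebra_simps)
  also have "\<bar>u z\<bar> powr 2 = u z * u z" by (simp add: powr_numeral power2_eq_square)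
  finally show ?thesis by (simp add: nonlin_def)
qed

lemma ddv_powr:
  assumes "z \<in> S" "1 < r"
  shows "has_ddv (\<lambda>z. \<bar>u z\<bar> powr r) b z (r * (\<bar>u z\<bar> powr (r - 2) * u z) * pd b u z)"
  using DERIV_chain2[OF DERIV_abs_powr[OF assms(2)] ddv(1)[OF assms(1), of b]] by simp

lemma ddv_w: "z \<in> S \<Longrightarrow> has_ddv w b z ((p + 1) * nonlin p (u z) * pd b u z)"
  using ddv_powr[of z "p + 1" b] p1 by (simp add: w_def[abs_def] nonlin_def)

lemma ddv_U:
  assumes "z \<in> S"
  shows "has_ddv U b z (pd b V z * w z / (p + 1) + V z * nonlin p (u z) * pd b u z)"
  unfolding U_def[abs_def] using p1
  by (intro DERIV_cong[OF DERIV_cdivide[OF DERIV_mult[OF ddv(3)[OF assms] ddv_w[OF assms]]]])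
    (simp add: add_divide_distrib)

lemma ddv_L:
  assumes "z \<in> S" "b \<in> Basis"
  shows "has_ddv L b z (\<Sum>c\<in>Basis. sg c * (2 * pd c u z * pd b (pd c u) z))"
  unfolding L_def[abs_def]
proof (rule DERIV_sum)
  fix c :: 'a assume c: "c \<in> Basis"
  show "has_ddv (\<lambda>z. sg c * (pd c u z)\<^sup>2) b z (sg c * (2 * pd c u z * pd b (pd c u) z))"
    by (rule DERIV_cong[OF DERIV_cmult[OF DERIV_power[OF ddv(2)[OF assms(1) c], where n = 2]]]) simp
qed

lemma cont_w: "continuous_on S w"
  unfolding w_def[abs_def] using p1 by (intro continuous_on_abs_powr cont) auto

lemma cont_nonlin: "continuous_on S (\<lambda>z. nonlin p (u z))"
  unfolding nonlin_def using p1 by (intro continuous_intros continuous_on_abs_powr cont) auto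

lemma cont_U: "continuous_on S U"
  unfolding U_def[abs_def] using p1 by (intro continuous_intros cont cont_w) auto

lemma cont_L: "continuous_on S L"
  unfolding L_def[abs_def] by (intro continuous_intros cont)

lemma cont_Q: "continuous_on S Q"
  unfolding Q_def[abs_def] by (intro continuous_intros cont)

lemma Q_ge: "b \<in> Basis \<Longrightarrow> (pd b u z)\<^sup>2 \<le> Q z" "(u z)\<^sup>2 \<le> Q z" "0 \<le> Q z"
proof -
  show "(pd b u z)\<^sup>2 \<le> Q z" if "b \<in> Basis" for b
    using member_le_sum[OF that, of "\<lambda>b. (pd b u z)\<^sup>2"] by (simp add: Q_def add_increasing2)
  show "(u z)\<^sup>2 \<le> Q z" "0 \<le> Q z" by (simp_all add: Q_def sum_nonneg)
qed

lemma Q_ge_prod: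
  "b \<in> Basis \<Longrightarrow> c \<in> Basis \<Longrightarrow> \<bar>pd b u z * pd c u z\<bar> \<le> Q z"
  "b \<in> Basis \<Longrightarrow> \<bar>u z * pd b u z\<bar> \<le> Q z"
proof -
  have k: "\<bar>x * y\<bar> \<le> Q z" if "x\<^sup>2 \<le> Q z" "y\<^sup>2 \<le> Q z" for x y
    using that sum_squares_bound[of "\<bar>x\<bar>" "\<bar>y\<bar>"] by (simp add: abs_mult)
  show "b \<in> Basis \<Longrightarrow> c \<in> Basis \<Longrightarrow> \<bar>pd b u z * pd c u z\<bar> \<le> Q z"
    by (intro k Q_ge)
  show "b \<in> Basis \<Longrightarrow> \<bar>u z * pd b u z\<bar> \<le> Q z"
    by (intro k Q_ge)
qed

lemma abs_L_le: "\<bar>L z\<bar> \<le> Q z"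
proof -
  have "\<bar>L z\<bar> \<le> (\<Sum>b\<in>Basis. \<bar>sg b * (pd b u z)\<^sup>2\<bar>)" unfolding L_def by (rule sum_abs)
  also have "\<dots> = (\<Sum>b\<in>Basis. (pd b u z)\<^sup>2)"
  proof (rule sum.cong[OF refl])
    fix b :: 'a assume "b \<in> Basis"
    then have "(sg b)\<^sup>2 = 1" using sg by (simp add: power2_eq_square)
    then have "\<bar>sg b\<bar> = 1" by (simp add: abs_square_eq_1)
    then show "\<bar>sg b * (pd b u z)\<^sup>2\<bar> = (pd b u z)\<^sup>2" by (simp add: abs_mult)
  qed
  finally show ?thesis by (simp add: Q_def add_increasing2)
qed

text \<open>With centre \<open>q\<close>, the weight \<open>f q\<close> is the squared Lorentzian distance to \<open>q\<close> and \<open>Su q\<close> the scaling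
  derivative. The current \<open>J\<close> belongs to the multiplier \<open>f powr a * (Su + \<gamma> * u)\<close>; its last term makes the \<open>u\<^sup>2\<close>
  contributions to the divergence complete the square in lemma \<open>sum_dJ\<close>.\<close>

definition f :: "'a \<Rightarrow> 'a \<Rightarrow> real" where "f q z = (\<Sum>b\<in>Basis. sg b * ((z - q) \<bullet> b)\<^sup>2)"
definition Su :: "'a \<Rightarrow> 'a \<Rightarrow> real" where "Su q z = (\<Sum>b\<in>Basis. ((z - q) \<bullet> b) * pd b u z)"

definition J :: "'a \<Rightarrow> real \<Rightarrow> real \<Rightarrow> 'a \<Rightarrow> 'a \<Rightarrow> real" where
  "J q a \<gamma> b z = f q z powr a * (sg b * pd b u z * Su q z - ((z - q) \<bullet> b) / 2 * L z
      + ((z - q) \<bullet> b) * U z + \<gamma> * u z * sg b * pd b u z)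
    + \<gamma> * (a * f q z powr (a - 1)) * (u z)\<^sup>2 * ((z - q) \<bullet> b)"

text \<open>The product rule written out term by term, so that the sum over \<open>b\<close> has
  literally the shape treated by \<open>carleman_algebra\<close>: first the derivative of the
  weight, then that of the bracket, then that of the \<open>u\<^sup>2\<close> correction.\<close>

definition dJ :: "'a \<Rightarrow> real \<Rightarrow> real \<Rightarrow> 'a \<Rightarrow> 'a \<Rightarrow> real" where
  "dJ q a \<gamma> b z =
     (a * f q z powr (a - 1)) * (2 * sg b * ((z - q) \<bullet> b)) * (sg b * pd b u z * Su q z - ((z - q) \<bullet> b) / 2 * L z
       + ((z - q) \<bullet> b) * U z + \<gamma> * u z * sg b * pd b u z)
     + f q z powr a * (sg b * pd b (pd b u) z * Su q z
         + sg b * pd b u z * (pd b u z + (\<Sum>c\<in>Basis. ((z - q) \<bullet> c) * pd b (pd c u) z)) - L z / 2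
         - ((z - q) \<bullet> b) / 2 * (\<Sum>c\<in>Basis. sg c * (2 * pd c u z * pd b (pd c u) z))
         + U z + ((z - q) \<bullet> b) * (pd b V z * w z / (p + 1) + V z * nonlin p (u z) * pd b u z)
         + \<gamma> * pd b u z * sg b * pd b u z + \<gamma> * u z * sg b * pd b (pd b u) z)
     + \<gamma> * (a * ((a - 1) * f q z powr (a - 2)) * (2 * sg b * ((z - q) \<bullet> b)) * (u z)\<^sup>2 * ((z - q) \<bullet> b)
         + (a * f q z powr (a - 1)) * (2 * u z * pd b u z) * ((z - q) \<bullet> b)
         + (a * f q z powr (a - 1)) * (u z)\<^sup>2)"

lemma ddv_y: "has_ddv (\<lambda>z. (z - q) \<bullet> c) b z (b \<bullet> c)"
  by (auto intro!: derivative_eq_intros simp: inner_add_left inner_diff_left)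

lemma sum_Basis_delta: "b \<in> Basis \<Longrightarrow> (\<Sum>c\<in>Basis. (b \<bullet> c) * g c) = g b"
  for g :: "'a \<Rightarrow> real"
proof -
  assume b: "b \<in> Basis"
  then have "(\<Sum>c\<in>Basis. (b \<bullet> c) * g c) = (\<Sum>c\<in>Basis. if b = c then g c else 0)"
    by (intro sum.cong refl) (auto simp: inner_Basis)
  then show ?thesis using b by simp
qed

lemma ddv_f:
  assumes "b \<in> Basis"
  shows "has_ddv (f q) b z (2 * sg b * ((z - q) \<bullet> b))"
proof -
  have "has_ddv (f q) b z (\<Sum>c\<in>Basis. (b \<bullet> c) * (2 * sg c * ((z - q) \<bullet> c)))"
    unfolding f_def[abs_def]
    by (auto intro!: derivative_eq_intros ddv_y sum.cong)
  then show ?thesis using sum_Basis_delta[OF assms] by simp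
qed

lemma ddv_Su:
  assumes "z \<in> S" "b \<in> Basis"
  shows "has_ddv (Su q) b z (pd b u z + (\<Sum>c\<in>Basis. ((z - q) \<bullet> c) * pd b (pd c u) z))"
proof -
  have "has_ddv (Su q) b z (\<Sum>c\<in>Basis. (b \<bullet> c) * pd c u z + ((z - q) \<bullet> c) * pd b (pd c u) z)"
    unfolding Su_def[abs_def] using assms
    by (auto intro!: derivative_eq_intros ddv_y ddv sum.cong)
  then show ?thesis using sum_Basis_delta[OF assms(2), of "\<lambda>c. pd c u z"] by (simp add: sum.distrib)
qed

lemma ddv_f_powr:
  assumes "b \<in> Basis" "0 < f q z"
  shows "has_ddv (\<lambda>z. f q z powr r) b z (r * f q z powr (r - 1) * (2 * sg b * ((z - q) \<bullet> b)))"
proof -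
  have "((\<lambda>x. x powr r) has_real_derivative r * f q z powr (r - 1)) (at (f q (z + 0 *\<^sub>R b)))"
    using has_real_derivative_powr[OF assms(2)] by simp
  from DERIV_chain2[OF this ddv_f[OF assms(1)]] show ?thesis .
qed

lemma ddv_J:
  assumes z: "z \<in> S" and b: "b \<in> Basis" and f: "0 < f q z"
  shows "has_ddv (J q a \<gamma> b) b z (dJ q a \<gamma> b z)"
proof -
  have y: "has_ddv (\<lambda>z. (z - q) \<bullet> b) b z 1" using ddv_y[where q = q and c = b and b = b and z = z] b by simp
  have X: "has_ddv (\<lambda>z. sg b * pd b u z * Su q z - ((z - q) \<bullet> b) / 2 * L z
      + ((z - q) \<bullet> b) * U z + \<gamma> * u z * sg b * pd b u z) b z
      (sg b * pd b (pd b u) z * Su q z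
         + sg b * pd b u z * (pd b u z + (\<Sum>c\<in>Basis. ((z - q) \<bullet> c) * pd b (pd c u) z)) - L z / 2
         - ((z - q) \<bullet> b) / 2 * (\<Sum>c\<in>Basis. sg c * (2 * pd c u z * pd b (pd c u) z))
         + U z + ((z - q) \<bullet> b) * (pd b V z * w z / (p + 1) + V z * nonlin p (u z) * pd b u z)
         + \<gamma> * pd b u z * sg b * pd b u z + \<gamma> * u z * sg b * pd b (pd b u) z)"
    by (rule DERIV_cong[OF DERIV_add[OF DERIV_add[OF DERIV_diff[OF
          DERIV_mult[OF DERIV_cmult[OF ddv(2)[OF z b], where c = "sg b"] ddv_Su[OF z b, of q]]
          DERIV_mult[OF DERIV_cdivide[OF y, where c = 2] ddv_L[OF z b]]]
          DERIV_mult[OF y ddv_U[OF z]]]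
          DERIV_mult[OF DERIV_cmult_right[OF DERIV_cmult[OF ddv(1)[OF z], where c = \<gamma>], where c = "sg b"] ddv(2)[OF z b]]]])
       (simp add: algebra_simps)
  have R: "has_ddv (\<lambda>z. \<gamma> * (a * f q z powr (a - 1)) * (u z)\<^sup>2 * ((z - q) \<bullet> b)) b z
     (\<gamma> * (a * ((a - 1) * f q z powr (a - 2)) * (2 * sg b * ((z - q) \<bullet> b)) * (u z)\<^sup>2 * ((z - q) \<bullet> b)
         + (a * f q z powr (a - 1)) * (2 * u z * pd b u z) * ((z - q) \<bullet> b)
         + (a * f q z powr (a - 1)) * (u z)\<^sup>2))"
    by (rule DERIV_cong[OF DERIV_mult[OF DERIV_mult[OF DERIV_cmult[OF DERIV_cmult[OF
          ddv_f_powr[OF b f, where r = "a - 1"], where c = a], where c = \<gamma>] DERIV_power[OF ddv(1)[OF z], where n = 2]] y]])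
       (simp add: algebra_simps)
  show ?thesis
    unfolding J_def[abs_def] dJ_def
    by (rule DERIV_cong[OF DERIV_add[OF DERIV_mult[OF ddv_f_powr[OF b f, of a] X] R]])
       (simp only: add_0_right scaleR_zero_left, simp only: ac_simps)
qed

text \<open>For this \<open>\<gamma>\<close> the indefinite \<open>L\<close> drops out of the
  divergence. What remains is a square, the potential with coefficient
  \<open>2 - (p - 1) * \<gamma>\<close>, and an error that stems only from the derivatives of
  \<open>V\<close>.\<close>

lemma sum_dJ:
  assumes z: "z \<in> S" and f: "0 < f q z" and g: "\<gamma> = (real DIM('a) - 2) / 2 + a"
  shows "(\<Sum>b\<in>Basis. dJ q a \<gamma> b z) = 2 * (a * f q z powr (a - 1)) * (Su q z + \<gamma> * u z)\<^sup>2
     + (2 - (p - 1) * \<gamma>) * f q z powr a * U z + f q z powr a * (\<Sum>b\<in>Basis. ((z - q) \<bullet> b) * pd b V z) * w z / (p + 1)"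
  unfolding dJ_def
proof (rule carleman_algebra[where f = "f q z" and B = Basis and H = "\<lambda>c b. pd b (pd c u) z"])
  show "f q z * (a * f q z powr (a - 1)) = a * f q z powr a"
    using f powr_add[of "f q z" "a - 1" 1] by simp
  show "f q z * (a * ((a - 1) * f q z powr (a - 2))) = (a - 1) * (a * f q z powr (a - 1))"
    using f powr_add[of "f q z" "a - 2" 1] by simp
  show "(\<Sum>b\<in>Basis. sg b * pd b (pd b u) z) = - V z * nonlin p (u z)" by (rule eq[OF z])
qed (use p1 g in \<open>auto simp: sg f_def Su_def L_def U_def w_eq intro: pd_symmetric[OF z]\<close>)

end

section \<open>Integrals over compact sets\<close>

lemma set_integrable_compact:
  fixes g :: "'a::euclidean_space \<Rightarrow> real"
  assumes "compact K" "continuous_on K g"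
  shows "set_integrable lborel K g"
  unfolding set_integrable_def by (rule borel_integrable_compact[OF assms])

text \<open>Serves both to enlarge the domain of a nonnegative integrand and to discard a part of
  the domain where the integrand is nonpositive.\<close>

lemma int_le:
  fixes g h :: "'a::euclidean_space \<Rightarrow> real"
  assumes "compact K" "continuous_on K g" "compact K'" "continuous_on K' h"
    and "\<And>z. z \<in> K \<Longrightarrow> z \<notin> K' \<Longrightarrow> g z \<le> 0" "\<And>z. z \<in> K \<Longrightarrow> z \<in> K' \<Longrightarrow> g z \<le> h z" "\<And>z. z \<in> K' \<Longrightarrow> 0 \<le> h z"
  shows "(LINT z:K|lborel. g z) \<le> (LINT z:K'|lborel. h z)"
  unfolding set_lebesgue_integral_def
proof (rule integral_mono)
  show "integrable lborel (\<lambda>z. indicator K z *\<^sub>R g z)" "integrable lborel (\<lambda>z. indicator K' z *\<^sub>R h z)"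
    using set_integrable_compact[OF assms(1,2)] set_integrable_compact[OF assms(3,4)]
    by (simp_all add: set_integrable_def)
  show "indicator K z *\<^sub>R g z \<le> indicator K' z *\<^sub>R h z" for z
    using assms(5-7)[of z] by (auto simp: indicator_def)
qed

lemma int_add:
  fixes g h :: "'a::euclidean_space \<Rightarrow> real"
  assumes "compact K" "continuous_on K g" "continuous_on K h"
  shows "(LINT z:K|lborel. g z + h z) = (LINT z:K|lborel. g z) + (LINT z:K|lborel. h z)"
  by (rule set_integral_add(2)[OF set_integrable_compact[OF assms(1,2)] set_integrable_compact[OF assms(1,3)]])

lemma int_diff:
  fixes g h :: "'a::euclidean_space \<Rightarrow> real"
  assumes "compact K" "continuous_on K g" "continuous_on K h"
  shows "(LINT z:K|lborel. g z - h z) = (LINT z:K|lborel. g z) - (LINT z:K|lborel. h z)"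
  by (rule set_integral_diff(2)[OF set_integrable_compact[OF assms(1,2)] set_integrable_compact[OF assms(1,3)]])

lemma int_sum:
  fixes g :: "'b \<Rightarrow> 'a::euclidean_space \<Rightarrow> real"
  assumes "compact K" "\<And>b. b \<in> B \<Longrightarrow> continuous_on K (g b)"
  shows "(LINT z:K|lborel. (\<Sum>b\<in>B. g b z)) = (\<Sum>b\<in>B. LINT z:K|lborel. g b z)"
  unfolding set_lebesgue_integral_def scaleR_sum_right
  by (rule Bochner_Integration.integral_sum)
    (use set_integrable_compact[OF assms(1)] assms(2) in \<open>simp add: set_integrable_def\<close>)

lemma int_cmult: "(LINT z:K|lborel. (c::real) * g z) = c * (LINT z:K|lborel. g z)"
  for g :: "'a::euclidean_space \<Rightarrow> real"
  by simp

lemma compact_bound: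
  fixes g :: "'a::euclidean_space \<Rightarrow> real"
  assumes "compact K" "continuous_on K g"
  obtains M where "M > 0" "\<And>z. z \<in> K \<Longrightarrow> \<bar>g z\<bar> \<le> M"
proof -
  have "bounded (g ` K)" using assms compact_continuous_image compact_imp_bounded by blast
  then obtain M where "M > 0" "\<forall>x\<in>g ` K. norm x \<le> M" by (auto simp: bounded_pos)
  then show ?thesis by (intro that[of M]) auto
qed

section \<open>Cutoff functions\<close>

text \<open>A line derivative, unlike \<open>pd\<close>, which is taken from the Frechet derivative:
  integration by parts in one direction at a time requires no total differentiability of the
  cutoffs.\<close>

definition dd :: "'a::euclidean_space \<Rightarrow> ('a \<Rightarrow> real) \<Rightarrow> 'a \<Rightarrow> real" where
  "dd b g z = deriv (\<lambda>h. g (z + h *\<^sub>R b)) 0"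

definition C1 :: "'a::euclidean_space set \<Rightarrow> ('a \<Rightarrow> real) \<Rightarrow> bool" where
  "C1 S g \<longleftrightarrow> continuous_on S g \<and>
    (\<forall>b\<in>Basis. continuous_on S (dd b g) \<and> (\<forall>z\<in>S. has_ddv g b z (dd b g z)))"

lemma C1I:
  assumes "continuous_on S g" "\<And>b. b \<in> Basis \<Longrightarrow> continuous_on S (g' b)"
    and "\<And>b z. b \<in> Basis \<Longrightarrow> z \<in> S \<Longrightarrow> has_ddv g b z (g' b z)"
  shows "C1 S g"
proof -
  have "dd b g z = g' b z" if "b \<in> Basis" "z \<in> S" for b z
    unfolding dd_def by (rule DERIV_imp_deriv[OF assms(3)[OF that]])
  then show ?thesis
    using assms unfolding C1_def by (auto cong: continuous_on_cong)
qed

lemma C1D: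
  assumes "C1 S g"
  shows "continuous_on S g" "b \<in> Basis \<Longrightarrow> continuous_on S (dd b g)"
    "b \<in> Basis \<Longrightarrow> z \<in> S \<Longrightarrow> has_ddv g b z (dd b g z)"
  using assms by (auto simp: C1_def)

lemma C1_mono: "C1 S g \<Longrightarrow> T \<subseteq> S \<Longrightarrow> C1 T g"
  by (auto simp: C1_def intro: continuous_on_subset)

lemma C1_mult:
  assumes "C1 S g" "C1 S h"
  shows "C1 S (\<lambda>z. g z * h z)"
proof (rule C1I)
  show "continuous_on S (\<lambda>z. g z * h z)"
    by (rule continuous_on_mult[OF C1D(1)[OF assms(1)] C1D(1)[OF assms(2)]])
  show "b \<in> Basis \<Longrightarrow> continuous_on S (\<lambda>z. dd b g z * h z + dd b h z * g z)" for b
    by (intro continuous_on_add continuous_on_mult C1D(1)[OF assms(1)] C1D(1)[OF assms(2)]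
        C1D(2)[OF assms(1)] C1D(2)[OF assms(2)])
  show "has_ddv (\<lambda>z. g z * h z) b z (dd b g z * h z + dd b h z * g z)" if "b \<in> Basis" "z \<in> S" for b z
    using DERIV_mult[OF C1D(3)[OF assms(1) that] C1D(3)[OF assms(2) that]] by simp
qed

lemma C1_compose:
  assumes "C1 S g" "continuous_on UNIV F'" "\<And>x::real. (F has_real_derivative F' x) (at x)"
  shows "C1 S (\<lambda>z. F (g z))"
proof (rule C1I)
  have "continuous_on UNIV F"
    using DERIV_isCont[OF assms(3)] by (simp add: continuous_at_imp_continuous_on)
  then show "continuous_on S (\<lambda>z. F (g z))"
    by (rule continuous_on_compose2[OF _ C1D(1)[OF assms(1)]]) auto
  show "continuous_on S (\<lambda>z. F' (g z) * dd b g z)" if "b \<in> Basis" for b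
    by (intro continuous_intros continuous_on_compose2[OF assms(2) C1D(1)[OF assms(1)]] C1D(2)[OF assms(1)] that) auto
  show "has_ddv (\<lambda>z. F (g z)) b z (F' (g z) * dd b g z)" if "b \<in> Basis" "z \<in> S" for b z
    using DERIV_chain2[OF assms(3) C1D(3)[OF assms(1) that]] by simp
qed

lemma dd_locally_const:
  assumes "open T" "z \<in> T" "\<And>w. w \<in> T \<Longrightarrow> g w = c"
  shows "dd b g z = 0"
proof -
  have "((\<lambda>h. z + h *\<^sub>R b) \<longlongrightarrow> z + 0 *\<^sub>R b) (at 0)"
    by (intro tendsto_intros)
  then have "((\<lambda>h. z + h *\<^sub>R b) \<longlongrightarrow> z + 0 *\<^sub>R b) (nhds 0)"
    by (subst (asm) tendsto_at_iff_tendsto_nhds[of "\<lambda>h. z + h *\<^sub>R b" 0])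
  then have "\<forall>\<^sub>F h in nhds 0. z + h *\<^sub>R b \<in> T"
    using topological_tendstoD assms(1,2) by fastforce
  then have ev: "\<forall>\<^sub>F h in nhds 0. g (z + h *\<^sub>R b) = c"
    by (rule eventually_mono) (use assms(3) in auto)
  have "((\<lambda>h. g (z + h *\<^sub>R b)) has_real_derivative 0) (at 0)"
    using DERIV_cong_ev[OF refl ev refl] by simp
  then show ?thesis unfolding dd_def by (rule DERIV_imp_deriv)
qed

definition pos_sq :: "real \<Rightarrow> real" where "pos_sq x = (max 0 x)\<^sup>2"

lemma DERIV_pos_sq: "(pos_sq has_real_derivative 2 * max 0 x) (at x)"
proof -
  consider "x > 0" | "x < 0" | "x = 0" by linarith
  then show ?thesis
  proof cases
    case 1
    have "\<forall>\<^sub>F s in nhds x. pos_sq s = s\<^sup>2"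
      by (rule eventually_mono[OF eventually_nhds_in_open[of "{0<..}" x]]) (use 1 in \<open>auto simp: pos_sq_def\<close>)
    from DERIV_cong_ev[OF refl this refl] show ?thesis
      using 1 by (auto intro!: derivative_eq_intros)
  next
    case 2
    have "\<forall>\<^sub>F s in nhds x. pos_sq s = 0"
      by (rule eventually_mono[OF eventually_nhds_in_open[of "{..<0}" x]]) (use 2 in \<open>auto simp: pos_sq_def\<close>)
    from DERIV_cong_ev[OF refl this refl] show ?thesis
      using 2 by auto
  next
    case 3
    have ev: "\<forall>\<^sub>F h in at 0. norm ((pos_sq (0 + h) - pos_sq 0) / h) \<le> \<bar>h\<bar>"
      by (intro always_eventually allI) (auto simp: pos_sq_def power2_eq_square max_def)
    have "((\<lambda>h. \<bar>h\<bar>) \<longlongrightarrow> 0) (at (0::real))"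
      by (intro tendsto_rabs_zero tendsto_ident_at)
    from Lim_null_comparison[OF ev this] show ?thesis using 3 by (simp add: DERIV_def)
  qed
qed

text \<open>Only \<open>C\<^sup>1\<close>, despite the name: one derivative of a cutoff is all that
  the integrations by parts use. The denominator is positive because \<open>x\<close> and
  \<open>1 - x\<close> are never both nonpositive.\<close>

definition smooth_step :: "real \<Rightarrow> real" where "smooth_step x = pos_sq x / (pos_sq x + pos_sq (1 - x))"

definition smooth_step_deriv :: "real \<Rightarrow> real" where
  "smooth_step_deriv x = (2 * max 0 x * pos_sq (1 - x) + pos_sq x * (2 * max 0 (1 - x))) / (pos_sq x + pos_sq (1 - x))\<^sup>2"

lemma pos_sq_sum_pos: "0 < pos_sq x + pos_sq (1 - x)"
proof (cases "x > 0")
  case True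
  then have "0 < pos_sq x" by (simp add: pos_sq_def)
  then show ?thesis by (simp add: pos_sq_def add_pos_nonneg)
next
  case False
  then have "0 < pos_sq (1 - x)" by (simp add: pos_sq_def)
  then show ?thesis by (simp add: pos_sq_def add_nonneg_pos)
qed

lemma DERIV_smooth_step: "(smooth_step has_real_derivative smooth_step_deriv x) (at x)"
proof -
  have 1: "((\<lambda>x. pos_sq (1 - x)) has_real_derivative - (2 * max 0 (1 - x))) (at x)"
  proof -
    have "((\<lambda>x. 1 - x) has_real_derivative -1) (at x)" by (auto intro!: derivative_eq_intros)
    from DERIV_chain2[OF DERIV_pos_sq this] show ?thesis by simp
  qed
  have "(smooth_step has_real_derivative (2 * max 0 x * (pos_sq x + pos_sq (1 - x)) -
      pos_sq x * (2 * max 0 x + - (2 * max 0 (1 - x)))) / ((pos_sq x + pos_sq (1 - x)) * (pos_sq x + pos_sq (1 - x)))) (at x)"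
    unfolding smooth_step_def[abs_def] using pos_sq_sum_pos[of x]
    by (intro DERIV_divide DERIV_add DERIV_pos_sq 1) auto
  moreover have "2 * max 0 x * (pos_sq x + pos_sq (1 - x)) - pos_sq x * (2 * max 0 x + - (2 * max 0 (1 - x))) =
      2 * max 0 x * pos_sq (1 - x) + pos_sq x * (2 * max 0 (1 - x))"
    by (simp only: algebra_simps)
  ultimately show ?thesis unfolding smooth_step_deriv_def power2_eq_square by simp
qed

lemma cont_smooth_step_deriv: "continuous_on UNIV smooth_step_deriv"
  unfolding smooth_step_deriv_def[abs_def] pos_sq_def[abs_def]
proof (intro continuous_intros ballI)
  show "((max 0 x)\<^sup>2 + (max 0 (1 - x))\<^sup>2)\<^sup>2 \<noteq> 0" for x :: real
    by (rule less_imp_neq[OF zero_less_power[OF pos_sq_sum_pos[of x, unfolded pos_sq_def]], symmetric])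
qed

lemma smooth_step_bounds: "0 \<le> smooth_step x" "smooth_step x \<le> 1" "x \<le> 0 \<Longrightarrow> smooth_step x = 0" "1 \<le> x \<Longrightarrow> smooth_step x = 1" "0 \<le> smooth_step_deriv x"
  "x \<le> 0 \<or> 1 \<le> x \<Longrightarrow> smooth_step_deriv x = 0"
proof -
  show "0 \<le> smooth_step x" "smooth_step x \<le> 1" using pos_sq_sum_pos[of x] by (auto simp: smooth_step_def pos_sq_def)
  show "x \<le> 0 \<Longrightarrow> smooth_step x = 0" by (simp add: smooth_step_def pos_sq_def)
  show "1 \<le> x \<Longrightarrow> smooth_step x = 1" using pos_sq_sum_pos[of x] by (simp add: smooth_step_def pos_sq_def)
  show "0 \<le> smooth_step_deriv x" by (auto simp: smooth_step_deriv_def pos_sq_def)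
  show "x \<le> 0 \<or> 1 \<le> x \<Longrightarrow> smooth_step_deriv x = 0" by (auto simp: smooth_step_deriv_def pos_sq_def)
qed

type_synonym 'n spacetime = "real \<times> (real^'n)"

text \<open>The slope enters squared because the square is differentiable also on the axis
  \<open>snd z = 0\<close>. It is invariant under scaling about the origin, so regions described by
  it are compatible with the rescaling.\<close>

definition rat :: "'n::finite spacetime \<Rightarrow> real" where "rat z = (norm (snd z))\<^sup>2 / (fst z)\<^sup>2"

text \<open>Multiplied out instead of stated through \<open>rat\<close>, which makes closedness
  immediate. The parameters \<open>l\<close> and \<open>l'\<close> are squared slopes;
  \<open>l = 0\<close> gives a full truncated cone, \<open>l > 0\<close> an annular region.\<close>

definition Kbox :: "real \<Rightarrow> real \<Rightarrow> real \<Rightarrow> ('n::finite spacetime) set" where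
  "Kbox l l' \<beta> = {z. - \<beta> \<le> fst z \<and> fst z \<le> - (1 / \<beta>) \<and> l * (fst z)\<^sup>2 \<le> (norm (snd z))\<^sup>2 \<and> (norm (snd z))\<^sup>2 \<le> l' * (fst z)\<^sup>2}"

lemma compact_Kbox: "compact (Kbox l l' \<beta> :: ('n::finite spacetime) set)"
proof -
  have "closed (Kbox l l' \<beta> :: ('n spacetime) set)"
    unfolding Kbox_def by (intro closed_Collect_conj closed_Collect_le continuous_intros)
  moreover have "bounded (Kbox l l' \<beta> :: ('n spacetime) set)"
    unfolding bounded_iff
  proof (intro exI ballI)
    fix z :: "'n spacetime" assume z: "z \<in> Kbox l l' \<beta>"
    define T where "T = \<bar>\<beta>\<bar> + \<bar>1 / \<beta>\<bar>"
    have t: "\<bar>fst z\<bar> \<le> T" using z unfolding Kbox_def T_def by (auto simp del: abs_divide)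
    have T: "0 \<le> T" by (simp add: T_def)
    have "(norm (snd z))\<^sup>2 \<le> \<bar>l'\<bar> * (fst z)\<^sup>2"
      using z mult_right_mono[OF abs_ge_self[of l'], of "(fst z)\<^sup>2"] by (auto simp: Kbox_def)
    also have "\<dots> \<le> (\<bar>l'\<bar> + 1)\<^sup>2 * T\<^sup>2"
    proof (rule mult_mono)
      show "\<bar>l'\<bar> \<le> (\<bar>l'\<bar> + 1)\<^sup>2" by (simp add: power2_eq_square algebra_simps)
      show "(fst z)\<^sup>2 \<le> T\<^sup>2" using t T by (simp add: abs_le_square_iff[symmetric])
    qed auto
    also have "\<dots> = ((\<bar>l'\<bar> + 1) * T)\<^sup>2" by (simp add: power_mult_distrib)
    finally have "norm (snd z) \<le> (\<bar>l'\<bar> + 1) * T" by (rule power2_le_imp_le) (use T in auto)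
    moreover have "norm z \<le> \<bar>fst z\<bar> + norm (snd z)"
      using norm_Pair_le[of "fst z" "snd z"] by simp
    ultimately show "norm z \<le> (\<bar>\<beta>\<bar> + \<bar>1 / \<beta>\<bar>) + (\<bar>l'\<bar> + 1) * (\<bar>\<beta>\<bar> + \<bar>1 / \<beta>\<bar>)"
      using t unfolding T_def by linarith
  qed
  ultimately show ?thesis by (simp add: compact_eq_bounded_closed)
qed

lemma Kbox_mono:
  assumes "l2 \<le> l1" "l1' \<le> l2'" "0 < \<beta>1" "\<beta>1 \<le> \<beta>2"
  shows "Kbox l1 l1' \<beta>1 \<subseteq> Kbox l2 l2' \<beta>2"
proof
  fix z :: "'a spacetime" assume z: "z \<in> Kbox l1 l1' \<beta>1"
  have "1 / \<beta>2 \<le> 1 / \<beta>1" using assms by (simp add: frac_le)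
  moreover have "l2 * (fst z)\<^sup>2 \<le> l1 * (fst z)\<^sup>2" "l1' * (fst z)\<^sup>2 \<le> l2' * (fst z)\<^sup>2"
    using assms by (auto intro: mult_right_mono)
  ultimately show "z \<in> Kbox l2 l2' \<beta>2" using z assms(4) unfolding Kbox_def by auto
qed

lemma rat_iff:
  assumes "fst z < 0"
  shows "rat z \<le> l \<longleftrightarrow> (norm (snd z))\<^sup>2 \<le> l * (fst z)\<^sup>2" "l \<le> rat z \<longleftrightarrow> l * (fst z)\<^sup>2 \<le> (norm (snd z))\<^sup>2"
  using assms by (simp_all add: rat_def field_simps)

lemma Kbox_iff:
  assumes "fst z < 0"
  shows "z \<in> Kbox l l' \<beta> \<longleftrightarrow> - \<beta> \<le> fst z \<and> fst z \<le> - (1 / \<beta>) \<and> l \<le> rat z \<and> rat z \<le> l'"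
  using rat_iff[OF assms] by (simp add: Kbox_def)

lemma C1_rat: "C1 {z::'n::finite spacetime. fst z < 0} rat"
proof (rule C1I)
  show "continuous_on {z::'n spacetime. fst z < 0} rat"
    unfolding rat_def[abs_def] by (intro continuous_intros) auto
  show "continuous_on {z::'n spacetime. fst z < 0} (\<lambda>z. (2 * (snd z \<bullet> snd b) * (fst z)\<^sup>2 - (norm (snd z))\<^sup>2 * (2 * fst z * fst b)) / ((fst z)\<^sup>2 * (fst z)\<^sup>2))" for b
    by (intro continuous_intros) auto
  show "has_ddv rat b z ((2 * (snd z \<bullet> snd b) * (fst z)\<^sup>2 - (norm (snd z))\<^sup>2 * (2 * fst z * fst b)) / ((fst z)\<^sup>2 * (fst z)\<^sup>2))"
    if "z \<in> {z::'n spacetime. fst z < 0}" for b z :: "'n spacetime"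
  proof -
    have 1: "has_ddv (\<lambda>z. (norm (snd z))\<^sup>2) b z (2 * (snd z \<bullet> snd b))"
    proof -
      have e: "(\<lambda>h. (norm (snd (z + h *\<^sub>R b)))\<^sup>2) =
          (\<lambda>h. (norm (snd z))\<^sup>2 + h * (2 * (snd z \<bullet> snd b)) + h\<^sup>2 * (norm (snd b))\<^sup>2)"
        unfolding power2_norm_eq_inner
        by (simp add: inner_simps fun_eq_iff algebra_simps power2_eq_square inner_commute)
      show ?thesis unfolding e by (auto intro!: derivative_eq_intros)
    qed
    have 2: "has_ddv (\<lambda>z. (fst z)\<^sup>2) b z (2 * fst z * fst b)"
      by (auto intro!: derivative_eq_intros)
    show ?thesis unfolding rat_def[abs_def]
      using DERIV_divide[OF 1 2] that by simp
  qed
qed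

definition cone_cutoff :: "real \<Rightarrow> real \<Rightarrow> 'n::finite spacetime \<Rightarrow> real" where
  "cone_cutoff l l' z = smooth_step ((rat z - l) / (l' - l))"

lemma C1_smooth_step_affine:
  assumes "C1 S g"
  shows "C1 S (\<lambda>z. smooth_step (c * g z + d))"
proof (rule C1_compose[where F' = "\<lambda>x. smooth_step_deriv (c * x + d) * c", OF assms])
  show "continuous_on UNIV (\<lambda>x. smooth_step_deriv (c * x + d) * c)"
    by (intro continuous_intros continuous_on_compose2[OF cont_smooth_step_deriv]) auto
  show "((\<lambda>x. smooth_step (c * x + d)) has_real_derivative smooth_step_deriv (c * x + d) * c) (at x)" for x
    by (rule DERIV_chain2[OF DERIV_smooth_step]) (auto intro!: derivative_eq_intros)
qed

lemma C1_cone_cutoff: "C1 {z::'n::finite spacetime. fst z < 0} (cone_cutoff l l')"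
proof -
  have "cone_cutoff l l' = (\<lambda>z::'n spacetime. smooth_step (inverse (l' - l) * rat z + (- (l / (l' - l)))))"
    by (auto simp: cone_cutoff_def fun_eq_iff divide_inverse algebra_simps)
  then show ?thesis by (simp only: C1_smooth_step_affine[OF C1_rat])
qed

lemma cone_cutoff_bounds:
  assumes "l < l'"
  shows "0 \<le> cone_cutoff l l' z" "cone_cutoff l l' z \<le> 1" "rat z \<le> l \<Longrightarrow> cone_cutoff l l' z = 0" "l' \<le> rat z \<Longrightarrow> cone_cutoff l l' z = 1"
  using assms by (auto simp: cone_cutoff_def intro!: smooth_step_bounds simp: divide_simps)

lemma dd_cone_cutoff_zero:
  fixes z :: "'n::finite spacetime"
  assumes "l < l'" "fst z < 0" "rat z < l \<or> l' < rat z"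
  shows "dd b (cone_cutoff l l') z = 0"
proof -
  have c: "continuous_on {z::'n spacetime. fst z < 0} rat" using C1D(1)[OF C1_rat] .
  have o: "open {z::'n spacetime. fst z < 0}" by (intro open_Collect_less continuous_intros)
  have "open ({z::'n spacetime. fst z < 0} \<inter> rat -` {..<l})" "open ({z::'n spacetime. fst z < 0} \<inter> rat -` {l'<..})"
    using continuous_on_open_vimage[OF o, THEN iffD1, rule_format, OF c, of "{..<l}"]
      continuous_on_open_vimage[OF o, THEN iffD1, rule_format, OF c, of "{l'<..}"]
    by (simp_all add: Int_commute)
  then show ?thesis
    using assms dd_locally_const[of "{z. fst z < 0} \<inter> rat -` {..<l}" z "cone_cutoff l l'" 0 b]
      dd_locally_const[of "{z. fst z < 0} \<inter> rat -` {l'<..}" z "cone_cutoff l l'" 1 b]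
    by (auto simp: cone_cutoff_bounds[OF assms(1)])
qed

definition sgm :: "'n::finite spacetime \<Rightarrow> real" where "sgm b = (if b = (1, 0) then -1 else 1)"

lemma sgm_sq: "sgm b * sgm b = 1" by (simp add: sgm_def)

lemma time_Basis: "(1, 0) \<in> (Basis :: ('n::finite spacetime) set)"
  by (simp add: Basis_prod_def)

lemma Basis_spacetime: "(Basis :: ('n::finite spacetime) set) = insert (1, 0) ((\<lambda>b. (0, b)) ` Basis)"
  by (auto simp: Basis_prod_def)

lemma sum_Basis_spacetime:
  "(\<Sum>b\<in>(Basis :: ('n::finite spacetime) set). g b) = g (1, 0) + (\<Sum>b\<in>Basis. g (0, b))"
  unfolding Basis_spacetime
  by (subst sum.insert) (auto simp: sum.reindex inj_on_def)

section \<open>The integrated Carleman estimate\<close>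

lemma int_le_add:
  fixes g G1 G2 :: "'a::euclidean_space \<Rightarrow> real"
  assumes "compact K" "continuous_on K g" "compact K1" "continuous_on K1 G1" "compact K2" "continuous_on K2 G2"
    and le: "\<And>z. indicator K z * g z \<le> indicator K1 z * G1 z + indicator K2 z * G2 z"
  shows "(LINT z:K|lborel. g z) \<le> (LINT z:K1|lborel. G1 z) + (LINT z:K2|lborel. G2 z)"
proof -
  have i: "integrable lborel (\<lambda>z. indicator K z *\<^sub>R g z)" "integrable lborel (\<lambda>z. indicator K1 z *\<^sub>R G1 z)"
    "integrable lborel (\<lambda>z. indicator K2 z *\<^sub>R G2 z)"
    using set_integrable_compact[OF assms(1,2)] set_integrable_compact[OF assms(3,4)]
      set_integrable_compact[OF assms(5,6)] by (simp_all add: set_integrable_def)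
  have "(LINT z|lborel. indicator K z *\<^sub>R g z) \<le> (LINT z|lborel. indicator K1 z *\<^sub>R G1 z + indicator K2 z *\<^sub>R G2 z)"
    by (rule integral_mono[OF i(1) Bochner_Integration.integrable_add[OF i(2,3)]]) (use le in simp)
  then show ?thesis
    unfolding set_lebesgue_integral_def by (simp only: Bochner_Integration.integral_add[OF i(2,3)])
qed

lemma int_mono:
  fixes g h :: "'a::euclidean_space \<Rightarrow> real"
  assumes "compact K" "continuous_on K g" "continuous_on K h" "\<And>z. z \<in> K \<Longrightarrow> g z \<le> h z"
  shows "(LINT z:K|lborel. g z) \<le> (LINT z:K|lborel. h z)"
  by (rule set_integral_mono[OF set_integrable_compact[OF assms(1,2)] set_integrable_compact[OF assms(1,3)]])
    (use assms(4) in auto)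

lemma int_nonneg:
  fixes g :: "'a::euclidean_space \<Rightarrow> real"
  assumes "\<And>z. z \<in> K \<Longrightarrow> 0 \<le> g z"
  shows "0 \<le> (LINT z:K|lborel. g z)"
  unfolding set_lebesgue_integral_def
  by (rule Bochner_Integration.integral_nonneg) (use assms in \<open>auto simp: indicator_def\<close>)

lemma abs_mult_le: "\<bar>x\<bar> \<le> X \<Longrightarrow> \<bar>y\<bar> \<le> Y \<Longrightarrow> \<bar>x * y\<bar> \<le> X * Y" for x y X Y :: real
  unfolding abs_mult by (intro mult_mono) auto

text \<open>\<open>J\<close> is an arbitrary field with one differentiable component for each basis
  direction; the compact support is carried by \<open>\<Theta>\<close>, so no boundary term
  arises.\<close>

lemma divergence_identity:
  fixes J dJ \<Theta>' :: "'a::euclidean_space \<Rightarrow> 'a \<Rightarrow> real"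
  assumes "open S" "compact K" "K \<subseteq> S" and T: "continuous_on S \<Theta>" "\<And>z. z \<in> S - K \<Longrightarrow> \<Theta> z = 0"
    and T': "\<And>b. b \<in> Basis \<Longrightarrow> continuous_on S (\<Theta>' b)"
      "\<And>b z. b \<in> Basis \<Longrightarrow> z \<in> S \<Longrightarrow> has_ddv \<Theta> b z (\<Theta>' b z)"
    and J: "\<And>b. b \<in> Basis \<Longrightarrow> continuous_on S (J b)" "\<And>b. b \<in> Basis \<Longrightarrow> continuous_on S (dJ b)"
      "\<And>b z. b \<in> Basis \<Longrightarrow> z \<in> S \<Longrightarrow> has_ddv (J b) b z (dJ b z)"
  shows "(LINT z:K|lborel. (\<Sum>b\<in>Basis. \<Theta>' b z * J b z + \<Theta> z * dJ b z)) = 0"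
proof -
  have "(LINT z:K|lborel. 1 * (\<Theta>' b z * J b z + \<Theta> z * dJ b z)) = 0" if b: "b \<in> Basis" for b
  proof (rule integral_compact_ddv_zero[OF assms(1-3), where b = b and g = "\<lambda>z. \<Theta> z * J b z" and w = "\<lambda>_. 1"])
    show "continuous_on S (\<lambda>z. \<Theta> z * J b z)" "continuous_on S (\<lambda>z. \<Theta>' b z * J b z + \<Theta> z * dJ b z)"
      using T T'(1)[OF b] J(1,2)[OF b] by (auto intro!: continuous_intros)
    show "has_ddv (\<lambda>z. \<Theta> z * J b z) b z (\<Theta>' b z * J b z + \<Theta> z * dJ b z)" if "z \<in> S" for z
      using DERIV_mult[OF T'(2)[OF b that] J(3)[OF b that]] by (simp add: mult.commute)
  qed (use T in auto)
  then have z: "(\<Sum>b\<in>Basis. LINT z:K|lborel. (\<Theta>' b z * J b z + \<Theta> z * dJ b z)) = 0" by simp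
  show ?thesis
    by (subst int_sum[OF assms(2)], intro continuous_intros)
      (use z in \<open>auto intro!: continuous_on_subset[OF _ assms(3)] T T' J\<close>)
qed

section \<open>Continuity, size and flux of the Carleman current\<close>

context wave_fun
begin

lemma cont_f: "continuous_on T (f q)"
  unfolding f_def[abs_def] by (intro continuous_intros)

lemma open_Sf: "open (S \<inter> {z. 0 < f q z})"
  by (intro open_Int open_S open_Collect_less continuous_intros cont_f)

lemma cont_f_powr: "continuous_on (S \<inter> {z. 0 < f q z}) (\<lambda>z. f q z powr r)"
  by (intro continuous_on_powr cont_f continuous_intros) auto

lemma cont_Su: "continuous_on S (Su q)"
  unfolding Su_def[abs_def] by (intro continuous_intros cont)

lemma cont_on_pos:
  assumes "T = S \<inter> {z. 0 < f q z}"
  shows "continuous_on T (\<lambda>z. f q z powr r)" "continuous_on T (\<lambda>z. (z - q) \<bullet> b)" "continuous_on T (\<lambda>z. (z - q) \<bullet> b / 2)"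
    "continuous_on T u" "b \<in> Basis \<Longrightarrow> continuous_on T (pd b u)"
    "b \<in> Basis \<Longrightarrow> c \<in> Basis \<Longrightarrow> continuous_on T (pd b (pd c u))"
    "continuous_on T V" "b \<in> Basis \<Longrightarrow> continuous_on T (pd b V)"
    "continuous_on T L" "continuous_on T (\<lambda>z. L z / 2)" "continuous_on T U" "continuous_on T (Su q)"
    "continuous_on T (\<lambda>z. w z / (p + 1))" "continuous_on T (\<lambda>z. nonlin p (u z))"
    "continuous_on T w" "continuous_on T Q"
proof -
  have T: "T \<subseteq> S" using assms by auto
  show "continuous_on T (\<lambda>z. f q z powr r)" unfolding assms by (rule cont_f_powr)
  show "continuous_on T (\<lambda>z. (z - q) \<bullet> b)" by (intro continuous_intros)
  show "continuous_on T (\<lambda>z. (z - q) \<bullet> b / 2)" by (intro continuous_intros) simp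
  show L: "continuous_on T L" and w: "continuous_on T w" and "continuous_on T U" "continuous_on T (Su q)"
    "continuous_on T (\<lambda>z. nonlin p (u z))" "continuous_on T Q"
    by (rule continuous_on_subset[OF _ T], rule cont_L cont_w cont_U cont_Su cont_nonlin cont_Q)+
  show "continuous_on T u" "continuous_on T V"
    by (rule continuous_on_subset[OF _ T], rule cont(1) cont(4))+
  show "b \<in> Basis \<Longrightarrow> continuous_on T (pd b u)" "b \<in> Basis \<Longrightarrow> continuous_on T (pd b V)"
    "b \<in> Basis \<Longrightarrow> c \<in> Basis \<Longrightarrow> continuous_on T (pd b (pd c u))"
    using continuous_on_subset[OF cont(2) T] continuous_on_subset[OF cont(5) T] continuous_on_subset[OF cont(3) T] by blast+
  show "continuous_on T (\<lambda>z. L z / 2)"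
    by (rule continuous_on_divide[OF L continuous_on_const]) simp
  show "continuous_on T (\<lambda>z. w z / (p + 1))"
    by (rule continuous_on_divide[OF w continuous_on_const]) (use p1 in simp)
qed

lemma cont_J: "b \<in> Basis \<Longrightarrow> continuous_on (S \<inter> {z. 0 < f q z}) (J q a \<gamma> b)"
  unfolding J_def[abs_def]
  by (intro cont_on_pos[OF refl] continuous_on_add continuous_on_diff continuous_on_mult continuous_on_const continuous_on_power)

lemma cont_dJ: "b \<in> Basis \<Longrightarrow> continuous_on (S \<inter> {z. 0 < f q z}) (dJ q a \<gamma> b)"
  unfolding dJ_def[abs_def] times_divide_eq_right[symmetric]
  by (intro cont_on_pos[OF refl] continuous_on_add continuous_on_diff continuous_on_mult continuous_on_const continuous_on_power continuous_on_sum)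

lemma abs_sg: "b \<in> Basis \<Longrightarrow> \<bar>sg b\<bar> = 1"
  using sg[of b] abs_square_eq_1[of "sg b"] by (simp add: power2_eq_square)

text \<open>Only the regular terms are gathered under \<open>f q z powr a\<close>. The
  \<open>u\<^sup>2\<close> term keeps its weight \<open>f q z powr (a - 1)\<close>, which is
  unbounded near \<open>f = 0\<close> for \<open>a < 1\<close> and has to be estimated in integrated
  form.\<close>

lemma J_bound:
  fixes M a \<gamma> :: real
  assumes b: "b \<in> Basis" and M: "0 \<le> M" "\<And>c. c \<in> Basis \<Longrightarrow> \<bar>(z - q) \<bullet> c\<bar> \<le> M" "\<bar>V z\<bar> \<le> M"
    and "0 \<le> \<gamma>" "0 \<le> a"
  shows "\<bar>J q a \<gamma> b z\<bar> \<le> f q z powr a * ((DIM('a) * M + M + \<gamma>) * Q z + M * M * w z)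
     + \<gamma> * M * (a * f q z powr (a - 1) * (u z)\<^sup>2)"
proof -
  have 1: "\<bar>sg b * pd b u z * Su q z\<bar> \<le> DIM('a) * M * Q z"
  proof -
    have "\<bar>sg b * pd b u z * Su q z\<bar> = \<bar>pd b u z * Su q z\<bar>"
      by (simp add: abs_mult abs_sg[OF b])
    also have "pd b u z * Su q z = (\<Sum>c\<in>Basis. ((z - q) \<bullet> c) * (pd c u z * pd b u z))"
      by (simp add: Su_def sum_distrib_left ac_simps)
    also have "\<bar>\<dots>\<bar> \<le> (\<Sum>c\<in>Basis. \<bar>((z - q) \<bullet> c) * (pd c u z * pd b u z)\<bar>)" by (rule sum_abs)
    also have "\<dots> \<le> (\<Sum>c\<in>(Basis::'a set). M * Q z)"
      by (intro sum_mono abs_mult_le M Q_ge_prod b)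
    finally show ?thesis by simp
  qed
  have 2: "\<bar>((z - q) \<bullet> b) / 2 * L z\<bar> \<le> M * Q z"
    using M(2)[OF b] by (intro abs_mult_le abs_L_le) auto
  have 3: "\<bar>((z - q) \<bullet> b) * U z\<bar> \<le> M * (M * w z)"
  proof (intro abs_mult_le M(2) b)
    have "\<bar>U z\<bar> = \<bar>V z * w z\<bar> / (p + 1)" using p1 by (simp add: U_def)
    also have "\<dots> \<le> \<bar>V z * w z\<bar> / 1" using p1 by (intro divide_left_mono) auto
    also have "\<dots> \<le> M * w z"
      using abs_mult_le[OF M(3), of "w z" "w z"] w_nonneg[of z] by simp
    finally show "\<bar>U z\<bar> \<le> M * w z" .
  qed
  have 4: "\<bar>\<gamma> * u z * sg b * pd b u z\<bar> \<le> \<gamma> * Q z"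
  proof -
    have "\<bar>\<gamma> * u z * sg b * pd b u z\<bar> = \<gamma> * \<bar>u z * pd b u z\<bar>"
      using abs_sg[OF b] \<open>0 \<le> \<gamma>\<close> by (simp add: abs_mult)
    then show ?thesis using Q_ge_prod(2)[OF b] \<open>0 \<le> \<gamma>\<close> by (simp add: mult_left_mono)
  qed
  have "\<bar>sg b * pd b u z * Su q z - ((z - q) \<bullet> b) / 2 * L z
      + ((z - q) \<bullet> b) * U z + \<gamma> * u z * sg b * pd b u z\<bar> \<le> (DIM('a) * M + M + \<gamma>) * Q z + M * M * w z"
  proof -
    have r: "(DIM('a) * M + M + \<gamma>) * Q z + M * M * w z = DIM('a) * M * Q z + M * Q z + M * (M * w z) + \<gamma> * Q z"
      by (simp add: algebra_simps)
    have t: "\<bar>A - B + C + D\<bar> \<le> \<bar>A\<bar> + \<bar>B\<bar> + \<bar>C\<bar> + \<bar>D\<bar>" for A B C D :: real by linarith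
    show ?thesis unfolding r
      by (rule order_trans[OF t]) (intro add_mono 1 2 3 4)
  qed
  then have 5: "\<bar>f q z powr a * (sg b * pd b u z * Su q z - ((z - q) \<bullet> b) / 2 * L z
      + ((z - q) \<bullet> b) * U z + \<gamma> * u z * sg b * pd b u z)\<bar> \<le> f q z powr a * ((DIM('a) * M + M + \<gamma>) * Q z + M * M * w z)"
    by (intro abs_mult_le) auto
  have "\<bar>\<gamma> * (a * f q z powr (a - 1)) * (u z)\<^sup>2 * ((z - q) \<bullet> b)\<bar> \<le> \<gamma> * (a * f q z powr (a - 1)) * (u z)\<^sup>2 * M"
    using \<open>0 \<le> \<gamma>\<close> \<open>0 \<le> a\<close> by (intro abs_mult_le M b) simp_all
  with 5 show ?thesis unfolding J_def by (simp add: algebra_simps)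
qed

text \<open>Up to a factor 2 the left side is the flux of \<open>J\<close> through the level sets of
  \<open>f\<close>, because the derivative of \<open>f\<close> in direction \<open>b\<close> is
  \<open>2 * sg b * ((z - q) \<bullet> b)\<close>. The factor \<open>f q z powr (a - 1)\<close> in
  the last term of \<open>J\<close> meets another \<open>f q z\<close> here, so the whole flux
  carries \<open>f q z powr a\<close> and dies out at \<open>f = 0\<close>.\<close>

lemma sum_y_J:
  assumes "0 < f q z"
  shows "(\<Sum>b\<in>Basis. sg b * ((z - q) \<bullet> b) * J q a \<gamma> b z) =
    f q z powr a * ((Su q z)\<^sup>2 - f q z * L z / 2 + f q z * U z + \<gamma> * u z * Su q z + \<gamma> * a * (u z)\<^sup>2)"
proof -
  have fp: "f q z * f q z powr (a - 1) = f q z powr a"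
    using assms powr_add[of "f q z" "a - 1" 1] by simp
  have "(\<Sum>b\<in>Basis. sg b * ((z - q) \<bullet> b) * J q a \<gamma> b z) =
     (\<Sum>b\<in>Basis. f q z powr a * Su q z * (((z - q) \<bullet> b) * pd b u z) - f q z powr a * L z / 2 * (sg b * ((z - q) \<bullet> b)\<^sup>2)
       + f q z powr a * U z * (sg b * ((z - q) \<bullet> b)\<^sup>2) + f q z powr a * \<gamma> * u z * (((z - q) \<bullet> b) * pd b u z)
       + \<gamma> * a * f q z powr (a - 1) * (u z)\<^sup>2 * (sg b * ((z - q) \<bullet> b)\<^sup>2))"
  proof (rule sum.cong[OF refl])
    fix b :: 'a assume b: "b \<in> Basis"
    define Y where "Y = (z - q) \<bullet> b"
    have "sg b * ((z - q) \<bullet> b) * J q a \<gamma> b z =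
       f q z powr a * Su q z * ((sg b * sg b) * (((z - q) \<bullet> b) * pd b u z)) - f q z powr a * L z / 2 * (sg b * ((z - q) \<bullet> b)\<^sup>2)
       + f q z powr a * U z * (sg b * ((z - q) \<bullet> b)\<^sup>2) + f q z powr a * \<gamma> * u z * ((sg b * sg b) * (((z - q) \<bullet> b) * pd b u z))
       + \<gamma> * a * f q z powr (a - 1) * (u z)\<^sup>2 * (sg b * ((z - q) \<bullet> b)\<^sup>2)"
      unfolding J_def Y_def[symmetric] by (simp add: algebra_simps power2_eq_square)
    then show "sg b * ((z - q) \<bullet> b) * J q a \<gamma> b z =
       f q z powr a * Su q z * (((z - q) \<bullet> b) * pd b u z) - f q z powr a * L z / 2 * (sg b * ((z - q) \<bullet> b)\<^sup>2)
       + f q z powr a * U z * (sg b * ((z - q) \<bullet> b)\<^sup>2) + f q z powr a * \<gamma> * u z * (((z - q) \<bullet> b) * pd b u z)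
       + \<gamma> * a * f q z powr (a - 1) * (u z)\<^sup>2 * (sg b * ((z - q) \<bullet> b)\<^sup>2)"
      by (simp only: sg[OF b] mult_1)
  qed
  also have "\<dots> = f q z powr a * Su q z * Su q z - f q z powr a * L z / 2 * f q z + f q z powr a * U z * f q z
     + f q z powr a * \<gamma> * u z * Su q z + \<gamma> * a * f q z powr (a - 1) * (u z)\<^sup>2 * f q z"
    by (simp only: sum.distrib sum_subtractf sum_distrib_left[symmetric] f_def[symmetric] Su_def[symmetric])
  also have "\<gamma> * a * f q z powr (a - 1) * (u z)\<^sup>2 * f q z = \<gamma> * a * (u z)\<^sup>2 * (f q z * f q z powr (a - 1))"
    by (simp only: ac_simps)
  finally show ?thesis unfolding fp by (simp add: algebra_simps power2_eq_square)
qed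

text \<open>The divergence theorem for the field \<open>\<Theta> z * u z * sg b * pd b u z\<close>:
  the equation turns the second derivatives into \<open>V z * w z\<close>, so a potential integral
  is expressed by quadratic terms.\<close>

lemma multiplier_identity:
  assumes "compact K" "K \<subseteq> S" "C1 S \<Theta>" "\<And>z. z \<in> S - K \<Longrightarrow> \<Theta> z = 0"
  shows "(LINT z:K|lborel. \<Theta> z * V z * w z) =
     (LINT z:K|lborel. \<Theta> z * L z + u z * (\<Sum>b\<in>Basis. sg b * dd b \<Theta> z * pd b u z))"
proof -
  let ?J = "\<lambda>b z. u z * (sg b * pd b u z)"
  let ?dJ = "\<lambda>b z. pd b u z * (sg b * pd b u z) + u z * (sg b * pd b (pd b u) z)"
  have "(LINT z:K|lborel. (\<Sum>b\<in>Basis. dd b \<Theta> z * ?J b z + \<Theta> z * ?dJ b z)) = 0"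
  proof (rule divergence_identity[OF open_S assms(1,2) C1D(1)[OF assms(3)] assms(4)])
    show "has_ddv (?J b) b z (?dJ b z)" if "b \<in> Basis" "z \<in> S" for b z
      using DERIV_mult[OF ddv(1)[OF that(2)] DERIV_cmult[OF ddv(2)[OF that(2,1)], where c = "sg b"]]
      by (simp add: algebra_simps)
  qed (auto intro!: continuous_intros cont C1D[OF assms(3)])
  also have "(LINT z:K|lborel. (\<Sum>b\<in>Basis. dd b \<Theta> z * ?J b z + \<Theta> z * ?dJ b z)) =
      (LINT z:K|lborel. (\<Theta> z * L z + u z * (\<Sum>b\<in>Basis. sg b * dd b \<Theta> z * pd b u z)) - \<Theta> z * V z * w z)"
  proof (rule set_lebesgue_integral_cong)
    show "\<forall>z. z \<in> K \<longrightarrow> (\<Sum>b\<in>Basis. dd b \<Theta> z * ?J b z + \<Theta> z * ?dJ b z) =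
      (\<Theta> z * L z + u z * (\<Sum>b\<in>Basis. sg b * dd b \<Theta> z * pd b u z)) - \<Theta> z * V z * w z"
    proof (intro allI impI)
      fix z assume "z \<in> K"
      then have z: "z \<in> S" using assms(2) by auto
      have "(\<Sum>b\<in>Basis. dd b \<Theta> z * ?J b z + \<Theta> z * ?dJ b z) =
         (\<Sum>b\<in>Basis. u z * (sg b * dd b \<Theta> z * pd b u z) + \<Theta> z * (sg b * (pd b u z)\<^sup>2) + \<Theta> z * u z * (sg b * pd b (pd b u) z))"
        by (rule sum.cong) (auto simp: algebra_simps power2_eq_square)
      also have "\<dots> = u z * (\<Sum>b\<in>Basis. sg b * dd b \<Theta> z * pd b u z) + \<Theta> z * L z + \<Theta> z * u z * (- V z * nonlin p (u z))"
        by (simp only: sum.distrib sum_distrib_left[symmetric] L_def[symmetric] eq[OF z])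
      finally show "(\<Sum>b\<in>Basis. dd b \<Theta> z * ?J b z + \<Theta> z * ?dJ b z) =
        (\<Theta> z * L z + u z * (\<Sum>b\<in>Basis. sg b * dd b \<Theta> z * pd b u z)) - \<Theta> z * V z * w z"
        by (simp add: w_eq[symmetric])
    qed
  qed (use assms(1) in \<open>simp add: borel_compact\<close>)
  also have "\<dots> = (LINT z:K|lborel. \<Theta> z * L z + u z * (\<Sum>b\<in>Basis. sg b * dd b \<Theta> z * pd b u z)) - (LINT z:K|lborel. \<Theta> z * V z * w z)"
    by (rule int_diff[OF assms(1)])
      (auto intro!: continuous_intros continuous_on_subset[OF _ assms(2)] cont cont_w cont_L C1D[OF assms(3)])
  finally show ?thesis by simp
qed

end

text \<open>Lets the cutoff width \<open>e\<close> tend to 0. The factor \<open>Z\<close> may depend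
  on the solution, since it disappears in the limit.\<close>

lemma le_of_le_add_powr:
  fixes X Y Z a e0 :: real
  assumes "0 < a" "0 < e0" "\<And>e. 0 < e \<Longrightarrow> e < e0 \<Longrightarrow> X \<le> Y + Z * (2 * e) powr a"
  shows "X \<le> Y"
proof -
  have "((\<lambda>e. Y + Z * (2 * e) powr a) \<longlongrightarrow> Y + Z * (2 * 0) powr a) (at_right 0)"
    using assms(1) by (intro tendsto_intros tendsto_powr') (auto simp: eventually_at_right intro!: exI[of _ 1])
  then have l: "((\<lambda>e. Y + Z * (2 * e) powr a) \<longlongrightarrow> Y) (at_right 0)" using assms(1) by simp
  show ?thesis
    by (rule tendsto_lowerbound[OF l]) (use assms in \<open>auto simp: eventually_at_right intro!: exI[of _ e0]\<close>)
qed

text \<open>The levels \<open>m1\<close> to \<open>m5\<close> are squared slopes that separate the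
  cutoffs: \<open>\<zeta>\<close> is 1 between \<open>m2\<close> and \<open>m4\<close> and supported
  between \<open>m1\<close> and \<open>m5\<close>, while the cutoff of the Carleman estimate falls
  from 1 to 0 between \<open>m3\<close> and \<open>m4\<close>. No solution is fixed here, so the
  constants obtained are uniform. The factor 2 in \<open>Kbox 0 m5 (2 * \<beta>)\<close> leaves room
  for a cutoff in time.\<close>

locale cone_setting =
  fixes m1 m2 m3 m4 m5 \<beta> \<epsilon> Mv p :: real and S :: "('n::finite spacetime) set"
  assumes m: "0 < m1" "m1 < m2" "m2 < m3" "m3 < m4" "m4 < m5" "m5 < 1"
    and \<beta>: "1 < \<beta>" and p: "1 < p" and \<epsilon>: "0 < \<epsilon>"
    and S: "open S" "S \<subseteq> {z. fst z < 0}" "Kbox 0 m5 (2 * \<beta>) \<subseteq> S"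
begin

definition sol :: "('n spacetime \<Rightarrow> real) \<Rightarrow> ('n spacetime \<Rightarrow> real) \<Rightarrow> bool" where
  "sol u V \<longleftrightarrow> wave_fun S sgm p u V \<and> (\<forall>z\<in>S. \<epsilon> \<le> V z \<and> V z \<le> Mv)"

definition W :: "('n spacetime \<Rightarrow> real) \<Rightarrow> 'n spacetime \<Rightarrow> real" where
  "W u z = \<bar>u z\<bar> powr (p + 1)"

abbreviation "Qu \<equiv> wave_fun.Q"

definition \<zeta> :: "'n spacetime \<Rightarrow> real" where "\<zeta> z = cone_cutoff m1 m2 z * (1 - cone_cutoff m4 m5 z)"

lemma Kbox_sub: "0 \<le> l \<Longrightarrow> l' \<le> m5 \<Longrightarrow> 0 < b \<Longrightarrow> b \<le> 2 * \<beta> \<Longrightarrow> Kbox l l' b \<subseteq> S"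
  using Kbox_mono[of 0 l l' m5 b "2 * \<beta>"] S(3) by auto

lemma C1_one_minus: "C1 T g \<Longrightarrow> C1 T (\<lambda>z. 1 - g z)"
  by (rule C1_compose[where F' = "\<lambda>_. -1"]) (auto intro!: derivative_eq_intros)

lemma C1_cone_cutoff_S: "C1 S (cone_cutoff l l')"
  using C1_mono[OF C1_cone_cutoff S(2)] .

lemma C1_zeta: "C1 S \<zeta>"
  unfolding \<zeta>_def[abs_def] by (intro C1_mult C1_one_minus C1_cone_cutoff_S)

lemma zeta_bounds: "0 \<le> \<zeta> z" "\<zeta> z \<le> 1" "rat z \<le> m1 \<Longrightarrow> \<zeta> z = 0" "m5 \<le> rat z \<Longrightarrow> \<zeta> z = 0"
  "m2 \<le> rat z \<Longrightarrow> rat z \<le> m4 \<Longrightarrow> \<zeta> z = 1"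
  using m cone_cutoff_bounds[of m1 m2 z] cone_cutoff_bounds[of m4 m5 z]
  by (auto simp: \<zeta>_def intro: mult_le_one)

lemma C1_fst_affine: "C1 T (\<lambda>z. smooth_step (c * fst z + d))" for T :: "'n spacetime set"
proof (rule C1_smooth_step_affine, rule C1I[where g' = "\<lambda>b _. fst b"])
  show "has_ddv fst b z (fst b)" for b z :: "'n spacetime"
    by (auto intro!: derivative_eq_intros)
qed (auto intro!: continuous_intros)

text \<open>Testing the equation with \<open>u\<close> times a cutoff controls the potential energy on an annulus by quadratic
  quantities, because \<open>V\<close> is bounded below.\<close>

lemma annulus_potential_estimate:
  "\<exists>C\<ge>0. \<forall>u V. sol u V \<longrightarrow>
    (LINT z:Kbox m2 m4 \<beta>|lborel. W u z) \<le> C * (LINT z:Kbox m1 m5 (2 * \<beta>)|lborel. Qu u z)"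
proof -
  let ?K = "Kbox m1 m5 (2 * \<beta>) :: 'n spacetime set"
  \<comment> \<open>A cutoff in time: 1 from \<open>- \<beta>\<close> to
    \<open>- (1 / \<beta>)\<close>, and 0 before \<open>- (2 * \<beta>)\<close> and after
    \<open>- (1 / (2 * \<beta>))\<close>.\<close>
  define \<eta> :: "'n spacetime \<Rightarrow> real" where
    "\<eta> z = smooth_step (1 / \<beta> * fst z + 2) * smooth_step ((- (2 * \<beta>)) * fst z + (-1))" for z
  have C\<eta>: "C1 S \<eta>" unfolding \<eta>_def[abs_def] by (intro C1_mult C1_fst_affine)
  define \<Theta> where "\<Theta> z = \<zeta> z * \<eta> z" for z
  have C\<Theta>: "C1 S \<Theta>" unfolding \<Theta>_def[abs_def] by (intro C1_mult C1_zeta C\<eta>)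
  have \<eta>01: "0 \<le> \<eta> z" "\<eta> z \<le> 1" for z using smooth_step_bounds by (auto simp: \<eta>_def intro: mult_le_one)
  have \<Theta>01: "0 \<le> \<Theta> z" "\<Theta> z \<le> 1" for z
    using \<eta>01[of z] zeta_bounds(1,2)[of z] by (auto simp: \<Theta>_def intro: mult_le_one)
  have KS: "?K \<subseteq> S" using m \<beta> by (intro Kbox_sub) auto
  have \<Theta>0: "\<Theta> z = 0" if z: "z \<in> S - ?K" for z
  proof -
    have t: "fst z < 0" using z S(2) by auto
    then consider "fst z < - (2 * \<beta>)" | "- (1 / (2 * \<beta>)) < fst z" | "rat z < m1" | "m5 < rat z"
      using z Kbox_iff[OF t, of m1 m5 "2 * \<beta>"] by force
    then show ?thesis
    proof cases
      case 1
      then have "1 / \<beta> * fst z + 2 \<le> 0" using \<beta> by (simp add: field_simps)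
      then show ?thesis by (simp add: \<Theta>_def \<eta>_def smooth_step_bounds)
    next
      case 2
      then have "(- (2 * \<beta>)) * fst z + (-1) \<le> 0" using \<beta> by (simp add: field_simps)
      then show ?thesis unfolding \<Theta>_def \<eta>_def by (simp only: smooth_step_bounds(3))
    qed (simp_all add: \<Theta>_def zeta_bounds)
  qed
  have \<Theta>1: "\<Theta> z = 1" if z: "z \<in> Kbox m2 m4 \<beta>" for z
  proof -
    have "0 < 1 / \<beta>" using \<beta> by simp
    then have t: "fst z < 0"
    proof -
      have "fst z \<le> - (1 / \<beta>)" using z by (simp add: Kbox_def)
      then show ?thesis using \<open>0 < 1 / \<beta>\<close> by linarith
    qed
    have "1 \<le> 1 / \<beta> * fst z + 2" "1 \<le> (- (2 * \<beta>)) * fst z + (-1)"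
      using z \<beta> by (auto simp: Kbox_def field_simps)
    then show ?thesis using z zeta_bounds(5)[of z] unfolding \<Theta>_def \<eta>_def
      by (simp only: smooth_step_bounds(4)) (auto simp: Kbox_iff[OF t])
  qed
  \<comment> \<open>The bound \<open>M\<close> for the derivatives of the cutoff is obtained before
    \<open>u\<close> and \<open>V\<close> are introduced; together with \<open>\<epsilon>\<close> it
    determines the constant.\<close>
  have "continuous_on ?K (\<lambda>z. \<Sum>b\<in>Basis. \<bar>dd b \<Theta> z\<bar>)"
    by (intro continuous_intros continuous_on_subset[OF C1D(2)[OF C\<Theta>] KS])
  from compact_bound[OF compact_Kbox this] obtain M
    where M: "M > 0" "\<And>z. z \<in> ?K \<Longrightarrow> \<bar>\<Sum>b\<in>Basis. \<bar>dd b \<Theta> z\<bar>\<bar> \<le> M" by blast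
  show ?thesis
  proof (intro exI[of _ "(1 + M) / \<epsilon>"] conjI allI impI)
    show "0 \<le> (1 + M) / \<epsilon>" using M \<epsilon> by simp
    fix u V assume s: "sol u V"
    then interpret wave_fun S sgm p u V by (simp add: sol_def)
    have V: "\<epsilon> \<le> V z" if "z \<in> S" for z using s that by (simp add: sol_def)
    have Ww: "W u = w" by (auto simp: W_def w_def)
    have "(LINT z:Kbox m2 m4 \<beta>|lborel. \<epsilon> * W u z) \<le> (LINT z:?K|lborel. \<Theta> z * V z * w z)"
    proof (rule int_le)
      have sub: "Kbox m2 m4 \<beta> \<subseteq> ?K" using m \<beta> by (intro Kbox_mono) auto
      show "continuous_on (Kbox m2 m4 \<beta>) (\<lambda>z. \<epsilon> * W u z)"
        by (rule continuous_on_subset[of S]) (use sub KS in \<open>auto simp: Ww intro!: continuous_intros cont_w\<close>)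
      show "continuous_on ?K (\<lambda>z. \<Theta> z * V z * w z)"
        by (rule continuous_on_subset[OF _ KS]) (intro continuous_intros cont cont_w C1D[OF C\<Theta>])
      show "\<epsilon> * W u z \<le> \<Theta> z * V z * w z" if "z \<in> Kbox m2 m4 \<beta>" "z \<in> ?K" for z
        using that KS V[of z] \<Theta>1[OF that(1)] w_nonneg[of z] by (auto simp: W_def w_def intro!: mult_right_mono)
      show "0 \<le> \<Theta> z * V z * w z" if "z \<in> ?K" for z
        using that KS V[of z] \<Theta>01[of z] w_nonneg[of z] \<epsilon> by (auto intro!: mult_nonneg_nonneg)
      show "\<epsilon> * W u z \<le> 0" if "z \<in> Kbox m2 m4 \<beta>" "z \<notin> ?K" for z using that sub by auto
    qed (rule compact_Kbox)+
    also have "\<dots> = (LINT z:?K|lborel. \<Theta> z * L z + u z * (\<Sum>b\<in>Basis. sgm b * dd b \<Theta> z * pd b u z))"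
      by (rule multiplier_identity[OF compact_Kbox KS C\<Theta> \<Theta>0])
    also have "\<dots> \<le> (LINT z:?K|lborel. (1 + M) * Q z)"
    proof (rule int_mono[OF compact_Kbox])
      show "continuous_on ?K (\<lambda>z. \<Theta> z * L z + u z * (\<Sum>b\<in>Basis. sgm b * dd b \<Theta> z * pd b u z))"
        by (rule continuous_on_subset[OF _ KS]) (intro continuous_intros cont cont_L C1D[OF C\<Theta>])
      show "continuous_on ?K (\<lambda>z. (1 + M) * Q z)"
        by (rule continuous_on_subset[OF _ KS]) (intro continuous_on_mult continuous_on_const cont_Q)
      fix z assume z: "z \<in> ?K"
      have "\<bar>\<Theta> z * L z\<bar> \<le> 1 * Q z" using \<Theta>01[of z] by (intro abs_mult_le abs_L_le) auto
      moreover have "\<bar>u z * (\<Sum>b\<in>Basis. sgm b * dd b \<Theta> z * pd b u z)\<bar> \<le> M * Q z"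
      proof -
        have "\<bar>u z * (\<Sum>b\<in>Basis. sgm b * dd b \<Theta> z * pd b u z)\<bar> =
            \<bar>\<Sum>b\<in>Basis. (sgm b * dd b \<Theta> z) * (u z * pd b u z)\<bar>"
          by (simp add: sum_distrib_left ac_simps)
        also have "\<dots> \<le> (\<Sum>b\<in>Basis. \<bar>(sgm b * dd b \<Theta> z) * (u z * pd b u z)\<bar>)" by (rule sum_abs)
        also have "\<dots> \<le> (\<Sum>b\<in>Basis. \<bar>dd b \<Theta> z\<bar> * Q z)"
          by (intro sum_mono abs_mult_le Q_ge_prod) (auto simp: abs_mult abs_sg)
        also have "\<dots> = (\<Sum>b\<in>Basis. \<bar>dd b \<Theta> z\<bar>) * Q z" by (simp add: sum_distrib_right)
        also have "\<dots> \<le> M * Q z" using M(2)[OF z] Q_ge(3)[of z] by (intro mult_right_mono) auto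
        finally show ?thesis .
      qed
      ultimately show "\<Theta> z * L z + u z * (\<Sum>b\<in>Basis. sgm b * dd b \<Theta> z * pd b u z) \<le> (1 + M) * Q z"
        by (simp add: algebra_simps abs_le_iff)
    qed
    finally have "\<epsilon> * (LINT z:Kbox m2 m4 \<beta>|lborel. W u z) \<le> (1 + M) * (LINT z:?K|lborel. Q z)"
      by simp
    then show "(LINT z:Kbox m2 m4 \<beta>|lborel. W u z) \<le> (1 + M) / \<epsilon> * (LINT z:?K|lborel. Q z)"
      using \<epsilon> by (simp add: field_simps)
  qed
qed

end

section \<open>The Carleman inequality for one solution, one centre and one cutoff width\<close>

lemma combine_bounds:
  fixes d x y s r A B C ax :: real
  assumes "d \<le> ax + s" "x \<le> B" "ax \<le> A" "y \<le> C" "0 \<le> r"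
  shows "d + (x + y) / 2 - s - r \<le> A + (B + C) / 2"
proof -
  have "(x + y) / 2 \<le> (B + C) / 2" using assms(2,4) by simp
  then show ?thesis using assms(1,3,5) by linarith
qed

locale carleman_setting = cone_setting m1 m2 m3 m4 m5 \<beta> \<epsilon> Mv p S + wave_fun S sgm p u V
  for m1 m2 m3 m4 m5 \<beta> \<epsilon> Mv p :: real and S :: "('n::finite spacetime) set" and u V +
  fixes q :: "'n spacetime" and a \<gamma> \<kappa> d0 f0 M \<nu> e :: real
  assumes V\<epsilon>: "\<And>z. z \<in> S \<Longrightarrow> \<epsilon> \<le> V z"
    and a: "0 < a" and \<gamma>: "\<gamma> = (real DIM('n spacetime) - 2) / 2 + a" "0 \<le> \<gamma>"
    and \<kappa>: "\<kappa> = 2 - (p - 1) * \<gamma>" "0 < \<kappa>"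
    and M: "1 \<le> M" "\<And>z b. z \<in> Kbox 0 m5 \<beta> \<Longrightarrow> b \<in> Basis \<Longrightarrow> \<bar>(z - q) \<bullet> b\<bar> \<le> M"
      "\<And>z. z \<in> Kbox 0 m5 \<beta> \<Longrightarrow> f q z \<le> M" "\<And>z. z \<in> Kbox 0 m5 \<beta> \<Longrightarrow> V z \<le> M"
      "\<And>(z::'n spacetime) b. z \<in> Kbox 0 m5 \<beta> \<Longrightarrow> b \<in> Basis \<Longrightarrow> \<bar>dd b (\<lambda>z. 1 - cone_cutoff m3 m4 z) z\<bar> \<le> M"
      "\<And>(z::'n spacetime) b. z \<in> Kbox 0 m5 \<beta> \<Longrightarrow> b \<in> Basis \<Longrightarrow> \<bar>dd b \<zeta> z\<bar> \<le> M"
    and geo1: "\<And>z. z \<in> S \<Longrightarrow> rat z \<le> m5 \<Longrightarrow> 0 \<le> f q z \<Longrightarrow> z \<in> Kbox 0 m5 \<beta>"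
    and geo2: "\<And>z. z \<in> Kbox 0 m5 \<beta> \<Longrightarrow> 0 \<le> f q z \<Longrightarrow> d0 \<le> f q z + (fst z - fst q)\<^sup>2" "0 < d0"
    and \<nu>: "\<And>z b. z \<in> S \<Longrightarrow> b \<in> Basis \<Longrightarrow> \<bar>pd b V z\<bar> \<le> \<nu>" "0 \<le> \<nu>"
      "real DIM('n spacetime) * M * \<nu> \<le> \<kappa> * \<epsilon> / 2"
    and e: "0 < e" "2 * e \<le> f0" "4 * e \<le> d0"
begin

abbreviation "Kf \<equiv> Kbox 0 m5 \<beta> :: 'n spacetime set"

definition Ke :: "'n spacetime set" where "Ke = Kf \<inter> {z. e \<le> f q z}"
definition \<psi> :: "'n spacetime \<Rightarrow> real" where "\<psi> z = smooth_step (f q z / e - 1)"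
definition d\<psi> :: "'n spacetime \<Rightarrow> real" where "d\<psi> z = smooth_step_deriv (f q z / e - 1) / e"
definition \<xi> :: "'n spacetime \<Rightarrow> real" where "\<xi> z = 1 - cone_cutoff m3 m4 z"
abbreviation "T \<equiv> S \<inter> {z. 0 < f q z}"

lemma Kf_S: "Kf \<subseteq> S" using m \<beta> by (intro Kbox_sub) auto

lemma Ke_T: "Ke \<subseteq> T" "Ke \<subseteq> S" using Kf_S e unfolding Ke_def by force+

lemma compact_Ke: "compact Ke"
  unfolding Ke_def by (intro compact_Int_closed compact_Kbox closed_Collect_le continuous_intros cont_f)

lemma \<psi>_bounds: "0 \<le> \<psi> z" "\<psi> z \<le> 1" "f q z \<le> e \<Longrightarrow> \<psi> z = 0" "2 * e \<le> f q z \<Longrightarrow> \<psi> z = 1"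
  "0 \<le> d\<psi> z" "2 * e \<le> f q z \<Longrightarrow> d\<psi> z = 0"
  using e(1) by (auto simp: \<psi>_def d\<psi>_def intro!: smooth_step_bounds divide_nonneg_pos)
    (simp_all add: field_simps)

lemma cont_\<psi>: "continuous_on A \<psi>" "continuous_on A d\<psi>"
proof -
  have c: "continuous_on A (\<lambda>z. f q z / e - 1)" using e(1) by (intro continuous_intros cont_f) auto
  have "continuous_on UNIV smooth_step" using DERIV_isCont[OF DERIV_smooth_step] by (simp add: continuous_at_imp_continuous_on)
  then show "continuous_on A \<psi>" unfolding \<psi>_def[abs_def] by (rule continuous_on_compose2[OF _ c]) auto
  have "continuous_on A (\<lambda>z. smooth_step_deriv (f q z / e - 1))" by (rule continuous_on_compose2[OF cont_smooth_step_deriv c]) auto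
  then show "continuous_on A d\<psi>" unfolding d\<psi>_def[abs_def] using e(1) by (intro continuous_intros) auto
qed

lemma ddv_\<psi>:
  assumes "b \<in> Basis"
  shows "has_ddv \<psi> b z (d\<psi> z * (2 * sgm b * ((z - q) \<bullet> b)))"
proof -
  have "((\<lambda>x. smooth_step (x / e - 1)) has_real_derivative smooth_step_deriv (f q z / e - 1) * (1 / e)) (at (f q (z + 0 *\<^sub>R b)))"
    using e(1) by (intro DERIV_chain2[OF DERIV_smooth_step, THEN DERIV_cong]) (auto intro!: derivative_eq_intros)
  from DERIV_chain2[OF this ddv_f[OF assms]] show ?thesis
    by (simp add: \<psi>_def d\<psi>_def)
qed

lemma C1_\<xi>: "C1 S \<xi>" unfolding \<xi>_def[abs_def] by (intro C1_one_minus C1_cone_cutoff_S)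

lemma \<xi>_bounds: "0 \<le> \<xi> z" "\<xi> z \<le> 1" "rat z \<le> m3 \<Longrightarrow> \<xi> z = 1" "m4 \<le> rat z \<Longrightarrow> \<xi> z = 0"
  using m cone_cutoff_bounds[of m3 m4 z] by (auto simp: \<xi>_def)

lemma dd_\<xi>: "z \<in> Kf \<Longrightarrow> b \<in> Basis \<Longrightarrow> \<bar>dd b \<xi> z\<bar> \<le> M"
  using M(5) by (simp add: \<xi>_def[abs_def])

lemma dd_\<xi>_zero:
  assumes "z \<in> S" "b \<in> Basis" "rat z < m3 \<or> m4 < rat z"
  shows "dd b \<xi> z = 0"
proof -
  have "has_ddv \<xi> b z (0 - dd b (cone_cutoff m3 m4) z)"
    unfolding \<xi>_def[abs_def] by (intro DERIV_diff DERIV_const C1D(3)[OF C1_cone_cutoff_S] assms)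
  moreover have "dd b (cone_cutoff m3 m4) z = 0" using m assms S(2) by (intro dd_cone_cutoff_zero) auto
  ultimately show ?thesis by (simp add: dd_def DERIV_imp_deriv)
qed

text \<open>By \<open>geo1\<close> a point with \<open>rat z < m5\<close> and
  \<open>0 \<le> f q z\<close> lies in \<open>Kf\<close>, so if it is outside \<open>Ke\<close> then
  \<open>f q z < e\<close>. Since \<open>\<xi>\<close> and \<open>\<zeta>\<close> vanish for slopes
  beyond \<open>m5\<close>, their products with \<open>\<psi>\<close> are supported in the compact
  set \<open>Ke\<close>.\<close>

lemma off_Ke: "z \<in> S - Ke \<Longrightarrow> rat z < m5 \<Longrightarrow> \<psi> z = 0"
  using geo1[of z] \<psi>_bounds(3)[of z] e(1) by (force simp: Ke_def)

lemma off_Ke_\<xi>: "z \<in> S - Ke \<Longrightarrow> \<psi> z * \<xi> z = 0"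
  using off_Ke[of z] \<xi>_bounds(4)[of z] m by (cases "rat z < m5") auto

lemma off_Ke_\<zeta>: "z \<in> S - Ke \<Longrightarrow> \<psi> z * \<zeta> z = 0"
  using off_Ke[of z] zeta_bounds(4)[of z] by (cases "rat z < m5") auto

lemma y_time: "(z - q) \<bullet> (1, 0) = fst z - fst q"
  by (simp add: inner_prod_def)

lemma ddv_time: "has_ddv (\<lambda>z. fst z - fst q) (1, 0) z 1" for z :: "'n spacetime"
  by (auto intro!: derivative_eq_intros)

lemma ddv_\<psi>_time: "has_ddv \<psi> (1, 0) z (- (2 * d\<psi> z * (fst z - fst q)))"
  by (rule DERIV_cong[OF ddv_\<psi>[OF time_Basis]]) (simp add: y_time sgm_def, simp add: algebra_simps)

lemma time_bound: "z \<in> Kf \<Longrightarrow> \<bar>fst z - fst q\<bar> \<le> M"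
  using M(2)[OF _ time_Basis] by (simp add: y_time)

text \<open>Since \<open>d\<psi>\<close> is of size \<open>1 / e\<close>, its integral is bounded not pointwise but by integrating the time derivative of
  \<open>(fst z - fst q) * \<psi> * \<xi>\<close>.\<close>

lemma \<psi>_mass: "d0 * (LINT z:Ke|lborel. \<xi> z * d\<psi> z) \<le> (1 + M * M) * (LINT z:Kf|lborel. 1)"
proof -
  let ?D = "\<lambda>z. \<psi> z * \<xi> z + (fst z - fst q) * (\<psi> z * dd (1, 0) \<xi> z + \<xi> z * - (2 * d\<psi> z * (fst z - fst q)))"
  have "(LINT z:Ke|lborel. 1 * ?D z) = 0"
  proof (rule integral_compact_ddv_zero[OF S(1) compact_Ke Ke_T(2), where b = "(1, 0)" and g = "\<lambda>z. (fst z - fst q) * (\<psi> z * \<xi> z)" and w = "\<lambda>_. 1"])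
    show "has_ddv (\<lambda>z. (fst z - fst q) * (\<psi> z * \<xi> z)) (1, 0) z (?D z)" if "z \<in> S" for z
      by (rule DERIV_cong[OF DERIV_mult[OF ddv_time[of z] DERIV_mult[OF ddv_\<psi>_time[of z] C1D(3)[OF C1_\<xi> time_Basis that]]]])
        (simp only: scaleR_zero_left add_0_right, simp add: algebra_simps)
    show "continuous_on S (\<lambda>z. (fst z - fst q) * (\<psi> z * \<xi> z))"
      by (intro continuous_intros cont_\<psi> C1D(1)[OF C1_\<xi>])
    show "continuous_on S ?D"
      by (intro continuous_intros cont_\<psi> C1D(1)[OF C1_\<xi>] C1D(2)[OF C1_\<xi> time_Basis])
  qed (use off_Ke_\<xi> in auto)
  then have z: "(LINT z:Ke|lborel. ?D z) = 0" by simp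
  have cD: "continuous_on Ke ?D"
    by (rule continuous_on_subset[OF _ Ke_T(2)]) (intro continuous_intros cont_\<psi> C1D(1)[OF C1_\<xi>] C1D(2)[OF C1_\<xi> time_Basis])
  have c1: "continuous_on Ke (\<lambda>z. d0 * (\<xi> z * d\<psi> z))"
    by (rule continuous_on_subset[OF _ Ke_T(2)]) (intro continuous_intros cont_\<psi> C1D(1)[OF C1_\<xi>])
  have "(LINT z:Ke|lborel. d0 * (\<xi> z * d\<psi> z)) + (LINT z:Ke|lborel. ?D z) = (LINT z:Ke|lborel. d0 * (\<xi> z * d\<psi> z) + ?D z)"
    by (rule int_add[OF compact_Ke c1 cD, symmetric])
  also have "\<dots> \<le> (LINT z:Kf|lborel. 1 + M * M)"
  proof (rule int_le[OF compact_Ke _ compact_Kbox])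
    show "continuous_on Ke (\<lambda>z. d0 * (\<xi> z * d\<psi> z) + ?D z)" by (intro continuous_on_add c1 cD)
    fix z assume z: "z \<in> Ke" "z \<in> Kf"
    have 1: "d0 * (\<xi> z * d\<psi> z) \<le> 2 * (fst z - fst q)\<^sup>2 * (\<xi> z * d\<psi> z)"
    proof (cases "2 * e \<le> f q z")
      case False
      have "d0 \<le> f q z + (fst z - fst q)\<^sup>2" using z e by (intro geo2(1)) (auto simp: Ke_def)
      then have "d0 \<le> 2 * (fst z - fst q)\<^sup>2" using False e(3) by linarith
      then show ?thesis using \<xi>_bounds(1)[of z] \<psi>_bounds(5)[of z] by (intro mult_right_mono) auto
    qed (simp add: \<psi>_bounds)
    have "\<bar>(fst z - fst q) * (\<psi> z * dd (1, 0) \<xi> z)\<bar> \<le> M * (1 * M)"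
      using \<psi>_bounds(1,2)[of z] z by (intro abs_mult_le time_bound dd_\<xi> time_Basis) auto
    moreover have "\<psi> z * \<xi> z \<le> 1" using \<psi>_bounds(1,2)[of z] \<xi>_bounds(1,2)[of z] by (intro mult_le_one) auto
    moreover have "d0 * (\<xi> z * d\<psi> z) + ?D z = (d0 * (\<xi> z * d\<psi> z) - 2 * (fst z - fst q)\<^sup>2 * (\<xi> z * d\<psi> z)) + \<psi> z * \<xi> z + (fst z - fst q) * (\<psi> z * dd (1, 0) \<xi> z)"
      by (simp add: algebra_simps power2_eq_square)
    ultimately show "d0 * (\<xi> z * d\<psi> z) + ?D z \<le> 1 + M * M" using 1 by linarith
  qed (use M(1) in \<open>auto simp: Ke_def\<close>)
  also have "\<dots> = (1 + M * M) * (LINT z:Kf|lborel. 1)"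
    using int_cmult[of Kf "1 + M * M" "\<lambda>_. 1"] by simp
  finally show ?thesis using z by simp
qed

abbreviation "A0 z \<equiv> f q z powr a"
abbreviation "A1 z \<equiv> a * f q z powr (a - 1)"
abbreviation "K15 \<equiv> Kbox m1 m5 (2 * \<beta>) :: 'n spacetime set"
abbreviation "K34 \<equiv> Kbox m3 m4 \<beta> :: 'n spacetime set"
definition "c3 = M powr a * (a + (1 + M * M + 2 * M) / 2)"

lemma A0_bound: "z \<in> Ke \<Longrightarrow> A0 z \<le> M powr a"
  using M(3)[of z] a e by (intro powr_mono2) (auto simp: Ke_def)

lemma contA: "continuous_on T A0" "continuous_on T A1"
  by (intro continuous_on_mult continuous_on_const cont_on_pos[OF refl])+

lemma ddv_A0_time:
  assumes "z \<in> T"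
  shows "has_ddv A0 (1, 0) z (- (2 * A1 z * (fst z - fst q)))"
proof -
  have z: "0 < f q z" using assms by simp
  show ?thesis
    by (rule DERIV_cong[OF ddv_f_powr[OF time_Basis z]]) (simp only: y_time, simp add: sgm_def algebra_simps)
qed

lemma K15_S: "K15 \<subseteq> S" using m \<beta> by (intro Kbox_sub) auto

lemma Ke_mem_K15:
  assumes "z \<in> Ke" "m1 \<le> rat z" "rat z \<le> m5"
  shows "z \<in> K15"
proof -
  have z: "z \<in> Kf" and t: "fst z < 0" using assms Ke_T(2) S(2) by (auto simp: Ke_def)
  have "1 / (2 * \<beta>) \<le> 1 / \<beta>" using \<beta> by (simp add: field_simps)
  then show ?thesis using assms z \<beta> unfolding Kbox_iff[OF t] by auto
qed

text \<open>The weight \<open>A1\<close> blows up at \<open>f q = 0\<close> when \<open>a < 1\<close>. It appears in the time derivative of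
  \<open>(fst z - fst q) * A0 * \<zeta> * u\<^sup>2 * \<psi>\<close>, where the term containing \<open>d\<psi>\<close> has the favourable sign.\<close>

lemma singular_weight:
  "d0 * (LINT z:Ke|lborel. A1 z * \<zeta> z * (u z)\<^sup>2 * \<psi> z) \<le> c3 * (LINT z:K15|lborel. Q z)"
proof -
  let ?t = "\<lambda>z::'n spacetime. fst z - fst q"
  let ?D = "\<lambda>z. A0 z * \<zeta> z * (u z)\<^sup>2 * \<psi> z
     + ?t z * (A0 z * (dd (1, 0) \<zeta> z * (u z)\<^sup>2 * \<psi> z + 2 * \<zeta> z * (u z * pd (1, 0) u z) * \<psi> z))
     - 2 * (?t z)\<^sup>2 * (A1 z * \<zeta> z * (u z)\<^sup>2 * \<psi> z) - 2 * (?t z)\<^sup>2 * (A0 z * \<zeta> z * (u z)\<^sup>2 * d\<psi> z)"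
  have cD: "continuous_on T ?D" if "T = S \<inter> {z. 0 < f q z}" for T
    unfolding that
    by (intro continuous_on_add continuous_on_diff continuous_on_mult continuous_on_const continuous_on_power contA
       cont_\<psi> cont_on_pos(4,5)[OF refl] continuous_on_subset[OF C1D(1)[OF C1_zeta]] continuous_on_subset[OF C1D(2)[OF C1_zeta time_Basis]]
       continuous_on_fst continuous_on_id time_Basis Int_lower1)
  have "(LINT z:Ke|lborel. 1 * ?D z) = 0"
  proof (rule integral_compact_ddv_zero[OF open_Sf compact_Ke Ke_T(1), where b = "(1, 0)" and g = "\<lambda>z. ?t z * (A0 z * (\<zeta> z * ((u z)\<^sup>2 * \<psi> z)))" and w = "\<lambda>_. 1"])
    show "has_ddv (\<lambda>z. ?t z * (A0 z * (\<zeta> z * ((u z)\<^sup>2 * \<psi> z)))) (1, 0) z (?D z)" if z: "z \<in> T" for z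
    proof -
      have zS: "z \<in> S" using z by simp
      show ?thesis
        by (rule DERIV_cong[OF DERIV_mult[OF ddv_time[of z] DERIV_mult[OF ddv_A0_time[OF z]
            DERIV_mult[OF C1D(3)[OF C1_zeta time_Basis zS] DERIV_mult[OF DERIV_power[OF ddv(1)[OF zS, of "(1, 0)"], where n = 2] ddv_\<psi>_time[of z]]]]]])
          (simp only: scaleR_zero_left add_0_right, simp add: algebra_simps power2_eq_square)
    qed
    show "continuous_on T (\<lambda>z. ?t z * (A0 z * (\<zeta> z * ((u z)\<^sup>2 * \<psi> z))))"
      by (intro continuous_on_diff continuous_on_mult continuous_on_const continuous_on_power contA
         cont_\<psi> cont_on_pos(4)[OF refl] continuous_on_subset[OF C1D(1)[OF C1_zeta]]
         continuous_on_fst continuous_on_id Int_lower1)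
    show "continuous_on T ?D" by (rule cD) simp
    show "?t z * (A0 z * (\<zeta> z * ((u z)\<^sup>2 * \<psi> z))) = 0" if "z \<in> T - Ke" for z
      using off_Ke_\<zeta>[of z] that by auto
  qed auto
  \<comment> \<open>The derivative of \<open>A0\<close> contributes
    \<open>- 2 * (?t z)\<^sup>2 * A1 z\<close>, so half of the identity cancels the second part of
    \<open>d0 * A1 z \<le> f q z * A1 z + (?t z)\<^sup>2 * A1 z\<close>. The first part is harmless,
    being equal to \<open>a * A0 z\<close>.\<close>
  then have zero: "(LINT z:Ke|lborel. 1 / 2 * ?D z) = 0" by simp
  have cD': "continuous_on Ke (\<lambda>z. 1 / 2 * ?D z)"
    using continuous_on_subset[OF cD[OF refl] Ke_T(1)] by (intro continuous_on_mult continuous_on_const)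
  have c1: "continuous_on Ke (\<lambda>z. d0 * (A1 z * \<zeta> z * (u z)\<^sup>2 * \<psi> z))"
    by (rule continuous_on_subset[OF _ Ke_T(1)])
      (intro continuous_on_mult continuous_on_const continuous_on_power contA
       cont_\<psi> cont_on_pos(4)[OF refl] continuous_on_subset[OF C1D(1)[OF C1_zeta]] Int_lower1)
  have "(LINT z:Ke|lborel. d0 * (A1 z * \<zeta> z * (u z)\<^sup>2 * \<psi> z)) + (LINT z:Ke|lborel. 1 / 2 * ?D z) =
     (LINT z:Ke|lborel. d0 * (A1 z * \<zeta> z * (u z)\<^sup>2 * \<psi> z) + 1 / 2 * ?D z)"
    by (rule int_add[OF compact_Ke c1 cD', symmetric])
  also have "\<dots> \<le> (LINT z:K15|lborel. c3 * Q z)"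
  proof (rule int_le[OF compact_Ke _ compact_Kbox])
    show "continuous_on Ke (\<lambda>z. d0 * (A1 z * \<zeta> z * (u z)\<^sup>2 * \<psi> z) + 1 / 2 * ?D z)"
      by (rule continuous_on_add[OF c1 cD'])
    show "continuous_on K15 (\<lambda>z. c3 * Q z)"
      by (rule continuous_on_subset[OF _ K15_S]) (intro continuous_on_mult continuous_on_const cont_Q)
    have c3: "0 \<le> c3" unfolding c3_def using a M(1) by (intro mult_nonneg_nonneg add_nonneg_nonneg) auto
    show "0 \<le> c3 * Q z" for z using c3 Q_ge(3) by simp
    show "d0 * (A1 z * \<zeta> z * (u z)\<^sup>2 * \<psi> z) + 1 / 2 * ?D z \<le> 0" if z: "z \<in> Ke" "z \<notin> K15" for z
    proof -
      have t: "fst z < 0" and zf: "z \<in> Kf" using z Ke_T(2) S(2) by (auto simp: Ke_def)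
      have "rat z < m1" using Ke_mem_K15[of z] z zf unfolding Kbox_iff[OF t] by linarith
      moreover from this have "dd (1, 0) \<zeta> z = 0"
      proof -
        have "open ({z. fst z < 0} \<inter> rat -` {..<m1} :: 'n spacetime set)"
          using continuous_on_open_vimage[THEN iffD1, rule_format, OF _ C1D(1)[OF C1_rat], of "{..<m1}"]
          by (simp add: Int_commute open_Collect_less continuous_intros)
        then show ?thesis using t \<open>rat z < m1\<close> zeta_bounds(3)
          by (intro dd_locally_const[where c = 0 and T = "{z. fst z < 0} \<inter> rat -` {..<m1}"]) auto
      qed
      ultimately show ?thesis by (simp add: zeta_bounds(3))
    qed
    show "d0 * (A1 z * \<zeta> z * (u z)\<^sup>2 * \<psi> z) + 1 / 2 * ?D z \<le> c3 * Q z" if z: "z \<in> Ke" for z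
    proof -
      have zf: "z \<in> Kf" "0 < f q z" using z e by (auto simp: Ke_def)
      define X where "X = \<zeta> z * (u z)\<^sup>2 * \<psi> z"
      have X: "0 \<le> X" "X \<le> Q z"
      proof -
        show "0 \<le> X" unfolding X_def by (intro mult_nonneg_nonneg zeta_bounds \<psi>_bounds) auto
        have "X = (\<zeta> z * \<psi> z) * (u z)\<^sup>2" by (simp add: X_def)
        also have "\<dots> \<le> 1 * Q z"
          by (intro mult_mono mult_le_one zeta_bounds \<psi>_bounds Q_ge mult_nonneg_nonneg) auto
        finally show "X \<le> Q z" by simp
      qed
      have fA: "f q z * A1 z = a * A0 z" using zf powr_add[of "f q z" "a - 1" 1] by simp
      have A1p: "0 \<le> A1 z" using a by simp
      have "d0 * (A1 z * X) \<le> (f q z + (?t z)\<^sup>2) * (A1 z * X)"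
        using geo2(1)[OF zf(1)] zf(2) X A1p by (intro mult_right_mono) auto
      also have "\<dots> = (f q z * A1 z) * X + (?t z)\<^sup>2 * (A1 z * X)" by (simp add: algebra_simps)
      finally have 1: "d0 * (A1 z * X) \<le> a * A0 z * X + (?t z)\<^sup>2 * (A1 z * X)" unfolding fA .
      have 2: "A0 z * X \<le> M powr a * Q z" using A0_bound[OF z] X by (intro mult_mono) auto
      then have aux2: "a * A0 z * X \<le> a * (M powr a * Q z)" using a by simp
      have 3: "\<bar>?t z * (A0 z * (dd (1, 0) \<zeta> z * (u z)\<^sup>2 * \<psi> z + 2 * \<zeta> z * (u z * pd (1, 0) u z) * \<psi> z))\<bar> \<le> M * (M powr a * (M * Q z * 1 + 2 * 1 * Q z * 1))"
      proof (intro abs_mult_le time_bound zf)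
        show "\<bar>A0 z\<bar> \<le> M powr a" using A0_bound[OF z] by simp
        have "\<bar>dd (1, 0) \<zeta> z * (u z)\<^sup>2 * \<psi> z\<bar> \<le> M * Q z * 1"
          using \<psi>_bounds(1,2)[of z] Q_ge(2)[of z] by (intro abs_mult_le M(6) zf time_Basis) auto
        moreover have "\<bar>2 * \<zeta> z * (u z * pd (1, 0) u z) * \<psi> z\<bar> \<le> 2 * 1 * Q z * 1"
          using \<psi>_bounds(1,2)[of z] zeta_bounds(1,2)[of z] by (intro abs_mult_le Q_ge_prod time_Basis) auto
        ultimately show "\<bar>dd (1, 0) \<zeta> z * (u z)\<^sup>2 * \<psi> z + 2 * \<zeta> z * (u z * pd (1, 0) u z) * \<psi> z\<bar> \<le> M * Q z * 1 + 2 * 1 * Q z * 1"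
          by linarith
      qed
      have 4: "0 \<le> (?t z)\<^sup>2 * (A0 z * \<zeta> z * (u z)\<^sup>2 * d\<psi> z)"
        by (intro mult_nonneg_nonneg zeta_bounds \<psi>_bounds) auto
      have "d0 * (A1 z * \<zeta> z * (u z)\<^sup>2 * \<psi> z) + 1 / 2 * ?D z = d0 * (A1 z * X) + (A0 z * X
        + ?t z * (A0 z * (dd (1, 0) \<zeta> z * (u z)\<^sup>2 * \<psi> z + 2 * \<zeta> z * (u z * pd (1, 0) u z) * \<psi> z))) / 2
        - (?t z)\<^sup>2 * (A1 z * X) - (?t z)\<^sup>2 * (A0 z * \<zeta> z * (u z)\<^sup>2 * d\<psi> z)"
        by (simp add: X_def algebra_simps add_divide_distrib diff_divide_distrib)
      also have "\<dots> \<le> a * (M powr a * Q z) + (M powr a * Q z + M * (M powr a * (M * Q z * 1 + 2 * 1 * Q z * 1))) / 2"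
      proof -
        show ?thesis by (rule combine_bounds[OF 1 2 aux2 abs_le_D1[OF 3] 4])
      qed
      also have "\<dots> = c3 * Q z" unfolding c3_def by (simp add: algebra_simps add_divide_distrib)
      finally show ?thesis .
    qed
  qed
  finally show ?thesis using zero by simp
qed

definition "N = real DIM('n spacetime)"
definition "c1 = N * M * (M powr a * (N * M + M + \<gamma> + M * M))"
definition "c2 = N * M * (\<gamma> * M)"
text \<open>\<open>f q z powr (a - 1)\<close> increases or decreases in \<open>f q z\<close>
  according to the sign of \<open>a - 1\<close>; hence the minimum over both ends \<open>f0\<close>
  and \<open>M\<close> of the range.\<close>

definition "c0 = min (2 * (a * min (f0 powr (a - 1)) (M powr (a - 1)))) (\<kappa> / 2 * (f0 powr a * (\<epsilon> / (p + 1))))"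
definition "Ks = Kbox 0 m3 \<beta> \<inter> {z. f0 \<le> f q z}"

lemma N_pos: "0 \<le> N" by (simp add: N_def)

lemma c12_nonneg: "0 \<le> c1" "0 \<le> c2"
  unfolding c1_def c2_def using N_pos M(1) \<gamma>(2) by (auto intro!: mult_nonneg_nonneg add_nonneg_nonneg)

lemma compact_Ks: "compact Ks"
  unfolding Ks_def by (intro compact_Int_closed compact_Kbox closed_Collect_le continuous_intros cont_f)

lemma Ks_Ke: "Ks \<subseteq> Ke"
  using Kbox_mono[of 0 0 m3 m5 \<beta> \<beta>] m \<beta> e unfolding Ks_def Ke_def by force

lemma K34_S: "K34 \<subseteq> S" using m \<beta> by (intro Kbox_sub) auto

text \<open>Derivatives of \<open>\<xi>\<close> live between the levels \<open>m3\<close> and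
  \<open>m4\<close>, where \<open>\<zeta> = 1\<close>. The singular \<open>u\<^sup>2\<close> part of
  \<open>J_bound\<close> may therefore be multiplied by \<open>\<zeta>\<close> at no cost, and
  becomes the integrand of \<open>singular_weight\<close>.\<close>

lemma flux_bound:
  assumes z: "z \<in> Ke"
  shows "\<bar>\<Sum>b\<in>Basis. \<psi> z * dd b \<xi> z * J q a \<gamma> b z\<bar> \<le>
    indicator K34 z * (c1 * (Q z + w z)) + c2 * (A1 z * \<zeta> z * (u z)\<^sup>2 * \<psi> z)"
proof (cases "z \<in> K34")
  case False
  have t: "fst z < 0" and zf: "z \<in> Kf" and zS: "z \<in> S" using z Ke_T(2) S(2) by (auto simp: Ke_def)
  then have "rat z < m3 \<or> m4 < rat z"
    using False unfolding Kbox_iff[OF t] by auto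
  then have "dd b \<xi> z = 0" if "b \<in> Basis" for b using dd_\<xi>_zero[OF zS that] by simp
  then have "(\<Sum>b\<in>Basis. \<psi> z * dd b \<xi> z * J q a \<gamma> b z) = 0" by (intro sum.neutral) auto
  moreover have "0 \<le> c2 * (A1 z * \<zeta> z * (u z)\<^sup>2 * \<psi> z)"
    using a by (intro mult_nonneg_nonneg c12_nonneg zeta_bounds \<psi>_bounds) auto
  ultimately show ?thesis using False by simp
next
  case True
  have t: "fst z < 0" and zf: "z \<in> Kf" and zS: "z \<in> S" using z Ke_T(2) S(2) by (auto simp: Ke_def)
  have \<zeta>1: "\<zeta> z = 1" using True m unfolding Kbox_iff[OF t] by (intro zeta_bounds(5)) auto
  have V0: "\<bar>V z\<bar> \<le> M" using V\<epsilon>[OF zS] \<epsilon> M(4)[OF zf] by simp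
  have MQ: "0 \<le> N * M + M + \<gamma>" using N_pos M(1) \<gamma>(2) by (intro add_nonneg_nonneg) auto
  let ?R = "M powr a * ((N * M + M + \<gamma> + M * M) * (Q z + w z)) + \<gamma> * M * (A1 z * (u z)\<^sup>2 * \<psi> z)"
  have "\<bar>\<psi> z * dd b \<xi> z * J q a \<gamma> b z\<bar> \<le> M * ?R" if b: "b \<in> Basis" for b
  proof -
    have "\<bar>J q a \<gamma> b z\<bar> \<le> A0 z * ((N * M + M + \<gamma>) * Q z + M * M * w z) + \<gamma> * M * (A1 z * (u z)\<^sup>2)"
      unfolding N_def using M(1) \<gamma>(2) a by (intro J_bound b M(2) zf V0) auto
    also have "A0 z * ((N * M + M + \<gamma>) * Q z + M * M * w z) \<le> M powr a * ((N * M + M + \<gamma> + M * M) * (Q z + w z))"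
    proof (intro mult_mono A0_bound z)
      have "0 \<le> (N * M + M + \<gamma>) * w z" "0 \<le> M * M * Q z"
        using MQ w_nonneg Q_ge(3) by (auto intro!: mult_nonneg_nonneg)
      then show "(N * M + M + \<gamma>) * Q z + M * M * w z \<le> (N * M + M + \<gamma> + M * M) * (Q z + w z)"
        by (simp add: algebra_simps)
      show "0 \<le> (N * M + M + \<gamma>) * Q z + M * M * w z"
        using mult_nonneg_nonneg[OF MQ Q_ge(3)] w_nonneg by (intro add_nonneg_nonneg) auto
    qed auto
    finally have j: "\<bar>J q a \<gamma> b z\<bar> \<le> M powr a * ((N * M + M + \<gamma> + M * M) * (Q z + w z)) + \<gamma> * M * (A1 z * (u z)\<^sup>2)"
      by simp
    have "\<bar>\<psi> z * J q a \<gamma> b z\<bar> \<le> \<psi> z * (M powr a * ((N * M + M + \<gamma> + M * M) * (Q z + w z)) + \<gamma> * M * (A1 z * (u z)\<^sup>2))"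
      using j \<psi>_bounds(1)[of z] by (simp add: abs_mult mult_left_mono)
    also have "\<dots> \<le> ?R"
    proof -
      have "0 \<le> M powr a * ((N * M + M + \<gamma> + M * M) * (Q z + w z))"
        using N_pos \<gamma>(2) w_nonneg[of z] Q_ge(3)[of z] M(1) by (intro mult_nonneg_nonneg add_nonneg_nonneg) auto
      then have "\<psi> z * (M powr a * ((N * M + M + \<gamma> + M * M) * (Q z + w z))) \<le> M powr a * ((N * M + M + \<gamma> + M * M) * (Q z + w z))"
        using \<psi>_bounds(1,2)[of z] by (intro mult_left_le_one_le) auto
      then show ?thesis by (simp add: algebra_simps)
    qed
    finally have "\<bar>dd b \<xi> z * (\<psi> z * J q a \<gamma> b z)\<bar> \<le> M * ?R"
      by (intro abs_mult_le dd_\<xi> zf b)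
    then show ?thesis by (simp add: ac_simps)
  qed
  then have "(\<Sum>b\<in>Basis. \<bar>\<psi> z * dd b \<xi> z * J q a \<gamma> b z\<bar>) \<le> N * (M * ?R)"
    unfolding N_def by (intro sum_bounded_above) auto
  then have "\<bar>\<Sum>b\<in>Basis. \<psi> z * dd b \<xi> z * J q a \<gamma> b z\<bar> \<le> N * (M * ?R)"
    by (rule order_trans[OF sum_abs])
  also have "\<dots> = indicator K34 z * (c1 * (Q z + w z)) + c2 * (A1 z * \<zeta> z * (u z)\<^sup>2 * \<psi> z)"
    using True by (simp add: c1_def c2_def \<zeta>1 algebra_simps)
  finally show ?thesis .
qed

text \<open>Half of the positive potential term pays for the derivatives of \<open>V\<close>: the
  size of \<open>\<nu>\<close> makes their sum at most \<open>\<kappa> / 2 * V z\<close>.\<close>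

lemma bulk_lower:
  assumes z: "z \<in> Ke"
  shows "2 * A1 z * (Su q z + \<gamma> * u z)\<^sup>2 + \<kappa> / 2 * (A0 z * U z) \<le> (\<Sum>b\<in>Basis. dJ q a \<gamma> b z)"
proof -
  have zT: "z \<in> S" "0 < f q z" "z \<in> Kf" using z Ke_T by (auto simp: Ke_def)
  have "\<bar>\<Sum>b\<in>Basis. ((z - q) \<bullet> b) * pd b V z\<bar> \<le> (\<Sum>b\<in>Basis. \<bar>((z - q) \<bullet> b) * pd b V z\<bar>)"
    by (rule sum_abs)
  also have "\<dots> \<le> (\<Sum>b\<in>(Basis::'n spacetime set). M * \<nu>)"
    by (intro sum_mono abs_mult_le M(2) \<nu>(1) zT)
  also have "\<dots> = real DIM('n spacetime) * M * \<nu>" by simp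
  also have "\<dots> \<le> \<kappa> / 2 * V z"
  proof -
    have "\<kappa> * \<epsilon> / 2 \<le> \<kappa> / 2 * V z" using V\<epsilon>[OF zT(1)] \<kappa>(2) by simp
    then show ?thesis using \<nu>(3) by linarith
  qed
  finally have s: "\<bar>\<Sum>b\<in>Basis. ((z - q) \<bullet> b) * pd b V z\<bar> \<le> \<kappa> / 2 * V z" .
  have "\<bar>(\<Sum>b\<in>Basis. ((z - q) \<bullet> b) * pd b V z) * (A0 z * w z / (p + 1))\<bar> \<le> (\<kappa> / 2 * V z) * (A0 z * w z / (p + 1))"
    using p w_nonneg[of z] by (intro abs_mult_le s) auto
  moreover have "(\<Sum>b\<in>Basis. ((z - q) \<bullet> b) * pd b V z) * (A0 z * w z / (p + 1)) = A0 z * (\<Sum>b\<in>Basis. ((z - q) \<bullet> b) * pd b V z) * w z / (p + 1)"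
    by simp
  moreover have "(\<kappa> / 2 * V z) * (A0 z * w z / (p + 1)) = \<kappa> / 2 * (A0 z * U z)"
    by (simp add: U_def)
  ultimately have "- (\<kappa> / 2 * (A0 z * U z)) \<le> A0 z * (\<Sum>b\<in>Basis. ((z - q) \<bullet> b) * pd b V z) * w z / (p + 1)"
    by linarith
  moreover have "(2 - (p - 1) * \<gamma>) * A0 z * U z = \<kappa> / 2 * (A0 z * U z) + \<kappa> / 2 * (A0 z * U z)"
    by (simp add: \<kappa>(1)[symmetric])
  ultimately show ?thesis
    unfolding sum_dJ[OF zT(1,2) \<gamma>(1)] by linarith
qed

lemma U_nonneg: "z \<in> S \<Longrightarrow> 0 \<le> U z"
  using V\<epsilon>[of z] \<epsilon> p w_nonneg[of z] by (auto simp: U_def intro!: divide_nonneg_nonneg mult_nonneg_nonneg)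

text \<open>Off \<open>Ks\<close> it suffices that the divergence is nonnegative. On
  \<open>Ks\<close> both cutoffs are 1 and the weights lie above the constants collected in
  \<open>c0\<close>.\<close>

lemma bulk_coercive:
  assumes z: "z \<in> Ke"
  shows "indicator Ks z * (c0 * ((Su q z + \<gamma> * u z)\<^sup>2 + w z)) \<le> \<psi> z * \<xi> z * (\<Sum>b\<in>Basis. dJ q a \<gamma> b z)"
proof -
  have zT: "z \<in> S" "0 < f q z" "z \<in> Kf" "fst z < 0" using z Ke_T S(2) by (auto simp: Ke_def)
  have nn: "0 \<le> 2 * A1 z * (Su q z + \<gamma> * u z)\<^sup>2 + \<kappa> / 2 * (A0 z * U z)"
    using a \<kappa>(2) U_nonneg[OF zT(1)] by (intro add_nonneg_nonneg mult_nonneg_nonneg) auto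
  then have nn2: "0 \<le> (\<Sum>b\<in>Basis. dJ q a \<gamma> b z)" using bulk_lower[OF z] by linarith
  show ?thesis
  proof (cases "z \<in> Ks")
    case False
    then show ?thesis using nn2 by (simp add: \<psi>_bounds \<xi>_bounds)
  next
    case True
    have f: "f0 \<le> f q z" "f q z \<le> M" "0 < f0" using True M(3)[OF zT(3)] e by (auto simp: Ks_def)
    have one: "\<psi> z * \<xi> z = 1"
      using True e zT(4) by (auto simp: Ks_def Kbox_iff \<psi>_bounds \<xi>_bounds)
    have "min (f0 powr (a - 1)) (M powr (a - 1)) \<le> f q z powr (a - 1)"
    proof (cases "1 \<le> a")
      case True
      then have "f0 powr (a - 1) \<le> f q z powr (a - 1)" using f by (intro powr_mono2) auto
      then show ?thesis by linarith
    next
      case False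
      then have "M powr (a - 1) \<le> f q z powr (a - 1)" using f zT(2) by (intro powr_mono2') auto
      then show ?thesis by linarith
    qed
    then have "2 * (a * min (f0 powr (a - 1)) (M powr (a - 1))) \<le> 2 * A1 z"
      using a by (intro mult_left_mono) auto
    then have "c0 \<le> 2 * A1 z" unfolding c0_def by linarith
    then have 1: "c0 * (Su q z + \<gamma> * u z)\<^sup>2 \<le> 2 * A1 z * (Su q z + \<gamma> * u z)\<^sup>2"
      by (intro mult_right_mono) auto
    have "c0 * w z \<le> (\<kappa> / 2 * (f0 powr a * (\<epsilon> / (p + 1)))) * w z"
      unfolding c0_def using w_nonneg by (intro mult_right_mono) auto
    also have "\<dots> \<le> (\<kappa> / 2 * (A0 z * (V z / (p + 1)))) * w z"
      using \<kappa>(2) f a p \<epsilon> V\<epsilon>[OF zT(1)] w_nonneg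
      by (intro mult_right_mono mult_left_mono mult_mono powr_mono2 divide_right_mono) auto
    also have "\<dots> = \<kappa> / 2 * (A0 z * U z)" by (simp add: U_def)
    finally have "c0 * ((Su q z + \<gamma> * u z)\<^sup>2 + w z) \<le> (\<Sum>b\<in>Basis. dJ q a \<gamma> b z)"
      using 1 bulk_lower[OF z] by (simp add: distrib_left)
    then show ?thesis using True one by simp
  qed
qed

text \<open>None of \<open>c0\<close>, \<open>c1\<close>, \<open>c2\<close>, \<open>c3\<close>
  depends on \<open>u\<close> or \<open>e\<close>. The size of the solution enters the last term
  alone, through \<open>Mu\<close>; its factor \<open>(2 * e) powr a\<close> comes from the flux
  through the layer where \<open>\<psi>\<close> varies, so this term is lost as \<open>e\<close>
  tends to 0.\<close>

lemma carleman_inequality: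
  assumes Mu: "\<And>z. z \<in> Kf \<Longrightarrow> \<bar>(Su q z)\<^sup>2 - f q z * L z / 2 + f q z * U z + \<gamma> * u z * Su q z + \<gamma> * a * (u z)\<^sup>2\<bar> \<le> Mu"
  shows "c0 * (LINT z:Ks|lborel. (Su q z + \<gamma> * u z)\<^sup>2 + w z) \<le>
    (c2 * c3 / d0 + c1) * (LINT z:K15|lborel. Q z) + c1 * (LINT z:K34|lborel. w z)
    + (2 * Mu * ((1 + M * M) * (LINT z:Kf|lborel. 1)) / d0) * (2 * e) powr a"
proof -
  let ?D = "\<lambda>z. \<Sum>b\<in>Basis. (d\<psi> z * (2 * sgm b * ((z - q) \<bullet> b)) * \<xi> z + dd b \<xi> z * \<psi> z) * J q a \<gamma> b z + \<psi> z * \<xi> z * dJ q a \<gamma> b z"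
  let ?X = "\<lambda>z. A1 z * \<zeta> z * (u z)\<^sup>2 * \<psi> z"
  let ?m = "2 * Mu * (2 * e) powr a"
  have "C1 T \<xi>" by (rule C1_mono[OF C1_\<xi>]) simp
  note c\<xi> = C1D(1,2)[OF this]
  have zero: "(LINT z:Ke|lborel. ?D z) = 0"
  proof (rule divergence_identity[OF open_Sf compact_Ke Ke_T(1)])
    show "continuous_on T (\<lambda>z. \<psi> z * \<xi> z)" by (intro continuous_on_mult cont_\<psi> c\<xi>)
    show "continuous_on T (\<lambda>z. d\<psi> z * (2 * sgm b * ((z - q) \<bullet> b)) * \<xi> z + dd b \<xi> z * \<psi> z)" if "b \<in> Basis" for b
      by (intro continuous_on_add continuous_on_mult continuous_on_const cont_\<psi> c\<xi> that cont_on_pos(2)[OF refl])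
    show "has_ddv (\<lambda>z. \<psi> z * \<xi> z) b z (d\<psi> z * (2 * sgm b * ((z - q) \<bullet> b)) * \<xi> z + dd b \<xi> z * \<psi> z)"
      if "b \<in> Basis" "z \<in> T" for b z
      using that by (intro DERIV_cong[OF DERIV_mult[OF ddv_\<psi> C1D(3)[OF C1_\<xi>]]]) auto
    show "\<psi> z * \<xi> z = 0" if "z \<in> T - Ke" for z using off_Ke_\<xi> that by auto
  qed (auto intro: cont_J cont_dJ ddv_J)
  have cD: "continuous_on Ke ?D"
    by (rule continuous_on_subset[OF _ Ke_T(1)])
      (intro continuous_on_sum continuous_on_add continuous_on_mult continuous_on_const cont_\<psi> c\<xi> cont_on_pos(2)[OF refl] cont_J cont_dJ)
  have cX: "continuous_on Ke ?X"
    by (rule continuous_on_subset[OF _ Ke_T(1)])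
      (intro continuous_on_mult continuous_on_const continuous_on_power contA
       cont_\<psi> cont_on_pos(4)[OF refl] continuous_on_subset[OF C1D(1)[OF C1_zeta]] Int_lower1)
  have cY: "continuous_on Ke (\<lambda>z. \<xi> z * d\<psi> z)"
    by (rule continuous_on_subset[OF _ Ke_T(1)]) (intro continuous_on_mult cont_\<psi> c\<xi>)
  have c2X: "continuous_on Ke (\<lambda>z. c2 * ?X z)" and cmY: "continuous_on Ke (\<lambda>z. ?m * (\<xi> z * d\<psi> z))"
    by (intro continuous_on_mult continuous_on_const cX cY)+
  have cQ: "continuous_on K34 Q" "continuous_on K34 w" "continuous_on K15 Q"
    using cont_Q cont_w K34_S K15_S continuous_on_subset by blast+
  have "(LINT z:Ks|lborel. c0 * ((Su q z + \<gamma> * u z)\<^sup>2 + w z)) \<le>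
     (LINT z:Ke|lborel. ?D z + c2 * ?X z + ?m * (\<xi> z * d\<psi> z)) + (LINT z:K34|lborel. c1 * (Q z + w z))"
  proof (rule int_le_add[OF compact_Ks _ compact_Ke _ compact_Kbox])
    show "continuous_on Ks (\<lambda>z. c0 * ((Su q z + \<gamma> * u z)\<^sup>2 + w z))"
      by (rule continuous_on_subset[of S])
        (use Ks_Ke Ke_T(2) in \<open>auto intro!: continuous_on_mult continuous_on_add continuous_on_power continuous_on_const cont_Su cont_w cont(1)\<close>)
    show "continuous_on Ke (\<lambda>z. ?D z + c2 * ?X z + ?m * (\<xi> z * d\<psi> z))"
      by (rule continuous_on_add[OF continuous_on_add[OF cD c2X] cmY])
    show "continuous_on K34 (\<lambda>z. c1 * (Q z + w z))"
      by (intro continuous_on_mult continuous_on_add continuous_on_const cQ)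
    fix z
    show "indicator Ks z * (c0 * ((Su q z + \<gamma> * u z)\<^sup>2 + w z)) \<le>
      indicator Ke z * (?D z + c2 * ?X z + ?m * (\<xi> z * d\<psi> z)) + indicator K34 z * (c1 * (Q z + w z))"
    proof (cases "z \<in> Ke")
      case False
      then show ?thesis using Ks_Ke Q_ge(3)[of z] w_nonneg[of z] c12_nonneg by (auto simp: indicator_def)
    next
      case True
      then have zT: "0 < f q z" "z \<in> Kf" using e by (auto simp: Ke_def)
      \<comment> \<open>Three contributions, by the factor that is differentiated:
        \<open>\<psi>\<close> gives the flux through the level sets of \<open>f q\<close>,
        \<open>\<xi>\<close> the flux on the annulus, and \<open>J\<close> the bulk.\<close>
      have D: "?D z = 2 * (\<xi> z * d\<psi> z) * (\<Sum>b\<in>Basis. sgm b * ((z - q) \<bullet> b) * J q a \<gamma> b z)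
         + (\<Sum>b\<in>Basis. \<psi> z * dd b \<xi> z * J q a \<gamma> b z) + \<psi> z * \<xi> z * (\<Sum>b\<in>Basis. dJ q a \<gamma> b z)"
        unfolding sum_distrib_left sum.distrib[symmetric] by (intro sum.cong refl) (simp add: algebra_simps)
      have "\<bar>2 * (\<xi> z * d\<psi> z) * (\<Sum>b\<in>Basis. sgm b * ((z - q) \<bullet> b) * J q a \<gamma> b z)\<bar> \<le> ?m * (\<xi> z * d\<psi> z)"
      proof (cases "2 * e \<le> f q z")
        case True
        then show ?thesis by (simp add: \<psi>_bounds)
      next
        case False
        have "\<bar>\<Sum>b\<in>Basis. sgm b * ((z - q) \<bullet> b) * J q a \<gamma> b z\<bar> \<le> (2 * e) powr a * Mu"
          unfolding sum_y_J[OF zT(1)] using False zT(1) a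
          by (intro abs_mult_le Mu zT) (auto intro!: powr_mono2)
        then have "(2 * (\<xi> z * d\<psi> z)) * \<bar>\<Sum>b\<in>Basis. sgm b * ((z - q) \<bullet> b) * J q a \<gamma> b z\<bar> \<le> (2 * (\<xi> z * d\<psi> z)) * ((2 * e) powr a * Mu)"
          by (intro mult_left_mono) (auto simp: \<psi>_bounds \<xi>_bounds)
        then show ?thesis using \<psi>_bounds(5)[of z] \<xi>_bounds(1)[of z] by (simp add: abs_mult ac_simps)
      qed
      then have "indicator Ks z * (c0 * ((Su q z + \<gamma> * u z)\<^sup>2 + w z)) \<le> ?D z + c2 * ?X z + ?m * (\<xi> z * d\<psi> z) + indicator K34 z * (c1 * (Q z + w z))"
        using flux_bound[OF True] bulk_coercive[OF True] unfolding D by linarith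
      then show ?thesis using True by simp
    qed
  qed
  also have "(LINT z:Ke|lborel. ?D z + c2 * ?X z + ?m * (\<xi> z * d\<psi> z)) =
     c2 * (LINT z:Ke|lborel. ?X z) + ?m * (LINT z:Ke|lborel. \<xi> z * d\<psi> z)"
    unfolding int_add[OF compact_Ke continuous_on_add[OF cD c2X] cmY] int_add[OF compact_Ke cD c2X] zero int_cmult by simp
  also have "(LINT z:K34|lborel. c1 * (Q z + w z)) = c1 * ((LINT z:K34|lborel. Q z) + (LINT z:K34|lborel. w z))"
    unfolding int_cmult int_add[OF compact_Kbox cQ(1,2)] ..
  also have "c1 * ((LINT z:K34|lborel. Q z) + (LINT z:K34|lborel. w z)) \<le> c1 * ((LINT z:K15|lborel. Q z) + (LINT z:K34|lborel. w z))"
    by (intro mult_left_mono[OF _ c12_nonneg(1)] add_right_mono int_le[OF compact_Kbox cQ(1) compact_Kbox cQ(3)])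
      (use Q_ge(3) Kbox_mono[of m1 m3 m4 m5 \<beta> "2 * \<beta>"] m \<beta> in auto)
  also have "c2 * (LINT z:Ke|lborel. ?X z) \<le> c2 * (c3 / d0 * (LINT z:K15|lborel. Q z))"
    using singular_weight geo2(2) c12_nonneg by (intro mult_left_mono) (auto simp: field_simps)
  also have "?m * (LINT z:Ke|lborel. \<xi> z * d\<psi> z) \<le> ?m * ((1 + M * M) * (LINT z:Kf|lborel. 1) / d0)"
  proof (intro mult_left_mono)
    show "(LINT z:Ke|lborel. \<xi> z * d\<psi> z) \<le> (1 + M * M) * (LINT z:Kf|lborel. 1) / d0"
      using \<psi>_mass geo2(2) by (simp add: field_simps)
    \<comment> \<open>\<open>Mu\<close> bounds an absolute value at this point of \<open>Kf\<close>,
      hence is nonnegative.\<close>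
    have "(-1, 0) \<in> Kf" using \<beta> m by (simp add: Kbox_def)
    then show "0 \<le> ?m" using Mu[of "(-1, 0)"] by (auto intro!: mult_nonneg_nonneg)
  qed
  finally show ?thesis unfolding int_cmult[of Ks] by (simp add: algebra_simps)
qed

end

section \<open>The estimate on a time slab\<close>

text \<open>The weight \<open>wave_fun.f\<close> restated outside its locale: it depends on no
  solution, and the uniform estimates mention it before one is fixed.\<close>

definition hyp :: "'n::finite spacetime \<Rightarrow> 'n spacetime \<Rightarrow> real" where
  "hyp q z = (\<Sum>b\<in>Basis. sgm b * ((z - q) \<bullet> b)\<^sup>2)"

definition euler :: "('n::finite spacetime \<Rightarrow> real) \<Rightarrow> 'n spacetime \<Rightarrow> 'n spacetime \<Rightarrow> real" where
  "euler u q z = (\<Sum>b\<in>Basis. ((z - q) \<bullet> b) * pd b u z)"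

lemma cont_hyp: "continuous_on A (hyp q)"
  unfolding hyp_def[abs_def] by (intro continuous_intros)

lemma hyp_eq: "hyp q z = (norm (snd z - snd q))\<^sup>2 - (fst z - fst q)\<^sup>2"
proof -
  have "hyp q z = - (fst z - fst q)\<^sup>2 + (\<Sum>b\<in>Basis. ((snd z - snd q) \<bullet> b)\<^sup>2)"
    unfolding hyp_def sum_Basis_spacetime
    by (auto simp: sgm_def inner_prod_def intro!: sum.cong)
  then show ?thesis by (simp add: norm_sq_Basis)
qed

context cone_setting
begin

lemma compact_sum_bound:
  fixes g :: "'n spacetime \<Rightarrow> 'n spacetime \<Rightarrow> real"
  assumes "compact K" "\<And>b. b \<in> Basis \<Longrightarrow> continuous_on K (g b)"
  obtains M where "M > 0" "\<And>z b. z \<in> K \<Longrightarrow> b \<in> Basis \<Longrightarrow> \<bar>g b z\<bar> \<le> M"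
proof -
  have "continuous_on K (\<lambda>z. \<Sum>b\<in>Basis. \<bar>g b z\<bar>)" by (intro continuous_intros assms)
  from compact_bound[OF assms(1) this] obtain M
    where M: "M > 0" "\<And>z. z \<in> K \<Longrightarrow> \<bar>\<Sum>b\<in>Basis. \<bar>g b z\<bar>\<bar> \<le> M" by blast
  have "\<bar>g b z\<bar> \<le> M" if "z \<in> K" "b \<in> Basis" for z b
    using M(2)[OF that(1)] member_le_sum[OF that(2), of "\<lambda>b. \<bar>g b z\<bar>"] by simp
  then show ?thesis using that M(1) by blast
qed

text \<open>\<open>\<nu>\<close> and \<open>C\<close> are chosen before \<open>u\<close> and
  \<open>V\<close>, and \<open>e\<close> tends to 0 only after a solution has been fixed. The
  annular potential integral in \<open>carleman_inequality\<close> is converted into an integral of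
  \<open>Q\<close> by \<open>annulus_potential_estimate\<close>.\<close>

lemma carleman_estimate:
  fixes q :: "'n spacetime" and a \<gamma> d0 f0 :: real
  assumes a: "0 < a" and \<gamma>: "\<gamma> = (real DIM('n spacetime) - 2) / 2 + a" and \<kappa>: "0 < 2 - (p - 1) * \<gamma>"
    and geo1: "\<And>z. z \<in> S \<Longrightarrow> rat z \<le> m5 \<Longrightarrow> 0 \<le> hyp q z \<Longrightarrow> z \<in> Kbox 0 m5 \<beta>"
    and geo2: "\<And>z. z \<in> Kbox 0 m5 \<beta> \<Longrightarrow> 0 \<le> hyp q z \<Longrightarrow> d0 \<le> hyp q z + (fst z - fst q)\<^sup>2"
    and d0: "0 < d0" and f0: "0 < f0"
  shows "\<exists>\<nu>>0. \<exists>C\<ge>0. \<forall>u V. sol u V \<longrightarrow> (\<forall>z\<in>S. \<forall>b\<in>Basis. \<bar>pd b V z\<bar> \<le> \<nu>) \<longrightarrow>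
    (LINT z:Kbox 0 m3 \<beta> \<inter> {z. f0 \<le> hyp q z}|lborel. (euler u q z + \<gamma> * u z)\<^sup>2 + W u z)
      \<le> C * (LINT z:Kbox m1 m5 (2 * \<beta>)|lborel. Qu u z)"
proof -
  let ?K = "Kbox 0 m5 \<beta> :: 'n spacetime set"
  let ?Ks = "Kbox 0 m3 \<beta> \<inter> {z. f0 \<le> hyp q z} :: 'n spacetime set"
  let ?K15 = "Kbox m1 m5 (2 * \<beta>) :: 'n spacetime set"
  define \<kappa> where "\<kappa> = 2 - (p - 1) * \<gamma>"
  have KS: "?K \<subseteq> S" using m \<beta> by (intro Kbox_sub) auto
  obtain Ma where Ma: "Ma > 0" "\<And>z b. z \<in> ?K \<Longrightarrow> b \<in> Basis \<Longrightarrow> \<bar>(z - q) \<bullet> b\<bar> \<le> Ma"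
    by (rule compact_sum_bound[OF compact_Kbox, of 0 m5 \<beta> "\<lambda>b z. (z - q) \<bullet> b"]) (auto intro!: continuous_intros)
  obtain Mb where Mb: "Mb > 0" "\<And>z. z \<in> ?K \<Longrightarrow> \<bar>hyp q z\<bar> \<le> Mb"
    by (rule compact_bound[OF compact_Kbox cont_hyp, of 0 m5 \<beta> q]) blast
  have cx: "C1 S (\<lambda>z. 1 - cone_cutoff m3 m4 z)" by (intro C1_one_minus C1_cone_cutoff_S)
  obtain Mc where Mc: "Mc > 0" "\<And>z b. z \<in> ?K \<Longrightarrow> b \<in> Basis \<Longrightarrow> \<bar>dd b (\<lambda>z. 1 - cone_cutoff m3 m4 z) z\<bar> \<le> Mc"
    by (rule compact_sum_bound[OF compact_Kbox, of 0 m5 \<beta> "\<lambda>b. dd b (\<lambda>z. 1 - cone_cutoff m3 m4 z)"])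
      (auto intro: continuous_on_subset[OF C1D(2)[OF cx] KS])
  obtain Md where Md: "Md > 0" "\<And>z b. z \<in> ?K \<Longrightarrow> b \<in> Basis \<Longrightarrow> \<bar>dd b \<zeta> z\<bar> \<le> Md"
    by (rule compact_sum_bound[OF compact_Kbox, of 0 m5 \<beta> "\<lambda>b. dd b \<zeta>"])
      (auto intro: continuous_on_subset[OF C1D(2)[OF C1_zeta] KS])
  define M where "M = 1 + Ma + Mb + Mc + Md + \<bar>Mv\<bar>"
  have M1: "1 \<le> M" and Mle: "Ma \<le> M" "Mb \<le> M" "Mc \<le> M" "Md \<le> M" "\<bar>Mv\<bar> \<le> M"
    using Ma(1) Mb(1) Mc(1) Md(1) by (auto simp: M_def)
  define N where "N = real DIM('n spacetime)"
  have N1: "1 \<le> N" unfolding N_def by (simp add: DIM_positive Suc_le_eq)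
  \<comment> \<open>The equality case \<open>N * M * \<nu> = \<kappa> * \<epsilon> / 2\<close> of
    the smallness condition in \<open>carleman_setting\<close>.\<close>
  define \<nu> where "\<nu> = \<kappa> * \<epsilon> / (2 * N * M)"
  have \<nu>: "\<nu> > 0" using \<kappa> \<epsilon> N1 M1 by (simp add: \<nu>_def \<kappa>_def)
  have \<gamma>0: "0 \<le> \<gamma>" using a by (simp add: \<gamma>)
  define c3 where "c3 = M powr a * (a + (1 + M * M + 2 * M) / 2)"
  define c1 where "c1 = N * M * (M powr a * (N * M + M + \<gamma> + M * M))"
  define c2 where "c2 = N * M * (\<gamma> * M)"
  define c0 where "c0 = min (2 * (a * min (f0 powr (a - 1)) (M powr (a - 1)))) (\<kappa> / 2 * (f0 powr a * (\<epsilon> / (p + 1))))"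
  have c0: "c0 > 0" unfolding c0_def using a f0 M1 \<kappa> \<epsilon> p by (simp add: \<kappa>_def)
  have c123: "0 \<le> c1" "0 \<le> c2" "0 \<le> c3"
    unfolding c1_def c2_def c3_def using N1 M1 \<gamma>0 a by (auto intro!: mult_nonneg_nonneg add_nonneg_nonneg)
  obtain CA where CA: "CA \<ge> 0" "\<And>u V. sol u V \<Longrightarrow>
    (LINT z:Kbox m2 m4 \<beta>|lborel. W u z) \<le> CA * (LINT z:?K15|lborel. Qu u z)"
    using annulus_potential_estimate by blast
  define C where "C = (c2 * c3 / d0 + c1 + c1 * CA) / c0"
  have C: "0 \<le> C" unfolding C_def using c0 c123 CA(1) d0 by (intro divide_nonneg_pos add_nonneg_nonneg mult_nonneg_nonneg) auto
  show ?thesis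
  proof (rule exI[of _ \<nu>], intro conjI \<nu>, rule exI[of _ C], intro conjI C allI impI)
    fix u V assume s: "sol u V" and dV: "\<forall>z\<in>S. \<forall>b\<in>Basis. \<bar>pd b V z\<bar> \<le> \<nu>"
    interpret wf: wave_fun S sgm p u V using s by (simp add: sol_def)
    have V: "\<epsilon> \<le> V z" "V z \<le> Mv" if "z \<in> S" for z using s that by (auto simp: sol_def)
    have fh: "wf.f = hyp" by (auto simp: wf.f_def hyp_def fun_eq_iff)
    have se: "wf.Su = euler u" by (auto simp: wf.Su_def euler_def fun_eq_iff)
    have ww: "wf.w = W u" by (auto simp: wf.w_def W_def fun_eq_iff)
    let ?B = "\<lambda>z. (wf.Su q z)\<^sup>2 - wf.f q z * wf.L z / 2 + wf.f q z * wf.U z + \<gamma> * u z * wf.Su q z + \<gamma> * a * (u z)\<^sup>2"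
    have cB: "continuous_on ?K ?B"
      by (rule continuous_on_subset[OF _ KS])
        (intro continuous_on_add continuous_on_diff continuous_on_mult continuous_on_power continuous_on_const
          continuous_on_divide wf.cont_Su wf.cont_f wf.cont_L wf.cont_U wf.cont(1), simp)
    \<comment> \<open>This bound depends on the solution, but it only multiplies a positive power of
      \<open>e\<close>.\<close>
    obtain Mu where Mu: "Mu > 0" "\<And>z. z \<in> ?K \<Longrightarrow> \<bar>?B z\<bar> \<le> Mu"
      by (rule compact_bound[OF compact_Kbox cB]) blast
    have ineq: "c0 * (LINT z:?Ks|lborel. (euler u q z + \<gamma> * u z)\<^sup>2 + W u z) \<le>
      ((c2 * c3 / d0 + c1) * (LINT z:?K15|lborel. Qu u z) + c1 * (LINT z:Kbox m3 m4 \<beta>|lborel. W u z))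
      + (2 * Mu * ((1 + M * M) * (LINT z:?K|lborel. 1)) / d0) * (2 * e) powr a"
      if e: "0 < e" "e < min (f0 / 2) (d0 / 4)" for e
    proof -
      interpret cs: carleman_setting m1 m2 m3 m4 m5 \<beta> \<epsilon> Mv p S u V q a \<gamma> \<kappa> d0 f0 M \<nu> e
      proof unfold_locales
        show "\<gamma> = (real DIM('n spacetime) - 2) / 2 + a" "0 < a" "0 \<le> \<gamma>" using \<gamma> a \<gamma>0 by auto
        show "\<kappa> = 2 - (p - 1) * \<gamma>" "0 < \<kappa>" using \<kappa> by (auto simp: \<kappa>_def)
        show "1 \<le> M" by (rule M1)
        show "\<bar>(z - q) \<bullet> b\<bar> \<le> M" if "z \<in> ?K" "b \<in> Basis" for z b using Ma(2)[OF that] Mle by linarith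
        show "wf.f q z \<le> M" if "z \<in> ?K" for z using Mb(2)[OF that] Mle unfolding fh by linarith
        show "V z \<le> M" if "z \<in> ?K" for z using V(2)[of z] that KS Mle by force
        show "\<bar>dd b (\<lambda>z. 1 - cone_cutoff m3 m4 z) z\<bar> \<le> M" if "z \<in> ?K" "b \<in> Basis" for z b using Mc(2)[OF that] Mle by linarith
        show "\<bar>dd b \<zeta> z\<bar> \<le> M" if "z \<in> ?K" "b \<in> Basis" for z b using Md(2)[OF that] Mle by linarith
        show "z \<in> ?K" if "z \<in> S" "rat z \<le> m5" "0 \<le> wf.f q z" for z using geo1[of z] that unfolding fh by simp
        show "d0 \<le> wf.f q z + (fst z - fst q)\<^sup>2" if "z \<in> ?K" "0 \<le> wf.f q z" for z using geo2[of z] that unfolding fh by simp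
        show "\<bar>pd b V z\<bar> \<le> \<nu>" if "z \<in> S" "b \<in> Basis" for z b using dV that by blast
        show "real DIM('n spacetime) * M * \<nu> \<le> \<kappa> * \<epsilon> / 2"
        proof -
          have "N * M * \<nu> = \<kappa> * \<epsilon> / 2" using N1 M1 by (simp add: \<nu>_def)
          then show ?thesis unfolding N_def[symmetric] by simp
        qed
      qed (use V \<nu> d0 e in auto)
      show ?thesis
        using cs.carleman_inequality[of Mu] Mu(2)
        unfolding cs.c0_def cs.c1_def cs.c2_def cs.c3_def cs.N_def cs.Ks_def fh se ww
          c0_def c1_def c2_def c3_def N_def by blast
    qed
    have "c0 * (LINT z:?Ks|lborel. (euler u q z + \<gamma> * u z)\<^sup>2 + W u z) \<le>
      (c2 * c3 / d0 + c1) * (LINT z:?K15|lborel. Qu u z) + c1 * (LINT z:Kbox m3 m4 \<beta>|lborel. W u z)"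
      by (rule le_of_le_add_powr[OF a _ ineq, where ?e0.0 = "min (f0 / 2) (d0 / 4)"]) (use f0 d0 in simp)
    also have "\<dots> \<le> (c2 * c3 / d0 + c1) * (LINT z:?K15|lborel. Qu u z) + c1 * (CA * (LINT z:?K15|lborel. Qu u z))"
    proof (intro add_left_mono mult_left_mono c123)
      have sub: "Kbox m3 m4 \<beta> \<subseteq> (Kbox m2 m4 \<beta> :: 'n spacetime set)" using m \<beta> by (intro Kbox_mono) auto
      have "Kbox m2 m4 \<beta> \<subseteq> S" using m \<beta> by (intro Kbox_sub) auto
      then have "continuous_on (Kbox m2 m4 \<beta>) (W u)" "continuous_on (Kbox m3 m4 \<beta>) (W u)"
        using wf.cont_w sub unfolding ww by (auto intro: continuous_on_subset)
      then have "(LINT z:Kbox m3 m4 \<beta>|lborel. W u z) \<le> (LINT z:Kbox m2 m4 \<beta>|lborel. W u z)"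
        by (intro int_le compact_Kbox) (use sub in \<open>auto simp: W_def\<close>)
      also have "\<dots> \<le> CA * (LINT z:?K15|lborel. Qu u z)" by (rule CA(2)[OF s])
      finally show "(LINT z:Kbox m3 m4 \<beta>|lborel. W u z) \<le> CA * (LINT z:?K15|lborel. Qu u z)" .
    qed
    finally have "c0 * (LINT z:?Ks|lborel. (euler u q z + \<gamma> * u z)\<^sup>2 + W u z) \<le>
      (c2 * c3 / d0 + c1 + c1 * CA) * (LINT z:?K15|lborel. Qu u z)" by (simp add: algebra_simps)
    then show "(LINT z:?Ks|lborel. (euler u q z + \<gamma> * u z)\<^sup>2 + W u z) \<le> C * (LINT z:?K15|lborel. Qu u z)"
      unfolding C_def using c0 by (simp add: field_simps)
  qed
qed

end

text \<open>The Carleman centres lie near \<open>(-1, \<rho> e)\<close> with \<open>sqrt m5 < \<rho> < 1\<close>, i.e. outside the solid cone but inside the light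
  cone, so that \<open>hyp q \<ge> 0\<close> confines the cone to a compact time interval.\<close>

locale slab_setting = cone_setting m1 m2 m3 m4 m5 \<beta> \<epsilon> Mv p S
  for m1 m2 m3 m4 m5 \<beta> \<epsilon> Mv p :: real and S :: "('n::finite spacetime) set" +
  fixes \<rho> \<theta> :: real
  assumes p_sub: "(p - 1) * (real DIM('n spacetime) - 2) < 4"
    and \<theta>: "0 < \<theta>" "10 * \<theta> \<le> \<rho> - sqrt m5" "10 * \<theta> \<le> 1 - \<rho>"
    and \<beta>2: "4 / (1 - sqrt m5) \<le> \<beta>" "4 / (1 - \<rho>) \<le> \<beta>"
begin

definition Sl :: "real \<Rightarrow> 'n spacetime set" where
  "Sl l = {z. - 1 - \<theta> \<le> fst z \<and> fst z \<le> - 1 + \<theta> \<and> (norm (snd z))\<^sup>2 \<le> l * (fst z)\<^sup>2}"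

lemma sqrt_m5: "0 < sqrt m5" "sqrt m5 < \<rho>" "\<rho> < 1" "\<theta> \<le> 1 / 10"
proof -
  show 1: "0 < sqrt m5" using m by simp
  show 2: "sqrt m5 < \<rho>" "\<rho> < 1" using \<theta> by linarith+
  show "\<theta> \<le> 1 / 10" using 1 2 \<theta> by linarith
qed

lemma norm_le_of_rat:
  assumes "fst z < 0" "rat z \<le> m5"
  shows "norm (snd z) \<le> sqrt m5 * \<bar>fst z\<bar>"
proof (rule power2_le_imp_le)
  show "(norm (snd z))\<^sup>2 \<le> (sqrt m5 * \<bar>fst z\<bar>)\<^sup>2"
    using assms m by (simp add: rat_iff power_mult_distrib)
qed (use m in auto)

lemma hyp_nonneg_iff: "0 \<le> hyp q z \<longleftrightarrow> \<bar>fst z - fst q\<bar> \<le> norm (snd z - snd q)"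
  unfolding hyp_eq using abs_le_square_iff[of "fst z - fst q" "norm (snd z - snd q)"] by simp

lemma Sl_Kbox: "Sl l \<subseteq> Kbox 0 l \<beta>" "compact (Sl l)"
proof -
  have b4: "4 \<le> \<beta>"
  proof -
    have "0 < \<rho>" using sqrt_m5 by linarith
    then have "4 / 1 \<le> 4 / (1 - \<rho>)" using sqrt_m5(3) by (intro divide_left_mono) auto
    then show ?thesis using \<beta>2 by simp
  qed
  then have "1 / \<beta> \<le> 1 / 4" by (intro divide_left_mono) auto
  then have b: "- 1 + \<theta> \<le> - (1 / \<beta>)" "- \<beta> \<le> - 1 - \<theta>" using sqrt_m5(4) b4 by linarith+
  show "Sl l \<subseteq> Kbox 0 l \<beta>"
  proof
    fix z assume "z \<in> Sl l"
    then show "z \<in> Kbox 0 l \<beta>" using b unfolding Sl_def Kbox_def by (auto simp del: divide_minus_left)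
  qed
  moreover have "closed (Sl l)"
    unfolding Sl_def by (intro closed_Collect_conj closed_Collect_le continuous_intros)
  ultimately show "compact (Sl l)"
    using compact_Int_closed[OF compact_Kbox[of 0 l \<beta>], of "Sl l"] by (simp add: Int_absorb1)
qed

text \<open>In the cone \<open>norm (snd z) \<le> sqrt m5 * \<bar>fst z\<bar>\<close>, and
  \<open>0 \<le> hyp q z\<close> means that the time distance to \<open>q\<close> is at most the
  spatial distance. Together they bound the time from both sides: \<open>sqrt m5 < 1\<close>
  excludes very early times and \<open>\<rho> < 1\<close> excludes times near 0. Because
  \<open>sqrt m5 < \<rho>\<close>, the relevant points keep a positive spatial distance from
  \<open>q\<close>, which gives the other two claims.\<close>

lemma centre_geometry:
  assumes q: "\<bar>fst q + 1\<bar> \<le> \<theta>" "\<rho> - \<theta> \<le> norm (snd q)" "norm (snd q) \<le> \<rho> + \<theta>"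
  shows "\<And>z. z \<in> S \<Longrightarrow> rat z \<le> m5 \<Longrightarrow> 0 \<le> hyp q z \<Longrightarrow> z \<in> Kbox 0 m5 \<beta>"
    and "\<And>z. z \<in> Kbox 0 m5 \<beta> \<Longrightarrow> 0 \<le> hyp q z \<Longrightarrow> 16 * \<theta>\<^sup>2 \<le> hyp q z + (fst z - fst q)\<^sup>2"
    and "Sl m3 \<subseteq> Kbox 0 m3 \<beta> \<inter> {z. \<theta>\<^sup>2 \<le> hyp q z}"
proof -
  let ?l = "sqrt m5"
  have l: "0 < ?l" "?l < 1" using sqrt_m5 by linarith+
  have tri: "norm (snd q) - norm (snd z) \<le> norm (snd z - snd q)" "norm (snd z - snd q) \<le> norm (snd z) + norm (snd q)" for z :: "'n spacetime"
    using norm_triangle_ineq3[of "snd z" "snd q"] norm_triangle_ineq4[of "snd z" "snd q"] by linarith+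
  show "z \<in> Kbox 0 m5 \<beta>" if z: "z \<in> S" "rat z \<le> m5" "0 \<le> hyp q z" for z
  proof -
    have t: "fst z < 0" using z S(2) by auto
    have x: "norm (snd z) \<le> ?l * - fst z" using norm_le_of_rat[OF t z(2)] t by simp
    have h: "\<bar>fst z - fst q\<bar> \<le> norm (snd z - snd q)" using z(3) by (simp add: hyp_nonneg_iff)
    \<comment> \<open>The centre has time about -1 and spatial norm about \<open>\<rho> < 1\<close>,
      so points close to the origin are timelike from it; this excludes small
      \<open>- fst z\<close>.\<close>
    have "- fst z * (1 + ?l) \<ge> 1 - \<rho> - 2 * \<theta>" using x h tri(2)[of z] q by (simp add: algebra_simps abs_le_iff)
    moreover have "- fst z * (1 + ?l) \<le> - fst z * 2" using t l by (intro mult_left_mono) auto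
    ultimately have "1 - \<rho> - 2 * \<theta> \<le> - fst z * 2" by linarith
    then have "1 - \<rho> \<le> 4 * - fst z" using \<theta> by linarith
    then have lo: "(1 - \<rho>) / 4 \<le> - fst z" by simp
    have "- fst z * (1 - ?l) \<le> 1 + \<rho> + 2 * \<theta>" using x h tri(2)[of z] q by (simp add: algebra_simps abs_le_iff)
    then have "- fst z * (1 - ?l) \<le> 4" using \<theta> sqrt_m5 by linarith
    then have hi: "- fst z \<le> 4 / (1 - ?l)" using l by (simp add: field_simps)
    have "1 / \<beta> \<le> 1 / (4 / (1 - \<rho>))" using \<beta>2 sqrt_m5 \<beta> by (intro divide_left_mono) auto
    then have "1 / \<beta> \<le> - fst z" using lo by simp
    moreover have "- fst z \<le> \<beta>" using hi \<beta>2 by linarith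
    moreover have "0 \<le> rat z" by (simp add: rat_def)
    ultimately show ?thesis unfolding Kbox_iff[OF t] using z by auto
  qed
  show "16 * \<theta>\<^sup>2 \<le> hyp q z + (fst z - fst q)\<^sup>2" if z: "z \<in> Kbox 0 m5 \<beta>" "0 \<le> hyp q z" for z
  proof -
    have "0 < 1 / \<beta>" using \<beta> by simp
    moreover have "fst z \<le> - (1 / \<beta>)" using z by (simp add: Kbox_def)
    ultimately have t: "fst z < 0" by linarith
    have x: "norm (snd z) \<le> ?l * - fst z" using norm_le_of_rat[OF t] z Kbox_iff[OF t, of 0 m5 \<beta>] t by simp
    have h: "\<bar>fst z - fst q\<bar> \<le> norm (snd z - snd q)" using z(2) by (simp add: hyp_nonneg_iff)
    \<comment> \<open>If \<open>d\<close> were small, \<open>z\<close> would be close to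
      \<open>q\<close> in time as well, and \<open>q\<close> would nearly lie in the cone of slope
      \<open>sqrt m5\<close>. Quantitatively, \<open>10 * \<theta> \<le> \<rho> - sqrt m5\<close>
      forces \<open>4 * \<theta> \<le> d\<close>.\<close>
    define d where "d = norm (snd z - snd q)"
    have "- fst z \<le> 1 + \<theta> + d" using h q by (simp add: d_def abs_le_iff)
    then have "?l * - fst z \<le> ?l * (1 + \<theta> + d)" using l by (intro mult_left_mono) auto
    then have "\<rho> - \<theta> \<le> ?l * (1 + \<theta> + d) + d" using x tri(1)[of z] q unfolding d_def by linarith
    moreover have "?l * \<theta> \<le> 1 * \<theta>" using l \<theta> by (intro mult_right_mono) auto
    moreover have "?l * d \<le> 1 * d" using l by (intro mult_right_mono) (auto simp: d_def)
    moreover have "?l * (1 + \<theta> + d) = ?l + ?l * \<theta> + ?l * d" by (simp add: algebra_simps)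
    ultimately have "4 * \<theta> \<le> d" using \<theta> by linarith
    then have "(4 * \<theta>)\<^sup>2 \<le> d\<^sup>2" using \<theta> by (intro power_mono) auto
    then show ?thesis by (simp add: hyp_eq d_def power_mult_distrib)
  qed
  show "Sl m3 \<subseteq> Kbox 0 m3 \<beta> \<inter> {z. \<theta>\<^sup>2 \<le> hyp q z}"
  proof
    fix z assume z: "z \<in> Sl m3"
    have t: "fst z < 0" and tb: "- fst z \<le> 1 + \<theta>" "\<bar>fst z + 1\<bar> \<le> \<theta>" using z sqrt_m5(4) by (auto simp: Sl_def)
    have "rat z \<le> m3" using z by (simp add: Sl_def rat_iff[OF t])
    then have x: "norm (snd z) \<le> ?l * - fst z" using norm_le_of_rat[OF t] m t by simp
    also have "\<dots> \<le> ?l * (1 + \<theta>)" using l tb by (intro mult_left_mono) auto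
    also have "\<dots> \<le> ?l + \<theta>" using l \<theta> mult_right_mono[of ?l 1 \<theta>] by (simp add: algebra_simps)
    finally have "8 * \<theta> \<le> norm (snd z - snd q)" using tri(1)[of z] q \<theta> by linarith
    then have "(8 * \<theta>)\<^sup>2 \<le> (norm (snd z - snd q))\<^sup>2" using \<theta> by (intro power_mono) auto
    moreover have "(fst z - fst q)\<^sup>2 \<le> (2 * \<theta>)\<^sup>2"
      using tb q \<theta> by (subst abs_le_square_iff[symmetric]) (simp add: abs_le_iff)
    ultimately have "64 * \<theta>\<^sup>2 - 4 * \<theta>\<^sup>2 \<le> hyp q z" by (simp add: hyp_eq power_mult_distrib)
    moreover have "\<theta>\<^sup>2 \<le> 64 * \<theta>\<^sup>2 - 4 * \<theta>\<^sup>2" by simp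
    ultimately have "\<theta>\<^sup>2 \<le> hyp q z" by linarith
    then show "z \<in> Kbox 0 m3 \<beta> \<inter> {z. \<theta>\<^sup>2 \<le> hyp q z}" using z Sl_Kbox by auto
  qed
qed

text \<open>Finitely many centres suffice, \<open>q0\<close> and one shift for each basis direction,
  so thresholds and constants combine by a minimum and a sum. Once the gradient is known,
  \<open>\<gamma> > 0\<close> recovers \<open>u\<close> from
  \<open>euler u q0 z + \<gamma> * u z\<close>.\<close>

lemma slab_estimate:
  "\<exists>\<nu>>0. \<nu> \<le> 1 \<and> (\<exists>C\<ge>0. \<forall>u V. sol u V \<longrightarrow> (\<forall>z\<in>S. \<forall>b\<in>Basis. \<bar>pd b V z\<bar> \<le> \<nu>) \<longrightarrow>
    (LINT z:Sl m4|lborel. Qu u z + W u z) \<le> C * (LINT z:Kbox m1 m5 (2 * \<beta>)|lborel. Qu u z))"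
proof -
  let ?K15 = "Kbox m1 m5 (2 * \<beta>) :: 'n spacetime set"
  \<comment> \<open>Half of the largest value compatible with
    \<open>(p - 1) * \<gamma> \<le> 2\<close>; it is positive exactly by
    \<open>p_sub\<close>.\<close>
  define a where "a = (4 - (p - 1) * (real DIM('n spacetime) - 2)) / (4 * (p - 1))"
  define \<gamma> where "\<gamma> = (real DIM('n spacetime) - 2) / 2 + a"
  have a0: "0 < a" unfolding a_def using p p_sub by (intro divide_pos_pos) auto
  have "0 < CARD('n)" by simp
  then have "2 \<le> real DIM('n spacetime)" by (simp add: Suc_le_eq)
  then have \<gamma>0: "0 < \<gamma>" unfolding \<gamma>_def using a0 by (intro add_nonneg_pos) simp_all
  have \<kappa>0: "0 < 2 - (p - 1) * \<gamma>"
  proof -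
    have "(p - 1) * \<gamma> = 1 + (p - 1) * (real DIM('n spacetime) - 2) / 4"
      unfolding \<gamma>_def a_def using p by (simp add: field_simps)
    then show ?thesis using p_sub by simp
  qed
  \<comment> \<open>The spatial direction of the centre is arbitrary; \<open>undefined\<close>
    merely names some index.\<close>
  define q0 :: "'n spacetime" where "q0 = (-1, \<rho> *\<^sub>R axis undefined 1)"
  define q where "q b = q0 + \<theta> *\<^sub>R b" for b
  define qs where "qs = insert q0 (q ` Basis)"
  have qs: "finite qs" "q0 \<in> qs" "b \<in> Basis \<Longrightarrow> q b \<in> qs" for b by (auto simp: qs_def)
  have "0 < \<rho>" using sqrt_m5 by linarith
  then have q0n: "norm (snd q0) = \<rho>" by (simp add: q0_def norm_axis_1)
  have adm: "\<bar>fst r + 1\<bar> \<le> \<theta>" "\<rho> - \<theta> \<le> norm (snd r)" "norm (snd r) \<le> \<rho> + \<theta>" if "r \<in> qs" for r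
  proof -
    obtain b where b: "r = q0 + \<theta> *\<^sub>R b" "norm b \<le> 1"
    proof (cases "r = q0")
      case True
      then show ?thesis using that[of 0] by simp
    next
      case False
      then obtain b where "b \<in> Basis" "r = q b" using \<open>r \<in> qs\<close> by (auto simp: qs_def)
      then show ?thesis using that[of b] by (simp add: q_def)
    qed
    have nb: "\<bar>fst b\<bar> \<le> 1" "norm (snd b) \<le> 1"
      using b(2) norm_fst_le[of "fst b" "snd b"] norm_snd_le[of "snd b" "fst b"] by auto
    have "\<bar>fst r + 1\<bar> = \<theta> * \<bar>fst b\<bar>" using \<theta>(1) by (simp add: b q0_def abs_mult)
    then show "\<bar>fst r + 1\<bar> \<le> \<theta>" using nb \<theta>(1) by (simp add: mult_left_le)
    have "norm (snd r - snd q0) = \<theta> * norm (snd b)" using \<theta>(1) by (simp add: b)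
    then have "norm (snd r - snd q0) \<le> \<theta>" using nb \<theta>(1) by (simp add: mult_left_le)
    then show "\<rho> - \<theta> \<le> norm (snd r)" "norm (snd r) \<le> \<rho> + \<theta>"
      using norm_triangle_ineq3[of "snd r" "snd q0"] q0n by linarith+
  qed
  define G where "G r \<nu> C \<longleftrightarrow> \<nu> > 0 \<and> C \<ge> 0 \<and> (\<forall>u V. sol u V \<longrightarrow> (\<forall>z\<in>S. \<forall>b\<in>Basis. \<bar>pd b V z\<bar> \<le> \<nu>) \<longrightarrow>
    (LINT z:Kbox 0 m3 \<beta> \<inter> {z. \<theta>\<^sup>2 \<le> hyp r z}|lborel. (euler u r z + \<gamma> * u z)\<^sup>2 + W u z)
      \<le> C * (LINT z:?K15|lborel. Qu u z))" for r \<nu> C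
  have "\<forall>r\<in>qs. \<exists>\<nu> C. G r \<nu> C"
  proof
    fix r assume "r \<in> qs"
    note g = centre_geometry[OF adm[OF this]]
    have "0 < \<theta>\<^sup>2" "0 < 16 * \<theta>\<^sup>2" using \<theta>(1) by auto
    with carleman_estimate[OF a0 \<gamma>_def \<kappa>0 g(1) g(2), of "\<theta>\<^sup>2"]
    show "\<exists>\<nu> C. G r \<nu> C" unfolding G_def by blast
  qed
  then obtain nu Cq where G: "\<And>r. r \<in> qs \<Longrightarrow> G r (nu r) (Cq r)" by metis
  have Cq: "\<And>r. r \<in> qs \<Longrightarrow> nu r > 0" "\<And>r. r \<in> qs \<Longrightarrow> Cq r \<ge> 0"
    using G unfolding G_def by auto
  have Cq3: "(LINT z:Kbox 0 m3 \<beta> \<inter> {z. \<theta>\<^sup>2 \<le> hyp r z}|lborel. (euler u r z + \<gamma> * u z)\<^sup>2 + W u z)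
      \<le> Cq r * (LINT z:?K15|lborel. Qu u z)"
    if "r \<in> qs" "sol u V" "\<And>z b. z \<in> S \<Longrightarrow> b \<in> Basis \<Longrightarrow> \<bar>pd b V z\<bar> \<le> nu r" for r u V
    using G[OF that(1)] that(2,3) unfolding G_def by blast
  \<comment> \<open>The 1 in the minimum provides the bound by 1 on the derivatives of
    \<open>V\<close> that \<open>energy_bound\<close> asks for.\<close>
  define \<nu> where "\<nu> = Min (insert 1 (nu ` qs))"
  have \<nu>: "\<nu> > 0" "\<nu> \<le> 1" "\<And>r. r \<in> qs \<Longrightarrow> \<nu> \<le> nu r"
    using qs(1) Cq(1) by (auto simp: \<nu>_def)
  obtain CA where CA: "CA \<ge> 0" "\<And>u V. sol u V \<Longrightarrow>
    (LINT z:Kbox m2 m4 \<beta>|lborel. W u z) \<le> CA * (LINT z:?K15|lborel. Qu u z)"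
    using annulus_potential_estimate by blast
  obtain R where R: "R > 0" "\<And>z. z \<in> Sl m3 \<Longrightarrow> \<bar>(norm (z - q0))\<^sup>2\<bar> \<le> R"
    by (rule compact_bound[OF Sl_Kbox(2)[of m3], of "\<lambda>z. (norm (z - q0))\<^sup>2"]) (auto intro!: continuous_intros)
  define N where "N = real DIM('n spacetime)"
  have N1: "1 \<le> N" unfolding N_def by (simp add: DIM_positive Suc_le_eq)
  \<comment> \<open>\<open>k1\<close> bounds the squared gradient, from \<open>N\<close> directions
    with \<open>4 / \<theta>\<^sup>2\<close> each. \<open>k2\<close> adds \<open>u\<^sup>2\<close>,
    for which the scaling derivative about \<open>q0\<close> is subtracted and the rest divided by
    \<open>\<gamma>\<close>.\<close>
  define k1 where "k1 = 4 * N / \<theta>\<^sup>2"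
  define k2 where "k2 = k1 + (2 + 2 * R * k1) / \<gamma>\<^sup>2"
  have k: "0 \<le> k1" "0 \<le> k2" using N1 R(1) by (auto simp: k1_def k2_def)
  define C where "C = (k2 + 1) * sum Cq qs + 1 + CA"
  have C: "0 \<le> C" unfolding C_def using k CA(1) sum_nonneg[of qs Cq] Cq(2) by simp
  show ?thesis
  proof (rule exI[of _ \<nu>], intro conjI \<nu>, rule exI[of _ C], intro conjI C allI impI)
    fix u V assume s: "sol u V" and dV: "\<forall>z\<in>S. \<forall>b\<in>Basis. \<bar>pd b V z\<bar> \<le> \<nu>"
    interpret wf: wave_fun S sgm p u V using s by (simp add: sol_def)
    have se: "wf.Su = euler u" by (auto simp: wf.Su_def euler_def fun_eq_iff)
    have ww: "wf.w = W u" by (auto simp: wf.w_def W_def fun_eq_iff)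
    have cE: "continuous_on S (euler u r)" for r using wf.cont_Su[of r] unfolding se .
    have cW: "continuous_on S (W u)" using wf.cont_w unfolding ww .
    have W0: "0 \<le> W u z" for z by (simp add: W_def)
    define X where "X r z = (euler u r z + \<gamma> * u z)\<^sup>2 + W u z" for r z
    have cX: "continuous_on S (X r)" for r
      unfolding X_def by (intro continuous_intros cE cW wf.cont(1))
    have X0: "0 \<le> X r z" for r z using W0[of z] by (simp add: X_def)
    have SlS: "Sl l \<subseteq> S" if "l \<le> m5" for l
      using Sl_Kbox(1)[of l] Kbox_sub[of 0 l \<beta>] that \<beta> by auto
    have K3S: "Kbox 0 m3 \<beta> \<subseteq> S" using m \<beta> by (intro Kbox_sub) auto
    have Xint: "(LINT z:Sl m3|lborel. X r z) \<le> Cq r * (LINT z:?K15|lborel. wf.Q z)" if r: "r \<in> qs" for r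
    proof -
      have cK: "compact (Kbox 0 m3 \<beta> \<inter> {z. \<theta>\<^sup>2 \<le> hyp r z})"
        by (intro compact_Int_closed compact_Kbox closed_Collect_le continuous_intros cont_hyp)
      have "(LINT z:Sl m3|lborel. X r z) \<le> (LINT z:Kbox 0 m3 \<beta> \<inter> {z. \<theta>\<^sup>2 \<le> hyp r z}|lborel. X r z)"
      proof (rule int_le[OF Sl_Kbox(2) _ cK])
        show "continuous_on (Sl m3) (X r)" using continuous_on_subset[OF cX SlS] m by auto
        show "continuous_on (Kbox 0 m3 \<beta> \<inter> {z. \<theta>\<^sup>2 \<le> hyp r z}) (X r)"
          by (rule continuous_on_subset[OF cX]) (use K3S in auto)
      qed (use X0 centre_geometry(3)[OF adm[OF r]] in auto)
      also have "\<dots> \<le> Cq r * (LINT z:?K15|lborel. wf.Q z)"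
        unfolding X_def by (rule Cq3[OF r s]) (use dV \<nu>(3)[OF r] in force)
      finally show ?thesis .
    qed
    have pw: "wf.Q z + W u z \<le> (k2 + 1) * (\<Sum>r\<in>qs. X r z)" if z: "z \<in> Sl m3" for z
    proof -
      define T where "T = (\<Sum>r\<in>qs. X r z)"
      have XT: "X r z \<le> T" if "r \<in> qs" for r
        unfolding T_def using member_le_sum[OF that, of "\<lambda>r. X r z"] X0 qs(1) by simp
      have sqT: "(euler u r z + \<gamma> * u z)\<^sup>2 \<le> T" if "r \<in> qs" for r
        using XT[OF that] W0[of z] by (simp add: X_def)
      have two: "(x - y)\<^sup>2 \<le> 2 * x\<^sup>2 + 2 * y\<^sup>2" for x y :: real
        using sum_squares_bound[of x "-y"] by (simp add: power2_diff)
      \<comment> \<open>the scaling derivatives about \<open>q0\<close> and \<open>q0 + \<theta> b\<close> differ by \<open>\<theta> \<partial>\<^sub>b u\<close>\<close>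
      have pb: "(pd b u z)\<^sup>2 \<le> 4 / \<theta>\<^sup>2 * T" if b: "b \<in> Basis" for b
      proof -
        have "euler u q0 z - euler u (q b) z = (\<Sum>c\<in>Basis. (b \<bullet> c) * (\<theta> * pd c u z))"
          unfolding euler_def sum_subtractf[symmetric] q_def
          by (rule sum.cong) (auto simp: inner_diff_left inner_add_left algebra_simps)
        then have "\<theta> * pd b u z = (euler u q0 z + \<gamma> * u z) - (euler u (q b) z + \<gamma> * u z)"
          using wf.sum_Basis_delta[OF b, of "\<lambda>c. \<theta> * pd c u z"] by simp
        then have "(\<theta> * pd b u z)\<^sup>2 \<le> 2 * T + 2 * T"
          using two[of "euler u q0 z + \<gamma> * u z" "euler u (q b) z + \<gamma> * u z"] sqT[OF qs(2)] sqT[OF qs(3)[OF b]] by simp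
        then show ?thesis using \<theta>(1) by (simp add: power_mult_distrib field_simps)
      qed
      define P where "P = (\<Sum>b\<in>Basis. (pd b u z)\<^sup>2)"
      have "P \<le> N * (4 / \<theta>\<^sup>2 * T)" unfolding P_def N_def by (intro sum_bounded_above pb)
      then have P: "P \<le> k1 * T" by (simp add: k1_def mult.assoc mult.left_commute)
      have P0: "0 \<le> P" by (simp add: P_def sum_nonneg)
      have "(euler u q0 z)\<^sup>2 \<le> (\<Sum>b\<in>Basis. ((z - q0) \<bullet> b)\<^sup>2) * P"
        unfolding euler_def P_def by (rule Cauchy_Schwarz_ineq_sum)
      also have "\<dots> \<le> R * P" using R(2)[OF z] P0 by (intro mult_right_mono) (auto simp: norm_sq_Basis)
      also have "\<dots> \<le> R * (k1 * T)" using R(1) P by simp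
      finally have eu: "(euler u q0 z)\<^sup>2 \<le> R * (k1 * T)" .
      have "(\<gamma> * u z)\<^sup>2 = ((euler u q0 z + \<gamma> * u z) - euler u q0 z)\<^sup>2" by simp
      also have "\<dots> \<le> 2 * (euler u q0 z + \<gamma> * u z)\<^sup>2 + 2 * (euler u q0 z)\<^sup>2" by (rule two)
      also have "\<dots> \<le> 2 * T + 2 * (R * (k1 * T))" using sqT[OF qs(2)] eu by (intro add_mono) auto
      finally have "(u z)\<^sup>2 \<le> (2 + 2 * R * k1) / \<gamma>\<^sup>2 * T"
        using \<gamma>0 by (simp add: power_mult_distrib field_simps)
      then have "wf.Q z \<le> k2 * T" using P unfolding wf.Q_def P_def[symmetric] k2_def by (simp add: algebra_simps)
      moreover have "W u z \<le> T" using XT[OF qs(2)] by (simp add: X_def) (smt (verit) zero_le_power2)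
      ultimately show ?thesis unfolding T_def[symmetric] by (simp add: algebra_simps)
    qed
    have c3: "continuous_on (Sl m3) (\<lambda>z. wf.Q z + W u z)" "continuous_on (Sl m4) (\<lambda>z. wf.Q z + W u z)"
      using continuous_on_subset[OF continuous_on_add[OF wf.cont_Q cW] SlS] m by auto
    have K34: "Kbox m3 m4 \<beta> \<subseteq> S" "Kbox m2 m4 \<beta> \<subseteq> S"
      using m \<beta> Kbox_sub[of m3 m4 \<beta>] Kbox_sub[of m2 m4 \<beta>] by simp_all
    have K15: "?K15 \<subseteq> S" using m \<beta> by (intro Kbox_sub) auto
    have cK: "continuous_on (Kbox m3 m4 \<beta>) wf.Q" "continuous_on (Kbox m3 m4 \<beta>) (W u)"
      "continuous_on ?K15 wf.Q" "continuous_on (Kbox m2 m4 \<beta>) (W u)"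
      using continuous_on_subset[OF wf.cont_Q] continuous_on_subset[OF cW] K34 K15 by auto
    have cXs: "continuous_on (Sl m3) (X r)" for r
      by (rule continuous_on_subset[OF cX SlS]) (use m in auto)
    have "(LINT z:Sl m3|lborel. wf.Q z + W u z) \<le> (LINT z:Sl m3|lborel. (k2 + 1) * (\<Sum>r\<in>qs. X r z))"
      by (intro int_mono Sl_Kbox c3 continuous_on_mult continuous_on_const continuous_on_sum cXs pw)
    also have "\<dots> = (k2 + 1) * (\<Sum>r\<in>qs. LINT z:Sl m3|lborel. X r z)"
      unfolding int_cmult by (subst int_sum[OF Sl_Kbox(2) cXs]) auto
    also have "\<dots> \<le> (k2 + 1) * (\<Sum>r\<in>qs. Cq r * (LINT z:?K15|lborel. wf.Q z))"
      using k by (intro mult_left_mono sum_mono Xint) auto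
    also have "\<dots> = (k2 + 1) * sum Cq qs * (LINT z:?K15|lborel. wf.Q z)"
      by (simp add: sum_distrib_right)
    finally have 1: "(LINT z:Sl m3|lborel. wf.Q z + W u z) \<le> (k2 + 1) * sum Cq qs * (LINT z:?K15|lborel. wf.Q z)" .
    have "(LINT z:Sl m4|lborel. wf.Q z + W u z) \<le>
        (LINT z:Sl m3|lborel. wf.Q z + W u z) + (LINT z:Kbox m3 m4 \<beta>|lborel. wf.Q z + W u z)"
    proof (rule int_le_add[OF Sl_Kbox(2) c3(2) Sl_Kbox(2) c3(1) compact_Kbox continuous_on_add[OF cK(1,2)]])
      fix z
      have "z \<in> Sl m3 \<or> z \<in> Kbox m3 m4 \<beta>" if "z \<in> Sl m4"
        using that Sl_Kbox(1)[of m4] by (auto simp: Sl_def Kbox_def)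
      then show "indicator (Sl m4) z * (wf.Q z + W u z) \<le>
        indicator (Sl m3) z * (wf.Q z + W u z) + indicator (Kbox m3 m4 \<beta>) z * (wf.Q z + W u z)"
        using wf.Q_ge(3)[of z] W0[of z] by (auto simp: indicator_def)
    qed
    moreover have "(LINT z:Kbox m3 m4 \<beta>|lborel. wf.Q z + W u z) = (LINT z:Kbox m3 m4 \<beta>|lborel. wf.Q z) + (LINT z:Kbox m3 m4 \<beta>|lborel. W u z)"
      by (rule int_add[OF compact_Kbox cK(1,2)])
    moreover have "(LINT z:Kbox m3 m4 \<beta>|lborel. wf.Q z) \<le> (LINT z:?K15|lborel. wf.Q z)"
      by (rule int_le[OF compact_Kbox cK(1) compact_Kbox cK(3)])
        (use wf.Q_ge(3) Kbox_mono[of m1 m3 m4 m5 \<beta> "2 * \<beta>"] m \<beta> in auto)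
    moreover have "(LINT z:Kbox m3 m4 \<beta>|lborel. W u z) \<le> (LINT z:Kbox m2 m4 \<beta>|lborel. W u z)"
      by (rule int_le[OF compact_Kbox cK(2) compact_Kbox cK(4)])
        (use W0 Kbox_mono[of m2 m3 m4 m4 \<beta> \<beta>] m \<beta> in auto)
    moreover have "(LINT z:Kbox m2 m4 \<beta>|lborel. W u z) \<le> CA * (LINT z:?K15|lborel. wf.Q z)"
      by (rule CA(2)[OF s])
    ultimately have "(LINT z:Sl m4|lborel. wf.Q z + W u z) \<le>
      (k2 + 1) * sum Cq qs * (LINT z:?K15|lborel. wf.Q z) + ((LINT z:?K15|lborel. wf.Q z) + CA * (LINT z:?K15|lborel. wf.Q z))"
      using 1 by linarith
    then show "(LINT z:Sl m4|lborel. wf.Q z + W u z) \<le> C * (LINT z:?K15|lborel. wf.Q z)"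
      by (simp add: C_def algebra_simps)
  qed
qed

end

section \<open>The estimate on a time slice\<close>

lemma half_integrable:
  fixes g :: "'n::finite spacetime \<Rightarrow> real"
  assumes "compact K" "continuous_on K g"
  shows "set_integrable lborel K (\<lambda>z. indicator {z. fst z \<le> T} z * g z)"
proof -
  have [measurable]: "{z :: 'n spacetime. fst z \<le> T} \<in> sets borel"
    by (intro borel_closed closed_Collect_le continuous_intros)
  have i: "integrable lborel (\<lambda>z. indicator K z *\<^sub>R g z)"
    by (rule borel_integrable_compact[OF assms])
  then have [measurable]: "(\<lambda>z. indicator K z *\<^sub>R g z) \<in> borel_measurable borel"
    by (simp add: borel_measurable_integrable)
  have "(\<lambda>z. indicator {z. fst z \<le> T} z * (indicator K z *\<^sub>R g z)) \<in> borel_measurable borel"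
    by measurable
  then have "integrable lborel (\<lambda>z. indicator {z. fst z \<le> T} z * (indicator K z *\<^sub>R g z))"
    by (intro Bochner_Integration.integrable_bound[OF i]) (auto simp: indicator_def)
  then show ?thesis unfolding set_integrable_def by (simp add: ac_simps)
qed

lemma half_le:
  fixes g G :: "'n::finite spacetime \<Rightarrow> real"
  assumes "compact K" "continuous_on K g" "continuous_on K G" "\<And>z. z \<in> K \<Longrightarrow> \<bar>g z\<bar> \<le> G z"
  shows "(LINT z:K|lborel. indicator {z. fst z \<le> T} z * g z) \<le> (LINT z:K|lborel. G z)"
proof (rule set_integral_mono[OF half_integrable[OF assms(1,2)] set_integrable_compact[OF assms(1,3)]])
  show "indicator {z. fst z \<le> T} z * g z \<le> G z" if "z \<in> K" for z
    using assms(4)[OF that] by (auto simp: indicator_def)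
qed

lemma nn_integral_compact:
  fixes g :: "'a::euclidean_space \<Rightarrow> real"
  assumes "compact K" "continuous_on K g" "\<And>x. x \<in> K \<Longrightarrow> 0 \<le> g x"
  shows "(\<integral>\<^sup>+x. ennreal (if x \<in> K then g x else 0) \<partial>lborel) = ennreal (LINT x:K|lborel. g x)"
proof -
  have e: "(if x \<in> K then g x else 0) = indicator K x *\<^sub>R g x" for x by (auto simp: indicator_def)
  show ?thesis unfolding e set_lebesgue_integral_def
    using set_integrable_compact[OF assms(1,2)] assms(3)
    by (intro nn_integral_eq_integral) (auto simp: set_integrable_def indicator_def)
qed

lemma has_ddv_slice:
  fixes F :: "'n::finite spacetime \<Rightarrow> real"
  assumes "has_ddv F (0, b) (t, x) D"
  shows "has_ddv (\<lambda>x. F (t, x)) b x D"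
  using assms by simp

text \<open>The parameter is the square of the radius, to match \<open>rat\<close> on the slice at
  time -1.\<close>

definition Bl :: "real \<Rightarrow> (real^'n::finite) set" where "Bl l = {x. (norm x)\<^sup>2 \<le> l}"

lemma compact_Bl: "compact (Bl l)"
proof -
  have "closed (Bl l)" unfolding Bl_def by (intro closed_Collect_le continuous_intros)
  moreover have "bounded (Bl l)"
    unfolding bounded_iff
  proof (intro exI ballI)
    fix x assume "x \<in> Bl l"
    then show "norm x \<le> sqrt l" by (intro real_le_rsqrt) (simp add: Bl_def)
  qed
  ultimately show ?thesis by (simp add: compact_eq_bounded_closed)
qed

lemma rat_slice: "rat (-1, x) = (norm x)\<^sup>2" by (simp add: rat_def)

context slab_setting
begin

abbreviation "K15 \<equiv> Kbox m1 m5 (2 * \<beta>) :: 'n spacetime set"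

text \<open>Peaks at time -1, with a flank of width \<open>\<theta>\<close> on each side. The slice
  identities integrate over \<open>fst z \<le> -1\<close> only; the right flank keeps the support of
  the cutoff inside the slab.\<close>

definition \<tau> :: "'n spacetime \<Rightarrow> real" where
  "\<tau> z = smooth_step (1 / \<theta> * fst z + (1 + \<theta>) / \<theta>) * smooth_step (- (1 / \<theta>) * fst z + (\<theta> - 1) / \<theta>)"

lemma C1_\<tau>: "C1 A \<tau>" unfolding \<tau>_def[abs_def] by (intro C1_mult C1_fst_affine)

lemma \<tau>_bounds: "0 \<le> \<tau> z" "\<tau> z \<le> 1" "\<tau> (-1, x) = 1" "fst z < -1 - \<theta> \<or> -1 + \<theta> < fst z \<Longrightarrow> \<tau> z = 0"
proof -
  show "0 \<le> \<tau> z" "\<tau> z \<le> 1" by (auto simp: \<tau>_def smooth_step_bounds intro: mult_le_one)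
  have "1 / \<theta> * -1 + (1 + \<theta>) / \<theta> = 1" "- (1 / \<theta>) * -1 + (\<theta> - 1) / \<theta> = 1"
    using \<theta>(1) by (simp_all add: field_simps)
  then show "\<tau> (-1, x) = 1" unfolding \<tau>_def fst_conv by (simp only: smooth_step_bounds(4) order_refl mult_1)
  assume "fst z < -1 - \<theta> \<or> -1 + \<theta> < fst z"
  moreover have "1 / \<theta> * fst z + (1 + \<theta>) / \<theta> = (fst z + 1 + \<theta>) / \<theta>" "- (1 / \<theta>) * fst z + (\<theta> - 1) / \<theta> = (\<theta> - 1 - fst z) / \<theta>"
    using \<theta>(1) by (simp_all add: field_simps)
  ultimately have "1 / \<theta> * fst z + (1 + \<theta>) / \<theta> \<le> 0 \<or> - (1 / \<theta>) * fst z + (\<theta> - 1) / \<theta> \<le> 0"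
    using \<theta>(1) by (auto intro!: divide_nonpos_pos)
  then show "\<tau> z = 0" unfolding \<tau>_def by (auto simp only: smooth_step_bounds(3) mult_zero_left mult_zero_right)
qed

definition \<Xi> :: "real \<Rightarrow> real \<Rightarrow> 'n spacetime \<Rightarrow> real" where "\<Xi> l l' z = \<tau> z * (1 - cone_cutoff l l' z)"

lemma C1_\<Xi>: "C1 S (\<Xi> l l')"
  unfolding \<Xi>_def[abs_def] by (intro C1_mult C1_one_minus C1_cone_cutoff_S C1_\<tau>)

lemma \<Xi>_bounds: "l < l' \<Longrightarrow> 0 \<le> \<Xi> l l' z" "l < l' \<Longrightarrow> \<Xi> l l' z \<le> 1"
  unfolding \<Xi>_def using \<tau>_bounds(1,2)[of z] cone_cutoff_bounds[of l l' z] by (auto intro!: mult_le_one mult_nonneg_nonneg)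

lemma \<Xi>_off:
  assumes "l < l'" "l' \<le> m4" "z \<in> S - Sl m4"
  shows "\<Xi> l l' z = 0"
proof -
  have t: "fst z < 0" using assms(3) S(2) by auto
  consider "fst z < -1 - \<theta> \<or> -1 + \<theta> < fst z" | "m4 \<le> rat z"
    using assms(3) rat_iff[OF t, of m4] by (auto simp: Sl_def)
  then show ?thesis
    using \<tau>_bounds(4)[of z] cone_cutoff_bounds(4)[OF assms(1), of z] assms(2) by cases (auto simp: \<Xi>_def)
qed

lemma \<Xi>_slice: "\<Xi> l l' (-1, x) = 1 - cone_cutoff l l' (-1, x)" by (simp add: \<Xi>_def \<tau>_bounds)

lemma Sl_S: "l \<le> m5 \<Longrightarrow> Sl l \<subseteq> S"
  using Sl_Kbox(1)[of l] Kbox_sub[of 0 l \<beta>] \<beta> by auto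

lemma Sl_slice: "Pair (-1) -` Sl l = Bl l"
  using \<theta>(1) by (auto simp: Sl_def Bl_def)

lemma slice_in_S: "l \<le> m5 \<Longrightarrow> x \<in> Bl l \<Longrightarrow> (-1, x) \<in> S"
  using Sl_S[of l] Sl_slice[of l] by auto

lemma cont_slice: "continuous_on S F \<Longrightarrow> continuous_on (Bl m4) (\<lambda>x. F (-1, x))"
  by (rule continuous_on_compose2[of S F]) (use slice_in_S[of m4] m in \<open>auto intro!: continuous_intros\<close>)

text \<open>The time derivative of \<open>\<Xi> l l' z * h z\<close> is integrated over
  \<open>fst z \<le> -1\<close>; the factor \<open>\<tau>\<close> removes the lower boundary and is
  1 on the slice.\<close>

lemma slice_identity:
  assumes "l < l'" "l' \<le> m4" and h: "continuous_on S h" "continuous_on S h'" "\<And>z. z \<in> S \<Longrightarrow> has_ddv h (1, 0) z (h' z)"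
  shows "(LINT x:Bl m4|lborel. (1 - cone_cutoff l l' (-1, x)) * h (-1, x)) =
    (LINT z:Sl m4|lborel. indicator {z. fst z \<le> -1} z * (dd (1, 0) (\<Xi> l l') z * h z + \<Xi> l l' z * h' z))"
proof -
  have "(LINT z:Sl m4|lborel. indicator {z. fst z \<le> -1} z * (dd (1, 0) (\<Xi> l l') z * h z + \<Xi> l l' z * h' z)) =
      (LINT x:(Pair (-1) -` Sl m4)|lborel. \<Xi> l l' (-1, x) * h (-1, x))"
  proof (rule integral_compact_halfspace_ddv[OF S(1) Sl_Kbox(2) Sl_S])
    show "continuous_on S (\<lambda>z. \<Xi> l l' z * h z)"
      "continuous_on S (\<lambda>z. dd (1, 0) (\<Xi> l l') z * h z + \<Xi> l l' z * h' z)"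
      by (intro continuous_on_mult continuous_on_add C1D(1)[OF C1_\<Xi>] C1D(2)[OF C1_\<Xi> time_Basis] h)+
    show "has_ddv (\<lambda>z. \<Xi> l l' z * h z) (1, 0) z (dd (1, 0) (\<Xi> l l') z * h z + \<Xi> l l' z * h' z)" if "z \<in> S" for z
      by (rule DERIV_cong[OF DERIV_mult[OF C1D(3)[OF C1_\<Xi> time_Basis that] h(3)[OF that]]])
        (simp only: scaleR_zero_left add_0_right, simp)
    show "\<Xi> l l' z * h z = 0" if "z \<in> S - Sl m4" for z using \<Xi>_off[OF assms(1,2) that] by simp
  qed (use m in auto)
  then show ?thesis unfolding Sl_slice \<Xi>_slice by simp
qed

text \<open>A slice integral costs one time derivative. This transfers control from the slab to the
  slice for every \<open>h\<close> that is, together with its time derivative, pointwise bounded by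
  \<open>Q\<close> plus \<open>W\<close>; it is applied to \<open>u\<^sup>2\<close> and to a power
  of \<open>\<bar>u\<bar>\<close>. The squared gradient is not such an \<open>h\<close> and goes
  through \<open>energy_bound\<close>.\<close>

lemma slice_function_bound:
  assumes "l < l'" "l' \<le> m4"
  shows "\<exists>M>0. \<forall>u V h h' c. sol u V \<longrightarrow> 0 \<le> c \<longrightarrow> continuous_on S h \<longrightarrow> continuous_on S h' \<longrightarrow>
    (\<forall>z\<in>S. has_ddv h (1, 0) z (h' z)) \<longrightarrow> (\<forall>z\<in>S. \<bar>h z\<bar> \<le> c * (Qu u z + W u z)) \<longrightarrow>
    (\<forall>z\<in>S. \<bar>h' z\<bar> \<le> c * (Qu u z + W u z)) \<longrightarrow>
    (LINT x:Bl m4|lborel. (1 - cone_cutoff l l' (-1, x)) * h (-1, x)) \<le> c * M * (LINT z:Sl m4|lborel. Qu u z + W u z)"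
proof -
  have KS: "Sl m4 \<subseteq> S" using Sl_S m by simp
  obtain M where M: "M > 0" "\<And>z. z \<in> Sl m4 \<Longrightarrow> \<bar>dd (1, 0) (\<Xi> l l') z\<bar> \<le> M"
    by (rule compact_bound[OF Sl_Kbox(2) continuous_on_subset[OF C1D(2)[OF C1_\<Xi> time_Basis] KS]]) blast
  show ?thesis
  proof (rule exI[of _ "M + 1"], intro conjI allI impI)
    show "0 < M + 1" using M by simp
    fix u V :: "'n spacetime \<Rightarrow> real" and h h' :: "'n spacetime \<Rightarrow> real" and c :: real
    assume s: "sol u V" and c: "0 \<le> c" and ch: "continuous_on S h" "continuous_on S h'"
      and d: "\<forall>z\<in>S. has_ddv h (1, 0) z (h' z)"
      and b: "\<forall>z\<in>S. \<bar>h z\<bar> \<le> c * (Qu u z + W u z)" "\<forall>z\<in>S. \<bar>h' z\<bar> \<le> c * (Qu u z + W u z)"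
    interpret wf: wave_fun S sgm p u V using s by (simp add: sol_def)
    have ww: "wf.w = W u" by (auto simp: wf.w_def W_def fun_eq_iff)
    have cQ: "continuous_on (Sl m4) (\<lambda>z. wf.Q z + W u z)"
      using continuous_on_subset[OF continuous_on_add[OF wf.cont_Q wf.cont_w] KS] unfolding ww .
    have "(LINT x:Bl m4|lborel. (1 - cone_cutoff l l' (-1, x)) * h (-1, x)) =
      (LINT z:Sl m4|lborel. indicator {z. fst z \<le> -1} z * (dd (1, 0) (\<Xi> l l') z * h z + \<Xi> l l' z * h' z))"
      by (rule slice_identity[OF assms ch]) (use d in auto)
    also have "\<dots> \<le> (LINT z:Sl m4|lborel. c * (M + 1) * (wf.Q z + W u z))"
    proof (rule half_le[OF Sl_Kbox(2)])
      show "continuous_on (Sl m4) (\<lambda>z. dd (1, 0) (\<Xi> l l') z * h z + \<Xi> l l' z * h' z)"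
        by (rule continuous_on_subset[OF _ KS])
          (intro continuous_on_mult continuous_on_add C1D(1)[OF C1_\<Xi>] C1D(2)[OF C1_\<Xi> time_Basis] ch)
      show "continuous_on (Sl m4) (\<lambda>z. c * (M + 1) * (wf.Q z + W u z))"
        by (rule continuous_on_mult[OF continuous_on_const cQ])
      show "\<bar>dd (1, 0) (\<Xi> l l') z * h z + \<Xi> l l' z * h' z\<bar> \<le> c * (M + 1) * (wf.Q z + W u z)" if z: "z \<in> Sl m4" for z
      proof -
        have zS: "z \<in> S" using KS z by auto
        have "\<bar>dd (1, 0) (\<Xi> l l') z * h z\<bar> \<le> M * (c * (wf.Q z + W u z))"
          using b zS by (intro abs_mult_le M z) auto
        moreover have "\<bar>\<Xi> l l' z * h' z\<bar> \<le> 1 * (c * (wf.Q z + W u z))"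
          using b zS \<Xi>_bounds[OF assms(1), of z] by (intro abs_mult_le) auto
        ultimately show ?thesis by (simp add: algebra_simps abs_le_iff)
      qed
    qed
    finally show "(LINT x:Bl m4|lborel. (1 - cone_cutoff l l' (-1, x)) * h (-1, x)) \<le> c * (M + 1) * (LINT z:Sl m4|lborel. Qu u z + W u z)"
      by (simp only: int_cmult)
  qed
qed

text \<open>By the equation, the time derivative of the energy density is the spatial divergence of
  \<open>pd tt u z * pd b u z\<close> minus a term with \<open>pd tt V\<close>. The divergence can
  be integrated by parts over \<open>fst z \<le> -1\<close>, because the indicator of this half
  space is constant in spatial directions; the derivatives then fall on the cutoff.\<close>

lemma energy_bound:
  assumes "l < l'" "l' \<le> m4"
  shows "\<exists>M>0. \<forall>u V. sol u V \<longrightarrow> (\<forall>z\<in>S. \<forall>b\<in>Basis. \<bar>pd b V z\<bar> \<le> 1) \<longrightarrow>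
    (LINT x:Bl m4|lborel. (1 - cone_cutoff l l' (-1, x)) * ((\<Sum>b\<in>Basis. (pd b u (-1, x))\<^sup>2) / 2 - V (-1, x) * W u (-1, x) / (p + 1)))
      \<le> M * (LINT z:Sl m4|lborel. Qu u z + W u z)"
proof -
  have KS: "Sl m4 \<subseteq> S" using Sl_S m by simp
  obtain M where M: "M > 0" "\<And>z b. z \<in> Sl m4 \<Longrightarrow> b \<in> Basis \<Longrightarrow> \<bar>dd b (\<Xi> l l') z\<bar> \<le> M"
    by (rule compact_sum_bound[OF Sl_Kbox(2), of m4 "\<lambda>b. dd b (\<Xi> l l')"])
      (auto intro: continuous_on_subset[OF C1D(2)[OF C1_\<Xi>] KS])
  define N where "N = real CARD('n)"
  define M' where "M' = M * (1 + \<bar>Mv\<bar>) + N * M + 1"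
  show ?thesis
  proof (rule exI[of _ M'], intro conjI allI impI)
    show "0 < M'" unfolding M'_def N_def using M(1) by (intro add_nonneg_pos add_nonneg_nonneg mult_nonneg_nonneg) auto
    fix u V assume s: "sol u V" and dV: "\<forall>z\<in>S. \<forall>b\<in>Basis. \<bar>pd b V z\<bar> \<le> 1"
    interpret wf: wave_fun S sgm p u V using s by (simp add: sol_def)
    have ww: "wf.w = W u" by (auto simp: wf.w_def W_def fun_eq_iff)
    have cQ: "continuous_on (Sl m4) (\<lambda>z. wf.Q z + W u z)"
      using continuous_on_subset[OF continuous_on_add[OF wf.cont_Q wf.cont_w] KS] unfolding ww .
    define tt :: "'n spacetime" where "tt = (1, 0)"
    define sp :: "'n spacetime set" where "sp = (\<lambda>b. (0, b)) ` Basis"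
    have tB: "tt \<in> Basis" unfolding tt_def by (rule time_Basis)
    have spB: "b \<in> Basis" if "b \<in> sp" for b using that unfolding sp_def Basis_spacetime by auto
    have sumB: "(\<Sum>b\<in>Basis. g b) = g tt + (\<Sum>b\<in>sp. g b)" for g :: "'n spacetime \<Rightarrow> real"
      unfolding sum_Basis_spacetime tt_def sp_def by (simp add: sum.reindex inj_on_def)
    have fsp: "finite sp" "card sp = CARD('n)" unfolding sp_def by (auto simp: card_image inj_on_def)
    have sg: "sgm tt = -1" "b \<in> sp \<Longrightarrow> sgm b = 1" for b by (auto simp: sgm_def tt_def sp_def)
    let ?en = "\<lambda>z. (\<Sum>b\<in>Basis. (pd b u z)\<^sup>2) / 2 - wf.U z"
    let ?nl = "\<lambda>z. nonlin p (u z)"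
    let ?en' = "\<lambda>z. (\<Sum>b\<in>Basis. pd b u z * pd tt (pd b u) z) - (pd tt V z * wf.w z / (p + 1) + V z * ?nl z * pd tt u z)"
    let ?X = "\<Xi> l l'"
    have cen: "continuous_on S ?en"
      by (intro continuous_on_diff continuous_on_divide continuous_on_sum continuous_on_power continuous_on_const wf.cont wf.cont_U) auto
    have cen': "continuous_on S ?en'"
      using p by (intro continuous_on_diff continuous_on_add continuous_on_mult continuous_on_divide continuous_on_sum continuous_on_const
          wf.cont tB wf.cont_w wf.cont_nonlin) auto
    have den: "has_ddv ?en (1, 0) z (?en' z)" if z: "z \<in> S" for z
    proof -
      have "has_ddv (\<lambda>z. \<Sum>b\<in>Basis. (pd b u z)\<^sup>2) tt z (\<Sum>b\<in>Basis. 2 * (pd b u z * pd tt (pd b u) z))"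
      proof (rule DERIV_sum)
        fix b :: "'n spacetime" assume b: "b \<in> Basis"
        show "has_ddv (\<lambda>z. (pd b u z)\<^sup>2) tt z (2 * (pd b u z * pd tt (pd b u) z))"
          by (rule DERIV_cong[OF DERIV_power[OF wf.ddv(2)[OF z b], where n = 2]]) simp
      qed
      then have "has_ddv ?en tt z (?en' z)"
        by (intro DERIV_cong[OF DERIV_diff[OF DERIV_cdivide[where c = 2] wf.ddv_U[OF z, of tt]]])
          (auto simp: sum_distrib_left[symmetric] mult.commute)
      then show ?thesis unfolding tt_def .
    qed
    let ?w = "indicator {z::'n spacetime. fst z \<le> -1} :: _ \<Rightarrow> real"
    have ident: "(LINT x:Bl m4|lborel. (1 - cone_cutoff l l' (-1, x)) * ?en (-1, x)) =
      (LINT z:Sl m4|lborel. ?w z * (dd (1, 0) ?X z * ?en z + ?X z * ?en' z))"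
      by (rule slice_identity[OF assms cen cen' den])
    let ?F = "\<lambda>b z. dd b ?X z * (pd tt u z * pd b u z) + ?X z * (pd b (pd tt u) z * pd b u z + pd tt u z * pd b (pd b u) z)"
    have cF: "continuous_on S (?F b)" if "b \<in> Basis" for b
      by (intro continuous_on_add continuous_on_mult wf.cont C1D(1)[OF C1_\<Xi>] C1D(2)[OF C1_\<Xi>] tB that)
    have Fzero: "(LINT z:Sl m4|lborel. ?w z * ?F b z) = 0" if b: "b \<in> sp" for b
    proof (rule integral_compact_ddv_zero[OF S(1) Sl_Kbox(2) KS, where b = b and g = "\<lambda>z. ?X z * (pd tt u z * pd b u z)"])
      note bB = spB[OF b]
      show "continuous_on S (\<lambda>z. ?X z * (pd tt u z * pd b u z))"
        by (intro continuous_on_mult wf.cont C1D(1)[OF C1_\<Xi>] tB bB)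
      show "continuous_on S (?F b)" by (rule cF[OF bB])
      show "?X z * (pd tt u z * pd b u z) = 0" if "z \<in> S - Sl m4" for z using \<Xi>_off[OF assms that] by simp
      show "has_ddv (\<lambda>z. ?X z * (pd tt u z * pd b u z)) b z (?F b z)" if z: "z \<in> S" for z
        by (rule DERIV_cong[OF DERIV_mult[OF C1D(3)[OF C1_\<Xi> bB z] DERIV_mult[OF wf.ddv(2)[OF z tB] wf.ddv(2)[OF z bB]]]])
          (simp only: scaleR_zero_left add_0_right, simp add: algebra_simps)
      have "{z::'n spacetime. fst z \<le> -1} \<in> sets borel"
        by (intro borel_closed closed_Collect_le continuous_intros)
      then show "?w \<in> borel_measurable borel" by simp
      show "?w (z + h *\<^sub>R b) = ?w z" for z h using b by (auto simp: sp_def indicator_def)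
    qed (auto simp: indicator_def)
    let ?G = "\<lambda>z. dd tt ?X z * ?en z - (\<Sum>b\<in>sp. dd b ?X z * (pd tt u z * pd b u z)) - ?X z * (pd tt V z * wf.w z / (p + 1))"
    \<comment> \<open>All second derivatives of \<open>u\<close> cancel here, which is what allows a
      bound by \<open>Q\<close> plus \<open>W\<close>.\<close>
    have G: "dd (1, 0) ?X z * ?en z + ?X z * ?en' z - (\<Sum>b\<in>sp. ?F b z) = ?G z" if z: "z \<in> S" for z
    proof -
      have e: "- pd tt (pd tt u) z + (\<Sum>b\<in>sp. pd b (pd b u) z) = - V z * ?nl z"
        using wf.eq[OF z] unfolding sumB using sg by simp
      have sy: "(\<Sum>b\<in>sp. pd b u z * pd tt (pd b u) z) = (\<Sum>b\<in>sp. pd b (pd tt u) z * pd b u z)"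
        by (intro sum.cong refl) (use wf.pd_symmetric[OF z _ tB] spB in \<open>simp add: mult.commute\<close>)
      have "?en' z = pd tt u z * pd tt (pd tt u) z + (\<Sum>b\<in>sp. pd b (pd tt u) z * pd b u z) - (pd tt V z * wf.w z / (p + 1) + V z * ?nl z * pd tt u z)"
        unfolding sumB sy by simp
      also have "pd tt (pd tt u) z = (\<Sum>b\<in>sp. pd b (pd b u) z) + V z * ?nl z" using e by linarith
      also have "pd tt u z * ((\<Sum>b\<in>sp. pd b (pd b u) z) + V z * ?nl z) + (\<Sum>b\<in>sp. pd b (pd tt u) z * pd b u z) - (pd tt V z * wf.w z / (p + 1) + V z * ?nl z * pd tt u z)
        = (\<Sum>b\<in>sp. pd b (pd tt u) z * pd b u z + pd tt u z * pd b (pd b u) z) - pd tt V z * wf.w z / (p + 1)"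
        by (simp add: algebra_simps sum.distrib sum_distrib_left)
      finally have en': "?en' z = (\<Sum>b\<in>sp. pd b (pd tt u) z * pd b u z + pd tt u z * pd b (pd b u) z) - pd tt V z * wf.w z / (p + 1)" .
      have "(\<Sum>b\<in>sp. ?F b z) = (\<Sum>b\<in>sp. dd b ?X z * (pd tt u z * pd b u z)) + ?X z * (\<Sum>b\<in>sp. pd b (pd tt u) z * pd b u z + pd tt u z * pd b (pd b u) z)"
        unfolding sum_distrib_left sum.distrib[symmetric] ..
      then show ?thesis unfolding en' tt_def[symmetric] by (simp add: algebra_simps)
    qed
    have c1: "continuous_on (Sl m4) (\<lambda>z. dd (1, 0) ?X z * ?en z + ?X z * ?en' z)"
      by (rule continuous_on_subset[OF _ KS])
        (intro continuous_on_add continuous_on_mult C1D(1)[OF C1_\<Xi>] C1D(2)[OF C1_\<Xi> time_Basis] cen cen')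
    have cF': "continuous_on (Sl m4) (?F b)" if "b \<in> sp" for b
      by (rule continuous_on_subset[OF cF[OF spB[OF that]] KS])
    have cG: "continuous_on (Sl m4) ?G"
    proof -
      have "continuous_on (Sl m4) (\<lambda>z. dd (1, 0) ?X z * ?en z + ?X z * ?en' z - (\<Sum>b\<in>sp. ?F b z))"
        by (intro continuous_on_diff c1 continuous_on_sum cF')
      then show ?thesis by (rule continuous_on_eq) (use G KS in auto)
    qed
    have "(LINT z:Sl m4|lborel. ?w z * (dd (1, 0) ?X z * ?en z + ?X z * ?en' z)) =
      (LINT z:Sl m4|lborel. ?w z * (dd (1, 0) ?X z * ?en z + ?X z * ?en' z)) - (\<Sum>b\<in>sp. LINT z:Sl m4|lborel. ?w z * ?F b z)"
      using Fzero by simp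
    also have "(\<Sum>b\<in>sp. LINT z:Sl m4|lborel. ?w z * ?F b z) = (LINT z:Sl m4|lborel. (\<Sum>b\<in>sp. ?w z * ?F b z))"
      unfolding set_lebesgue_integral_def scaleR_sum_right
      by (rule Bochner_Integration.integral_sum[symmetric])
        (use half_integrable[OF Sl_Kbox(2) cF'] in \<open>simp add: set_integrable_def\<close>)
    also have "(LINT z:Sl m4|lborel. ?w z * (dd (1, 0) ?X z * ?en z + ?X z * ?en' z)) - (LINT z:Sl m4|lborel. (\<Sum>b\<in>sp. ?w z * ?F b z)) =
      (LINT z:Sl m4|lborel. ?w z * (dd (1, 0) ?X z * ?en z + ?X z * ?en' z) - (\<Sum>b\<in>sp. ?w z * ?F b z))"
    proof (rule set_integral_diff(2)[symmetric, OF half_integrable[OF Sl_Kbox(2) c1]])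
      have "set_integrable lborel (Sl m4) (\<lambda>z. ?w z * (\<Sum>b\<in>sp. ?F b z))"
        by (intro half_integrable Sl_Kbox(2) continuous_on_sum cF')
      then show "set_integrable lborel (Sl m4) (\<lambda>z. \<Sum>b\<in>sp. ?w z * ?F b z)" by (simp only: sum_distrib_left)
    qed
    also have "\<dots> = (LINT z:Sl m4|lborel. ?w z * ?G z)"
    proof (rule set_lebesgue_integral_cong)
      show "\<forall>z. z \<in> Sl m4 \<longrightarrow> ?w z * (dd (1, 0) ?X z * ?en z + ?X z * ?en' z) - (\<Sum>b\<in>sp. ?w z * ?F b z) = ?w z * ?G z"
      proof (intro allI impI)
        fix z assume "z \<in> Sl m4"
        then have "z \<in> S" using KS by auto
        from G[OF this] show "?w z * (dd (1, 0) ?X z * ?en z + ?X z * ?en' z) - (\<Sum>b\<in>sp. ?w z * ?F b z) = ?w z * ?G z"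
          unfolding sum_distrib_left[symmetric] right_diff_distrib[symmetric] by simp
      qed
    qed (use Sl_Kbox(2) in \<open>simp add: borel_compact\<close>)
    also have "\<dots> \<le> (LINT z:Sl m4|lborel. M' * (wf.Q z + W u z))"
    proof (rule half_le[OF Sl_Kbox(2) cG])
      show "continuous_on (Sl m4) (\<lambda>z. M' * (wf.Q z + W u z))"
        by (rule continuous_on_mult[OF continuous_on_const cQ])
      fix z assume z: "z \<in> Sl m4"
      then have zS: "z \<in> S" using KS by auto
      have V: "\<bar>V z\<bar> \<le> \<bar>Mv\<bar>" using s zS \<epsilon> by (force simp: sol_def)
      have Q0: "0 \<le> wf.Q z" "0 \<le> W u z" using wf.Q_ge(3) by (auto simp: W_def)
      have wp: "\<bar>wf.w z / (p + 1)\<bar> \<le> W u z"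
        using p Q0(2) unfolding ww by (simp add: field_simps)
      have "\<bar>wf.U z\<bar> \<le> \<bar>Mv\<bar> * W u z"
        unfolding wf.U_def times_divide_eq_right[symmetric] by (intro abs_mult_le V wp)
      moreover have "\<bar>(\<Sum>b\<in>Basis. (pd b u z)\<^sup>2) / 2\<bar> \<le> wf.Q z"
        unfolding wf.Q_def by (simp add: sum_nonneg)
      ultimately have "\<bar>?en z\<bar> \<le> wf.Q z + \<bar>Mv\<bar> * W u z" by linarith
      also have "\<dots> \<le> (1 + \<bar>Mv\<bar>) * (wf.Q z + W u z)"
        using Q0 mult_nonneg_nonneg[OF abs_ge_zero[of Mv] Q0(1)] by (simp add: algebra_simps)
      finally have 1: "\<bar>dd tt ?X z * ?en z\<bar> \<le> M * ((1 + \<bar>Mv\<bar>) * (wf.Q z + W u z))"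
        by (intro abs_mult_le M z tB)
      have "\<bar>\<Sum>b\<in>sp. dd b ?X z * (pd tt u z * pd b u z)\<bar> \<le> (\<Sum>b\<in>sp. \<bar>dd b ?X z * (pd tt u z * pd b u z)\<bar>)"
        by (rule sum_abs)
      also have "\<dots> \<le> (\<Sum>b\<in>sp. M * wf.Q z)"
        by (intro sum_mono abs_mult_le M z spB wf.Q_ge_prod tB)
      also have "\<dots> = N * M * wf.Q z" by (simp add: fsp N_def)
      also have "\<dots> \<le> N * M * (wf.Q z + W u z)"
        using Q0 M(1) by (intro mult_left_mono) (auto simp: N_def)
      finally have 2: "\<bar>\<Sum>b\<in>sp. dd b ?X z * (pd tt u z * pd b u z)\<bar> \<le> N * M * (wf.Q z + W u z)" .
      have "\<bar>?X z * (pd tt V z * (wf.w z / (p + 1)))\<bar> \<le> 1 * (1 * W u z)"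
        using \<Xi>_bounds[OF assms(1), of z] dV zS tB by (intro abs_mult_le wp) auto
      then have 3: "\<bar>?X z * (pd tt V z * wf.w z / (p + 1))\<bar> \<le> wf.Q z + W u z" using Q0 by simp
      have t: "\<bar>A - B - C\<bar> \<le> a + b + c" if "\<bar>A\<bar> \<le> a" "\<bar>B\<bar> \<le> b" "\<bar>C\<bar> \<le> c" for A B C a b c :: real
        using that by linarith
      have "\<bar>?G z\<bar> \<le> M * ((1 + \<bar>Mv\<bar>) * (wf.Q z + W u z)) + N * M * (wf.Q z + W u z) + (wf.Q z + W u z)"
        by (rule t[OF 1 2 3])
      also have "\<dots> = M' * (wf.Q z + W u z)" by (simp add: M'_def algebra_simps)
      finally show "\<bar>?G z\<bar> \<le> M' * (wf.Q z + W u z)" .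
    qed
    finally show "(LINT x:Bl m4|lborel. (1 - cone_cutoff l l' (-1, x)) * ((\<Sum>b\<in>Basis. (pd b u (-1, x))\<^sup>2) / 2 - V (-1, x) * W u (-1, x) / (p + 1)))
      \<le> M' * (LINT z:Sl m4|lborel. Qu u z + W u z)"
      using ident unfolding int_cmult wf.U_def ww by simp
  qed
qed

end

section \<open>Absorption of the potential on the slice\<close>

lemma absorb_half:
  fixes Y a b z :: real
  assumes "Y \<le> a + b + 1 / 2 * Y + 1 / 4 * z" "0 \<le> z"
  shows "Y \<le> 2 * (a + b + z)"
  using assms by simp

context slab_setting
begin

text \<open>Two nested cutoffs: \<open>xa\<close> is supported where \<open>xb = 1\<close>. The
  inner one weights the energy, the outer one localises \<open>u\<close> for
  Gagliardo--Nirenberg.\<close>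

definition xb :: "real^'n \<Rightarrow> real" where "xb x = 1 - cone_cutoff m3 m4 (-1, x)"
definition xa :: "real^'n \<Rightarrow> real" where "xa x = 1 - cone_cutoff m2 m3 (-1, x)"
definition vs :: "('n spacetime \<Rightarrow> real) \<Rightarrow> real^'n \<Rightarrow> real" where
  "vs u x = (if x \<in> Bl m4 then xb x * u (-1, x) else 0)"
definition gx :: "'n spacetime \<Rightarrow> real" where
  "gx z = (\<Sum>i\<in>Basis. (dd (0, i) (\<lambda>z. 1 - cone_cutoff m3 m4 z) z)\<^sup>2)"

lemma xab_bounds: "0 \<le> xb x" "xb x \<le> 1" "0 \<le> xa x" "xa x \<le> 1" "(norm x)\<^sup>2 \<le> m3 \<Longrightarrow> xb x = 1" "m4 \<le> (norm x)\<^sup>2 \<Longrightarrow> xb x = 0"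
  "(norm x)\<^sup>2 \<le> m2 \<Longrightarrow> xa x = 1" "m3 \<le> (norm x)\<^sup>2 \<Longrightarrow> xa x = 0"
  using m cone_cutoff_bounds[of m3 m4 "(-1, x)"] cone_cutoff_bounds[of m2 m3 "(-1, x)"]
  by (auto simp: xa_def xb_def rat_slice)

lemma C1_xbz: "C1 S (\<lambda>z. 1 - cone_cutoff m3 m4 z)" by (intro C1_one_minus C1_cone_cutoff_S)

lemma cont_xb: "continuous_on (Bl m4) xb"
  unfolding xb_def[abs_def] by (rule cont_slice[OF C1D(1)[OF C1_xbz]])

lemma cont_xa: "continuous_on (Bl m4) xa"
  unfolding xa_def[abs_def] by (rule cont_slice[OF C1D(1)[OF C1_one_minus[OF C1_cone_cutoff_S]]])

lemma sp_Basis: "i \<in> Basis \<Longrightarrow> (0, i) \<in> (Basis :: 'n spacetime set)"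
  by (auto simp: Basis_spacetime)

lemma cont_gx: "continuous_on S gx"
  unfolding gx_def[abs_def] by (intro continuous_on_sum continuous_on_power C1D(2)[OF C1_xbz] sp_Basis)

lemma gx_zero: "z \<in> S \<Longrightarrow> rat z < m3 \<or> m4 < rat z \<Longrightarrow> gx z = 0"
proof -
  assume z: "z \<in> S" and r: "rat z < m3 \<or> m4 < rat z"
  have "dd b (\<lambda>z. 1 - cone_cutoff m3 m4 z) z = 0" if b: "b \<in> Basis" for b
  proof -
    have "has_ddv (\<lambda>z. 1 - cone_cutoff m3 m4 z) b z (0 - dd b (cone_cutoff m3 m4) z)"
      by (intro DERIV_diff DERIV_const C1D(3)[OF C1_cone_cutoff_S] z b)
    moreover have "dd b (cone_cutoff m3 m4) z = 0" using m z r S(2) by (intro dd_cone_cutoff_zero) auto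
    ultimately show ?thesis by (simp add: dd_def DERIV_imp_deriv)
  qed
  then show ?thesis unfolding gx_def using sp_Basis by (intro sum.neutral) auto
qed

text \<open>\<open>C1\<close> yields partial derivatives only, whereas \<open>smooth_fun\<close>
  asks for total differentiability; on the slice the cutoff is explicit enough to provide
  it.\<close>

lemma differentiable_xb: "xb differentiable (at x)"
proof -
  have e: "xb = (\<lambda>x. 1 - smooth_step ((x \<bullet> x - m3) / (m4 - m3)))"
    by (auto simp: xb_def cone_cutoff_def rat_slice power2_norm_eq_inner)
  have "((\<lambda>x. (x \<bullet> x - m3) / (m4 - m3)) has_derivative (\<lambda>h. (x \<bullet> h + h \<bullet> x) / (m4 - m3))) (at x)" for x :: "real^'n"
    using m by (auto intro!: derivative_eq_intros)
  from has_derivative_diff[OF has_derivative_const DERIV_compose_FDERIV[OF DERIV_smooth_step this], of 1 x]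
  show ?thesis unfolding e differentiable_def by blast
qed

text \<open>\<open>xb\<close> vanishes on the part of the slice outside \<open>Bl m4\<close>, so
  extension by zero is legitimate. In the gradient bound \<open>gx\<close> is nonzero only where
  \<open>(norm x)\<^sup>2\<close> lies between \<open>m3\<close> and \<open>m4\<close>, a region in
  which the annulus hypothesis of \<open>unit_estimate\<close> controls \<open>u\<close>.\<close>

lemma smooth_vs:
  assumes s: "sol u V"
  shows "smooth_fun (vs u)"
    and "smooth_fun.gr (vs u) x \<le> (if x \<in> Bl m4 then 2 * ((xb x)\<^sup>2 * (\<Sum>i\<in>Basis. (pd (0, i) u (-1, x))\<^sup>2)) + 2 * (gx (-1, x) * (u (-1, x))\<^sup>2) else 0)"
proof -
  interpret wf: wave_fun S sgm p u V using s by (simp add: sol_def)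
  define S' :: "(real^'n) set" where "S' = Pair (-1) -` S"
  have oS: "open S'" unfolding S'_def by (rule open_vimage[OF S(1)]) (intro continuous_intros)
  have BS: "Bl m4 \<subseteq> S'" using slice_in_S[of m4] m by (auto simp: S'_def)
  let ?g = "\<lambda>x. xb x * u (-1, x)"
  let ?g' = "\<lambda>b x. dd (0, b) (\<lambda>z. 1 - cone_cutoff m3 m4 z) (-1, x) * u (-1, x) + xb x * pd (0, b) u (-1, x)"
  have off: "?g x = 0" if "x \<in> S' - Bl m4" for x
    using that xab_bounds(6)[of x] by (auto simp: Bl_def)
  have cs: "continuous_on S' (\<lambda>x. F (-1, x))" if "continuous_on S F" for F :: "'n spacetime \<Rightarrow> real"
    by (rule continuous_on_compose2[OF that]) (auto simp: S'_def intro!: continuous_intros)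
  have cg: "continuous_on S' ?g"
    unfolding xb_def by (intro continuous_on_mult cs[OF C1D(1)[OF C1_xbz]] cs[OF wf.cont(1)])
  have cg': "continuous_on S' (?g' b)" if "b \<in> Basis" for b
    unfolding xb_def
    by (intro continuous_on_add continuous_on_mult cs[OF C1D(1)[OF C1_xbz]] cs[OF C1D(2)[OF C1_xbz]] cs[OF wf.cont(1)] cs[OF wf.cont(2)] sp_Basis that)
  have dg: "has_ddv ?g b x (?g' b x)" if b: "b \<in> Basis" and x: "x \<in> S'" for b x
  proof -
    have z: "(-1, x) \<in> S" using x by (simp add: S'_def)
    have "has_ddv (\<lambda>z. (1 - cone_cutoff m3 m4 z) * u z) (0, b) (-1, x) (?g' b x)"
      by (rule DERIV_cong[OF DERIV_mult[OF C1D(3)[OF C1_xbz sp_Basis[OF b] z] wf.ddv(1)[OF z]]])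
        (simp only: scaleR_zero_left add_0_right, simp add: xb_def algebra_simps)
    from has_ddv_slice[OF this] show ?thesis by (simp add: xb_def)
  qed
  have ve: "vs u = (\<lambda>x. if x \<in> Bl m4 then ?g x else 0)" by (auto simp: vs_def)
  have ext: "has_ddv (vs u) b x (if x \<in> Bl m4 then ?g' b x else 0)"
    "continuous_on UNIV (\<lambda>x. if x \<in> Bl m4 then ?g' b x else 0)" if b: "b \<in> Basis" for b x
    unfolding ve
    by (rule extend_by_zero(2)[OF oS compact_Bl BS cg off dg[OF b] cg'[OF b]], assumption+)
      (rule extend_by_zero(3)[OF oS compact_Bl BS cg off dg[OF b] cg'[OF b]], assumption+)
  have du: "vs u differentiable (at x)" for x
  proof (cases "x \<in> S'")
    case True
    have "u differentiable (at (-1, x))"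
      using wf.u2 True by (simp add: numeral_2_eq_2 S'_def)
    moreover have "(\<lambda>x. (-1, x)) differentiable (at x)"
      unfolding differentiable_def by (auto intro!: exI derivative_eq_intros)
    ultimately have "(u \<circ> (\<lambda>x. (-1, x))) differentiable (at x)"
      by (intro differentiable_chain_at)
    then have "?g differentiable (at x)"
      by (intro differentiable_mult differentiable_xb) (simp add: o_def)
    then obtain D where "(?g has_derivative D) (at x)" by (auto simp: differentiable_def)
    then have "(vs u has_derivative D) (at x)"
      by (rule has_derivative_transform_within_open[OF _ oS True]) (use off in \<open>auto simp: vs_def\<close>)
    then show ?thesis by (auto simp: differentiable_def)
  next
    case False
    then have x: "x \<in> - Bl m4" using BS by auto
    have "((\<lambda>x. 0) has_derivative (\<lambda>h. 0)) (at x)" by simp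
    then have "(vs u has_derivative (\<lambda>h. 0)) (at x)"
      by (rule has_derivative_transform_within_open[where s = "- Bl m4"])
        (use x compact_imp_closed[OF compact_Bl] in \<open>auto simp: vs_def\<close>)
    then show ?thesis by (auto simp: differentiable_def)
  qed
  have pv: "pd b (vs u) x = (if x \<in> Bl m4 then ?g' b x else 0)" if b: "b \<in> Basis" for b x
    using DERIV_unique[OF differentiable_has_ddv[OF du, where z = x and b = b] ext(1)[OF b]] .
  show sm: "smooth_fun (vs u)"
  proof
    show "vs u differentiable (at x)" for x by (rule du)
    show "continuous_on UNIV (pd b (vs u))" if "b \<in> Basis" for b
      using ext(2)[OF that] by (rule continuous_on_eq) (simp add: pv[OF that])
  qed
  show "smooth_fun.gr (vs u) x \<le> (if x \<in> Bl m4 then 2 * ((xb x)\<^sup>2 * (\<Sum>i\<in>Basis. (pd (0, i) u (-1, x))\<^sup>2)) + 2 * (gx (-1, x) * (u (-1, x))\<^sup>2) else 0)"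
  proof -
    have gr: "smooth_fun.gr (vs u) x = (\<Sum>b\<in>Basis. (if x \<in> Bl m4 then ?g' b x else 0)\<^sup>2)"
      unfolding smooth_fun.gr_def[OF sm] by (intro sum.cong refl) (simp add: pv)
    show ?thesis
    proof (cases "x \<in> Bl m4")
      case True
      have two: "(a + b)\<^sup>2 \<le> 2 * b\<^sup>2 + 2 * a\<^sup>2" for a b :: real
        using sum_squares_bound[of a b] by (simp add: power2_sum)
      have "smooth_fun.gr (vs u) x \<le> (\<Sum>i\<in>Basis. 2 * (xb x * pd (0, i) u (-1, x))\<^sup>2 + 2 * (dd (0, i) (\<lambda>z. 1 - cone_cutoff m3 m4 z) (-1, x) * u (-1, x))\<^sup>2)"
        unfolding gr using True by (simp only: if_True) (intro sum_mono two)
      also have "\<dots> = 2 * ((xb x)\<^sup>2 * (\<Sum>i\<in>Basis. (pd (0, i) u (-1, x))\<^sup>2)) + 2 * (gx (-1, x) * (u (-1, x))\<^sup>2)"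
        by (simp add: gx_def sum.distrib sum_distrib_left sum_distrib_right power_mult_distrib)
      finally show ?thesis using True by simp
    qed (simp add: gr)
  qed
qed

text \<open>The energy contains the potential with the wrong sign; by Gagliardo--Nirenberg the potential is at most a small
  multiple of the gradient term, since the smallness of \<open>D\<close> makes \<open>\<integral> \<bar>u\<bar>\<^sup>r\<close> small, and is absorbed.\<close>

lemma unit_estimate:
  "\<exists>\<nu>>0. \<exists>D0>0. \<exists>C\<ge>0. \<forall>u V D. sol u V \<longrightarrow> (\<forall>z\<in>S. \<forall>b\<in>Basis. \<bar>pd b V z\<bar> \<le> \<nu>) \<longrightarrow> 0 < D \<longrightarrow> D \<le> D0 \<longrightarrow>
    (LINT z:K15|lborel. Qu u z) \<le> D \<longrightarrow> (LINT x:Bl m4 \<inter> {x. m2 \<le> (norm x)\<^sup>2}|lborel. Qu u (-1, x)) \<le> D \<longrightarrow>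
    (LINT x:Bl m2|lborel. Qu u (-1, x)) \<le> C * D"
proof -
  let ?n = "real DIM(real^'n)"
  let ?An = "Bl m4 \<inter> {x. m2 \<le> (norm x)\<^sup>2} :: (real^'n) set"
  have cAn: "compact ?An" by (intro compact_Int_closed compact_Bl closed_Collect_le continuous_intros)
  obtain \<nu> C1 where \<nu>: "\<nu> > 0" "\<nu> \<le> 1" "C1 \<ge> 0" "\<And>u V. sol u V \<Longrightarrow> (\<forall>z\<in>S. \<forall>b\<in>Basis. \<bar>pd b V z\<bar> \<le> \<nu>) \<Longrightarrow>
    (LINT z:Sl m4|lborel. Qu u z + W u z) \<le> C1 * (LINT z:K15|lborel. Qu u z)"
    using slab_estimate by blast
  obtain ME where ME: "ME > 0" "\<And>u V. sol u V \<Longrightarrow> (\<forall>z\<in>S. \<forall>b\<in>Basis. \<bar>pd b V z\<bar> \<le> 1) \<Longrightarrow>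
    (LINT x:Bl m4|lborel. xa x * ((\<Sum>b\<in>Basis. (pd b u (-1, x))\<^sup>2) / 2 - V (-1, x) * W u (-1, x) / (p + 1)))
      \<le> ME * (LINT z:Sl m4|lborel. Qu u z + W u z)"
    using energy_bound[of m2 m3] m unfolding xa_def by auto
  define SB where "SB l l' M \<longleftrightarrow> (\<forall>u V h h' c. sol u V \<longrightarrow> 0 \<le> c \<longrightarrow> continuous_on S h \<longrightarrow> continuous_on S h' \<longrightarrow>
    (\<forall>z\<in>S. has_ddv h (1, 0) z (h' z)) \<longrightarrow> (\<forall>z\<in>S. \<bar>h z\<bar> \<le> c * (Qu u z + W u z)) \<longrightarrow>
    (\<forall>z\<in>S. \<bar>h' z\<bar> \<le> c * (Qu u z + W u z)) \<longrightarrow>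
    (LINT x:Bl m4|lborel. (1 - cone_cutoff l l' (-1, x)) * h (-1, x)) \<le> c * M * (LINT z:Sl m4|lborel. Qu u z + W u z))" for l l' M
  obtain Ma where Ma: "Ma > 0" "SB m2 m3 Ma"
    using slice_function_bound[of m2 m3] m unfolding SB_def by auto
  obtain Mb where Mb: "Mb > 0" "SB m3 m4 Mb"
    using slice_function_bound[of m3 m4] m unfolding SB_def by auto
  obtain Mg where Mg: "Mg > 0" "\<And>x. x \<in> Bl m4 \<Longrightarrow> \<bar>gx (-1, x)\<bar> \<le> Mg"
    by (rule compact_bound[OF compact_Bl cont_slice[OF cont_gx]]) blast
  \<comment> \<open>The largest exponent that \<open>slice_function_bound\<close> can handle: the
    time derivative of \<open>\<bar>u z\<bar> powr r\<close> is a multiple of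
    \<open>\<bar>u z\<bar> powr ((p + 1) / 2)\<close> times the time derivative of \<open>u\<close>,
    a product dominated by \<open>W u z + Q z\<close>.\<close>
  define r where "r = (p + 3) / 2"
  have r: "2 < r" "r \<le> p + 1" "0 < r" using p by (auto simp: r_def)
  have n1: "1 \<le> ?n" by (simp add: Suc_le_eq)
  \<comment> \<open>Equivalent to \<open>(p - 1) * (?n - 1) < 4\<close>, that is, to
    \<open>p_sub\<close>; a smaller \<open>r\<close> would lose part of the range of
    \<open>p\<close>.\<close>
  have q_ok: "p + 1 < 2 + 2 * r / ?n"
  proof -
    have "(p - 1) * (?n - 1) < 4" using p_sub by simp
    then have "(p - 1) * ?n < p + 3" by (simp add: algebra_simps)
    then have "p - 1 < (p + 3) / ?n" using n1 by (simp add: field_simps)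
    moreover have "2 * r / ?n = (p + 3) / ?n" by (simp only: r_def)
    ultimately show ?thesis by linarith
  qed
  define CG where "CG = 8 * ?n * 2 powr (p + 1) * (2 powr (r + 1)) powr (2 / ?n) / (1 - 2 powr ((p + 1) - 2 - 2 * r / ?n))"
  have CG: "0 \<le> CG"
  proof -
    have "(2::real) powr ((p + 1) - 2 - 2 * r / ?n) \<le> 2 powr 0" using q_ok by (intro powr_mono) auto
    then show ?thesis unfolding CG_def by simp
  qed
  define V1 where "V1 = \<bar>Mv\<bar>"
  \<comment> \<open>The summand 1 makes \<open>A = CA * D\<close> positive, as
    \<open>gagliardo_nirenberg\<close> requires.\<close>
  define CA where "CA = r * Mb * C1 + 1"
  have CA: "0 < CA" unfolding CA_def using r Mb(1) \<nu>(3) by (intro add_nonneg_pos mult_nonneg_nonneg) auto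
  \<comment> \<open>Chosen so that \<open>V1 * CG * s \<le> 1 / 8\<close>; the summand 8 keeps the
    denominator positive. The threshold \<open>D0\<close> then ensures
    \<open>A powr (2 / ?n) \<le> s\<close>.\<close>
  define s where "s = 1 / (8 * V1 * CG + 8)"
  have s: "0 < s" unfolding s_def V1_def using CG by (intro divide_pos_pos add_nonneg_pos mult_nonneg_nonneg) auto
  define D0 where "D0 = s powr (?n / 2) / CA"
  have D0: "0 < D0" unfolding D0_def using s CA by simp
  define C2 where "C2 = 2 * (2 * ME * C1 + 2 * V1 * CA + (2 + 2 * Mg)) + 4 * Ma * C1"
  have C2: "0 \<le> C2" unfolding C2_def V1_def using ME(1) \<nu>(3) CA Mg(1) Ma(1) by (intro add_nonneg_nonneg mult_nonneg_nonneg) auto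
  show ?thesis
  proof (rule exI[of _ \<nu>], intro conjI \<nu>, rule exI[of _ D0], intro conjI D0, rule exI[of _ C2], intro conjI C2 allI impI)
    fix u V D
    assume so: "sol u V" and dV: "\<forall>z\<in>S. \<forall>b\<in>Basis. \<bar>pd b V z\<bar> \<le> \<nu>" and D: "0 < D" "D \<le> D0"
      and D15: "(LINT z:K15|lborel. Qu u z) \<le> D" and DAn: "(LINT x:?An|lborel. Qu u (-1, x)) \<le> D"
    interpret wf: wave_fun S sgm p u V using so by (simp add: sol_def)
    interpret sv: smooth_fun "vs u" by (rule smooth_vs(1)[OF so])
    have ww: "wf.w = W u" by (auto simp: wf.w_def W_def fun_eq_iff)
    have W0: "0 \<le> W u z" for z by (simp add: W_def)
    define I where "I = (LINT z:Sl m4|lborel. Qu u z + W u z)"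
    have "I \<le> C1 * (LINT z:K15|lborel. Qu u z)" unfolding I_def by (rule \<nu>(4)[OF so dV])
    also have "\<dots> \<le> C1 * D" by (rule mult_left_mono[OF D15 \<nu>(3)])
    finally have I: "I \<le> C1 * D" .
    have dV1: "\<forall>z\<in>S. \<forall>b\<in>Basis. \<bar>pd b V z\<bar> \<le> 1" using dV \<nu>(2) by force
    let ?P = "\<lambda>x. \<Sum>b\<in>Basis. (pd b u (-1, x))\<^sup>2"
    have cP: "continuous_on (Bl m4) ?P" by (intro continuous_on_sum continuous_on_power cont_slice[OF wf.cont(2)])
    have cu: "continuous_on (Bl m4) (\<lambda>x. u (-1, x))" by (rule cont_slice[OF wf.cont(1)])
    have cQ: "continuous_on (Bl m4) (\<lambda>x. wf.Q (-1, x))" by (rule cont_slice[OF wf.cont_Q])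
    have cU: "continuous_on (Bl m4) (\<lambda>x. wf.U (-1, x))" by (rule cont_slice[OF wf.cont_U])
    have cg: "continuous_on (Bl m4) (\<lambda>x. gx (-1, x))" by (rule cont_slice[OF cont_gx])
    have P0: "0 \<le> ?P x" for x by (simp add: sum_nonneg)
    have PQ: "?P x \<le> wf.Q (-1, x)" for x by (simp add: wf.Q_def)
    have inS: "(-1, x) \<in> S" if "x \<in> Bl m4" for x using slice_in_S[of m4 x] that m by simp
    define Y where "Y = (LINT x:Bl m4|lborel. xa x * ?P x)"
    define A where "A = CA * D"
    have A0: "0 < A" unfolding A_def using CA D by simp
    define NV where "NV = (LINT x:Bl m4|lborel. \<bar>xb x * u (-1, x)\<bar> powr (p + 1))"
    have cvp: "continuous_on (Bl m4) (\<lambda>x. \<bar>xb x * u (-1, x)\<bar> powr t)" if "0 < t" for t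
      by (rule continuous_on_abs_powr[OF continuous_on_mult[OF cont_xb cu] that])
    have nnv: "(\<integral>\<^sup>+x. ennreal (\<bar>vs u x\<bar> powr t) \<partial>lborel) = ennreal (LINT x:Bl m4|lborel. \<bar>xb x * u (-1, x)\<bar> powr t)" if t: "0 < t" for t
    proof -
      have "(\<integral>\<^sup>+x. ennreal (\<bar>vs u x\<bar> powr t) \<partial>lborel) = (\<integral>\<^sup>+x. ennreal (if x \<in> Bl m4 then \<bar>xb x * u (-1, x)\<bar> powr t else 0) \<partial>lborel)"
        by (intro nn_integral_cong) (simp add: vs_def)
      also have "\<dots> = ennreal (LINT x:Bl m4|lborel. \<bar>xb x * u (-1, x)\<bar> powr t)"
        by (rule nn_integral_compact[OF compact_Bl cvp[OF t]]) simp
      finally show ?thesis .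
    qed
    have powr_split: "\<bar>a\<bar> powr t \<le> a\<^sup>2 + \<bar>a\<bar> powr (p + 1)" if "2 \<le> t" "t \<le> p + 1" for a t :: real
    proof (cases "\<bar>a\<bar> \<le> 1")
      case True
      have "\<bar>a\<bar> powr t \<le> \<bar>a\<bar> powr 2" using True that by (intro powr_mono') auto
      also have "\<bar>a\<bar> powr 2 = a\<^sup>2" by (simp add: powr_numeral)
      finally show ?thesis by (simp add: add_increasing2)
    next
      case False
      then have "\<bar>a\<bar> powr t \<le> \<bar>a\<bar> powr (p + 1)" using that by (intro powr_mono) auto
      then show ?thesis by (simp add: add_increasing)
    qed
    have Ar: "(LINT x:Bl m4|lborel. \<bar>xb x * u (-1, x)\<bar> powr r) \<le> A"
    proof -
      have "(LINT x:Bl m4|lborel. \<bar>xb x * u (-1, x)\<bar> powr r) \<le> (LINT x:Bl m4|lborel. (1 - cone_cutoff m3 m4 (-1, x)) * \<bar>u (-1, x)\<bar> powr r)"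
        unfolding xb_def[symmetric]
      proof (rule int_mono[OF compact_Bl cvp[OF r(3)]])
        show "continuous_on (Bl m4) (\<lambda>x. xb x * \<bar>u (-1, x)\<bar> powr r)"
          by (intro continuous_on_mult cont_xb continuous_on_abs_powr[OF cu r(3)])
        show "\<bar>xb x * u (-1, x)\<bar> powr r \<le> xb x * \<bar>u (-1, x)\<bar> powr r" for x
        proof -
          have "\<bar>xb x * u (-1, x)\<bar> powr r = xb x powr r * \<bar>u (-1, x)\<bar> powr r"
            using xab_bounds(1)[of x] by (simp add: abs_mult powr_mult)
          also have "xb x powr r \<le> xb x powr 1" using xab_bounds(1,2)[of x] r by (intro powr_mono') auto
          also have "xb x powr 1 = xb x" using xab_bounds(1)[of x] by simp
          finally show ?thesis by (simp add: mult_right_mono)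
        qed
      qed
      also have "\<dots> \<le> r * Mb * I"
        unfolding I_def
      proof (rule Mb(2)[unfolded SB_def, rule_format, OF so])
        show "0 \<le> r" using r by simp
        show "continuous_on S (\<lambda>z. \<bar>u z\<bar> powr r)" by (rule continuous_on_abs_powr[OF wf.cont(1) r(3)])
        show "continuous_on S (\<lambda>z. r * (\<bar>u z\<bar> powr (r - 2) * u z) * pd (1, 0) u z)"
          using r by (intro continuous_on_mult continuous_on_const continuous_on_abs_powr wf.cont time_Basis) auto
        show "has_ddv (\<lambda>z. \<bar>u z\<bar> powr r) (1, 0) z (r * (\<bar>u z\<bar> powr (r - 2) * u z) * pd (1, 0) u z)" if "z \<in> S" for z
          by (rule wf.ddv_powr[OF that]) (use r in simp)
        show "\<bar>\<bar>u z\<bar> powr r\<bar> \<le> r * (Qu u z + W u z)" for z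
        proof -
          have "\<bar>u z\<bar> powr r \<le> 1 * (wf.Q z + W u z)"
            using powr_split[of r "u z"] r wf.Q_ge(2)[of z] by (simp add: W_def)
          also have "\<dots> \<le> r * (wf.Q z + W u z)" using r wf.Q_ge(3)[of z] W0[of z] by (intro mult_right_mono) auto
          finally show ?thesis by simp
        qed
        show "\<bar>r * (\<bar>u z\<bar> powr (r - 2) * u z) * pd (1, 0) u z\<bar> \<le> r * (Qu u z + W u z)" for z
        proof -
          have e: "\<bar>\<bar>u z\<bar> powr (r - 2) * u z\<bar> = \<bar>u z\<bar> powr ((p + 1) / 2)"
          proof -
            have "\<bar>u z\<bar> powr (r - 2) * \<bar>u z\<bar> = \<bar>u z\<bar> powr (r - 2) * \<bar>u z\<bar> powr 1" by simp
            also have "\<dots> = \<bar>u z\<bar> powr (r - 2 + 1)" by (rule powr_add[symmetric])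
            also have "r - 2 + 1 = (p + 1) / 2" by (simp add: r_def field_simps)
            finally show ?thesis by (simp add: abs_mult)
          qed
          have sq: "(\<bar>u z\<bar> powr ((p + 1) / 2))\<^sup>2 = W u z"
            by (simp add: W_def power2_eq_square powr_add[symmetric])
          have am: "\<bar>r * B * d\<bar> = r * (\<bar>B\<bar> * \<bar>d\<bar>)" for B d :: real using r by (simp add: abs_mult)
          have "\<bar>r * (\<bar>u z\<bar> powr (r - 2) * u z) * pd (1, 0) u z\<bar> = r * (\<bar>u z\<bar> powr ((p + 1) / 2) * \<bar>pd (1, 0) u z\<bar>)"
            unfolding am e ..
          also have "\<bar>u z\<bar> powr ((p + 1) / 2) * \<bar>pd (1, 0) u z\<bar> \<le> wf.Q z + W u z"
          proof -
            have b: "2 * (a * b) \<le> a\<^sup>2 + b\<^sup>2" for a b :: real using sum_squares_bound[of a b] by simp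
            have nn: "0 \<le> \<bar>u z\<bar> powr ((p + 1) / 2) * \<bar>pd (1, 0) u z\<bar>" by simp
            have "2 * (\<bar>u z\<bar> powr ((p + 1) / 2) * \<bar>pd (1, 0) u z\<bar>) \<le> (\<bar>u z\<bar> powr ((p + 1) / 2))\<^sup>2 + (\<bar>pd (1, 0) u z\<bar>)\<^sup>2"
              by (rule b)
            also have "\<dots> \<le> W u z + wf.Q z" using sq wf.Q_ge(1)[OF time_Basis, of z] by simp
            finally show ?thesis using nn by linarith
          qed
          finally show ?thesis using r by simp
        qed
      qed
      also have "\<dots> \<le> r * Mb * (C1 * D)" using I r Mb(1) by (intro mult_left_mono) auto
      also have "\<dots> \<le> A" unfolding A_def CA_def using D by (simp add: algebra_simps)
      finally show ?thesis .
    qed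
    have u2: "(LINT x:Bl m4|lborel. xa x * (u (-1, x))\<^sup>2) \<le> 2 * Ma * I"
      unfolding I_def xa_def
    proof (rule Ma(2)[unfolded SB_def, rule_format, OF so])
      show "continuous_on S (\<lambda>z. (u z)\<^sup>2)" by (intro continuous_on_power wf.cont)
      show "continuous_on S (\<lambda>z. 2 * (u z * pd (1, 0) u z))"
        by (intro continuous_on_mult continuous_on_const wf.cont time_Basis)
      show "has_ddv (\<lambda>z. (u z)\<^sup>2) (1, 0) z (2 * (u z * pd (1, 0) u z))" if "z \<in> S" for z
        by (rule DERIV_cong[OF DERIV_power[OF wf.ddv(1)[OF that], where n = 2]]) (simp add: zero_prod_def[symmetric])
      show "\<bar>(u z)\<^sup>2\<bar> \<le> 2 * (Qu u z + W u z)" for z using wf.Q_ge(2,3)[of z] W0[of z] by simp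
      show "\<bar>2 * (u z * pd (1, 0) u z)\<bar> \<le> 2 * (Qu u z + W u z)" for z
        using wf.Q_ge_prod(2)[OF time_Basis, of z] W0[of z] by simp
    qed simp
    \<comment> \<open>Bound for the squared gradient of \<open>vs u\<close>: where
      \<open>(norm x)\<^sup>2 < m2\<close> the cutoff \<open>xa\<close> is 1 and \<open>Y\<close>
      controls it, elsewhere the annulus hypothesis does.\<close>
    define GG where "GG = 2 * Y + (2 + 2 * Mg) * D"
    have Y0: "0 \<le> Y" unfolding Y_def using xab_bounds P0 by (intro int_nonneg mult_nonneg_nonneg)
    have GG0: "0 \<le> GG" unfolding GG_def using Y0 D Mg(1) by simp
    have cgr: "continuous_on (Bl m4) (\<lambda>x. 2 * ((xb x)\<^sup>2 * (\<Sum>i\<in>Basis. (pd (0, i) u (-1, x))\<^sup>2)) + 2 * (gx (-1, x) * (u (-1, x))\<^sup>2))"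
      by (intro continuous_on_add continuous_on_mult continuous_on_const continuous_on_power continuous_on_sum cont_xb cg cu cont_slice[OF wf.cont(2)] sp_Basis)
    have gx0: "0 \<le> gx z" for z by (simp add: gx_def sum_nonneg)
    have "(LINT x:Bl m4|lborel. 2 * ((xb x)\<^sup>2 * (\<Sum>i\<in>Basis. (pd (0, i) u (-1, x))\<^sup>2)) + 2 * (gx (-1, x) * (u (-1, x))\<^sup>2))
        \<le> (LINT x:Bl m4|lborel. 2 * (xa x * ?P x)) + (LINT x:?An|lborel. (2 + 2 * Mg) * wf.Q (-1, x))"
    proof (rule int_le_add[OF compact_Bl cgr compact_Bl _ cAn])
      show "continuous_on (Bl m4) (\<lambda>x. 2 * (xa x * ?P x))" by (intro continuous_on_mult continuous_on_const cont_xa cP)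
      show "continuous_on ?An (\<lambda>x. (2 + 2 * Mg) * wf.Q (-1, x))"
        by (rule continuous_on_mult[OF continuous_on_const continuous_on_subset[OF cQ]]) simp
      fix x
      show "indicator (Bl m4) x * (2 * ((xb x)\<^sup>2 * (\<Sum>i\<in>Basis. (pd (0, i) u (-1, x))\<^sup>2)) + 2 * (gx (-1, x) * (u (-1, x))\<^sup>2))
         \<le> indicator (Bl m4) x * (2 * (xa x * ?P x)) + indicator ?An x * ((2 + 2 * Mg) * wf.Q (-1, x))"
      proof (cases "x \<in> Bl m4")
        case True
        have sP: "(\<Sum>i\<in>Basis. (pd (0, i) u (-1, x))\<^sup>2) \<le> ?P x" "0 \<le> (\<Sum>i\<in>Basis. (pd (0, i) u (-1, x))\<^sup>2)"
          unfolding sum_Basis_spacetime by (auto simp: sum_nonneg)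
        show ?thesis
        proof (cases "(norm x)\<^sup>2 < m2")
          case t: True
          have "gx (-1, x) = 0" by (rule gx_zero[OF inS[OF True]]) (use t m in \<open>auto simp: rat_slice\<close>)
          moreover have "xb x = 1" "xa x = 1" using t m by (auto intro!: xab_bounds)
          ultimately show ?thesis using True t sP by (auto simp: indicator_def)
        next
          case f: False
          have "(xb x)\<^sup>2 * (\<Sum>i\<in>Basis. (pd (0, i) u (-1, x))\<^sup>2) \<le> 1 * wf.Q (-1, x)"
            using xab_bounds(1,2)[of x] sP PQ[of x] wf.Q_ge(3)[of "(-1,x)"] by (intro mult_mono) (auto simp: power_le_one)
          moreover have "gx (-1, x) * (u (-1, x))\<^sup>2 \<le> Mg * wf.Q (-1, x)"
            using Mg(2)[OF True] gx0 wf.Q_ge(2,3)[of "(-1,x)"] Mg(1) by (intro mult_mono) auto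
          moreover have "0 \<le> xa x * ?P x" by (intro mult_nonneg_nonneg xab_bounds P0)
          ultimately show ?thesis using True f by (simp add: algebra_simps)
        qed
      qed simp
    qed
    also have "\<dots> \<le> GG"
      unfolding int_cmult Y_def[symmetric] GG_def using DAn Mg(1) by (intro add_mono mult_left_mono) auto
    finally have grI: "(LINT x:Bl m4|lborel. 2 * ((xb x)\<^sup>2 * (\<Sum>i\<in>Basis. (pd (0, i) u (-1, x))\<^sup>2)) + 2 * (gx (-1, x) * (u (-1, x))\<^sup>2)) \<le> GG" .
    have "(\<integral>\<^sup>+x. ennreal (sv.gr x) \<partial>lborel) \<le> (\<integral>\<^sup>+x. ennreal (if x \<in> Bl m4 then 2 * ((xb x)\<^sup>2 * (\<Sum>i\<in>Basis. (pd (0, i) u (-1, x))\<^sup>2)) + 2 * (gx (-1, x) * (u (-1, x))\<^sup>2) else 0) \<partial>lborel)"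
      by (intro nn_integral_mono ennreal_leI smooth_vs(2)[OF so])
    also have "\<dots> = ennreal (LINT x:Bl m4|lborel. 2 * ((xb x)\<^sup>2 * (\<Sum>i\<in>Basis. (pd (0, i) u (-1, x))\<^sup>2)) + 2 * (gx (-1, x) * (u (-1, x))\<^sup>2))"
      by (rule nn_integral_compact[OF compact_Bl cgr]) (auto intro!: add_nonneg_nonneg mult_nonneg_nonneg sum_nonneg gx0)
    also have "\<dots> \<le> ennreal GG" by (rule ennreal_leI[OF grI])
    finally have nG: "(\<integral>\<^sup>+x. ennreal (sv.gr x) \<partial>lborel) \<le> ennreal GG" .
    have nA: "(\<integral>\<^sup>+x. ennreal (\<bar>vs u x\<bar> powr r) \<partial>lborel) \<le> ennreal A"
      unfolding nnv[OF r(3)] by (rule ennreal_leI[OF Ar])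
    have "ennreal NV \<le> ennreal (A + CG * A powr (2 / ?n) * GG)"
      using sv.gagliardo_nirenberg[OF r(3) r(2) q_ok A0 GG0 nA nG] nnv[of "p + 1"] p
      unfolding NV_def CG_def by simp
    then have NV: "NV \<le> A + CG * A powr (2 / ?n) * GG"
      using A0 GG0 CG by (subst (asm) ennreal_le_iff) (auto intro!: add_nonneg_nonneg mult_nonneg_nonneg)
    \<comment> \<open>Since \<open>xb = 1\<close> on the support of \<open>xa\<close>, the potential
      part of the energy weighted by \<open>xa\<close> is at most \<open>V1 * NV\<close>.\<close>
    have "Y / 2 - V1 * NV \<le> (LINT x:Bl m4|lborel. xa x * (?P x / 2 - wf.U (-1, x)))"
    proof -
      have c1: "continuous_on (Bl m4) (\<lambda>x. 1 / 2 * (xa x * ?P x))" by (intro continuous_on_mult continuous_on_const cont_xa cP)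
      have c2: "continuous_on (Bl m4) (\<lambda>x. V1 * \<bar>xb x * u (-1, x)\<bar> powr (p + 1))"
        using cvp[of "p + 1"] p by (intro continuous_on_mult continuous_on_const) auto
      have "Y / 2 - V1 * NV = (LINT x:Bl m4|lborel. 1 / 2 * (xa x * ?P x) - V1 * \<bar>xb x * u (-1, x)\<bar> powr (p + 1))"
        unfolding int_diff[OF compact_Bl c1 c2] int_cmult Y_def NV_def by simp
      also have "\<dots> \<le> (LINT x:Bl m4|lborel. xa x * (?P x / 2 - wf.U (-1, x)))"
      proof (rule int_mono[OF compact_Bl continuous_on_diff[OF c1 c2]])
        show "continuous_on (Bl m4) (\<lambda>x. xa x * (?P x / 2 - wf.U (-1, x)))"
          by (intro continuous_on_mult continuous_on_diff continuous_on_divide continuous_on_const cont_xa cP cU) auto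
        fix x :: "real^'n" assume x: "x \<in> Bl m4"
        have "xa x * wf.U (-1, x) \<le> V1 * \<bar>xb x * u (-1, x)\<bar> powr (p + 1)"
        proof (cases "m3 \<le> (norm x)\<^sup>2")
          case True
          then show ?thesis by (simp add: xab_bounds V1_def)
        next
          case False
          then have b: "xb x = 1" by (intro xab_bounds) auto
          have V: "\<epsilon> \<le> V (-1, x)" "V (-1, x) \<le> Mv" using so inS[OF x] by (auto simp: sol_def)
          have "wf.U (-1, x) \<le> V1 * W u (-1, x)"
          proof -
            have "wf.U (-1, x) = V (-1, x) * (W u (-1, x) / (p + 1))" by (simp add: wf.U_def ww)
            also have "\<dots> \<le> V1 * (W u (-1, x) / 1)"
              using V \<epsilon> p W0 by (intro mult_mono divide_left_mono) (auto simp: V1_def)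
            finally show ?thesis by simp
          qed
          moreover have "0 \<le> wf.U (-1, x)" using V \<epsilon> p W0 by (simp add: wf.U_def ww)
          then have "xa x * wf.U (-1, x) \<le> wf.U (-1, x)" using xab_bounds(3,4)[of x] by (simp add: mult_left_le_one_le)
          ultimately show ?thesis by (simp add: b W_def)
        qed
        then show "1 / 2 * (xa x * ?P x) - V1 * \<bar>xb x * u (-1, x)\<bar> powr (p + 1) \<le> xa x * (?P x / 2 - wf.U (-1, x))"
          by (simp add: right_diff_distrib)
      qed
      finally show ?thesis .
    qed
    also have "\<dots> \<le> ME * I"
      using ME(2)[OF so dV1] unfolding I_def wf.U_def ww by simp
    also have "\<dots> \<le> ME * (C1 * D)" using I ME(1) by simp
    finally have E: "Y \<le> 2 * (ME * (C1 * D)) + 2 * (V1 * NV)" by simp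
    have As: "A powr (2 / ?n) \<le> s"
    proof -
      have "A \<le> CA * D0" unfolding A_def using D CA by simp
      also have "\<dots> = s powr (?n / 2)" unfolding D0_def using CA by simp
      finally have "A powr (2 / ?n) \<le> (s powr (?n / 2)) powr (2 / ?n)" using A0 by (intro powr_mono2) auto
      also have "\<dots> = s" using s n1 by (simp add: powr_powr)
      finally show ?thesis .
    qed
    have "V1 * NV \<le> V1 * (A + CG * A powr (2 / ?n) * GG)" using NV by (intro mult_left_mono) (auto simp: V1_def)
    also have "\<dots> \<le> V1 * A + (V1 * CG * s) * GG"
    proof -
      have "(V1 * CG * GG) * A powr (2 / ?n) \<le> (V1 * CG * GG) * s"
        using CG GG0 by (intro mult_left_mono As mult_nonneg_nonneg) (auto simp: V1_def)
      then show ?thesis by (simp add: algebra_simps)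
    qed
    also have "(V1 * CG * s) * GG \<le> 1 / 8 * GG"
    proof (rule mult_right_mono[OF _ GG0])
      have "0 \<le> V1 * CG" using CG by (simp add: V1_def)
      then show "V1 * CG * s \<le> 1 / 8" unfolding s_def by (simp add: field_simps)
    qed
    finally have "V1 * NV \<le> V1 * A + 1 / 8 * GG" by simp
    \<comment> \<open>\<open>GG\<close> contains \<open>2 * Y\<close>, so
      \<open>2 * (V1 * NV)\<close> returns at most \<open>1 / 2 * Y\<close>, which is absorbed on
      the left.\<close>
    then have "Y \<le> 2 * (ME * (C1 * D)) + 2 * (V1 * (CA * D)) + 1 / 2 * Y + 1 / 4 * ((2 + 2 * Mg) * D)"
      using E unfolding GG_def A_def by (simp add: algebra_simps)
    moreover have "0 \<le> (2 + 2 * Mg) * D" using Mg(1) D by simp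
    ultimately have Yb: "Y \<le> 2 * (2 * (ME * (C1 * D)) + 2 * (V1 * (CA * D)) + (2 + 2 * Mg) * D)" by (rule absorb_half)
    have "(LINT x:Bl m2|lborel. wf.Q (-1, x)) \<le> (LINT x:Bl m4|lborel. xa x * ?P x + xa x * (u (-1, x))\<^sup>2)"
    proof (rule int_le[OF compact_Bl _ compact_Bl])
      have sub: "Bl m2 \<subseteq> Bl m4" using m by (auto simp: Bl_def)
      show "continuous_on (Bl m2) (\<lambda>x. wf.Q (-1, x))" by (rule continuous_on_subset[OF cQ sub])
      show "continuous_on (Bl m4) (\<lambda>x. xa x * ?P x + xa x * (u (-1, x))\<^sup>2)"
        by (intro continuous_on_add continuous_on_mult continuous_on_power cont_xa cP cu)
      show "0 \<le> xa x * ?P x + xa x * (u (-1, x))\<^sup>2" for x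
        by (intro add_nonneg_nonneg mult_nonneg_nonneg xab_bounds P0) simp
      show "wf.Q (-1, x) \<le> xa x * ?P x + xa x * (u (-1, x))\<^sup>2" if "x \<in> Bl m2" for x
        using that xab_bounds(7)[of x] by (simp add: Bl_def wf.Q_def)
      show "wf.Q (-1, x) \<le> 0" if "x \<in> Bl m2" "x \<notin> Bl m4" for x using that sub by auto
    qed
    also have "\<dots> = Y + (LINT x:Bl m4|lborel. xa x * (u (-1, x))\<^sup>2)"
      unfolding Y_def by (rule int_add[OF compact_Bl]) (intro continuous_on_mult continuous_on_power cont_xa cP cu)+
    also have "\<dots> \<le> 2 * (2 * (ME * (C1 * D)) + 2 * (V1 * (CA * D)) + (2 + 2 * Mg) * D) + 2 * Ma * (C1 * D)"
      using Yb u2 mult_left_mono[OF I, of "2 * Ma"] Ma(1) by linarith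
    also have "\<dots> \<le> C2 * D"
    proof -
      have "0 \<le> 2 * Ma * (C1 * D)" using Ma(1) \<nu>(3) D by simp
      then show ?thesis unfolding C2_def by (simp add: algebra_simps)
    qed
    finally show "(LINT x:Bl m2|lborel. Qu u (-1, x)) \<le> C2 * D" .
  qed
qed

end

section \<open>Rescaling\<close>

lemma has_derivative_cong_open:
  assumes "open S" "z \<in> S" "\<And>y. y \<in> S \<Longrightarrow> f y = g y"
  shows "(f has_derivative D) (at z) \<longleftrightarrow> (g has_derivative D) (at z)"
  using has_derivative_transform_within_open[OF _ assms(1,2), of f D UNIV g]
    has_derivative_transform_within_open[OF _ assms(1,2), of g D UNIV f] assms(3) by auto

lemma pd_cong_open:
  assumes "open S" "z \<in> S" "\<And>y. y \<in> S \<Longrightarrow> f y = g y"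
  shows "pd b f z = pd b g z"
  unfolding pd_def frechet_derivative_def using has_derivative_cong_open[OF assms] by simp

lemma Ck_on_cong_open:
  assumes "open S" "\<And>y. y \<in> S \<Longrightarrow> f y = g y" "Ck_on k S f"
  shows "Ck_on k S g"
  using assms(2,3)
proof (induction k arbitrary: f g)
  case 0
  then show ?case by (auto cong: continuous_on_cong)
next
  case (Suc k)
  have "g differentiable (at z)" if z: "z \<in> S" for z
  proof -
    have "f differentiable (at z)" using Suc.prems(2) z by simp
    then obtain D where "(f has_derivative D) (at z)" unfolding differentiable_def by blast
    then have "(g has_derivative D) (at z)"
      using has_derivative_cong_open[of S z f g D, OF assms(1) z Suc.prems(1)] by simp
    then show ?thesis unfolding differentiable_def by blast
  qed
  moreover have "Ck_on k S (pd b g)" if "b \<in> Basis" for b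
  proof (rule Suc.IH)
    show "Ck_on k S (pd b f)" using Suc.prems(2) that by simp
    show "pd b f y = pd b g y" if "y \<in> S" for y
      by (rule pd_cong_open[OF assms(1) that]) (rule Suc.prems(1))
  qed
  ultimately show ?case by simp
qed

lemma scale_differentiable:
  fixes f :: "'a::euclidean_space \<Rightarrow> real"
  assumes "f differentiable (at (l *\<^sub>R z))"
  shows "(\<lambda>z. c * f (l *\<^sub>R z)) differentiable (at z)" "pd b (\<lambda>z. c * f (l *\<^sub>R z)) z = c * l * pd b f (l *\<^sub>R z)"
proof -
  let ?D = "frechet_derivative f (at (l *\<^sub>R z))"
  have D: "(f has_derivative ?D) (at (l *\<^sub>R z))" using assms frechet_derivative_works by blast
  have "((\<lambda>z. l *\<^sub>R z) has_derivative (\<lambda>h. l *\<^sub>R h)) (at z)" by (auto intro!: derivative_eq_intros)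
  from has_derivative_compose[OF this D]
  have 1: "((\<lambda>z. c * f (l *\<^sub>R z)) has_derivative (\<lambda>h. c * ?D (l *\<^sub>R h))) (at z)"
    by (rule has_derivative_mult_right)
  then show "(\<lambda>z. c * f (l *\<^sub>R z)) differentiable (at z)" by (auto simp: differentiable_def)
  have "pd b (\<lambda>z. c * f (l *\<^sub>R z)) z = c * ?D (l *\<^sub>R b)"
    unfolding pd_def using frechet_derivative_at[OF 1] by metis
  also have "\<dots> = c * l * pd b f (l *\<^sub>R z)"
    using has_derivative_linear[OF D] by (simp add: linear_scale pd_def)
  finally show "pd b (\<lambda>z. c * f (l *\<^sub>R z)) z = c * l * pd b f (l *\<^sub>R z)" .
qed

text \<open>The induction runs over all \<open>c\<close>, since each derivative produces a further
  factor \<open>l\<close>.\<close>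

lemma Ck_on_scale:
  fixes f :: "'a::euclidean_space \<Rightarrow> real"
  assumes "open S" "\<And>z. z \<in> S \<Longrightarrow> l *\<^sub>R z \<in> T" "Ck_on k T f"
  shows "Ck_on k S (\<lambda>z. c * f (l *\<^sub>R z))"
  using assms(3)
proof (induction k arbitrary: f c)
  case 0
  then have "continuous_on S (\<lambda>z. f (l *\<^sub>R z))"
    by (intro continuous_on_compose2[of T f S] continuous_intros) (use assms(2) in auto)
  then show ?case by (auto intro!: continuous_intros)
next
  case (Suc k)
  have "(\<lambda>z. c * f (l *\<^sub>R z)) differentiable (at z)" if "z \<in> S" for z
    by (rule scale_differentiable) (use Suc.prems assms(2) that in auto)
  moreover have "Ck_on k S (pd b (\<lambda>z. c * f (l *\<^sub>R z)))" if "b \<in> Basis" for b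
  proof (rule Ck_on_cong_open[OF assms(1)])
    show "Ck_on k S (\<lambda>z. (c * l) * pd b f (l *\<^sub>R z))"
      by (rule Suc.IH) (use Suc.prems that in auto)
    show "c * l * pd b f (l *\<^sub>R y) = pd b (\<lambda>z. c * f (l *\<^sub>R z)) y" if "y \<in> S" for y
      by (rule scale_differentiable(2)[symmetric]) (use Suc.prems assms(2) that in auto)
  qed
  ultimately show ?case by simp
qed

lemma sum_Basis_vec: "(\<Sum>b\<in>Basis. g b) = (\<Sum>i\<in>UNIV. g (axis i 1))"
  for g :: "real^'n::finite \<Rightarrow> real"
proof -
  have "(Basis :: (real^'n) set) = (\<lambda>i. axis i 1) ` UNIV" by (auto simp: Basis_vec_def)
  then have "sum g Basis = sum g ((\<lambda>i. axis i 1) ` UNIV)" by (simp only:)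
  then show ?thesis by (subst (asm) sum.reindex) (auto simp: inj_on_def axis_eq_axis)
qed

lemma grad_sq_Basis: "grad_sq f z = (\<Sum>b\<in>Basis. (pd b f z)\<^sup>2)"
  by (simp add: grad_sq_def sum_Basis_spacetime sum_Basis_vec dt_def dx_def)

lemma wave_op_Basis: "wave_op f z = (\<Sum>b\<in>Basis. sgm b * pd b (pd b f) z)"
  by (simp add: wave_op_def sum_Basis_spacetime sum_Basis_vec dt_def dx_def sgm_def)

lemma nn_integral_lborel_scale:
  fixes g :: "'a::euclidean_space \<Rightarrow> ennreal"
  assumes [measurable]: "g \<in> borel_measurable borel" and l: "0 < l"
  shows "(\<integral>\<^sup>+x. g (l *\<^sub>R x) \<partial>lborel) = ennreal (l powr (- real DIM('a))) * (\<integral>\<^sup>+x. g x \<partial>lborel)"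
proof -
  have "(\<integral>\<^sup>+x. g x \<partial>lborel) = (\<integral>\<^sup>+x. g x \<partial>density (distr lborel borel (\<lambda>x. 0 + l *\<^sub>R x)) (\<lambda>_. \<bar>l\<bar> ^ DIM('a)))"
    using lborel_affine[of l "0::'a"] l by simp
  also have "\<dots> = ennreal (l ^ DIM('a)) * (\<integral>\<^sup>+x. g (l *\<^sub>R x) \<partial>lborel)"
    using l by (simp add: nn_integral_density nn_integral_distr nn_integral_cmult)
  finally have "ennreal (l powr (- real DIM('a))) * (\<integral>\<^sup>+x. g x \<partial>lborel) =
      (ennreal (l powr (- real DIM('a))) * ennreal (l ^ DIM('a))) * (\<integral>\<^sup>+x. g (l *\<^sub>R x) \<partial>lborel)"
    by (simp only: mult.assoc)
  also have "ennreal (l powr (- real DIM('a))) * ennreal (l ^ DIM('a)) = 1"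
    using l by (simp add: ennreal_mult[symmetric] powr_realpow[symmetric] powr_add[symmetric])
  finally show ?thesis by simp
qed

lemma nn_integral_lincomb:
  fixes a b :: ennreal
  assumes [measurable]: "f \<in> borel_measurable M" "g \<in> borel_measurable M"
  shows "(\<integral>\<^sup>+x. a * f x + b * g x \<partial>M) = a * (\<integral>\<^sup>+x. f x \<partial>M) + b * (\<integral>\<^sup>+x. g x \<partial>M)"
  by (simp add: nn_integral_add nn_integral_cmult)

lemma measurable_slice:
  fixes f :: "'a::euclidean_space \<Rightarrow> real"
  assumes "open A" "continuous_on A f"
  shows "(\<lambda>x. ennreal (f x) * indicator A x) \<in> borel_measurable borel"
proof -
  have [measurable]: "(\<lambda>x. indicator A x *\<^sub>R f x) \<in> borel_measurable borel"
    using assms by (intro borel_measurable_continuous_on_indicator) auto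
  have "(\<lambda>x. ennreal (indicator A x *\<^sub>R f x)) \<in> borel_measurable borel" by measurable
  moreover have "(\<lambda>x. ennreal (indicator A x *\<^sub>R f x)) = (\<lambda>x. ennreal (f x) * indicator A x)"
    by (auto simp: indicator_def)
  ultimately show ?thesis by simp
qed

section \<open>The estimate in the original variables\<close>

definition annulus_energy :: "real \<Rightarrow> real \<Rightarrow> real \<Rightarrow> ('n::finite spacetime \<Rightarrow> real) \<Rightarrow> real \<Rightarrow> ennreal" where
  "annulus_energy p \<sigma>0 \<sigma>1 \<phi> t =
     ennreal (\<bar>t\<bar> powr (2 - real CARD('n) + 4 / (p - 1))) *
       (\<integral>\<^sup>+x\<in>annulus \<sigma>0 \<sigma>1 t. ennreal (grad_sq \<phi> (t, x)) \<partial>lborel) +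
     ennreal (\<bar>t\<bar> powr (- real CARD('n) + 4 / (p - 1))) *
       (\<integral>\<^sup>+x\<in>annulus \<sigma>0 \<sigma>1 t. ennreal ((\<phi> (t, x))\<^sup>2) \<partial>lborel)"

definition core_energy :: "real \<Rightarrow> real \<Rightarrow> ('n::finite spacetime \<Rightarrow> real) \<Rightarrow> real \<Rightarrow> ennreal" where
  "core_energy p \<sigma>0 \<phi> t =
     ennreal (\<bar>t\<bar> powr (2 - real CARD('n) + 4 / (p - 1))) *
       (\<integral>\<^sup>+x\<in>{x. norm x < \<sigma>0 * \<bar>t\<bar>}. ennreal (grad_sq \<phi> (t, x) + \<bar>t\<bar> powr (-2) * (\<phi> (t, x))\<^sup>2) \<partial>lborel)"

lemma open_annulus: "open (annulus \<sigma>0 \<sigma>1 t :: (real^'n::finite) set)"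
  unfolding annulus_def by (intro open_Collect_conj open_Collect_less continuous_intros)

text \<open>The solution is rescaled so that time \<open>- l\<close> becomes -1, and
  \<open>unit_estimate\<close> is applied. All constants are independent of \<open>l\<close>;
  \<open>B\<close> records how far the region seen by the rescaled estimate reaches back in time.
  The bound is linear in \<open>\<delta>\<close>, so smallness of the annulus functional passes to
  the core.\<close>

lemma core_estimate:
  fixes \<phi> V :: "real \<times> (real^'n::finite) \<Rightarrow> real"
    and p \<sigma>0 \<sigma>1 \<epsilon> :: real
  assumes \<sigma>: "0 < \<sigma>0" "\<sigma>0 < \<sigma>1" "\<sigma>1 < 1"
    and p: "1 < p"
    and sub: "CARD('n) = 1 \<or> p < 1 + 4 / (real CARD('n) - 1)"
    and V: "C1_on_closure (tip_cone \<sigma>1) V"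
    and eps: "0 < \<epsilon>" "\<forall>z\<in>closure (tip_cone \<sigma>1). \<epsilon> \<le> V z"
    and sol: "C2_solution p V (tip_cone \<sigma>1) \<phi>"
  shows "\<exists>K\<ge>0. \<exists>\<delta>0>0. \<exists>l0>0. \<exists>B>0. \<forall>l \<delta>. 0 < l \<longrightarrow> l < l0 \<longrightarrow> 0 < \<delta> \<longrightarrow> \<delta> \<le> \<delta>0 \<longrightarrow>
    (\<forall>t. - (B * l) < t \<longrightarrow> t < 0 \<longrightarrow> annulus_energy p \<sigma>0 \<sigma>1 \<phi> t \<le> ennreal \<delta>) \<longrightarrow>
    core_energy p \<sigma>0 \<phi> (- l) \<le> ennreal (K * \<delta>)"
proof -
  let ?T = "tip_cone \<sigma>1 :: ('n spacetime) set"
  let ?n = "real CARD('n)"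
  \<comment> \<open>The levels \<open>m 1\<close> to \<open>m 5\<close> are equally spaced strictly
    between \<open>m 0 = \<sigma>0\<^sup>2\<close> and \<open>m 6 = \<sigma>1\<^sup>2\<close>. The
    gaps at both ends put the closed annular regions into the open annulus.\<close>
  define h where "h = (\<sigma>1\<^sup>2 - \<sigma>0\<^sup>2) / 6"
  have h: "0 < h" unfolding h_def using \<sigma> by (simp add: power_strict_mono)
  define m where "m i = \<sigma>0\<^sup>2 + real i * h" for i :: nat
  have m6: "m 6 = \<sigma>1\<^sup>2" by (simp add: m_def h_def field_simps)
  have m_less: "m i < m j" if "i < j" for i j using that h by (simp add: m_def)
  have s1: "\<sigma>1\<^sup>2 < 1" using \<sigma> by (simp add: power_less_one_iff abs_square_less_1)
  have m0: "0 < m 1" unfolding m_def using \<sigma> h by (intro add_pos_pos) auto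
  have m5: "m 5 < 1" using m_less[of 5 6] m6 s1 by simp
  have m0': "\<sigma>0\<^sup>2 < m i" if "0 < i" for i using m_less[OF that] by (simp add: m_def)
  have m6': "m i < \<sigma>1\<^sup>2" if "i < 6" for i using m_less[OF that] m6 by simp
  \<comment> \<open>The midpoint between \<open>sqrt (m 5)\<close> and 1;
    \<open>10 * \<theta>\<close> is its distance to either end, and \<open>\<beta>\<close> equals
    \<open>4 / (1 - \<rho>)\<close>, which exceeds \<open>4 / (1 - sqrt (m 5))\<close>.\<close>
  define \<rho> where "\<rho> = (sqrt (m 5) + 1) / 2"
  define \<theta> where "\<theta> = (1 - sqrt (m 5)) / 20"
  define \<beta> where "\<beta> = 8 / (1 - sqrt (m 5))"
  have q5: "0 < sqrt (m 5)" "sqrt (m 5) < 1" using m0 m_less[of 1 5] m5 by auto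
  have \<beta>8: "8 \<le> \<beta>" unfolding \<beta>_def using q5 by (simp add: field_simps)
  \<comment> \<open>Strictly larger than \<open>2 * \<beta>\<close>, so that the open set
    \<open>S\<close> contains the compact set \<open>Kbox 0 (m 5) (2 * \<beta>)\<close>.\<close>
  define B where "B = 2 * \<beta> + 1"
  have B: "0 < B" using \<beta>8 by (simp add: B_def)
  define S :: "('n spacetime) set" where "S = {z. - B < fst z \<and> fst z < 0 \<and> norm (snd z) < \<sigma>1 * \<bar>fst z\<bar>}"
  have oS: "open S" unfolding S_def by (intro open_Collect_conj open_Collect_less continuous_intros)
  have cT: "compact (closure ?T)"
  proof -
    have "bounded ?T"
      unfolding bounded_iff
    proof (intro exI ballI)
      fix z assume "z \<in> ?T"
      then have "norm (fst z) \<le> 1" "norm (snd z) \<le> 1"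
        using mult_mono[of \<sigma>1 1 "\<bar>fst z\<bar>" 1] \<sigma> by (auto simp: tip_cone_def)
      then show "norm z \<le> 1 + 1" using norm_Pair_le[of "fst z" "snd z"] by simp
    qed
    then show ?thesis by (simp add: compact_eq_bounded_closed bounded_closure)
  qed
  have cV: "continuous_on (closure ?T) V" using V unfolding C1_on_closure_def by blast
  obtain Mv where Mv: "Mv > 0" "\<And>z. z \<in> closure ?T \<Longrightarrow> \<bar>V z\<bar> \<le> Mv"
    by (rule compact_bound[OF cT cV]) blast
  have "\<exists>M>0. \<forall>z\<in>?T. \<bar>pd b V z\<bar> \<le> M" if b: "b \<in> Basis" for b
  proof -
    obtain g where g: "continuous_on (closure ?T) g" "\<forall>z\<in>?T. g z = pd b V z"
      using V b unfolding C1_on_closure_def by blast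
    obtain M where M: "M > 0" "\<And>z. z \<in> closure ?T \<Longrightarrow> \<bar>g z\<bar> \<le> M"
      by (rule compact_bound[OF cT g(1)]) blast
    have "\<forall>z\<in>?T. \<bar>pd b V z\<bar> \<le> M" using M(2) g(2) closure_subset[of ?T] by fastforce
    then show ?thesis using M(1) by blast
  qed
  then obtain Mb where Mb: "\<And>b. b \<in> Basis \<Longrightarrow> 0 < Mb b" "\<And>b z. b \<in> Basis \<Longrightarrow> z \<in> ?T \<Longrightarrow> \<bar>pd b V z\<bar> \<le> Mb b" by metis
  define Md where "Md = sum Mb Basis"
  have Md: "0 < Md" unfolding Md_def by (intro sum_pos Mb) auto
  have MdV: "\<bar>pd b V z\<bar> \<le> Md" if "b \<in> Basis" "z \<in> ?T" for b z
    using Mb(2)[OF that] member_le_sum[OF that(1), of Mb] Mb(1) unfolding Md_def by force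
  have K2: "Kbox 0 (m 5) (2 * \<beta>) \<subseteq> S"
  proof
    fix z :: "'n spacetime" assume z: "z \<in> Kbox 0 (m 5) (2 * \<beta>)"
    have "0 < 1 / (2 * \<beta>)" using \<beta>8 by simp
    moreover have "- (2 * \<beta>) \<le> fst z" "fst z \<le> - (1 / (2 * \<beta>))" using z by (auto simp: Kbox_def)
    ultimately have t: "fst z < 0" "- B < fst z" unfolding B_def by linarith+
    have "(norm (snd z))\<^sup>2 \<le> m 5 * (fst z)\<^sup>2" using z by (simp add: Kbox_def)
    also have "\<dots> < \<sigma>1\<^sup>2 * (fst z)\<^sup>2" using m6'[of 5] t by (intro mult_strict_right_mono) auto
    also have "\<dots> = (\<sigma>1 * \<bar>fst z\<bar>)\<^sup>2" by (simp add: power_mult_distrib)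
    finally have "norm (snd z) < \<sigma>1 * \<bar>fst z\<bar>" by (rule power_less_imp_less_base) (use \<sigma> in simp)
    then show "z \<in> S" using t by (simp add: S_def)
  qed
  interpret slab_setting "m 1" "m 2" "m 3" "m 4" "m 5" \<beta> \<epsilon> Mv p S \<rho> \<theta>
  proof unfold_locales
    show "(p - 1) * (real DIM('n spacetime) - 2) < 4"
    proof (cases "CARD('n) = 1")
      case False
      have "0 < CARD('n)" by simp
      with False have n: "1 < ?n" by linarith
      then have "(p - 1) * (?n - 1) < 4" using sub False by (simp add: field_simps)
      then show ?thesis by simp
    qed simp
    show "10 * \<theta> \<le> \<rho> - sqrt (m 5)" "10 * \<theta> \<le> 1 - \<rho>" unfolding \<theta>_def \<rho>_def by (simp_all add: field_simps)
    show "0 < \<theta>" unfolding \<theta>_def using q5 by simp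
    show "4 / (1 - sqrt (m 5)) \<le> \<beta>" unfolding \<beta>_def using q5 by (simp add: divide_right_mono)
    have 1: "1 - \<rho> = (1 - sqrt (m 5)) / 2" by (simp add: \<rho>_def field_simps)
    show "4 / (1 - \<rho>) \<le> \<beta>" unfolding \<beta>_def 1 by simp
  qed (use m0 m_less[of 1 2] m_less[of 2 3] m_less[of 3 4] m_less[of 4 5] m5 \<beta>8 p eps(1) oS K2 in \<open>auto simp: S_def\<close>)
  obtain \<nu> D0 C where UE: "\<nu> > 0" "D0 > 0" "C \<ge> 0"
    "\<forall>u V D. sol u V \<longrightarrow> (\<forall>z\<in>S. \<forall>b\<in>Basis. \<bar>pd b V z\<bar> \<le> \<nu>) \<longrightarrow> 0 < D \<longrightarrow> D \<le> D0 \<longrightarrow>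
    (LINT z:K15|lborel. Qu u z) \<le> D \<longrightarrow> (LINT x:Bl (m 4) \<inter> {x. m 2 \<le> (norm x)\<^sup>2}|lborel. Qu u (-1, x)) \<le> D \<longrightarrow>
    (LINT x:Bl (m 2)|lborel. Qu u (-1, x)) \<le> C * D"
    using unit_estimate by (elim exE conjE) (rule that[rotated 3], assumption+)
  define e1 where "e1 = 2 - ?n + 4 / (p - 1)"
  define e0 where "e0 = - ?n + 4 / (p - 1)"
  \<comment> \<open>The scaling exponent of the equation: \<open>\<alpha> * p = \<alpha> + 2\<close>
    balances two derivatives against the nonlinearity. The weights are
    \<open>e1 = 2 * \<alpha> + 2 - ?n\<close> and \<open>e0 = 2 * \<alpha> - ?n\<close>, so the
    functionals are scale invariant.\<close>
  define \<alpha> where "\<alpha> = 2 / (p - 1)"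
  have \<alpha>p: "\<alpha> * p = \<alpha> + 2" unfolding \<alpha>_def using p by (simp add: field_simps)
  have ee: "2 * \<alpha> + 2 - ?n = e1" "2 * \<alpha> - ?n = e0" unfolding \<alpha>_def e1_def e0_def by simp_all
  \<comment> \<open>Bounds \<open>\<bar>t\<bar> powr (- e1)\<close> and
    \<open>\<bar>t\<bar> powr (- e0)\<close> for \<open>\<bar>t\<bar>\<close> between
    \<open>1 / (2 * \<beta>)\<close> and \<open>2 * \<beta>\<close>; the absolute values cover
    either sign of the exponents.\<close>
  define K0 where "K0 = (2 * \<beta>) powr \<bar>e1\<bar> + (2 * \<beta>) powr \<bar>e0\<bar>"
  have K0: "0 < K0" unfolding K0_def using \<beta>8 by (intro add_pos_pos) auto
  define K where "K = C * (2 * \<beta> * K0)"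
  have K: "0 \<le> K" unfolding K_def using UE(3) K0 \<beta>8 by simp
  \<comment> \<open>\<open>1 / B\<close> keeps the scaled copy of \<open>S\<close> inside the given
    cone. \<open>\<nu> / Md\<close> makes the derivatives of the rescaled potential, which carry a
    factor \<open>l\<close>, at most \<open>\<nu>\<close>.\<close>
  define l0 where "l0 = min (1 / B) (\<nu> / Md)"
  have l0: "0 < l0" unfolding l0_def using B Md UE(1) by simp
  define \<delta>0 where "\<delta>0 = D0 / (2 * \<beta> * K0)"
  have \<delta>0: "0 < \<delta>0" unfolding \<delta>0_def using UE(2) K0 \<beta>8 by simp
  show ?thesis
  proof (rule exI[of _ K], intro conjI K, rule exI[of _ \<delta>0], intro conjI \<delta>0, rule exI[of _ l0], intro conjI l0,
      rule exI[of _ B], intro conjI B allI impI)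
    fix l \<delta> assume l: "0 < l" "l < l0" and \<delta>: "0 < \<delta>" "\<delta> \<le> \<delta>0"
      and small: "\<forall>t. - (B * l) < t \<longrightarrow> t < 0 \<longrightarrow> annulus_energy p \<sigma>0 \<sigma>1 \<phi> t \<le> ennreal \<delta>"
    define u where "u z = l powr \<alpha> * \<phi> (l *\<^sub>R z)" for z
    define Vl where "Vl z = 1 * V (l *\<^sub>R z)" for z
    have lB: "l * B < 1" using l B unfolding l0_def by (simp add: field_simps)
    have ST: "l *\<^sub>R z \<in> ?T" if "z \<in> S" for z
    proof -
      have "l * - B < l * fst z" "l * norm (snd z) < l * (\<sigma>1 * \<bar>fst z\<bar>)" "l * fst z < 0"
        using that l(1) unfolding S_def by (blast intro: mult_strict_left_mono mult_pos_neg)+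
      then show ?thesis using lB l by (cases z) (auto simp: tip_cone_def abs_mult algebra_simps)
    qed
    have \<phi>2: "Ck_on 2 ?T \<phi>" and weq: "\<And>z. z \<in> ?T \<Longrightarrow> wave_op \<phi> z + V z * nonlin p (\<phi> z) = 0"
      using sol by (auto simp: C2_solution_def)
    have \<phi>d: "\<phi> differentiable (at z)" "b \<in> Basis \<Longrightarrow> pd b \<phi> differentiable (at z)" if "z \<in> ?T" for z b
      using \<phi>2 that by (auto simp: numeral_2_eq_2)
    have V1: "Ck_on 1 ?T V" using V by (simp add: C1_on_closure_def)
    have pdu: "pd b u z = l powr \<alpha> * l * pd b \<phi> (l *\<^sub>R z)" if "z \<in> S" for b z
      unfolding u_def by (rule scale_differentiable(2)[OF \<phi>d(1)[OF ST[OF that]]])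
    have pdpdu: "pd b (pd b u) z = l powr \<alpha> * l * l * pd b (pd b \<phi>) (l *\<^sub>R z)" if z: "z \<in> S" and b: "b \<in> Basis" for b z
    proof -
      have "pd b (pd b u) z = pd b (\<lambda>z. l powr \<alpha> * l * pd b \<phi> (l *\<^sub>R z)) z"
        by (rule pd_cong_open[OF oS z]) (rule pdu)
      also have "\<dots> = l powr \<alpha> * l * l * pd b (pd b \<phi>) (l *\<^sub>R z)"
        by (rule scale_differentiable(2)[OF \<phi>d(2)[OF ST[OF z] b]])
      finally show ?thesis .
    qed
    have wfu: "wave_fun S sgm p u Vl"
    proof
      show "open S" by (rule oS)
      show "sgm b * sgm b = 1" for b :: "'n spacetime" by (rule sgm_sq)
      show "1 < p" by (rule p)
      show "Ck_on 2 S u" unfolding u_def by (rule Ck_on_scale[OF oS ST \<phi>2])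
      show "Ck_on 1 S Vl" unfolding Vl_def by (rule Ck_on_scale[OF oS ST V1])
      fix z assume z: "z \<in> S"
      have "(\<Sum>b\<in>Basis. sgm b * pd b (pd b u) z) = (\<Sum>b\<in>Basis. (l powr \<alpha> * l * l) * (sgm b * pd b (pd b \<phi>) (l *\<^sub>R z)))"
        by (intro sum.cong refl) (simp add: pdpdu[OF z])
      also have "\<dots> = (l powr \<alpha> * l * l) * wave_op \<phi> (l *\<^sub>R z)"
        by (simp only: sum_distrib_left[symmetric] wave_op_Basis)
      also have "wave_op \<phi> (l *\<^sub>R z) = - (V (l *\<^sub>R z) * nonlin p (\<phi> (l *\<^sub>R z)))"
        using weq[OF ST[OF z]] by linarith
      also have "(l powr \<alpha> * l * l) * - (V (l *\<^sub>R z) * nonlin p (\<phi> (l *\<^sub>R z))) = - Vl z * ((l powr \<alpha> * l * l) * nonlin p (\<phi> (l *\<^sub>R z)))"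
        by (simp add: Vl_def)
      also have "(l powr \<alpha> * l * l) * nonlin p (\<phi> (l *\<^sub>R z)) = nonlin p (u z)"
      proof -
        have "nonlin p (u z) = (l powr \<alpha>) powr (p - 1) * l powr \<alpha> * nonlin p (\<phi> (l *\<^sub>R z))"
          unfolding nonlin_def u_def by (simp add: abs_mult powr_mult)
        also have "(l powr \<alpha>) powr (p - 1) * l powr \<alpha> = l powr (\<alpha> * (p - 1) + \<alpha>)"
          by (simp add: powr_powr powr_add)
        also have "\<alpha> * (p - 1) + \<alpha> = \<alpha> + 1 + 1" using \<alpha>p by (simp add: algebra_simps)
        also have "l powr (\<alpha> + 1 + 1) = l powr \<alpha> * l * l" using l by (simp add: powr_add power2_eq_square)
        finally show ?thesis by simp
      qed
      finally show "(\<Sum>b\<in>Basis. sgm b * pd b (pd b u) z) = - Vl z * nonlin p (u z)" .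
    qed
    interpret wf: wave_fun S sgm p u Vl by (rule wfu)
    have solu: "sol u Vl"
      unfolding sol_def
    proof (intro conjI ballI wfu)
      fix z assume "z \<in> S"
      then have "l *\<^sub>R z \<in> closure ?T" using ST closure_subset by blast
      then show "\<epsilon> \<le> Vl z" "Vl z \<le> Mv" using eps(2) Mv(2)[of "l *\<^sub>R z"] by (auto simp: Vl_def)
    qed
    have dVl: "\<forall>z\<in>S. \<forall>b\<in>Basis. \<bar>pd b Vl z\<bar> \<le> \<nu>"
    proof (intro ballI)
      fix z b :: "'n spacetime" assume z: "z \<in> S" and b: "b \<in> Basis"
      have "pd b Vl z = 1 * l * pd b V (l *\<^sub>R z)"
        unfolding Vl_def using V1 ST[OF z] by (intro scale_differentiable(2)) simp
      then have "\<bar>pd b Vl z\<bar> \<le> l * Md" using MdV[OF b ST[OF z]] l by (simp add: abs_mult)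
      also have "\<dots> \<le> \<nu>" using l Md unfolding l0_def by (simp add: field_simps)
      finally show "\<bar>pd b Vl z\<bar> \<le> \<nu>" .
    qed
    have Qeq: "wf.Q z = l powr (2 * \<alpha> + 2) * grad_sq \<phi> (l *\<^sub>R z) + l powr (2 * \<alpha>) * (\<phi> (l *\<^sub>R z))\<^sup>2" if z: "z \<in> S" for z
    proof -
      have sq: "(l powr \<alpha>)\<^sup>2 = l powr (2 * \<alpha>)" by (simp add: power2_eq_square powr_add[symmetric])
      have l2: "l powr (2 * \<alpha> + 2) = l powr (2 * \<alpha>) * l\<^sup>2" using l by (simp add: powr_add powr_numeral)
      have "(\<Sum>b\<in>Basis. (pd b u z)\<^sup>2) = (\<Sum>b\<in>Basis. (l powr (2 * \<alpha>) * l\<^sup>2) * (pd b \<phi> (l *\<^sub>R z))\<^sup>2)"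
        by (intro sum.cong refl) (simp add: pdu[OF z] power_mult_distrib sq)
      also have "\<dots> = (l powr (2 * \<alpha>) * l\<^sup>2) * (\<Sum>b\<in>Basis. (pd b \<phi> (l *\<^sub>R z))\<^sup>2)"
        by (simp only: sum_distrib_left)
      finally have 1: "(\<Sum>b\<in>Basis. (pd b u z)\<^sup>2) = (l powr (2 * \<alpha>) * l\<^sup>2) * (\<Sum>b\<in>Basis. (pd b \<phi> (l *\<^sub>R z))\<^sup>2)" .
      have 2: "(u z)\<^sup>2 = l powr (2 * \<alpha>) * (\<phi> (l *\<^sub>R z))\<^sup>2"
        by (simp only: u_def power_mult_distrib sq)
      show ?thesis unfolding wf.Q_def grad_sq_Basis l2 1 2 by (simp only: add.commute)
    qed
    have cgrad: "continuous_on ?T (grad_sq \<phi>)" and c\<phi>: "continuous_on ?T \<phi>"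
    proof -
      have c2: "Ck_on (Suc (Suc 0)) ?T \<phi>" using \<phi>2 by (simp add: numeral_2_eq_2)
      then show "continuous_on ?T \<phi>" by (rule Ck_on_Suc_continuous)
      have "continuous_on ?T (pd b \<phi>)" if "b \<in> Basis" for b
        by (rule Ck_on_Suc_continuous[of 0]) (use c2 that in simp)
      then show "continuous_on ?T (grad_sq \<phi>)"
        unfolding grad_sq_Basis[abs_def] by (intro continuous_on_sum continuous_on_power)
    qed
    \<comment> \<open>The gradient part scales with \<open>l powr (2 * \<alpha> + 2)\<close>, the
      function part with \<open>l powr (2 * \<alpha>)\<close>, and the change of variables gives
      \<open>l powr (- ?n)\<close>. Nonnegative integrals avoid every question of integrability on
      open slices.\<close>
    have slice_scale: "(\<integral>\<^sup>+x. ennreal (wf.Q (t, x)) * indicator A x \<partial>lborel) =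
        ennreal (l powr e1) * (\<integral>\<^sup>+y. ennreal (grad_sq \<phi> (l * t, y)) * indicator A' y \<partial>lborel) +
        ennreal (l powr e0) * (\<integral>\<^sup>+y. ennreal ((\<phi> (l * t, y))\<^sup>2) * indicator A' y \<partial>lborel)"
      if A: "open A'" "\<And>x. x \<in> A \<longleftrightarrow> l *\<^sub>R x \<in> A'" "\<And>x. x \<in> A \<Longrightarrow> (t, x) \<in> S" for t A A'
    proof -
      have A'T: "(l * t, y) \<in> ?T" if "y \<in> A'" for y
      proof -
        have "l *\<^sub>R ((1 / l) *\<^sub>R y) \<in> A'" using that l by simp
        then have "l *\<^sub>R (t, (1 / l) *\<^sub>R y) \<in> ?T" using A(2,3) ST by blast
        then show ?thesis using l by simp
      qed
      let ?g = "\<lambda>y. ennreal (grad_sq \<phi> (l * t, y)) * indicator A' y"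
      let ?k = "\<lambda>y. ennreal ((\<phi> (l * t, y))\<^sup>2) * indicator A' y"
      have mg: "?g \<in> borel_measurable borel" "?k \<in> borel_measurable borel"
        by (intro measurable_slice[OF A(1)] continuous_on_power continuous_on_compose2[OF cgrad] continuous_on_compose2[OF c\<phi>] continuous_intros; use A'T in auto)+
      have "(\<integral>\<^sup>+x. ennreal (wf.Q (t, x)) * indicator A x \<partial>lborel) =
          (\<integral>\<^sup>+x. ennreal (l powr (2 * \<alpha> + 2)) * ?g (l *\<^sub>R x) + ennreal (l powr (2 * \<alpha>)) * ?k (l *\<^sub>R x) \<partial>lborel)"
      proof (rule nn_integral_cong)
        fix x
        have g0: "0 \<le> grad_sq \<phi> z" for z unfolding grad_sq_Basis by (simp add: sum_nonneg)
        show "ennreal (wf.Q (t, x)) * indicator A x = ennreal (l powr (2 * \<alpha> + 2)) * ?g (l *\<^sub>R x) + ennreal (l powr (2 * \<alpha>)) * ?k (l *\<^sub>R x)"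
        proof (cases "x \<in> A")
          case True
          then show ?thesis using A(2)[of x] Qeq[OF A(3)[OF True]] g0
            by (simp add: ennreal_plus ennreal_mult)
        next
          case False
          then show ?thesis using A(2)[of x] by simp
        qed
      qed
      also have "\<dots> = ennreal (l powr (2 * \<alpha> + 2)) * (\<integral>\<^sup>+x. ?g (l *\<^sub>R x) \<partial>lborel) + ennreal (l powr (2 * \<alpha>)) * (\<integral>\<^sup>+x. ?k (l *\<^sub>R x) \<partial>lborel)"
      proof -
        have 1: "(\<lambda>x. ?g (l *\<^sub>R x)) \<in> borel_measurable lborel"
          by (rule measurable_compose[OF _ mg(1)]) measurable
        have 2: "(\<lambda>x. ?k (l *\<^sub>R x)) \<in> borel_measurable lborel"
          by (rule measurable_compose[OF _ mg(2)]) measurable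
        show ?thesis by (rule nn_integral_lincomb[OF 1 2])
      qed
      also have "(\<integral>\<^sup>+x. ?g (l *\<^sub>R x) \<partial>lborel) = ennreal (l powr (- ?n)) * (\<integral>\<^sup>+y. ?g y \<partial>lborel)"
        using nn_integral_lborel_scale[OF mg(1) l(1)] by simp
      also have "(\<integral>\<^sup>+x. ?k (l *\<^sub>R x) \<partial>lborel) = ennreal (l powr (- ?n)) * (\<integral>\<^sup>+y. ?k y \<partial>lborel)"
        using nn_integral_lborel_scale[OF mg(2) l(1)] by simp
      also have "ennreal (l powr (2 * \<alpha> + 2)) * (ennreal (l powr (- ?n)) * (\<integral>\<^sup>+y. ?g y \<partial>lborel)) = ennreal (l powr e1) * (\<integral>\<^sup>+y. ?g y \<partial>lborel)"
        unfolding mult.assoc[symmetric] ennreal_mult[symmetric, OF powr_ge_zero powr_ge_zero] powr_add[symmetric] ee(1)[symmetric] by simp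
      also have "ennreal (l powr (2 * \<alpha>)) * (ennreal (l powr (- ?n)) * (\<integral>\<^sup>+y. ?k y \<partial>lborel)) = ennreal (l powr e0) * (\<integral>\<^sup>+y. ?k y \<partial>lborel)"
        unfolding mult.assoc[symmetric] ennreal_mult[symmetric, OF powr_ge_zero powr_ge_zero] powr_add[symmetric] ee(2)[symmetric] by simp
      finally show ?thesis .
    qed
    have slice_small: "(\<integral>\<^sup>+x. ennreal (wf.Q (t, x)) * indicator (annulus \<sigma>0 \<sigma>1 t) x \<partial>lborel) \<le> ennreal (K0 * \<delta>)"
      if t: "- (2 * \<beta>) \<le> t" "t \<le> - (1 / (2 * \<beta>))" for t
    proof -
      have "0 < 1 / (2 * \<beta>)" using \<beta>8 by simp
      then have t0: "t < 0" using t by linarith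
      have lt: "\<bar>l * t\<bar> = l * \<bar>t\<bar>" using l by (simp add: abs_mult)
      have tb: "\<bar>t\<bar> powr (- e) \<le> (2 * \<beta>) powr \<bar>e\<bar>" for e
      proof (cases "0 \<le> e")
        case True
        have "1 / (2 * \<beta>) \<le> \<bar>t\<bar>" using t t0 by simp
        then have "1 \<le> 2 * \<beta> * \<bar>t\<bar>" using \<beta>8 by (simp add: field_simps)
        then have "inverse \<bar>t\<bar> \<le> 2 * \<beta>" using t0 by (simp add: field_simps)
        then have "(inverse \<bar>t\<bar>) powr e \<le> (2 * \<beta>) powr e" using True by (intro powr_mono2) auto
        moreover have "\<bar>t\<bar> powr (- e) = (inverse \<bar>t\<bar>) powr e"
          by (simp only: powr_minus inverse_powr abs_ge_zero)
        ultimately show ?thesis using True by simp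
      next
        case False
        have "\<bar>t\<bar> powr (- e) \<le> (2 * \<beta>) powr (- e)" using False t t0 by (intro powr_mono2) auto
        then show ?thesis using False by simp
      qed
      let ?G = "\<integral>\<^sup>+y. ennreal (grad_sq \<phi> (l * t, y)) * indicator (annulus \<sigma>0 \<sigma>1 (l * t)) y \<partial>lborel"
      let ?H = "\<integral>\<^sup>+y. ennreal ((\<phi> (l * t, y))\<^sup>2) * indicator (annulus \<sigma>0 \<sigma>1 (l * t)) y \<partial>lborel"
      have mem: "x \<in> annulus \<sigma>0 \<sigma>1 t \<longleftrightarrow> l *\<^sub>R x \<in> annulus \<sigma>0 \<sigma>1 (l * t)" for x :: "real^'n"
        unfolding annulus_def using l(1) by (simp add: abs_mult mult.left_commute mult_less_cancel_left_pos)
      have inS: "(t, x) \<in> S" if "x \<in> annulus \<sigma>0 \<sigma>1 t" for x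
        using that t t0 by (simp add: S_def annulus_def B_def)
      have split: "l powr e = \<bar>l * t\<bar> powr e * \<bar>t\<bar> powr (- e)" for e
      proof -
        have "\<bar>l * t\<bar> powr e = l powr e * \<bar>t\<bar> powr e" using l unfolding lt by (simp only: powr_mult abs_ge_zero less_imp_le)
        moreover have "\<bar>t\<bar> powr e * \<bar>t\<bar> powr (- e) = 1" using t0 by (simp add: powr_add[symmetric])
        ultimately show ?thesis by (simp only: mult.assoc mult_1_right)
      qed
      have ann: "ennreal (\<bar>l * t\<bar> powr e1) * ?G + ennreal (\<bar>l * t\<bar> powr e0) * ?H \<le> ennreal \<delta>"
      proof -
        have "l * (- B) < l * t" using t l(1) by (intro mult_strict_left_mono) (auto simp: B_def)
        then have "- (B * l) < l * t" "l * t < 0" using l t0 by (auto simp: mult.commute mult_pos_neg)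
        with small have "annulus_energy p \<sigma>0 \<sigma>1 \<phi> (l * t) \<le> ennreal \<delta>" by blast
        then show ?thesis unfolding annulus_energy_def e1_def e0_def .
      qed
      have "(\<integral>\<^sup>+x. ennreal (wf.Q (t, x)) * indicator (annulus \<sigma>0 \<sigma>1 t) x \<partial>lborel) = ennreal (l powr e1) * ?G + ennreal (l powr e0) * ?H"
        by (rule slice_scale[OF open_annulus mem inS])
      also have "\<dots> = ennreal (\<bar>t\<bar> powr (- e1)) * (ennreal (\<bar>l * t\<bar> powr e1) * ?G) + ennreal (\<bar>t\<bar> powr (- e0)) * (ennreal (\<bar>l * t\<bar> powr e0) * ?H)"
        unfolding split by (simp add: ennreal_mult mult_ac)
      also have "\<dots> \<le> ennreal ((2 * \<beta>) powr \<bar>e1\<bar>) * ennreal \<delta> + ennreal ((2 * \<beta>) powr \<bar>e0\<bar>) * ennreal \<delta>"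
      proof (intro add_mono mult_mono ennreal_leI tb)
        show "ennreal (\<bar>l * t\<bar> powr e1) * ?G \<le> ennreal \<delta>" using ann by (rule order_trans[rotated]) simp
        show "ennreal (\<bar>l * t\<bar> powr e0) * ?H \<le> ennreal \<delta>" using ann by (rule order_trans[rotated]) simp
      qed auto
      also have "\<dots> = ennreal (K0 * \<delta>)"
        unfolding K0_def using \<delta>(1) by (simp add: ennreal_mult[symmetric] ennreal_plus[symmetric] distrib_right del: ennreal_plus)
      finally show ?thesis .
    qed
    have QS: "continuous_on S wf.Q" by (rule wf.cont_Q)
    \<comment> \<open>\<open>K0 * \<delta>\<close> bounds each slice and \<open>2 * \<beta>\<close>
      the length of the time interval. As \<open>2 * \<beta> \<ge> 1\<close>, the same
      \<open>D\<close> serves for the single slice at time -1.\<close>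
    define D where "D = 2 * \<beta> * (K0 * \<delta>)"
    have D: "0 < D" "D \<le> D0"
    proof -
      show "0 < D" unfolding D_def using \<beta>8 K0 \<delta> by simp
      have "2 * \<beta> * K0 * \<delta> \<le> 2 * \<beta> * K0 * \<delta>0" using \<delta>(2) \<beta>8 K0 by (intro mult_left_mono) auto
      also have "\<dots> = D0" unfolding \<delta>0_def using \<beta>8 K0 by simp
      finally show "D \<le> D0" by (simp add: D_def mult.assoc)
    qed
    have in_ann: "x \<in> annulus \<sigma>0 \<sigma>1 t" if "t < 0" "m i * t\<^sup>2 \<le> (norm x)\<^sup>2" "(norm x)\<^sup>2 \<le> m j * t\<^sup>2" "0 < i" "j < 6" for t i j and x :: "real^'n"
    proof -
      have "(\<sigma>0 * \<bar>t\<bar>)\<^sup>2 < (norm x)\<^sup>2"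
      proof -
        have "(\<sigma>0 * \<bar>t\<bar>)\<^sup>2 = \<sigma>0\<^sup>2 * t\<^sup>2" by (simp add: power_mult_distrib)
        also have "\<dots> < m i * t\<^sup>2" using m0'[OF that(4)] that(1) by simp
        finally show ?thesis using that(2) by linarith
      qed
      moreover have "(norm x)\<^sup>2 < (\<sigma>1 * \<bar>t\<bar>)\<^sup>2"
      proof -
        have "m j * t\<^sup>2 < \<sigma>1\<^sup>2 * t\<^sup>2" using m6'[OF that(5)] that(1) by simp
        also have "\<dots> = (\<sigma>1 * \<bar>t\<bar>)\<^sup>2" by (simp add: power_mult_distrib)
        finally show ?thesis using that(3) by linarith
      qed
      ultimately show ?thesis unfolding annulus_def
        using \<sigma> by (auto intro: power_less_imp_less_base)
    qed
    have 1: "(LINT z:K15|lborel. wf.Q z) \<le> D"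
    proof -
      have cK: "continuous_on K15 wf.Q" by (rule continuous_on_subset[OF QS]) (use Kbox_sub[of "m 1" "m 5" "2 * \<beta>"] m0 \<beta>8 in auto)
      have m15: "(\<lambda>z. ennreal (if z \<in> K15 then wf.Q z else 0)) \<in> borel_measurable (lborel \<Otimes>\<^sub>M lborel)"
      proof -
        have "(\<lambda>z. indicator K15 z *\<^sub>R wf.Q z) \<in> borel_measurable borel"
          by (rule borel_measurable_continuous_on_indicator[OF _ cK]) (simp add: borel_compact compact_Kbox)
        moreover have "(\<lambda>z. indicator K15 z *\<^sub>R wf.Q z) = (\<lambda>z. if z \<in> K15 then wf.Q z else 0)" by (auto simp: indicator_def)
        ultimately show ?thesis by (simp add: lborel_prod)
      qed
      have "ennreal (LINT z:K15|lborel. wf.Q z) = (\<integral>\<^sup>+z. ennreal (if z \<in> K15 then wf.Q z else 0) \<partial>lborel)"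
        by (rule nn_integral_compact[OF compact_Kbox cK wf.Q_ge(3), symmetric])
      also have "\<dots> = (\<integral>\<^sup>+t. \<integral>\<^sup>+x. ennreal (if (t, x) \<in> K15 then wf.Q (t, x) else 0) \<partial>lborel \<partial>lborel)"
        using lborel.nn_integral_fst[OF m15] by (simp add: lborel_prod)
      also have "\<dots> \<le> (\<integral>\<^sup>+t. ennreal (K0 * \<delta>) * indicator {- (2 * \<beta>)..0} t \<partial>lborel)"
      proof (rule nn_integral_mono)
        fix t :: real
        show "(\<integral>\<^sup>+x. ennreal (if (t, x) \<in> K15 then wf.Q (t, x) else 0) \<partial>lborel) \<le> ennreal (K0 * \<delta>) * indicator {- (2 * \<beta>)..0} t"
        proof (cases "- (2 * \<beta>) \<le> t \<and> t \<le> - (1 / (2 * \<beta>))")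
          case True
          have "0 < 1 / (2 * \<beta>)" using \<beta>8 by simp
          with True have t0: "t < 0" by linarith
          have "(\<integral>\<^sup>+x. ennreal (if (t, x) \<in> K15 then wf.Q (t, x) else 0) \<partial>lborel) \<le> (\<integral>\<^sup>+x. ennreal (wf.Q (t, x)) * indicator (annulus \<sigma>0 \<sigma>1 t) x \<partial>lborel)"
          proof (rule nn_integral_mono)
            fix x :: "real^'n"
            show "ennreal (if (t, x) \<in> K15 then wf.Q (t, x) else 0) \<le> ennreal (wf.Q (t, x)) * indicator (annulus \<sigma>0 \<sigma>1 t) x"
              using in_ann[OF t0, of 1 x 5] by (auto simp: Kbox_def)
          qed
          also have "\<dots> \<le> ennreal (K0 * \<delta>)" by (rule slice_small) (use True in auto)
          finally show ?thesis using True t0 by simp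
        next
          case False
          then have "(t, x) \<notin> K15" for x by (auto simp: Kbox_def)
          then show ?thesis by simp
        qed
      qed
      also have "\<dots> = ennreal (K0 * \<delta>) * ennreal (2 * \<beta>)"
        using \<beta>8 by (simp add: nn_integral_cmult)
      also have "\<dots> = ennreal D" unfolding D_def using K0 \<delta> \<beta>8 by (simp add: ennreal_mult[symmetric] mult_ac)
      finally show ?thesis using D by (simp add: ennreal_le_iff)
    qed
    have 2: "(LINT x:Bl (m 4) \<inter> {x. m 2 \<le> (norm x)\<^sup>2}|lborel. wf.Q (-1, x)) \<le> D"
    proof -
      let ?An = "Bl (m 4) \<inter> {x. m 2 \<le> (norm x)\<^sup>2} :: (real^'n) set"
      have cAn: "compact ?An" by (intro compact_Int_closed compact_Bl closed_Collect_le continuous_intros)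
      have cq: "continuous_on ?An (\<lambda>x. wf.Q (-1, x))" by (rule continuous_on_subset[OF cont_slice[OF QS]]) simp
      have "ennreal (LINT x:?An|lborel. wf.Q (-1, x)) = (\<integral>\<^sup>+x. ennreal (if x \<in> ?An then wf.Q (-1, x) else 0) \<partial>lborel)"
        by (rule nn_integral_compact[OF cAn cq wf.Q_ge(3), symmetric])
      also have "\<dots> \<le> (\<integral>\<^sup>+x. ennreal (wf.Q (-1, x)) * indicator (annulus \<sigma>0 \<sigma>1 (-1)) x \<partial>lborel)"
      proof (rule nn_integral_mono)
        fix x :: "real^'n"
        show "ennreal (if x \<in> ?An then wf.Q (-1, x) else 0) \<le> ennreal (wf.Q (-1, x)) * indicator (annulus \<sigma>0 \<sigma>1 (-1)) x"
          using in_ann[of "-1" 2 x 4] by (auto simp: Bl_def)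
      qed
      also have "\<dots> \<le> ennreal (K0 * \<delta>)" by (rule slice_small) (use \<beta>8 in \<open>auto simp: field_simps\<close>)
      also have "\<dots> \<le> ennreal D" unfolding D_def using K0 \<delta> \<beta>8 by (intro ennreal_leI) simp
      finally show ?thesis using D by (simp add: ennreal_le_iff)
    qed
    have main: "(LINT x:Bl (m 2)|lborel. wf.Q (-1, x)) \<le> C * D"
      by (rule UE(4)[rule_format, OF solu _ D 1 2]) (use dVl in blast)
    let ?ball = "{x::real^'n. norm x < \<sigma>0 * \<bar>-l\<bar>}"
    let ?ball1 = "{x::real^'n. norm x < \<sigma>0}"
    have ob: "open ?ball" by (intro open_Collect_less continuous_intros)
    have memb: "x \<in> ?ball1 \<longleftrightarrow> l *\<^sub>R x \<in> ?ball" for x using l(1) by (simp add: mult.commute)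
    have bS: "(-1, x) \<in> S" if "x \<in> ?ball1" for x using that \<sigma> \<beta>8 by (simp add: S_def B_def)
    have "core_energy p \<sigma>0 \<phi> (-l) = ennreal (l powr e1) * (\<integral>\<^sup>+y. ennreal (grad_sq \<phi> (l * -1, y)) * indicator ?ball y \<partial>lborel) +
        ennreal (l powr e0) * (\<integral>\<^sup>+y. ennreal ((\<phi> (l * -1, y))\<^sup>2) * indicator ?ball y \<partial>lborel)"
    proof -
      let ?g = "\<lambda>y. ennreal (grad_sq \<phi> (-l, y)) * indicator ?ball y"
      let ?k = "\<lambda>y. ennreal ((\<phi> (-l, y))\<^sup>2) * indicator ?ball y"
      have bT: "(-l, y) \<in> ?T" if "y \<in> ?ball" for y
      proof -
        have "(1 / l) *\<^sub>R y \<in> ?ball1" using memb[of "(1 / l) *\<^sub>R y"] that l by simp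
        then have "l *\<^sub>R (-1, (1 / l) *\<^sub>R y) \<in> ?T" by (intro ST bS)
        then show ?thesis using l by simp
      qed
      have mg: "?g \<in> borel_measurable borel" "?k \<in> borel_measurable borel"
        by (intro measurable_slice[OF ob] continuous_on_power continuous_on_compose2[OF cgrad] continuous_on_compose2[OF c\<phi>] continuous_intros; use bT in auto)+
      have g0: "0 \<le> grad_sq \<phi> z" for z unfolding grad_sq_Basis by (simp add: sum_nonneg)
      have "(\<integral>\<^sup>+x\<in>?ball. ennreal (grad_sq \<phi> (-l, x) + \<bar>-l\<bar> powr (-2) * (\<phi> (-l, x))\<^sup>2) \<partial>lborel) =
        (\<integral>\<^sup>+x. ?g x + ennreal (l powr (-2)) * ?k x \<partial>lborel)"
        by (intro nn_integral_cong) (use l g0 in \<open>auto simp: indicator_def ennreal_plus ennreal_mult\<close>)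
      also have "\<dots> = (\<integral>\<^sup>+x. ?g x \<partial>lborel) + ennreal (l powr (-2)) * (\<integral>\<^sup>+x. ?k x \<partial>lborel)"
        using mg by (subst nn_integral_add) (auto simp: nn_integral_cmult)
      finally have "core_energy p \<sigma>0 \<phi> (-l) = ennreal (l powr e1) * ((\<integral>\<^sup>+x. ?g x \<partial>lborel) + ennreal (l powr (-2)) * (\<integral>\<^sup>+x. ?k x \<partial>lborel))"
        unfolding core_energy_def e1_def[symmetric] using l by simp
      also have "\<dots> = ennreal (l powr e1) * (\<integral>\<^sup>+x. ?g x \<partial>lborel) + (ennreal (l powr e1) * ennreal (l powr (-2))) * (\<integral>\<^sup>+x. ?k x \<partial>lborel)"
        by (simp only: distrib_left mult.assoc)
      also have "ennreal (l powr e1) * ennreal (l powr (-2)) = ennreal (l powr e0)"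
        unfolding ennreal_mult[symmetric, OF powr_ge_zero powr_ge_zero] powr_add[symmetric] by (simp add: e1_def e0_def)
      finally show ?thesis by simp
    qed
    also have "\<dots> = (\<integral>\<^sup>+x. ennreal (wf.Q (-1, x)) * indicator ?ball1 x \<partial>lborel)"
      by (rule slice_scale[OF ob memb bS, symmetric])
    also have "\<dots> \<le> (\<integral>\<^sup>+x. ennreal (if x \<in> Bl (m 2) then wf.Q (-1, x) else 0) \<partial>lborel)"
    proof (rule nn_integral_mono)
      fix x :: "real^'n"
      have "x \<in> Bl (m 2)" if "norm x < \<sigma>0"
      proof -
        have "(norm x)\<^sup>2 \<le> \<sigma>0\<^sup>2" using that by (intro power_mono) auto
        then show ?thesis using m0'[of 2] by (simp add: Bl_def)
      qed
      then show "ennreal (wf.Q (-1, x)) * indicator ?ball1 x \<le> ennreal (if x \<in> Bl (m 2) then wf.Q (-1, x) else 0)"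
        by (auto simp: indicator_def)
    qed
    also have "\<dots> = ennreal (LINT x:Bl (m 2)|lborel. wf.Q (-1, x))"
    proof (rule nn_integral_compact[OF compact_Bl _ wf.Q_ge(3)])
      show "continuous_on (Bl (m 2)) (\<lambda>x. wf.Q (-1, x))"
        by (rule continuous_on_subset[OF cont_slice[OF QS]]) (use m_less[of 2 4] in \<open>auto simp: Bl_def\<close>)
    qed
    also have "\<dots> \<le> ennreal (K * \<delta>)"
      using main by (intro ennreal_leI) (simp add: K_def D_def mult.assoc)
    finally show "core_energy p \<sigma>0 \<phi> (- l) \<le> ennreal (K * \<delta>)" .
  qed
qed

theorem corollary1p6:
  fixes \<phi> V :: "real \<times> (real^'n::finite) \<Rightarrow> real"
    and p \<sigma>0 \<sigma>1 \<epsilon> :: real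
  assumes "0 < \<sigma>0" "\<sigma>0 < \<sigma>1" "\<sigma>1 < 1"
    and "1 < p"
    and "CARD('n) = 1 \<or> p < 1 + 4 / (real CARD('n) - 1)"
    and "C1_on_closure (tip_cone \<sigma>1) V"
    and "0 < \<epsilon>"
    and "\<forall>z\<in>closure (tip_cone \<sigma>1). \<epsilon> \<le> V z"
    and "C2_solution p V (tip_cone \<sigma>1) \<phi>"
    and "singular_point p V (tip_cone \<sigma>1) \<phi> (0, 0)"
    and "Limsup (at_left 0) (\<lambda>t::real.
           ennreal (\<bar>t\<bar> powr (2 - real CARD('n) + 4 / (p - 1))) *
           (\<integral>\<^sup>+x\<in>{x. norm x < \<sigma>0 * \<bar>t\<bar>}.
              ennreal (grad_sq \<phi> (t, x) + \<bar>t\<bar> powr (-2) * (\<phi> (t, x))\<^sup>2) \<partial>lborel)) > 0"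
  shows "Limsup (at_left 0) (\<lambda>t::real.
           ennreal (\<bar>t\<bar> powr (2 - real CARD('n) + 4 / (p - 1))) *
           (\<integral>\<^sup>+x\<in>annulus \<sigma>0 \<sigma>1 t. ennreal (grad_sq \<phi> (t, x)) \<partial>lborel) +
           ennreal (\<bar>t\<bar> powr (- real CARD('n) + 4 / (p - 1))) *
           (\<integral>\<^sup>+x\<in>annulus \<sigma>0 \<sigma>1 t. ennreal ((\<phi> (t, x))\<^sup>2) \<partial>lborel)) > 0"
proof -
  have core: "Limsup (at_left 0) (core_energy p \<sigma>0 \<phi>) > 0"
    using assms(11) unfolding core_energy_def[abs_def] .
  obtain K \<delta>0 l0 B where K: "K \<ge> 0" "\<delta>0 > 0" "l0 > 0" "B > 0" and
    est: "\<forall>l \<delta>. 0 < l \<longrightarrow> l < l0 \<longrightarrow> 0 < \<delta> \<longrightarrow> \<delta> \<le> \<delta>0 \<longrightarrow>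
      (\<forall>t. - (B * l) < t \<longrightarrow> t < 0 \<longrightarrow> annulus_energy p \<sigma>0 \<sigma>1 \<phi> t \<le> ennreal \<delta>) \<longrightarrow>
      core_energy p \<sigma>0 \<phi> (- l) \<le> ennreal (K * \<delta>)"
    using core_estimate[OF assms(1-9)] by (elim exE conjE) (rule that[rotated 4], assumption+)
  have "Limsup (at_left 0) (annulus_energy p \<sigma>0 \<sigma>1 \<phi>) > 0"
  proof (rule ccontr)
    assume "\<not> Limsup (at_left 0) (annulus_energy p \<sigma>0 \<sigma>1 \<phi>) > 0"
    then have z: "Limsup (at_left 0) (annulus_energy p \<sigma>0 \<sigma>1 \<phi>) = 0" by simp
    \<comment> \<open>The bound \<open>K * \<delta>\<close> can be brought below any
      \<open>\<eta>\<close>; the summand 0 gives the shape to which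
      \<open>ennreal_le_epsilon\<close> applies.\<close>
    have "Limsup (at_left 0) (core_energy p \<sigma>0 \<phi>) \<le> 0 + ennreal \<eta>" if \<eta>: "0 < \<eta>" for \<eta>
    proof -
      \<comment> \<open>The denominator is \<open>K + 1\<close> because \<open>K\<close> may be
        0.\<close>
      define \<delta> where "\<delta> = min \<delta>0 (\<eta> / (K + 1))"
      have \<delta>: "0 < \<delta>" "\<delta> \<le> \<delta>0" using K \<eta> by (auto simp: \<delta>_def)
      have K\<delta>: "K * \<delta> \<le> \<eta>"
      proof -
        have "K * \<delta> \<le> (K + 1) * (\<eta> / (K + 1))"
          using K \<delta> by (intro mult_mono) (auto simp: \<delta>_def)
        then show ?thesis using K by simp
      qed
      have "\<forall>\<^sub>F t in at_left 0. annulus_energy p \<sigma>0 \<sigma>1 \<phi> t < ennreal \<delta>"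
        by (rule Limsup_lessD) (simp only: z ennreal_less_zero_iff \<delta>)
      then obtain b where b: "b < 0" "\<And>t. b < t \<Longrightarrow> t < 0 \<Longrightarrow> annulus_energy p \<sigma>0 \<sigma>1 \<phi> t < ennreal \<delta>"
        unfolding eventually_at_left_field by blast
      \<comment> \<open>For times after \<open>b'\<close> two conditions hold:
        \<open>- t < l0\<close>, and the whole interval from \<open>B * t\<close> to 0 that the
        estimate inspects lies to the right of \<open>b\<close>.\<close>
      define b' where "b' = max (b / B) (- l0)"
      have b': "b' < 0" using divide_neg_pos[OF b(1) K(4)] K(3) by (simp add: b'_def)
      have "core_energy p \<sigma>0 \<phi> t \<le> ennreal \<eta>" if t: "b' < t" "t < 0" for t
      proof -
        have t': "0 < - t" "- t < l0" using t by (auto simp: b'_def)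
        have "b / B < t" using t by (simp add: b'_def)
        then have tB: "b < t * B" using K by (simp add: pos_divide_less_eq)
        have small: "annulus_energy p \<sigma>0 \<sigma>1 \<phi> s \<le> ennreal \<delta>" if s: "- (B * - t) < s" "s < 0" for s
        proof -
          have "- (B * - t) = t * B" by simp
          then have "b < s" using tB s(1) by linarith
          from b(2)[OF this s(2)] show ?thesis by (rule less_imp_le)
        qed
        have "core_energy p \<sigma>0 \<phi> (- (- t)) \<le> ennreal (K * \<delta>)"
          by (rule est[rule_format, OF t' \<delta> small])
        also have "\<dots> \<le> ennreal \<eta>" by (rule ennreal_leI[OF K\<delta>])
        finally show ?thesis by simp
      qed
      then have "\<forall>\<^sub>F t in at_left 0. core_energy p \<sigma>0 \<phi> t \<le> ennreal \<eta>"
        unfolding eventually_at_left_field using b' by (intro exI[of _ b']) simp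
      then show ?thesis by (simp only: add_0_left) (rule Limsup_bounded)
    qed
    then have "Limsup (at_left 0) (core_energy p \<sigma>0 \<phi>) \<le> 0"
      by (rule ennreal_le_epsilon)
    with core show False by simp
  qed
  then show ?thesis unfolding annulus_energy_def[abs_def] .
qed

end
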